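(* Assume $\mathbf{q}^N(0)\to\mathbf{q}^\infty$ in probability in $\mathcal{S}$ and $\lambda(N)/N\to\lambda>0$ as $N\to\infty$. Then any subsequence of the sequence of processes $\{\mathbf{q}^N(t)\}_{t\ge0}$ for the ordinary JSQ policy has a further subsequence that converges weakly with respect to the Skorohod $J_1$ topology to a limit $\{\mathbf{q}(t)\}_{t\ge0}$ satisfying the system of integral equations $$q_i(t)=q_i(0)+\lambda\int_0^tp_{i-1}(\mathbf{q}(s))\,ds-\int_0^t(q_i(s)-q_{i+1}(s))\,ds,\qquad i=1,2,\dots,b,$$ where $\mathbf{q}(0)=\mathbf{q}^\infty$ and the coefficients $p_i(\cdot)$ are as defined in the context.
   Context: Model: the $N$-th system has $N$ parallel identical single-server queues and one dispatcher. Tasks with independent unit-mean exponential service requirements arrive as a Poisson process of rate $\lambda(N)$ and, under the ordinary JSQ policy, are immediately assigned to a server with the shortest queue among all $N$ servers. Each server has buffer capacity $b$ ($1\le b\le\infty$, including the task in service); a task assigned to a server with $b$ pending tasks is permanently discarded. $Q_i^N(t)$ is the number of servers with queue length at least $i$ (including the task in service) at time $t$, $i=1,\dots,b$, and $\mathbf{q}^N(t)=(q_i^N(t))_{1\le i\le b}$ with $q_i^N(t)=Q_i^N(t)/N$. When $b=\infty$, "$i=1,\dots,b$" means all $i\ge1$; when $b<\infty$, $q_{b+1}\equiv0$. $\mathcal{S}=\{\mathbf{q}\in[0,1]^b: q_i\le q_{i-1}\text{ for } i=2,\dots,b,\ \sum_{i=1}^b q_i<\infty\}$, equipped with the $\ell_1$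 topology. For $\mathbf{q}\in\mathcal{S}$ let $m(\mathbf{q})=\min\{i\ge0:q_{i+1}<1\}$. If $m(\mathbf{q})=0$, then $p_0(\mathbf{q})=1$ and $p_i(\mathbf{q})=0$ for $i\ge1$. If $m(\mathbf{q})>0$, then $p_{m(\mathbf{q})-1}(\mathbf{q})=\min\{(1-q_{m(\mathbf{q})+1})/\lambda,\,1\}$, $p_{m(\mathbf{q})}(\mathbf{q})=1-p_{m(\mathbf{q})-1}(\mathbf{q})$, and $p_i(\mathbf{q})=0$ otherwise. *)

theory Defs
  imports "HOL-Probability.Probability"
begin

section \<open>The Skorohod \<open>J\<^sub>1\<close> topology on paths over \<open>[0,\<infinity>)\<close>\<close>

text \<open>
  A metric space is given by a carrier \<open>S\<close> and a distance \<open>d\<close>. Paths are functions on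
  \<open>{0..}\<close>, made extensional so that equality of paths is equality on \<open>[0,\<infinity>)\<close>.
\<close>

definition cadlag_paths :: "'a set \<Rightarrow> ('a \<Rightarrow> 'a \<Rightarrow> real) \<Rightarrow> (real \<Rightarrow> 'a) set" where
  "cadlag_paths S d =
    {x \<in> {0..} \<rightarrow>\<^sub>E S.
       (\<forall>t\<ge>0. ((\<lambda>s. d (x s) (x t)) \<longlongrightarrow> 0) (at_right t)) \<and>
       (\<forall>t>0. \<exists>l\<in>S. ((\<lambda>s. d (x s) l) \<longlongrightarrow> 0) (at_left t))}"

text \<open>Such a bijection of \<open>[0,\<infinity>)\<close> is automatically continuous and fixes \<open>0\<close>.\<close>

definition time_change :: "(real \<Rightarrow> real) \<Rightarrow> bool" where
  "time_change \<tau> \<longleftrightarrow> strict_mono_on {0..} \<tau> \<and> \<tau> ` {0..} = {0..}"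

text \<open>
  The sets \<open>J1_nbhd S d x T e\<close> with \<open>T > 0\<close> and \<open>e > 0\<close> form a neighbourhood base at \<open>x\<close> of
  the \<open>J\<^sub>1\<close> topology: a sequence \<open>x\<^sub>n\<close> is eventually in each of them iff for every \<open>T\<close> there
  are time changes \<open>\<tau>\<^sub>n\<close> such that \<open>\<tau>\<^sub>n t - t\<close> and \<open>d (x\<^sub>n t) (x (\<tau>\<^sub>n t))\<close> tend to \<open>0\<close> uniformly
  on \<open>[0,T]\<close>, which is \<open>J\<^sub>1\<close> convergence (Ethier and Kurtz, Markov Processes,
  Proposition 3.5.3).
\<close>

definition J1_nbhd ::
  "'a set \<Rightarrow> ('a \<Rightarrow> 'a \<Rightarrow> real) \<Rightarrow> (real \<Rightarrow> 'a) \<Rightarrow> real \<Rightarrow> real \<Rightarrow> (real \<Rightarrow> 'a) set" where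
  "J1_nbhd S d x T e =
    {y \<in> cadlag_paths S d.
       \<exists>\<tau>. time_change \<tau> \<and> (\<forall>t\<in>{0..T}. \<bar>\<tau> t - t\<bar> < e \<and> d (y t) (x (\<tau> t)) < e)}"

definition J1_topology :: "'a set \<Rightarrow> ('a \<Rightarrow> 'a \<Rightarrow> real) \<Rightarrow> (real \<Rightarrow> 'a) topology" where
  "J1_topology S d =
    topology (\<lambda>U. U \<subseteq> cadlag_paths S d \<and> (\<forall>x\<in>U. \<exists>T>0. \<exists>e>0. J1_nbhd S d x T e \<subseteq> U))"

lemma J1_nbhd_mono:
  "T \<le> T' \<Longrightarrow> e' \<le> e \<Longrightarrow> J1_nbhd S d x T' e' \<subseteq> J1_nbhd S d x T e"
  unfolding J1_nbhd_def
  by (smt (verit) Collect_mono atLeastAtMost_iff)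

lemma openin_J1_topology:
  "openin (J1_topology S d) U \<longleftrightarrow>
     U \<subseteq> cadlag_paths S d \<and> (\<forall>x\<in>U. \<exists>T>0. \<exists>e>0. J1_nbhd S d x T e \<subseteq> U)"
proof -
  let ?P = "\<lambda>U. U \<subseteq> cadlag_paths S d \<and> (\<forall>x\<in>U. \<exists>T>0. \<exists>e>0. J1_nbhd S d x T e \<subseteq> U)"
  have "?P (U \<inter> V)" if P: "?P U" "?P V" for U V
  proof (intro conjI ballI)
    show "U \<inter> V \<subseteq> cadlag_paths S d" using P by blast
    fix x assume "x \<in> U \<inter> V"
    then obtain T e T' e' where *: "T > 0" "e > 0" "J1_nbhd S d x T e \<subseteq> U"
      "T' > 0" "e' > 0" "J1_nbhd S d x T' e' \<subseteq> V"
      using P by (meson IntD1 IntD2)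
    have "J1_nbhd S d x (max T T') (min e e') \<subseteq> U \<inter> V"
      using * J1_nbhd_mono[of T "max T T'" "min e e'" e S d x]
        J1_nbhd_mono[of T' "max T T'" "min e e'" e' S d x] by auto
    then show "\<exists>T>0. \<exists>e>0. J1_nbhd S d x T e \<subseteq> U \<inter> V"
      using * by (meson less_max_iff_disj min_less_iff_conj)
  qed
  moreover have "?P (\<Union>K)" if "\<forall>U\<in>K. ?P U" for K
    using that by (meson Sup_le_iff Union_iff subset_trans Union_upper)
  ultimately have "istopology ?P"
    unfolding istopology_def by blast
  then show ?thesis
    unfolding J1_topology_def by (simp add: topology_inverse')
qed

lemma topspace_J1_topology [simp]: "topspace (J1_topology S d) = cadlag_paths S d"
proof
  show "topspace (J1_topology S d) \<subseteq> cadlag_paths S d"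
    by (simp add: topspace_def openin_J1_topology Sup_le_iff)
  have "openin (J1_topology S d) (cadlag_paths S d)"
    unfolding openin_J1_topology J1_nbhd_def by (auto intro!: exI[of _ "1::real"])
  then show "cadlag_paths S d \<subseteq> topspace (J1_topology S d)"
    by (rule openin_subset)
qed

section \<open>Weak convergence and convergence in probability\<close>

definition borel_of_topology :: "'a topology \<Rightarrow> 'a measure" where
  "borel_of_topology T = sigma (topspace T) {U. openin T U}"

text \<open>
  The random elements \<open>X n\<close>, each on its own probability space \<open>M n\<close>, converge weakly to the
  law \<open>P\<close>.
\<close>

definition converges_weakly ::
  "'a topology \<Rightarrow> (nat \<Rightarrow> 'w measure) \<Rightarrow> (nat \<Rightarrow> 'w \<Rightarrow> 'a) \<Rightarrow> 'a measure \<Rightarrow> bool" where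
  "converges_weakly T M X P \<longleftrightarrow>
     (\<forall>n. prob_space (M n) \<and> X n \<in> M n \<rightarrow>\<^sub>M borel_of_topology T) \<and>
     prob_space P \<and> sets P = sets (borel_of_topology T) \<and>
     (\<forall>f. continuous_map T euclideanreal f \<and> bounded (f ` topspace T) \<longrightarrow>
        (\<lambda>n. \<integral>\<omega>. f (X n \<omega>) \<partial>M n) \<longlonglongrightarrow> (\<integral>x. f x \<partial>P))"

definition converges_in_probability ::
  "('a \<Rightarrow> 'a \<Rightarrow> real) \<Rightarrow> (nat \<Rightarrow> 'w measure) \<Rightarrow> (nat \<Rightarrow> 'w \<Rightarrow> 'a) \<Rightarrow> 'a \<Rightarrow> bool" where
  "converges_in_probability d M X c \<longleftrightarrow>
     (\<forall>\<epsilon>>0. (\<lambda>n. measure (M n) {\<omega> \<in> space (M n). d (X n \<omega>) c > \<epsilon>}) \<longlonglongrightarrow> 0)"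

section \<open>Occupancy states\<close>

text \<open>
  A state \<open>(q\<^sub>1, q\<^sub>2, \<dots>, q\<^sub>b)\<close> is a function on \<open>nat\<close> that vanishes outside \<open>1, \<dots>, b\<close>. In
  particular \<open>q\<^bsub>b+1\<^esub> = 0\<close> when \<open>b\<close> is finite; the value at \<open>0\<close> has no meaning.
\<close>

definition occ_space :: "enat \<Rightarrow> (nat \<Rightarrow> real) set" where
  "occ_space b =
    {q. (\<forall>i. 1 \<le> i \<and> enat i \<le> b \<longrightarrow> 0 \<le> q i \<and> q i \<le> 1) \<and>
        (\<forall>i. 2 \<le> i \<and> enat i \<le> b \<longrightarrow> q i \<le> q (i - 1)) \<and>
        (\<forall>i. \<not> (1 \<le> i \<and> enat i \<le> b) \<longrightarrow> q i = 0) \<and>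
        summable q}"

definition l1_dist :: "(nat \<Rightarrow> real) \<Rightarrow> (nat \<Rightarrow> real) \<Rightarrow> real" where
  "l1_dist x y = (\<Sum>i. \<bar>x i - y i\<bar>)"

definition m_idx :: "(nat \<Rightarrow> real) \<Rightarrow> nat" where
  "m_idx q = (LEAST i. q (i + 1) < 1)"

definition p_coeff :: "real \<Rightarrow> (nat \<Rightarrow> real) \<Rightarrow> nat \<Rightarrow> real" where
  "p_coeff lam q i =
    (if m_idx q = 0 then (if i = 0 then 1 else 0)
     else if i = m_idx q - 1 then min ((1 - q (m_idx q + 1)) / lam) 1
     else if i = m_idx q then 1 - min ((1 - q (m_idx q + 1)) / lam) 1
     else 0)"

text \<open>For a path in \<open>cadlag_paths (occ_space b) l1_dist\<close> both integrands are bounded and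
  Borel measurable, so the integrals below exist.\<close>

definition fluid_equations :: "enat \<Rightarrow> real \<Rightarrow> (real \<Rightarrow> nat \<Rightarrow> real) \<Rightarrow> bool" where
  "fluid_equations b lam q \<longleftrightarrow>
    (\<forall>t\<ge>0. \<forall>i. 1 \<le> i \<and> enat i \<le> b \<longrightarrow>
       q t i = q 0 i + lam * (LBINT s:{0..t}. p_coeff lam (q s) (i - 1))
                     - (LBINT s:{0..t}. q s i - q s (i + 1)))"

section \<open>The system with \<open>N\<close> servers under JSQ\<close>

definition occupancy :: "enat \<Rightarrow> nat \<Rightarrow> (nat \<Rightarrow> nat) \<Rightarrow> nat \<Rightarrow> real" where
  "occupancy b N x i =
    (if 1 \<le> i \<and> enat i \<le> b then real (card {j. j < N \<and> i \<le> x j}) / real N else 0)"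

text \<open>A rule that selects a server with a shortest queue from the queue lengths and a random
  seed; the seed allows for randomised tie breaking.\<close>

definition jsq_rule :: "nat \<Rightarrow> ((nat \<Rightarrow> nat) \<Rightarrow> real \<Rightarrow> nat) \<Rightarrow> bool" where
  "jsq_rule N pick \<longleftrightarrow>
    (\<forall>x. pick x \<in> borel \<rightarrow>\<^sub>M count_space UNIV) \<and>
    (\<forall>x u. pick x u < N \<and> (\<forall>j<N. x (pick x u) \<le> x j))"

datatype source = Initial | Gap nat | Service nat nat | Seed nat

text \<open>
  Servers are \<open>0, \<dots>, N - 1\<close> and \<open>L \<omega> j t\<close> is the queue length of server \<open>j\<close> at time \<open>t\<close>.
  The time between consecutive arrivals is \<open>gap k\<close>; \<open>svc j n\<close> is the service requirement of the
  \<open>n\<close>-th task (from \<open>0\<close>, initial tasks included) served by server \<open>j\<close>; \<open>seed k\<close> breaks ties for the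
  \<open>k\<close>-th arrival. The tasks at a server are served one at a time at unit speed, so \<open>n + 1\<close> tasks
  have left server \<open>j\<close> as soon as its cumulative busy time reaches \<open>svc j 0 + \<dots> + svc j n\<close>.
\<close>

locale jsq_system = prob_space M
  for M :: "'w measure" +
  fixes N :: nat and b :: enat and rate :: real
    and pick :: "(nat \<Rightarrow> nat) \<Rightarrow> real \<Rightarrow> nat"
    and gap :: "nat \<Rightarrow> 'w \<Rightarrow> real"
    and svc :: "nat \<Rightarrow> nat \<Rightarrow> 'w \<Rightarrow> real"
    and seed :: "nat \<Rightarrow> 'w \<Rightarrow> real"
    and L :: "'w \<Rightarrow> nat \<Rightarrow> real \<Rightarrow> nat"
  assumes rate_pos: "0 < rate"
    and rule: "jsq_rule N pick"
    and gap_exponential: "\<And>k. distributed M lborel (gap k) (exponential_density rate)"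
    and svc_exponential: "\<And>j n. j < N \<Longrightarrow> distributed M lborel (svc j n) (exponential_density 1)"
    and seed_uniform: "\<And>k. distributed M lborel (seed k) (indicator {0..1})"
    and L_measurable: "\<And>j t. j < N \<Longrightarrow> 0 \<le> t \<Longrightarrow> (\<lambda>\<omega>. L \<omega> j t) \<in> M \<rightarrow>\<^sub>M count_space UNIV"
    and independent: "indep_sets
      (\<lambda>a. case a of
          Initial \<Rightarrow> sets (vimage_algebra (space M) (\<lambda>\<omega>. \<lambda>j\<in>{..<N}. L \<omega> j 0)
                            (\<Pi>\<^sub>M j\<in>{..<N}. count_space UNIV))
        | Gap k \<Rightarrow> sets (vimage_algebra (space M) (gap k) borel)
        | Service j n \<Rightarrow> sets (vimage_algebra (space M) (svc j n) borel)
        | Seed k \<Rightarrow> sets (vimage_algebra (space M) (seed k) borel))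
      ({Initial} \<union> range Gap \<union> {Service j n |j n. j < N} \<union> range Seed)"
    and initial_le_buffer: "\<And>\<omega> j. \<omega> \<in> space M \<Longrightarrow> j < N \<Longrightarrow> enat (L \<omega> j 0) \<le> b"
    and L_right_cont: "\<And>\<omega> j t. \<omega> \<in> space M \<Longrightarrow> j < N \<Longrightarrow> 0 \<le> t \<Longrightarrow>
                          (L \<omega> j \<longlongrightarrow> L \<omega> j t) (at_right t)"
    and L_left_limit: "\<And>\<omega> j t. \<omega> \<in> space M \<Longrightarrow> j < N \<Longrightarrow> 0 < t \<Longrightarrow>
                          \<exists>l. (L \<omega> j \<longlongrightarrow> l) (at_left t)"
    and dynamics: "AE \<omega> in M.
      (let arrival = (\<lambda>k. \<Sum>i\<le>k. gap i \<omega>);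
           before = (\<lambda>k. \<lambda>j\<in>{..<N}. Lim (at_left (arrival k)) (L \<omega> j));
           dest = (\<lambda>k. pick (before k) (seed k \<omega>));
           busy = (\<lambda>j t. measure lborel {s \<in> {0..t}. 0 < L \<omega> j s})
       in \<forall>j<N. \<forall>t\<ge>0.
         L \<omega> j t + card {n. (\<Sum>i\<le>n. svc j i \<omega>) \<le> busy j t} =
         L \<omega> j 0 + card {k. arrival k \<le> t \<and> dest k = j \<and> enat (before k j) < b})"

definition occupancy_path ::
  "enat \<Rightarrow> nat \<Rightarrow> ('w \<Rightarrow> nat \<Rightarrow> real \<Rightarrow> nat) \<Rightarrow> 'w \<Rightarrow> real \<Rightarrow> nat \<Rightarrow> real" where
  "occupancy_path b N L \<omega> = (\<lambda>t\<in>{0..}. occupancy b N (\<lambda>j. L \<omega> j t))"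

end

theory Submission
  imports Defs
begin

text \<open>
  The limit in the theorem is unique: the whole sequence of occupancy paths converges in
  probability, uniformly on bounded time intervals, to one deterministic path \<open>q\<close>. The law \<open>P\<close> is
  the point mass at \<open>q\<close> and the further subsequence is the given one.

  Write \<open>U i t\<close> for the number, divided by \<open>N\<close>, of arrivals up to time \<open>t\<close> that find at least \<open>i\<close>
  tasks at every server, and \<open>D i t\<close> for the number, divided by \<open>N\<close>, of departures up to \<open>t\<close> from
  queues of length \<open>i\<close>. Every trajectory of the system satisfies
  \<open>q\<^sub>i(t) = q\<^sub>i(0) + U\<^bsub>i-1\<^esub>(t) - U\<^sub>i(t) - D\<^sub>i(t)\<close>,
  and because tasks join shortest queues, \<open>U i\<close> increases only while \<open>q\<^sub>i = 1\<close>. Hence \<open>U i\<close> is the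
  least process that keeps \<open>q\<^sub>i\<close> below \<open>1\<close>: a Skorohod reflection (locale \<open>sys_path\<close>). The fluid path
  has \<open>U\<^sub>0(t) = \<lambda>t\<close> and \<open>D\<^sub>i(t) = \<integral> (q\<^sub>i - q\<^bsub>i+1\<^esub>)\<close> exactly, the system with \<open>N\<close> servers has both up
  to a small error.

  Three facts carry the proof.

  \<^item> Stability (\<open>stability\<close>). Reflection is Lipschitz in the supremum norm. With a weight
  \<open>exp (- \<theta> t)\<close> the integral term becomes a contraction, and only finitely many levels interact
  through \<open>U\<close>, since a level above the total mass is never full. So two paths that solve the equations
  up to small errors and start near each other stay near each other in \<open>\<ell>\<^sub>1\<close>. In particular
  approximate solutions of increasing accuracy form a Cauchy sequence, whose limit is an exact solution
  (\<open>fluid_path_exists\<close>).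

  \<^item> Identification (\<open>satisfies_fluid_equations\<close>). For an exact solution, \<open>U i\<close> has a density, which is
  \<open>w\<^sub>i = w\<^bsub>i-1\<^esub> - q\<^sub>i + q\<^bsub>i+1\<^esub>\<close> where \<open>q\<^sub>i = 1\<close> and \<open>0\<close> elsewhere, with \<open>w\<^sub>0 = \<lambda>\<close>
  (\<open>reflection_density\<close>). Then \<open>w\<^bsub>i-1\<^esub> - w\<^sub>i\<close> is \<open>\<lambda> p\<^bsub>i-1\<^esub>(q)\<close> for almost all times. The minimum in
  the definition of \<open>p\<close> is then attained by its first argument: \<open>U\<close> is nondecreasing, so its density
  cannot be negative on a set of positive measure.

  \<^item> Randomness (\<open>deviation_event\<close>). By the memoryless property of exponential times the system is a
  jump chain whose next jump is decided by a race between fresh exponential clocks: one for the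
  arrivals and one for each busy server. The numbers of jumps of a given kind minus their compensators
  are square integrable martingales with second moment at most \<open>(\<lambda>(N) + N) t\<close>
  (\<open>excess_second_moment\<close>). After division by \<open>N\<close>, Chebyshev's inequality makes the errors in \<open>U 0\<close>
  and \<open>D i\<close> small on a finite grid of times, and monotonicity extends this to all times.

  The dynamics of the system are given as an equation for the queue lengths, not as a chain. That this
  equation forces the queues to follow the jump chain is \<open>path_is_chain\<close>. Random paths are measurable
  for the \<open>J\<^sub>1\<close> Borel sets as limits of paths sampled on finer and finer grids
  (\<open>step_like_measurable\<close>).
\<close>

section \<open>Neighbourhoods in the \<open>J\<^sub>1\<close> topology\<close>

lemma time_change_id: "time_change (\<lambda>t. t)"
  by (auto simp: time_change_def strict_mono_on_def)

lemma time_change_nonneg: "time_change \<tau> \<Longrightarrow> 0 \<le> t \<Longrightarrow> 0 \<le> \<tau> t"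
  unfolding time_change_def by (metis atLeast_iff imageI)

lemma time_change_comp: "time_change \<tau> \<Longrightarrow> time_change \<sigma> \<Longrightarrow> time_change (\<lambda>t. \<tau> (\<sigma> t))"
  using time_change_nonneg[of \<sigma>]
  by (simp add: time_change_def strict_mono_on_def image_image[of \<tau> \<sigma>, symmetric])

text \<open>
  The inverse of a time change makes the \<open>J\<^sub>1\<close> neighbourhood relation symmetric, up to a loss in
  the time horizon.
\<close>

lemma time_change_inverse:
  assumes "time_change \<tau>"
  obtains \<sigma> where "time_change \<sigma>" "\<And>t. 0 \<le> t \<Longrightarrow> \<tau> (\<sigma> t) = t"
proof
  let ?s = "inv_into {0..} \<tau>"
  have sm: "strict_mono_on {0..} \<tau>" and im: "\<tau> ` {0..} = {0..}"
    using assms by (auto simp: time_change_def)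
  have inj: "inj_on \<tau> {0..}" using sm by (rule strict_mono_on_imp_inj_on)
  show eq: "\<tau> (?s t) = t" if "0 \<le> t" for t
    using that im by (intro f_inv_into_f) auto
  have nn: "0 \<le> ?s t" if "0 \<le> t" for t
    using that im inv_into_into[of t \<tau> "{0..}"] by auto
  have "?s t < ?s t'" if "0 \<le> t" "t < t'" for t t'
  proof (rule ccontr)
    assume "\<not> ?s t < ?s t'"
    then have "\<tau> (?s t') \<le> \<tau> (?s t)"
      using sm nn[of t] nn[of t'] that by (cases "?s t' = ?s t") (auto simp: strict_mono_on_def less_imp_le)
    then show False using eq[of t] eq[of t'] that by simp
  qed
  moreover have "?s ` {0..} = {0..}"
    using inv_into_f_f[OF inj] nn im by (auto simp: image_iff) (metis atLeast_iff image_eqI)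
  ultimately show "time_change ?s"
    by (auto simp: time_change_def strict_mono_on_def)
qed

lemma cadlag_paths_mem: "x \<in> cadlag_paths S d \<Longrightarrow> 0 \<le> t \<Longrightarrow> x t \<in> S"
  by (auto simp: cadlag_paths_def PiE_iff)

lemma cadlag_paths_eqI:
  assumes "x \<in> cadlag_paths S d" "y \<in> cadlag_paths S d'" "\<And>t. 0 \<le> t \<Longrightarrow> x t = y t"
  shows "x = y"
proof
  fix t show "x t = y t" using assms by (cases "0 \<le> t") (auto simp: cadlag_paths_def PiE_iff extensional_def)
qed

lemma J1_nbhd_cadlag: "y \<in> J1_nbhd S d x T e \<Longrightarrow> y \<in> cadlag_paths S d"
  by (simp add: J1_nbhd_def)

lemma J1_nbhd_uniformI:
  assumes "y \<in> cadlag_paths S d" "0 < e" "\<And>t. 0 \<le> t \<Longrightarrow> t \<le> T \<Longrightarrow> d (y t) (x t) < e"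
  shows "y \<in> J1_nbhd S d x T e"
  using assms time_change_id unfolding J1_nbhd_def by auto

text \<open>
  A metric on a carrier. Nothing is assumed about \<open>d\<close> outside \<open>M\<close>, since the \<open>\<ell>\<^sub>1\<close> distance
  behaves well on summable sequences only.
\<close>

locale carrier_metric =
  fixes M :: "'a set" and d :: "'a \<Rightarrow> 'a \<Rightarrow> real"
  assumes commute: "x \<in> M \<Longrightarrow> y \<in> M \<Longrightarrow> d x y = d y x"
    and triangle: "x \<in> M \<Longrightarrow> y \<in> M \<Longrightarrow> z \<in> M \<Longrightarrow> d x z \<le> d x y + d y z"
    and self: "x \<in> M \<Longrightarrow> d x x = 0"
    and separated: "x \<in> M \<Longrightarrow> y \<in> M \<Longrightarrow> d x y \<le> 0 \<Longrightarrow> x = y"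
begin

text \<open>
  Composition of the two time changes. The first one may move a time from \<open>[0,T]\<close> by up to \<open>e\<close>,
  which is why the horizon of the outer neighbourhood is larger.
\<close>

lemma J1_nbhd_trans:
  assumes x: "x \<in> cadlag_paths M d" and y: "y \<in> J1_nbhd M d x (T + e) e'" and z: "z \<in> J1_nbhd M d y T e"
  shows "z \<in> J1_nbhd M d x T (e + e')"
proof -
  obtain \<tau> where \<tau>: "time_change \<tau>" "\<And>t. 0 \<le> t \<Longrightarrow> t \<le> T + e \<Longrightarrow> \<bar>\<tau> t - t\<bar> < e' \<and> d (y t) (x (\<tau> t)) < e'"
    using y by (auto simp: J1_nbhd_def)
  obtain \<sigma> where \<sigma>: "time_change \<sigma>" "\<And>t. 0 \<le> t \<Longrightarrow> t \<le> T \<Longrightarrow> \<bar>\<sigma> t - t\<bar> < e \<and> d (z t) (y (\<sigma> t)) < e"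
    using z by (auto simp: J1_nbhd_def)
  have "\<bar>\<tau> (\<sigma> t) - t\<bar> < e + e' \<and> d (z t) (x (\<tau> (\<sigma> t))) < e + e'" if "0 \<le> t" "t \<le> T" for t
  proof -
    have s: "0 \<le> \<sigma> t" "\<sigma> t \<le> T + e" using \<sigma> that time_change_nonneg[of \<sigma> t] by force+
    have "x (\<tau> (\<sigma> t)) \<in> M" "y (\<sigma> t) \<in> M" "z t \<in> M"
      using s x y z \<tau>(1) that time_change_nonneg J1_nbhd_cadlag cadlag_paths_mem by metis+
    then have "d (z t) (x (\<tau> (\<sigma> t))) \<le> d (z t) (y (\<sigma> t)) + d (y (\<sigma> t)) (x (\<tau> (\<sigma> t)))"
      by (intro triangle)
    then show ?thesis using \<tau>(2)[OF s] \<sigma>(2)[OF that] by linarith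
  qed
  then show ?thesis
    using z time_change_comp[OF \<tau>(1) \<sigma>(1)] unfolding J1_nbhd_def by auto
qed

lemma J1_nbhd_sym:
  assumes x: "x \<in> cadlag_paths M d" and y: "y \<in> J1_nbhd M d x T e" and "0 < e" "0 \<le> T"
  shows "x \<in> J1_nbhd M d y (T - e) e"
proof -
  obtain \<tau> where \<tau>: "time_change \<tau>" "\<And>t. 0 \<le> t \<Longrightarrow> t \<le> T \<Longrightarrow> \<bar>\<tau> t - t\<bar> < e \<and> d (y t) (x (\<tau> t)) < e"
    using y by (auto simp: J1_nbhd_def)
  obtain \<sigma> where \<sigma>: "time_change \<sigma>" "\<And>t. 0 \<le> t \<Longrightarrow> \<tau> (\<sigma> t) = t"
    using time_change_inverse[OF \<tau>(1)] by blast
  have "\<bar>\<sigma> t - t\<bar> < e \<and> d (x t) (y (\<sigma> t)) < e" if t: "0 \<le> t" "t \<le> T - e" for t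
  proof -
    have s: "0 \<le> \<sigma> t" using \<sigma>(1) t(1) by (rule time_change_nonneg)
    have "\<sigma> t \<le> T"
    proof (rule ccontr)
      assume "\<not> \<sigma> t \<le> T"
      then have "\<tau> T < \<tau> (\<sigma> t)"
        using \<tau>(1) \<open>0 \<le> T\<close> s unfolding time_change_def strict_mono_on_def by auto
      then show False using \<tau>(2)[of T] \<sigma>(2)[OF t(1)] t \<open>0 \<le> T\<close> by auto
    qed
    moreover have "d (x t) (y (\<sigma> t)) = d (y (\<sigma> t)) (x t)"
      using x y s t(1) by (intro commute) (auto intro: cadlag_paths_mem J1_nbhd_cadlag)
    ultimately show ?thesis using \<tau>(2)[OF s] \<sigma>(2)[OF t(1)] by (auto simp: abs_minus_commute)
  qed
  then show ?thesis using x \<sigma>(1) unfolding J1_nbhd_def by auto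
qed

text \<open>
  One integer parameter suffices for both horizon and radius, so that the quantifiers over
  neighbourhoods become countable operations on sets.
\<close>

lemma J1_open_countable_nbhd:
  assumes "openin (J1_topology M d) U" "x \<in> U"
  shows "\<exists>m::nat. 1 \<le> m \<and> J1_nbhd M d x (real m) (1 / real m) \<subseteq> U"
proof -
  obtain T e where Te: "T > 0" "e > 0" "J1_nbhd M d x T e \<subseteq> U"
    using assms unfolding openin_J1_topology by blast
  obtain n1 :: nat where n1: "T \<le> real n1" using real_arch_simple by blast
  obtain n2 :: nat where n2: "1 / e \<le> real n2" using real_arch_simple by blast
  let ?m = "max 1 (max n1 n2)"
  have m1: "T \<le> real ?m" using n1 by simp
  have "1 / e \<le> real ?m" using n2 by simp
  then have "1 / real ?m \<le> e" using Te(2) by (simp add: field_simps)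
  then have "J1_nbhd M d x (real ?m) (1 / real ?m) \<subseteq> U"
    using J1_nbhd_mono[OF m1] Te(3) by blast
  then show ?thesis by (intro exI[of _ ?m]) auto
qed

text \<open>
  Pointwise limits of measurable maps are measurable, as in a metric space: an open set contains
  the limit iff some fixed neighbourhood of almost all terms lies in it. The set of points with
  such a neighbourhood need not be open, hence the assumption that the approximating maps pull
  every set back to a measurable one; it holds when they take countably many values.
\<close>

lemma measurable_J1_limit:
  assumes X: "\<And>w. w \<in> space \<Omega> \<Longrightarrow> X w \<in> cadlag_paths M d"
    and Xn: "\<And>n w. w \<in> space \<Omega> \<Longrightarrow> Xn n w \<in> cadlag_paths M d"
    and disc: "\<And>n A. {w \<in> space \<Omega>. Xn n w \<in> A} \<in> sets \<Omega>"
    and lim: "\<And>w T e. w \<in> space \<Omega> \<Longrightarrow> 0 < T \<Longrightarrow> 0 < e \<Longrightarrow>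
        \<forall>\<^sub>F n in sequentially. Xn n w \<in> J1_nbhd M d (X w) T e"
  shows "X \<in> \<Omega> \<rightarrow>\<^sub>M borel_of_topology (J1_topology M d)"
  unfolding borel_of_topology_def
proof (rule measurable_sigma_sets[OF sets_measure_of])
  show "{U. openin (J1_topology M d) U} \<subseteq> Pow (topspace (J1_topology M d))"
    using openin_subset by blast
  then show "{U. openin (J1_topology M d) U} \<subseteq> Pow (topspace (J1_topology M d))" .
  show "X \<in> space \<Omega> \<rightarrow> topspace (J1_topology M d)" using X by simp
  fix U assume "U \<in> {U. openin (J1_topology M d) U}"
  then have U: "openin (J1_topology M d) U" by simp
  \<comment> \<open>Points of \<open>U\<close> that keep a uniform distance from its complement.\<close>
  define V where "V m = {x \<in> cadlag_paths M d. J1_nbhd M d x (real m) (1 / real m) \<subseteq> U}" for m :: nat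
  have "X w \<in> U \<longleftrightarrow> (\<exists>m\<ge>1. \<exists>k. \<forall>n\<ge>k. Xn n w \<in> V m)" if w: "w \<in> space \<Omega>" for w
  proof
    assume "X w \<in> U"
    then obtain p :: nat where p: "1 \<le> p" "J1_nbhd M d (X w) (real p) (1 / real p) \<subseteq> U"
      using J1_open_countable_nbhd[OF U] by blast
    let ?m = "2 * p"
    have "\<forall>\<^sub>F n in sequentially. Xn n w \<in> J1_nbhd M d (X w) (real ?m + 1) (1 / real ?m)"
      using p by (intro lim w) auto
    then obtain k where k: "\<And>n. n \<ge> k \<Longrightarrow> Xn n w \<in> J1_nbhd M d (X w) (real ?m + 1) (1 / real ?m)"
      by (auto simp: eventually_sequentially)
    have "Xn n w \<in> V ?m" if "n \<ge> k" for n
      unfolding V_def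
    proof (safe intro!: Xn w)
      fix z assume z: "z \<in> J1_nbhd M d (Xn n w) (real ?m) (1 / real ?m)"
      have "Xn n w \<in> J1_nbhd M d (X w) (real ?m + 1 / real ?m) (1 / real ?m)"
        using k[OF that] J1_nbhd_mono[of "real ?m + 1 / real ?m" "real ?m + 1" "1 / real ?m" "1 / real ?m" M d "X w"] p by auto
      from J1_nbhd_trans[OF X[OF w] this z]
      have "z \<in> J1_nbhd M d (X w) (real ?m) (1 / real p)" using p by (simp add: field_simps)
      then have "z \<in> J1_nbhd M d (X w) (real p) (1 / real p)"
        using J1_nbhd_mono[of "real p" "real ?m" "1 / real p" "1 / real p" M d "X w"] by auto
      then show "z \<in> U" using p by auto
    qed
    then show "\<exists>m\<ge>1. \<exists>k. \<forall>n\<ge>k. Xn n w \<in> V m" using p by (intro exI[of _ ?m]) auto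
  next
    assume "\<exists>m\<ge>1. \<exists>k. \<forall>n\<ge>k. Xn n w \<in> V m"
    then obtain m k where mk: "m \<ge> 1" "\<And>n. n \<ge> k \<Longrightarrow> Xn n w \<in> V m" by blast
    have "\<forall>\<^sub>F n in sequentially. Xn n w \<in> J1_nbhd M d (X w) (real m + 1) (1 / real m)"
      using mk by (intro lim w) auto
    then obtain k' where k': "\<And>n. n \<ge> k' \<Longrightarrow> Xn n w \<in> J1_nbhd M d (X w) (real m + 1) (1 / real m)"
      by (auto simp: eventually_sequentially)
    let ?n = "max k k'"
    have "X w \<in> J1_nbhd M d (Xn ?n w) (real m + 1 - 1 / real m) (1 / real m)"
      using mk by (intro J1_nbhd_sym[OF X[OF w] k']) auto
    then have "X w \<in> J1_nbhd M d (Xn ?n w) (real m) (1 / real m)"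
      using J1_nbhd_mono[of "real m" "real m + 1 - 1 / real m" "1 / real m" "1 / real m"] mk(1) by auto
    then show "X w \<in> U" using mk(2)[of ?n] by (auto simp: V_def)
  qed
  then have "X -` U \<inter> space \<Omega> = {w \<in> space \<Omega>. \<exists>m\<ge>1. \<exists>k. \<forall>n\<ge>k. Xn n w \<in> V m}"
    by auto
  also have "\<dots> \<in> sets \<Omega>"
    using disc by (intro sets.sets_Collect_countable_Ex' sets.sets_Collect_countable_Ex sets.sets_Collect_countable_All' sets.sets_Collect) auto
  finally show "X -` U \<inter> space \<Omega> \<in> sets \<Omega>" .
qed

end

section \<open>Step paths\<close>

text \<open>Right continuous with left limits for the discrete topology on the values.\<close>

definition step_like :: "(real \<Rightarrow> 'v) \<Rightarrow> bool" where
  "step_like x \<longleftrightarrow> (\<forall>t\<ge>0. \<exists>e>0. \<forall>s. t \<le> s \<and> s < t + e \<longrightarrow> x s = x t) \<and>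
     (\<forall>t>0. \<exists>e>0. \<exists>l. \<forall>s. 0 \<le> s \<and> t - e < s \<and> s < t \<longrightarrow> x s = l)"

lemma step_like_right: "step_like x \<Longrightarrow> 0 \<le> t \<Longrightarrow> \<exists>e>0. \<forall>s. t \<le> s \<and> s < t + e \<longrightarrow> x s = x t"
  by (simp add: step_like_def)

lemma step_like_left: "step_like x \<Longrightarrow> 0 < t \<Longrightarrow> \<exists>e>0. \<exists>l. \<forall>s. 0 \<le> s \<and> t - e < s \<and> s < t \<longrightarrow> x s = l"
  by (simp add: step_like_def)

text \<open>\<open>F\<close> contains every jump time of \<open>x\<close> on the interval; it may contain other times.\<close>

definition jumps_within :: "(real \<Rightarrow> 'v) \<Rightarrow> real \<Rightarrow> real \<Rightarrow> real set \<Rightarrow> bool" where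
  "jumps_within x a c F \<longleftrightarrow> finite F \<and> F \<subseteq> {0<..} \<and>
     (\<forall>s s'. a \<le> s \<and> s \<le> s' \<and> s' \<le> c \<and> F \<inter> {s<..s'} = {} \<longrightarrow> x s = x s')"

lemma jumps_withinD:
  assumes "jumps_within x a c F"
  shows "finite F" "F \<subseteq> {0<..}" "\<And>s s'. a \<le> s \<Longrightarrow> s \<le> s' \<Longrightarrow> s' \<le> c \<Longrightarrow> F \<inter> {s<..s'} = {} \<Longrightarrow> x s = x s'"
  using assms by (simp_all add: jumps_within_def)

text \<open>
  Jump times cannot accumulate, because to the left and to the right of every point the path is
  constant for a while; compactness of the interval does the rest.
\<close>

lemma step_like_finite_jumps:
  assumes x: "step_like x" and T: "0 \<le> T"
  shows "\<exists>F. jumps_within x 0 T F"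
proof -
  define Q where "Q a c \<longleftrightarrow> (0 \<le> a \<longrightarrow> (\<exists>F. jumps_within x a c F))" for a c
  have "Q 0 T"
  proof (rule Bolzano[OF T])
    fix a b c assume Q: "Q a b" "Q b c" and o: "a \<le> b" "b \<le> c"
    show "Q a c"
      unfolding Q_def
    proof
      assume a: "0 \<le> a"
      then have "0 \<le> b" using o by simp
      obtain F where "jumps_within x a b F" using Q(1) a unfolding Q_def by blast
      note F = jumps_withinD[OF this]
      obtain G where "jumps_within x b c G" using Q(2) \<open>0 \<le> b\<close> unfolding Q_def by blast
      note G = jumps_withinD[OF this]
      have "x s = x s'" if s: "a \<le> s" "s \<le> s'" "s' \<le> c" "(F \<union> G) \<inter> {s<..s'} = {}" for s s'
      proof -
        consider "s' \<le> b" | "b \<le> s" | "s < b" "b < s'" by linarith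
        then show ?thesis
        proof cases
          case 1 then show ?thesis using s by (intro F) auto
        next
          case 2 then show ?thesis using s by (intro G) auto
        next
          case 3
          then have "x s = x b" using s by (intro F) auto
          also have "x b = x s'" using 3 s by (intro G) auto
          finally show ?thesis .
        qed
      qed
      then show "\<exists>F. jumps_within x a c F"
        using F(1,2) G(1,2) by (intro exI[of _ "F \<union> G"]) (simp add: jumps_within_def)
    qed
  next
    fix t assume t: "0 \<le> t" "t \<le> T"
    obtain e where e: "0 < e" "\<And>s. t \<le> s \<Longrightarrow> s < t + e \<Longrightarrow> x s = x t"
      using x t(1) unfolding step_like_def by blast
    show "\<exists>d>0. \<forall>a b. a \<le> t \<and> t \<le> b \<and> b - a < d \<longrightarrow> Q a b"
    proof (cases "t = 0")
      case True
      have "Q a b" if "a \<le> t" "t \<le> b" "b - a < e" for a b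
        unfolding Q_def jumps_within_def
      proof (intro impI exI[of _ "{}"] conjI allI)
        fix s s' assume "0 \<le> a" "a \<le> s \<and> s \<le> s' \<and> s' \<le> b \<and> {} \<inter> {s<..s'} = {}"
        then show "x s = x s'" using e(2)[of s] e(2)[of s'] that True by simp
      qed auto
      then show ?thesis using e(1) by blast
    next
      case False
      then obtain e' l where e': "0 < e'" "\<And>s. 0 \<le> s \<Longrightarrow> t - e' < s \<Longrightarrow> s < t \<Longrightarrow> x s = l"
        using x t(1) unfolding step_like_def by (metis order_le_less)
      have "Q a b" if "a \<le> t" "t \<le> b" "b - a < min e e'" for a b
        unfolding Q_def jumps_within_def
      proof (intro impI exI[of _ "{t}"] conjI allI)
        fix s s' assume a: "0 \<le> a" "a \<le> s \<and> s \<le> s' \<and> s' \<le> b \<and> {t} \<inter> {s<..s'} = {}"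
        then consider "t \<le> s" | "s' < t" by force
        then show "x s = x s'"
        proof cases
          case 1 then show ?thesis using e(2)[of s] e(2)[of s'] that a by simp
        next
          case 2 then show ?thesis using e'(2)[of s] e'(2)[of s'] that a by simp
        qed
      qed (use False t in auto)
      then show ?thesis using e(1) e'(1) by (intro exI[of _ "min e e'"]) auto
    qed
  qed
  then show ?thesis unfolding Q_def by auto
qed

text \<open>
  The position of the largest grid point up to \<open>t\<close> in the grid of mesh \<open>1 / (n + 1)\<close>. The grid
  ends at time \<open>n + 1\<close>, so that a sampled path depends on finitely many values of the original
  one.
\<close>

definition grid_index :: "nat \<Rightarrow> real \<Rightarrow> nat" where
  "grid_index n t = min (nat \<lfloor>t * real (Suc n)\<rfloor>) (Suc n * Suc n)"

definition sampled :: "nat \<Rightarrow> (real \<Rightarrow> 'v) \<Rightarrow> real \<Rightarrow> 'v" where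
  "sampled n x t = x (real (grid_index n t) / real (Suc n))"

lemma step_like_sampled: "step_like (sampled n x)"
  unfolding step_like_def
proof (intro conjI allI impI)
  fix t :: real assume t: "0 \<le> t"
  let ?g = "real (Suc n)"
  let ?e = "(real_of_int \<lfloor>t * ?g\<rfloor> + 1 - t * ?g) / ?g"
  have "0 < ?e" by (intro divide_pos_pos) (linarith, simp)
  moreover have "sampled n x s = sampled n x t" if "t \<le> s" "s < t + ?e" for s
  proof -
    have "t * ?g \<le> s * ?g" using that by (intro mult_right_mono) auto
    moreover have "s * ?g < (t + ?e) * ?g" using that(2) by (rule mult_strict_right_mono) simp
    then have "s * ?g < real_of_int \<lfloor>t * ?g\<rfloor> + 1" by (simp add: distrib_right del: of_nat_Suc)
    ultimately have "\<lfloor>s * ?g\<rfloor> = \<lfloor>t * ?g\<rfloor>" by linarith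
    then show ?thesis by (simp only: sampled_def grid_index_def)
  qed
  ultimately show "\<exists>e>0. \<forall>s. t \<le> s \<and> s < t + e \<longrightarrow> sampled n x s = sampled n x t" by blast
next
  fix t :: real assume t: "0 < t"
  let ?g = "real (Suc n)"
  let ?e = "(t * ?g - (real_of_int \<lceil>t * ?g\<rceil> - 1)) / ?g"
  let ?l = "x (real (min (nat (\<lceil>t * ?g\<rceil> - 1)) (Suc n * Suc n)) / ?g)"
  have "0 < ?e" by (intro divide_pos_pos) (linarith, simp)
  moreover have "sampled n x s = ?l" if "t - ?e < s" "s < t" for s
  proof -
    have "s * ?g < t * ?g" using that(2) by (rule mult_strict_right_mono) simp
    moreover have "(t - ?e) * ?g < s * ?g" using that(1) by (rule mult_strict_right_mono) simp
    moreover have "(t - z / g) * g = t * g - z" if "0 < g" for z g :: real using that by (simp add: left_diff_distrib)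
    then have "(t - ?e) * ?g = t * ?g - (t * ?g - (real_of_int \<lceil>t * ?g\<rceil> - 1))" by simp
    ultimately have "real_of_int \<lceil>t * ?g\<rceil> - 1 < s * ?g" "s * ?g < t * ?g" by linarith+
    then have "\<lfloor>s * ?g\<rfloor> = \<lceil>t * ?g\<rceil> - 1" by linarith
    then show ?thesis by (simp only: sampled_def grid_index_def)
  qed
  ultimately show "\<exists>e>0. \<exists>l. \<forall>s. 0 \<le> s \<and> t - e < s \<and> s < t \<longrightarrow> sampled n x s = l" by blast
qed

text \<open>
  A perturbation of the identity with slope at most one half is still increasing and onto.
\<close>

lemma bump_time_change:
  fixes B :: "real \<Rightarrow> real"
  assumes lip: "\<And>s t. \<bar>B s - B t\<bar> \<le> \<bar>s - t\<bar> / 2" and B0: "B 0 = 0" and Bb: "\<And>t. B t \<le> c"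
  shows "time_change (\<lambda>t. t - B t)"
  unfolding time_change_def
proof
  let ?\<tau> = "\<lambda>t. t - B t"
  have sm: "?\<tau> s < ?\<tau> t" if "s < t" for s t using lip[of s t] that by (simp add: abs_real_def split: if_splits)
  then show "strict_mono_on {0..} ?\<tau>" by (simp add: strict_mono_on_def)
  have cont: "continuous_on S ?\<tau>" for S
  proof (rule continuous_onI)
    fix t e :: real assume "0 < e"
    then show "\<exists>d>0. \<forall>x'\<in>S. dist x' t < d \<longrightarrow> dist (?\<tau> x') (?\<tau> t) \<le> e"
      using lip by (intro exI[of _ "e / 2"]) (auto simp: dist_real_def abs_real_def split: if_splits; smt (verit) field_sum_of_halves)
  qed
  show "?\<tau> ` {0..} = {0..}"
  proof (intro equalityI subsetI)
    fix y assume "y \<in> ?\<tau> ` {0..}"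
    then obtain t where t: "0 \<le> t" "y = ?\<tau> t" by auto
    then show "y \<in> {0..}" using sm[of 0 t] B0 by (cases "t = 0") auto
  next
    fix y :: real assume y: "y \<in> {0..}"
    have c0: "0 \<le> c" using Bb[of 0] B0 by simp
    have "\<exists>t\<ge>0. t \<le> y + c \<and> ?\<tau> t = y"
      by (rule IVT'[of ?\<tau>]) (use y B0 Bb[of "y + c"] c0 cont in auto)
    then show "y \<in> ?\<tau> ` {0..}" by auto
  qed
qed

lemma separation_constant:
  fixes F :: "real set"
  assumes "finite F" "F \<subseteq> {0<..}"
  obtains w where "0 < w" "\<And>a. a \<in> F \<Longrightarrow> w \<le> a" "\<And>a a'. a \<in> F \<Longrightarrow> a' \<in> F \<Longrightarrow> a \<noteq> a' \<Longrightarrow> 3 * w \<le> \<bar>a - a'\<bar>"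
proof
  let ?A = "insert 1 (F \<union> (\<lambda>(a, a'). \<bar>a - a'\<bar> / 3) ` {(a, a') \<in> F \<times> F. a \<noteq> a'})"
  let ?w = "Min ?A"
  have fin: "finite {(a, a') \<in> F \<times> F. a \<noteq> a'}" by (rule finite_subset[of _ "F \<times> F"]) (use assms in auto)
  then have finA: "finite ?A" using assms by simp
  show "0 < ?w" using finA assms by (subst Min_gr_iff) auto
  show "?w \<le> a" if "a \<in> F" for a using finA that by (intro Min_le) auto
  show "3 * ?w \<le> \<bar>a - a'\<bar>" if "a \<in> F" "a' \<in> F" "a \<noteq> a'" for a a'
  proof -
    have "\<bar>a - a'\<bar> / 3 \<in> ?A" using that by (auto intro!: image_eqI[of _ _ "(a, a')"])
    then have "?w \<le> \<bar>a - a'\<bar> / 3" by (rule Min_le[OF finA])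
    then show ?thesis by simp
  qed
qed

text \<open>
  Sampling delays each jump to the next grid point. If the mesh is small compared with the gaps
  between jumps, a time change that differs from the identity by a tent at each delayed jump
  undoes this exactly.
\<close>

lemma sampled_time_change:
  assumes x: "step_like x" and T: "0 \<le> T" and e: "0 < e"
  shows "\<forall>\<^sub>F n in sequentially. \<exists>\<tau>. time_change \<tau> \<and> (\<forall>t\<in>{0..T}. \<bar>\<tau> t - t\<bar> < e \<and> sampled n x t = x (\<tau> t))"
proof -
  obtain F where "jumps_within x 0 T F" using step_like_finite_jumps[OF x T] by blast
  note F = jumps_withinD[OF this]
  obtain w where w: "0 < w" "\<And>a. a \<in> F \<Longrightarrow> w \<le> a" "\<And>a a'. a \<in> F \<Longrightarrow> a' \<in> F \<Longrightarrow> a \<noteq> a' \<Longrightarrow> 3 * w \<le> \<bar>a - a'\<bar>"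
    using separation_constant[OF F(1,2)] by blast
  have "\<forall>\<^sub>F n in sequentially. inverse (real (Suc n)) < min e (w / 2)"
    using LIMSEQ_inverse_real_of_nat e w by (intro order_tendstoD(2)) auto
  moreover have "\<forall>\<^sub>F n in sequentially. T \<le> real (Suc n)"
    by (rule eventually_sequentiallyI[of "nat \<lceil>T\<rceil>"]) linarith
  ultimately show ?thesis
  proof eventually_elim
    case (elim n)
    define g where "g = real (Suc n)"
    have g: "0 < g" "1 / g < e" "1 / g < w / 2" "T \<le> g" using elim by (auto simp: g_def inverse_eq_divide)
    define c where "c a = real_of_int \<lceil>a * g\<rceil> / g" for a
    have c: "a \<le> c a" "c a < a + 1 / g" for a
    proof -
      have "a * g \<le> real_of_int \<lceil>a * g\<rceil>" "real_of_int \<lceil>a * g\<rceil> < a * g + 1" by linarith+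
      then show "a \<le> c a" "c a < a + 1 / g" using g(1) by (auto simp: c_def field_simps)
    qed
    \<comment> \<open>A tent of height \<open>c a - a\<close> at the grid point \<open>c a\<close> that follows the jump time \<open>a\<close>; the
      tents are disjoint because jumps are \<open>3 w\<close> apart.\<close>
    define bump where "bump a t = (c a - a) * max 0 (1 - \<bar>t - c a\<bar> / w)" for a t
    define B where "B t = Max (insert 0 ((\<lambda>a. bump a t) ` F))" for t
    have fin: "finite (insert 0 ((\<lambda>a. bump a t) ` F))" for t using F by simp
    have B_ge: "0 \<le> B t" "a \<in> F \<Longrightarrow> bump a t \<le> B t" for a t unfolding B_def using fin[of t] by (auto intro: Max_ge)
    have B_le: "B t \<le> k" if "0 \<le> k" "\<And>a. a \<in> F \<Longrightarrow> bump a t \<le> k" for t k unfolding B_def using fin[of t] that by (subst Max_le_iff) auto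
    have bump0: "0 \<le> bump a t" "bump a t \<le> 1 / g" for a t
    proof -
      show "0 \<le> bump a t" unfolding bump_def using c(1)[of a] by (intro mult_nonneg_nonneg) auto
      have "bump a t \<le> (1 / g) * 1" unfolding bump_def using c[of a] w(1) g by (intro mult_mono) (auto simp: less_imp_le)
      then show "bump a t \<le> 1 / g" by simp
    qed
    have bump_lip: "bump a t \<le> bump a s + \<bar>s - t\<bar> / 2" for a s t
    proof -
      have "max 0 (1 - \<bar>t - c a\<bar> / w) - max 0 (1 - \<bar>s - c a\<bar> / w) \<le> \<bar>s - t\<bar> / w"
      proof -
        have "1 - \<bar>t - c a\<bar> / w \<le> (1 - \<bar>s - c a\<bar> / w) + \<bar>s - t\<bar> / w"
        proof -
          have "\<bar>s - c a\<bar> \<le> \<bar>t - c a\<bar> + \<bar>s - t\<bar>" by linarith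
          then have "\<bar>s - c a\<bar> / w \<le> (\<bar>t - c a\<bar> + \<bar>s - t\<bar>) / w" using w(1) by (intro divide_right_mono) auto
          then show ?thesis by (simp add: add_divide_distrib)
        qed
        moreover have "0 \<le> \<bar>s - t\<bar> / w" using w(1) by simp
        ultimately show ?thesis by linarith
      qed
      then have "(c a - a) * (max 0 (1 - \<bar>t - c a\<bar> / w) - max 0 (1 - \<bar>s - c a\<bar> / w)) \<le> (c a - a) * (\<bar>s - t\<bar> / w)"
        using c(1)[of a] by (intro mult_left_mono) auto
      also have "\<dots> \<le> (w / 2) * (\<bar>s - t\<bar> / w)"
        using c[of a] g w(1) by (intro mult_right_mono) auto
      also have "\<dots> = \<bar>s - t\<bar> / 2" using w(1) by simp
      finally show ?thesis by (simp add: bump_def right_diff_distrib)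
    qed
    have B_lip: "\<bar>B s - B t\<bar> \<le> \<bar>s - t\<bar> / 2" for s t
    proof -
      have 1: "B t \<le> B s + \<bar>s - t\<bar> / 2" for s t
      proof (rule B_le)
        fix s t a assume "a \<in> F"
        then show "bump a t \<le> B s + \<bar>s - t\<bar> / 2" using B_ge(2)[of a s] bump_lip[of a t s] by linarith
      qed (use B_ge(1) in simp)
      show ?thesis
      proof (rule abs_leI)
        show "B s - B t \<le> \<bar>s - t\<bar> / 2" using 1[where s=t and t=s] by (simp add: abs_minus_commute)
        show "- (B s - B t) \<le> \<bar>s - t\<bar> / 2" using 1[where s=s and t=t] by simp
      qed
    qed
    have B1: "B t \<le> 1 / g" for t by (rule B_le) (use bump0 g in auto)
    have bump_zero: "bump a t = 0" if "w \<le> \<bar>t - c a\<bar>" for a t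
    proof -
      have "1 \<le> \<bar>t - c a\<bar> / w" using that w(1) by simp
      then show ?thesis by (simp add: bump_def)
    qed
    have B_0: "B 0 = 0"
    proof -
      have "bump a 0 = 0" if "a \<in> F" for a using w(2)[OF that] c(1)[of a] w(1) by (intro bump_zero) auto
      then show ?thesis using B_ge(1)[of 0] B_le[of 0 0] by force
    qed
    have B_c: "B (c a) = c a - a" if a: "a \<in> F" for a
    proof (rule antisym)
      have ca: "bump a (c a) = c a - a" by (simp add: bump_def)
      show "c a - a \<le> B (c a)" using B_ge(2)[OF a, of "c a"] ca by simp
      show "B (c a) \<le> c a - a"
      proof (rule B_le)
        fix a' assume a': "a' \<in> F"
        show "bump a' (c a) \<le> c a - a"
        proof (cases "a' = a")
          case False
          have "3 * w \<le> \<bar>a - a'\<bar>" using w(3)[OF a a'] False by auto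
          then have "w \<le> \<bar>c a - c a'\<bar>" using c[of a] c[of a'] g(3) w(1) by linarith
          then show ?thesis using bump_zero[of "c a" a'] c(1)[of a] by simp
        qed (simp add: ca)
      qed (use c(1)[of a] in simp)
    qed
    let ?\<tau> = "\<lambda>t. t - B t"
    have tc: "time_change ?\<tau>" by (rule bump_time_change[OF B_lip B_0 B1])
    have mono: "?\<tau> s \<le> ?\<tau> t \<longleftrightarrow> s \<le> t" for s t
      using B_lip[of s t] by (simp add: abs_real_def split: if_splits) linarith
    have "sampled n x t = x (?\<tau> t)" if t: "0 \<le> t" "t \<le> T" for t
    proof -
      define a where "a = real_of_int \<lfloor>t * g\<rfloor> / g"
      have "t * g \<le> g * g" using t g by (intro mult_right_mono) auto
      then have "t * g \<le> real (Suc n * Suc n)" by (simp only: g_def of_nat_mult)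
      then have "\<lfloor>t * g\<rfloor> \<le> \<lfloor>real (Suc n * Suc n)\<rfloor>" by (rule floor_mono)
      then have "\<lfloor>t * g\<rfloor> \<le> int (Suc n * Suc n)" by (simp only: floor_of_nat)
      then have "nat \<lfloor>t * g\<rfloor> \<le> Suc n * Suc n" by (simp only: nat_le_iff)
      then have "grid_index n t = nat \<lfloor>t * g\<rfloor>" unfolding grid_index_def g_def[symmetric] by (rule min_absorb1)
      moreover have "0 \<le> \<lfloor>t * g\<rfloor>" using t g by simp
      ultimately have sa: "sampled n x t = x a" by (simp add: sampled_def a_def g_def)
      have a: "0 \<le> a" "a \<le> t" using t g \<open>0 \<le> \<lfloor>t * g\<rfloor>\<close> by (auto simp: a_def divide_le_eq)
      have \<tau>: "0 \<le> ?\<tau> t" "?\<tau> t \<le> t" using time_change_nonneg[OF tc t(1)] B_ge(1)[of t] by auto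
      have key: "\<sigma> \<le> a \<longleftrightarrow> \<sigma> \<le> ?\<tau> t" if \<sigma>: "\<sigma> \<in> F" for \<sigma>
      proof -
        have "\<sigma> \<le> a \<longleftrightarrow> \<lceil>\<sigma> * g\<rceil> \<le> \<lfloor>t * g\<rfloor>" using g(1) by (simp add: a_def pos_le_divide_eq ceiling_le_iff)
        also have "\<dots> \<longleftrightarrow> real_of_int \<lceil>\<sigma> * g\<rceil> \<le> t * g" by (simp add: le_floor_iff)
        also have "\<dots> \<longleftrightarrow> c \<sigma> \<le> t" using g(1) by (simp add: c_def pos_divide_le_eq)
        also have "\<dots> \<longleftrightarrow> ?\<tau> (c \<sigma>) \<le> ?\<tau> t" by (rule mono[symmetric])
        also have "?\<tau> (c \<sigma>) = \<sigma>" using B_c[OF \<sigma>] by simp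
        finally show ?thesis .
      qed
      have "x a = x (?\<tau> t)"
      proof (cases "a \<le> ?\<tau> t")
        case True
        show ?thesis by (rule F(3)) (use a True \<tau> t key in force)+
      next
        case False
        have "x (?\<tau> t) = x a" by (rule F(3)) (use a False \<tau> t key in force)+
        then show ?thesis ..
      qed
      then show ?thesis using sa by simp
    qed
    moreover have "\<bar>?\<tau> t - t\<bar> < e" for t using B_ge(1)[of t] B1[of t] g by simp
    ultimately show ?case using tc by (intro exI[of _ ?\<tau>]) auto
  qed
qed

context carrier_metric
begin

lemma step_like_cadlag:
  assumes x: "step_like x" and f: "\<And>t. 0 \<le> t \<Longrightarrow> f (x t) \<in> M"
  shows "(\<lambda>t\<in>{0..}. f (x t)) \<in> cadlag_paths M d"
  unfolding cadlag_paths_def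
proof (intro CollectI conjI allI impI)
  show "(\<lambda>t\<in>{0..}. f (x t)) \<in> {0..} \<rightarrow>\<^sub>E M" using f by auto
  fix t :: real assume t: "0 \<le> t"
  then obtain e where e: "0 < e" "\<And>s. t \<le> s \<Longrightarrow> s < t + e \<Longrightarrow> x s = x t"
    using step_like_right[OF x t] by blast
  have "\<forall>\<^sub>F s in at_right t. d ((\<lambda>t\<in>{0..}. f (x t)) s) ((\<lambda>t\<in>{0..}. f (x t)) t) = 0"
    unfolding eventually_at_right_field
  proof (intro exI[of _ "t + e"] conjI allI impI)
    fix s assume "t < s" "s < t + e"
    then show "d ((\<lambda>t\<in>{0..}. f (x t)) s) ((\<lambda>t\<in>{0..}. f (x t)) t) = 0"
      using e(2)[of s] t self[OF f[OF t]] by simp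
  qed (use e in simp)
  then show "((\<lambda>s. d ((\<lambda>t\<in>{0..}. f (x t)) s) ((\<lambda>t\<in>{0..}. f (x t)) t)) \<longlongrightarrow> 0) (at_right t)"
    by (rule tendsto_eventually)
next
  fix t :: real assume t: "0 < t"
  then obtain e l where e: "0 < e" "\<And>s. 0 \<le> s \<Longrightarrow> t - e < s \<Longrightarrow> s < t \<Longrightarrow> x s = l"
    using step_like_left[OF x t] by blast
  define s0 where "s0 = max (t / 2) (t - e / 2)"
  have s0: "0 \<le> s0" "t - e < s0" "s0 < t" using t e by (auto simp: s0_def)
  have l: "f l \<in> M" using f[OF s0(1)] e(2)[OF s0] by simp
  have "\<forall>\<^sub>F s in at_left t. d ((\<lambda>t\<in>{0..}. f (x t)) s) (f l) = 0"
    unfolding eventually_at_left_field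
  proof (intro exI[of _ s0] conjI allI impI)
    fix s assume "s0 < s" "s < t"
    then show "d ((\<lambda>t\<in>{0..}. f (x t)) s) (f l) = 0" using s0 e(2)[of s] self[OF l] by simp
  qed (use s0 in simp)
  then show "\<exists>l\<in>M. ((\<lambda>s. d ((\<lambda>t\<in>{0..}. f (x t)) s) l) \<longlongrightarrow> 0) (at_left t)"
    using l by (intro bexI[of _ "f l"] tendsto_eventually)
qed

text \<open>
  A sampled path takes only countably many values in path space, so each of its preimages is a
  countable union of measurable sets.
\<close>

lemma step_like_measurable:
  fixes V :: "'w \<Rightarrow> real \<Rightarrow> 'v :: countable"
  assumes V: "\<And>w. w \<in> space \<Omega> \<Longrightarrow> step_like (V w)"
    and f: "\<And>w t. w \<in> space \<Omega> \<Longrightarrow> 0 \<le> t \<Longrightarrow> f (V w t) \<in> M"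
    and meas: "\<And>t. 0 \<le> t \<Longrightarrow> (\<lambda>w. V w t) \<in> \<Omega> \<rightarrow>\<^sub>M count_space UNIV"
  shows "(\<lambda>w. \<lambda>t\<in>{0..}. f (V w t)) \<in> \<Omega> \<rightarrow>\<^sub>M borel_of_topology (J1_topology M d)"
proof (rule measurable_J1_limit[where Xn="\<lambda>n w. \<lambda>t\<in>{0..}. f (sampled n (V w) t)"])
  show "(\<lambda>t\<in>{0..}. f (V w t)) \<in> cadlag_paths M d" if "w \<in> space \<Omega>" for w
    by (rule step_like_cadlag[OF V[OF that]]) (rule f[OF that])
  show cad: "(\<lambda>t\<in>{0..}. f (sampled n (V w) t)) \<in> cadlag_paths M d" if "w \<in> space \<Omega>" for n w
    by (rule step_like_cadlag[OF step_like_sampled]) (auto simp: sampled_def intro!: f that)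
  fix n A
  define code where "code w = map (\<lambda>k. V w (real k / real (Suc n))) [0..<Suc (Suc n * Suc n)]" for w
  have code: "code \<in> \<Omega> \<rightarrow>\<^sub>M count_space UNIV"
    unfolding measurable_count_space_eq2_countable
  proof safe
    fix l :: "'v list"
    have "code -` {l} \<inter> space \<Omega> = {w \<in> space \<Omega>. length l = Suc (Suc n * Suc n) \<and> (\<forall>k\<in>{..<Suc (Suc n * Suc n)}. V w (real k / real (Suc n)) = l ! k)}"
      by (auto simp: code_def list_eq_iff_nth_eq simp del: upt_Suc)
    also have "\<dots> \<in> sets \<Omega>"
    proof (rule sets.sets_Collect_conj)
      have "{w \<in> space \<Omega>. V w (real k / real (Suc n)) = l ! k} \<in> sets \<Omega>" for k
        using measurable_sets[OF meas[of "real k / real (Suc n)"], of "{l ! k}"] by (simp add: vimage_def Int_def conj_commute)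
      then show "{w \<in> space \<Omega>. \<forall>k\<in>{..<Suc (Suc n * Suc n)}. V w (real k / real (Suc n)) = l ! k} \<in> sets \<Omega>"
        by (intro sets.sets_Collect_finite_All) auto
    qed simp
    finally show "code -` {l} \<inter> space \<Omega> \<in> sets \<Omega>" .
  qed auto
  have "(\<lambda>t\<in>{0..}. f (sampled n (V w) t)) = (\<lambda>t\<in>{0..}. f (code w ! grid_index n t))" for w
  proof (rule restrict_ext)
    fix t
    have "grid_index n t < Suc (Suc n * Suc n)" by (simp add: grid_index_def less_Suc_eq_le)
    then show "f (sampled n (V w) t) = f (code w ! grid_index n t)" by (simp add: sampled_def code_def del: upt_Suc)
  qed
  then have "{w \<in> space \<Omega>. (\<lambda>t\<in>{0..}. f (sampled n (V w) t)) \<in> A} = code -` {l. (\<lambda>t\<in>{0..}. f (l ! grid_index n t)) \<in> A} \<inter> space \<Omega>"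
    by auto
  also have "\<dots> \<in> sets \<Omega>" by (rule measurable_sets[OF code]) simp
  finally show "{w \<in> space \<Omega>. (\<lambda>t\<in>{0..}. f (sampled n (V w) t)) \<in> A} \<in> sets \<Omega>" .
next
  fix w and T e :: real assume w: "w \<in> space \<Omega>" and Te: "0 < T" "0 < e"
  have cad: "(\<lambda>t\<in>{0..}. f (sampled n (V w) t)) \<in> cadlag_paths M d" for n
    by (rule step_like_cadlag[OF step_like_sampled]) (auto simp: sampled_def intro!: f w)
  show "\<forall>\<^sub>F n in sequentially. (\<lambda>t\<in>{0..}. f (sampled n (V w) t)) \<in> J1_nbhd M d (\<lambda>t\<in>{0..}. f (V w t)) T e"
    using sampled_time_change[OF V[OF w] less_imp_le[OF Te(1)] Te(2)]
  proof eventually_elim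
    case (elim n)
    then obtain \<tau> where \<tau>1: "time_change \<tau>" and \<tau>2: "\<forall>t\<in>{0..T}. \<bar>\<tau> t - t\<bar> < e \<and> sampled n (V w) t = V w (\<tau> t)"
      by (elim exE conjE)
    note \<tau> = \<tau>1 bspec[OF \<tau>2]
    have "d ((\<lambda>t\<in>{0..}. f (sampled n (V w) t)) t) ((\<lambda>t\<in>{0..}. f (V w t)) (\<tau> t)) < e" if "t \<in> {0..T}" for t
      using \<tau>(2)[OF that] that time_change_nonneg[OF \<tau>(1), of t] self[OF f[OF w, of "\<tau> t"]] Te by simp
    then show ?case using cad \<tau>1 \<tau>2 unfolding J1_nbhd_def by blast
  qed
qed

text \<open>
  At a continuous path small time changes are harmless: if \<open>x\<close> lies in every \<open>J\<^sub>1\<close> neighbourhood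
  of \<open>y\<close>, then \<open>y = x\<close>. This makes the complement of a continuous path a null set for the point
  mass there.
\<close>

lemma J1_singleton_closed:
  assumes x: "x \<in> cadlag_paths M d"
    and cont: "\<And>t. 0 \<le> t \<Longrightarrow> ((\<lambda>s. d (x s) (x t)) \<longlongrightarrow> 0) (at t within {0..})"
  shows "openin (J1_topology M d) (cadlag_paths M d - {x})"
  unfolding openin_J1_topology
proof (intro conjI ballI)
  fix y assume y: "y \<in> cadlag_paths M d - {x}"
  show "\<exists>T>0. \<exists>e>0. J1_nbhd M d y T e \<subseteq> cadlag_paths M d - {x}"
  proof (rule ccontr)
    assume "\<not> ?thesis"
    then have all: "x \<in> J1_nbhd M d y T e" if "0 < T" "0 < e" for T e
      using that J1_nbhd_cadlag by blast
    have "y t = x t" if t: "0 \<le> t" for t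
    proof -
      have m: "x s \<in> M" "y s \<in> M" if "0 \<le> s" for s using x y that cadlag_paths_mem by blast+
      have "d (y t) (x t) \<le> r" if r: "0 < r" for r
      proof -
        have "\<forall>\<^sub>F s in at t within {0..}. d (x s) (x t) < r / 2"
          using order_tendstoD(2)[OF cont[OF t], of "r / 2"] r by simp
        then obtain \<delta> where \<delta>: "0 < \<delta>" "\<And>s. 0 \<le> s \<Longrightarrow> s \<noteq> t \<Longrightarrow> dist s t < \<delta> \<Longrightarrow> d (x s) (x t) < r / 2"
          unfolding eventually_at by auto
        define e where "e = min 1 (min \<delta> (r / 2))"
        have e: "0 < e" "e \<le> 1" "e \<le> \<delta>" "e \<le> r / 2" using \<delta> r by (auto simp: e_def)
        have "x \<in> J1_nbhd M d y (t + 1) e" using all t e by simp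
        then have "y \<in> J1_nbhd M d x (t + 1 - e) e"
          using y t e by (intro J1_nbhd_sym) auto
        then obtain \<tau> where \<tau>: "time_change \<tau>" "\<bar>\<tau> t - t\<bar> < e" "d (y t) (x (\<tau> t)) < e"
          using t e unfolding J1_nbhd_def by force
        have \<tau>0: "0 \<le> \<tau> t" using time_change_nonneg[OF \<tau>(1) t] .
        have "d (x (\<tau> t)) (x t) < r / 2"
          using \<delta>(2)[OF \<tau>0] \<tau>(2) e self[OF m(1)[OF t]] r by (cases "\<tau> t = t") (auto simp: dist_real_def)
        moreover have "d (y t) (x t) \<le> d (y t) (x (\<tau> t)) + d (x (\<tau> t)) (x t)"
          using m t \<tau>0 by (intro triangle) auto
        ultimately show ?thesis using \<tau>(3) e by linarith
      qed
      then have "d (y t) (x t) \<le> 0" by (rule field_le_epsilon) simp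
      then show ?thesis by (rule separated[OF m(2)[OF t] m(1)[OF t]])
    qed
    then have "y = x" using y x by (intro cadlag_paths_eqI) auto
    then show False using y by simp
  qed
qed auto

end

section \<open>Paths with reflection\<close>

lemma occ_space_bounds:
  assumes "q \<in> occ_space b"
  shows "0 \<le> q i" "q i \<le> 1" "q 0 = 0" "summable q" "1 \<le> i \<Longrightarrow> q (Suc i) \<le> q i" "\<not> enat i \<le> b \<Longrightarrow> q i = 0"
proof -
  have a: "1 \<le> i \<and> enat i \<le> b \<Longrightarrow> 0 \<le> q i \<and> q i \<le> 1" and z: "\<not> (1 \<le> i \<and> enat i \<le> b) \<Longrightarrow> q i = 0" for i
    using assms by (auto simp: occ_space_def)
  show "0 \<le> q i" "q i \<le> 1" using a[of i] z[of i] by (cases "1 \<le> i \<and> enat i \<le> b", auto)+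
  show "q 0 = 0" "\<not> enat i \<le> b \<Longrightarrow> q i = 0" using z by auto
  show "summable q" using assms by (auto simp: occ_space_def)
  assume "1 \<le> i"
  show "q (Suc i) \<le> q i"
  proof (cases "enat (Suc i) \<le> b")
    case True
    then show ?thesis using assms \<open>1 \<le> i\<close> by (auto simp: occ_space_def dest!: spec[of _ "Suc i"])
  next
    case False
    then show ?thesis using z[of "Suc i"] \<open>0 \<le> q i\<close> by auto
  qed
qed

lemma l1_summable:
  assumes "x \<in> occ_space b" "y \<in> occ_space b"
  shows "summable (\<lambda>i. \<bar>x i - y i\<bar>)"
proof (rule summable_comparison_test'[of "\<lambda>i. x i + y i" 0])
  show "summable (\<lambda>i. x i + y i)" using assms by (intro summable_add occ_space_bounds)
  show "norm \<bar>x n - y n\<bar> \<le> x n + y n" for n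
    using occ_space_bounds(1)[OF assms(1), of n] occ_space_bounds(1)[OF assms(2), of n] by auto
qed

lemma l1_dist_component:
  assumes "x \<in> occ_space b" "y \<in> occ_space b"
  shows "\<bar>x i - y i\<bar> \<le> l1_dist x y"
  unfolding l1_dist_def using sum_le_suminf[OF l1_summable[OF assms], of "{i}"] by simp

lemma l1_dist_nonneg: "x \<in> occ_space b \<Longrightarrow> y \<in> occ_space b \<Longrightarrow> 0 \<le> l1_dist x y"
  using l1_dist_component[of x b y 0] by linarith

lemma l1_dist_commute: "l1_dist x y = l1_dist y x"
  unfolding l1_dist_def by (simp add: abs_minus_commute)

lemma l1_dist_refl [simp]: "l1_dist x x = 0"
  by (simp add: l1_dist_def)

lemma l1_dist_eq_0:
  assumes "x \<in> occ_space b" "y \<in> occ_space b" "l1_dist x y \<le> 0"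
  shows "x = y"
proof
  fix i show "x i = y i" using l1_dist_component[OF assms(1,2), of i] assms(3) by simp
qed

lemma l1_dist_triangle:
  assumes x: "x \<in> occ_space b" and y: "y \<in> occ_space b" and z: "z \<in> occ_space b"
  shows "l1_dist x z \<le> l1_dist x y + l1_dist y z"
proof -
  have "l1_dist x z \<le> (\<Sum>i. \<bar>x i - y i\<bar> + \<bar>y i - z i\<bar>)"
    unfolding l1_dist_def
  proof (rule suminf_le)
    show "\<bar>x n - z n\<bar> \<le> \<bar>x n - y n\<bar> + \<bar>y n - z n\<bar>" for n by simp
  qed (intro l1_summable[OF x z] summable_add l1_summable[OF x y] l1_summable[OF y z])+
  also have "\<dots> = l1_dist x y + l1_dist y z"
    unfolding l1_dist_def by (intro suminf_add[symmetric] l1_summable[OF x y] l1_summable[OF y z])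
  finally show ?thesis .
qed

lemma set_integral_Icc_split:
  fixes g :: "real \<Rightarrow> real"
  assumes "\<And>t. set_integrable lborel {0..t} g" "0 \<le> s" "s \<le> t"
  shows "(LBINT r:{0..t}. g r) - (LBINT r:{0..s}. g r) = (LBINT r:{s..t}. g r)"
proof -
  have "(LBINT r:{0..t}. g r) = (LBINT r:{0..s} \<union> {s<..t}. g r)"
    using assms by (intro arg_cong2[where f="\<lambda>A f. set_lebesgue_integral lborel A f"]) auto
  also have "\<dots> = (LBINT r:{0..s}. g r) + (LBINT r:{s<..t}. g r)"
    by (rule set_integral_Un[OF _ assms(1)[of s] set_integrable_subset[OF assms(1)[of t]]]) (use assms in auto)
  also have "(LBINT r:{s<..t}. g r) = (LBINT r:{s..t}. g r)"
    unfolding set_lebesgue_integral_def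
  proof (rule integral_cong_AE)
    show "AE r in lborel. indicator {s<..t} r *\<^sub>R g r = indicator {s..t} r *\<^sub>R g r"
      using AE_lborel_singleton[of s] by eventually_elim (auto simp: indicator_def)
    have "set_integrable lborel {s..t} g" "set_integrable lborel {s<..t} g"
      by (rule set_integrable_subset[OF assms(1)[of t]], use assms in auto)+
    then show "(\<lambda>r. indicator {s..t} r *\<^sub>R g r) \<in> borel_measurable lborel" "(\<lambda>r. indicator {s<..t} r *\<^sub>R g r) \<in> borel_measurable lborel"
      by (auto simp: set_integrable_def)
  qed
  finally show ?thesis by simp
qed

lemma set_integral_Icc_bound:
  fixes g :: "real \<Rightarrow> real"
  assumes "set_integrable lborel {s..t} g" "s \<le> t" "\<And>r. s \<le> r \<Longrightarrow> r \<le> t \<Longrightarrow> \<bar>g r\<bar> \<le> B"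
  shows "\<bar>LBINT r:{s..t}. g r\<bar> \<le> B * (t - s)"
proof -
  have "\<bar>LBINT r:{s..t}. g r\<bar> \<le> (LBINT r:{s..t}. \<bar>g r\<bar>)"
    using set_integral_norm_bound[OF assms(1)] by simp
  also have "\<dots> \<le> (LBINT r:{s..t}. B)"
    by (rule set_integral_mono[OF set_integrable_abs[OF assms(1)]]) (use assms(3) in \<open>auto simp: set_integrable_def intro!: integrable_mult_right integrable_real_indicator simp: emeasure_lborel_Icc_eq\<close>)
  also have "\<dots> = B * (t - s)" using assms(2) by (simp add: set_lebesgue_integral_def)
  finally show ?thesis .
qed

locale occ_path =
  fixes b :: enat and q :: "real \<Rightarrow> nat \<Rightarrow> real"
  assumes sp_occ: "\<And>t. 0 \<le> t \<Longrightarrow> q t \<in> occ_space b"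
    and sp_meas: "\<And>i. set_borel_measurable borel {0..} (\<lambda>t. q t i)"

text \<open>
  The equations shared by the occupancy paths of the finite systems and by the fluid path. The
  reflection assumption \<open>sp_reflect\<close> says that \<open>U i\<close> increases only while level \<open>i\<close> is full, in
  a form that also makes sense for paths with jumps: the last point of increase of \<open>U i\<close> in an
  interval is a time at which \<open>q\<^sub>i = 1\<close>. The assumption \<open>sp_U_Suc\<close> holds because an arrival that
  finds more than \<open>i\<close> tasks everywhere also finds at least \<open>i\<close>.
\<close>

locale sys_path = occ_path b q
  for b :: enat and q :: "real \<Rightarrow> nat \<Rightarrow> real" +
  fixes U D :: "nat \<Rightarrow> real \<Rightarrow> real"
  assumes sp_eq: "\<And>t i. 0 \<le> t \<Longrightarrow> 1 \<le> i \<Longrightarrow> enat i \<le> b \<Longrightarrow> q t i = q 0 i + U (i - 1) t - U i t - D i t"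
    and sp_0: "\<And>i. U i 0 = 0" "\<And>i. D i 0 = 0"
    and sp_U_mono: "\<And>i s t. 0 \<le> s \<Longrightarrow> s \<le> t \<Longrightarrow> U i s \<le> U i t"
    and sp_U_Suc: "\<And>i s t. 0 \<le> s \<Longrightarrow> s \<le> t \<Longrightarrow> U (Suc i) t - U (Suc i) s \<le> U i t - U i s"
    and sp_D_mono: "\<And>i s t. 1 \<le> i \<Longrightarrow> 0 \<le> s \<Longrightarrow> s \<le> t \<Longrightarrow> D i s \<le> D i t"
    and sp_reflect: "\<And>i s t. 1 \<le> i \<Longrightarrow> enat i \<le> b \<Longrightarrow> 0 \<le> s \<Longrightarrow> s \<le> t \<Longrightarrow> U i s < U i t \<Longrightarrow>
       \<exists>r\<in>{s..t}. q r i = 1 \<and> U i r = U i t"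

definition drift :: "(real \<Rightarrow> nat \<Rightarrow> real) \<Rightarrow> nat \<Rightarrow> real \<Rightarrow> real" where
  "drift q i t = (LBINT s:{0..t}. q s i - q s (i + 1))"

text \<open>
  Only finitely many levels are controlled, since the probabilistic estimates treat one level at
  a time.
\<close>

definition near_fluid :: "enat \<Rightarrow> real \<Rightarrow> real \<Rightarrow> nat \<Rightarrow> real \<Rightarrow> (real \<Rightarrow> nat \<Rightarrow> real) \<Rightarrow> (nat \<Rightarrow> real \<Rightarrow> real) \<Rightarrow> (nat \<Rightarrow> real \<Rightarrow> real) \<Rightarrow> bool" where
  "near_fluid b lam T J e q U D \<longleftrightarrow>
     (\<forall>t\<in>{0..T}. \<bar>U 0 t - lam * t\<bar> \<le> e \<and> (\<forall>i. 1 \<le> i \<and> i \<le> J \<and> enat i \<le> b \<longrightarrow> \<bar>D i t - drift q i t\<bar> \<le> e))"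

context occ_path
begin

lemma sp_integrable: "0 \<le> s \<Longrightarrow> set_integrable lborel {s..t} (\<lambda>s. q s i)"
proof -
  assume s: "0 \<le> s"
  have "set_borel_measurable borel {s..t} (\<lambda>t. q t i)"
    by (rule set_borel_measurable_subset[OF sp_meas]) (use s in auto)
  then have "(\<lambda>r. indicator {s..t} r *\<^sub>R q r i) \<in> borel_measurable lborel" by (simp add: set_borel_measurable_def)
  then show ?thesis
    unfolding set_integrable_def
  proof (intro Bochner_Integration.integrable_bound[where f="\<lambda>r. indicator {s..t} r :: real" and g="\<lambda>r. indicator {s..t} r *\<^sub>R q r i"] AE_I2)
    fix r
    show "norm (indicator {s..t} r *\<^sub>R q r i) \<le> norm (indicator {s..t} r :: real)"
      using occ_space_bounds(1,2)[OF sp_occ[of r], of i] s by (auto simp: indicator_def)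
    show "integrable lborel (indicator {s..t} :: real \<Rightarrow> real)"
      by (rule integrable_real_indicator) (auto simp: emeasure_lborel_Icc_eq)
  qed simp
qed

lemma sp_integrable_diff: "0 \<le> s \<Longrightarrow> set_integrable lborel {s..t} (\<lambda>s. q s i - q s (i + 1))"
  by (intro set_integral_diff(1) sp_integrable)

lemma sp_drift_diff:
  assumes "0 \<le> s" "s \<le> t"
  shows "drift q i t - drift q i s = (LBINT r:{s..t}. q r i - q r (i + 1))"
  unfolding drift_def by (rule set_integral_Icc_split[OF sp_integrable_diff assms]) simp

lemma sp_drift_bounds:
  assumes "0 \<le> s" "s \<le> t" "1 \<le> i"
  shows "0 \<le> drift q i t - drift q i s" "drift q i t - drift q i s \<le> t - s"
proof -
  have *: "0 \<le> q r i - q r (i + 1)" "q r i - q r (i + 1) \<le> 1" if "0 \<le> r" for r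
    using occ_space_bounds(1,2)[OF sp_occ[OF that], of i] occ_space_bounds(1)[OF sp_occ[OF that], of "i+1"]
      occ_space_bounds(5)[OF sp_occ[OF that], of i] assms(3) by auto
  show "0 \<le> drift q i t - drift q i s"
    unfolding sp_drift_diff[OF assms(1,2)] set_lebesgue_integral_def
    by (rule integral_nonneg_AE) (use * assms in \<open>auto simp: indicator_def\<close>)
  have "(LBINT r:{s..t}. q r i - q r (i + 1)) \<le> (LBINT r:{s..t}. 1)"
    by (rule set_integral_mono) (use * assms sp_integrable_diff in \<open>auto simp: set_integrable_def\<close>)
  also have "\<dots> = t - s" using assms by (simp add: set_lebesgue_integral_def)
  finally show "drift q i t - drift q i s \<le> t - s"
    unfolding sp_drift_diff[OF assms(1,2)] .
qed

end

context sys_path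
begin

lemma sp_U_nonneg: "0 \<le> t \<Longrightarrow> 0 \<le> U i t" using sp_U_mono[of 0 t i] sp_0 by simp
lemma sp_D_nonneg: "1 \<le> i \<Longrightarrow> 0 \<le> t \<Longrightarrow> 0 \<le> D i t" using sp_D_mono[of i 0 t] sp_0 by simp

text \<open>Summing the equations over the levels telescopes the overflow terms.\<close>

lemma sp_mass:
  assumes t: "0 \<le> t" and n: "enat n \<le> b"
  shows "(\<Sum>i\<in>{1..n}. q t i) \<le> (\<Sum>i\<in>{1..n}. q 0 i) + U 0 t - U n t"
  using n
proof (induction n)
  case (Suc n)
  have n: "enat n \<le> b" using Suc.prems by (meson enat_ord_simps(1) le_SucI order_refl order_trans)
  have "q t (Suc n) \<le> q 0 (Suc n) + U n t - U (Suc n) t"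
    using sp_eq[OF t, of "Suc n"] sp_D_nonneg[of "Suc n" t] t Suc.prems by simp
  then show ?case using Suc.IH[OF n] by simp
qed simp

text \<open>Level \<open>i\<close> can be full only if all lower levels are, which takes mass \<open>i\<close>.\<close>

lemma sp_no_overflow:
  assumes i: "1 \<le> i" "enat i \<le> b" and T: "0 \<le> t" "t \<le> T" and m: "(\<Sum>i. q 0 i) + U 0 T < real i"
  shows "U i t = 0"
proof (rule ccontr)
  assume "U i t \<noteq> 0"
  then have "U i 0 < U i t" using sp_U_nonneg[OF T(1), of i] sp_0 by simp
  then obtain r where r: "0 \<le> r" "r \<le> t" "q r i = 1" using sp_reflect[OF i _ T(1)] by force
  have occ: "q r \<in> occ_space b" using sp_occ r by simp
  have ge1: "1 \<le> q r k" if "1 \<le> k" "k \<le> i" for k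
    using that(2,1)
  proof (induction rule: inc_induct)
    case (step k)
    then show ?case using occ_space_bounds(5)[OF occ, of k] by auto
  qed (use r in simp)
  have "real i = (\<Sum>k\<in>{1..i}. 1)" by simp
  also have "\<dots> \<le> (\<Sum>k\<in>{1..i}. q r k)" by (rule sum_mono) (use ge1 in auto)
  also have "\<dots> \<le> (\<Sum>k\<in>{1..i}. q 0 k) + U 0 r - U i r" by (rule sp_mass) (use r i in auto)
  also have "\<dots> \<le> (\<Sum>k. q 0 k) + U 0 T"
    using sum_le_suminf[of "q 0" "{1..i}"] occ_space_bounds[OF sp_occ[of 0]] sp_U_mono[of r T 0] sp_U_nonneg[of r i] r T by force
  finally show False using m by simp
qed

text \<open>Above the total mass nothing arrives, so these levels can only lose tasks.\<close>

lemma sp_tail: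
  assumes "0 \<le> t" "t \<le> T" "1 < i" "(\<Sum>i. q 0 i) + U 0 T < real i - 1"
  shows "q t i \<le> q 0 i"
proof (cases "enat i \<le> b")
  case True
  then have b: "enat (i - 1) \<le> b" by (meson diff_le_self enat_ord_simps(1) order_trans)
  have "U (i - 1) t = 0" "U i t = 0"
    by (rule sp_no_overflow[OF _ _ assms(1,2)], use assms b True in auto)+
  then show ?thesis using sp_eq[OF assms(1) _ True] sp_D_nonneg[of i t] assms by simp
next
  case False
  then show ?thesis using occ_space_bounds(6)[OF sp_occ] assms(1) by simp
qed

end

text \<open>
  The integral of the weight \<open>exp (\<theta> s)\<close> is at most \<open>exp (\<theta> t) / \<theta>\<close>: in the weighted norm the
  drift is Lipschitz with a constant that a large \<open>\<theta>\<close> makes small.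
\<close>

lemma drift_diff_bound:
  assumes P: "occ_path b q" and P': "occ_path b q'" and th: "0 < \<theta>"
    and t: "0 \<le> t" and k: "\<And>s. 0 \<le> s \<Longrightarrow> s \<le> t \<Longrightarrow> \<bar>q s i - q' s i\<bar> \<le> k1 * exp (\<theta> * s)" "\<And>s. 0 \<le> s \<Longrightarrow> s \<le> t \<Longrightarrow> \<bar>q s (i + 1) - q' s (i + 1)\<bar> \<le> k2 * exp (\<theta> * s)"
    and kn: "0 \<le> k1 + k2"
  shows "\<bar>drift q i t - drift q' i t\<bar> \<le> (k1 + k2) / \<theta> * exp (\<theta> * t)"
proof -
  have i1: "set_integrable lborel {0..t} (\<lambda>s. (q s i - q s (i + 1)) - (q' s i - q' s (i + 1)))"
    by (intro set_integral_diff(1) occ_path.sp_integrable[OF P] occ_path.sp_integrable[OF P']) auto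
  have i2: "set_integrable lborel {0..t} (\<lambda>s. (k1 + k2) * exp (\<theta> * s))"
    by (rule borel_integrable_atLeastAtMost') (intro continuous_intros)
  have "drift q i t - drift q' i t = (LBINT s:{0..t}. (q s i - q s (i + 1)) - (q' s i - q' s (i + 1)))"
    unfolding drift_def
    by (rule set_integral_diff(2)[symmetric]) (intro set_integral_diff(1) occ_path.sp_integrable[OF P] occ_path.sp_integrable[OF P']; simp)+
  also have "\<bar>\<dots>\<bar> \<le> (LBINT s:{0..t}. \<bar>(q s i - q s (i + 1)) - (q' s i - q' s (i + 1))\<bar>)"
    using set_integral_norm_bound[OF i1] by simp
  also have "\<dots> \<le> (LBINT s:{0..t}. (k1 + k2) * exp (\<theta> * s))"
  proof (rule set_integral_mono[OF set_integrable_abs[OF i1] i2])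
    fix s assume "s \<in> {0..t}"
    then show "\<bar>(q s i - q s (i + 1)) - (q' s i - q' s (i + 1))\<bar> \<le> (k1 + k2) * exp (\<theta> * s)"
      using k(1)[of s] k(2)[of s] by (simp add: algebra_simps)
  qed
  also have "\<dots> = (k1 + k2) / \<theta> * exp (\<theta> * t) - (k1 + k2) / \<theta> * exp (\<theta> * 0)"
    unfolding set_lebesgue_integral_def
  proof (rule integral_FTC_atLeastAtMost[OF t])
    fix s
    have "((\<lambda>s. (k1 + k2) / \<theta> * exp (\<theta> * s)) has_real_derivative (k1 + k2) * exp (\<theta> * s)) (at s within {0..t})"
      using th by (auto intro!: derivative_eq_intros)
    then show "((\<lambda>s. (k1 + k2) / \<theta> * exp (\<theta> * s)) has_vector_derivative (k1 + k2) * exp (\<theta> * s)) (at s within {0..t})"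
      by (simp only: has_real_derivative_iff_has_vector_derivative)
  qed (intro continuous_intros)
  also have "\<dots> \<le> (k1 + k2) / \<theta> * exp (\<theta> * t)" using kn th by simp
  finally show ?thesis .
qed

section \<open>Stability of the reflected equations\<close>

text \<open>
  The distance of two approximate solutions in the norm weighted by \<open>exp (- \<theta> t)\<close>, where \<open>J\<close>
  levels are kept and levels from \<open>I\<close> on never overflow. By the reflection property, the
  difference of \<open>U i\<close> is at most the largest difference of the processes that are being
  reflected, which involve \<open>U (i - 1)\<close> and \<open>D i\<close>. Induction on \<open>i\<close> bounds every difference of
  overflow by \<open>V i\<close>. Inserted into the equations, this bounds the sum \<open>S\<close> of the weighted
  distances by \<open>(2 I + 2) (a + (2 S + \<eta>) / \<theta>)\<close>, and \<open>\<theta> = 8 (I + 1)\<close> leaves half of \<open>S\<close> on the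
  right.
\<close>

lemma stability_core:
  assumes P: "sys_path b q U D" and P': "sys_path b q' U' D'"
    and N: "near_fluid b lam T J \<delta> q U D" and N': "near_fluid b lam T J \<delta> q' U' D'"
    and T: "0 \<le> T" and J: "enat J \<le> b"
    and I: "\<And>i t. I \<le> i \<Longrightarrow> i \<le> J \<Longrightarrow> 1 \<le> i \<Longrightarrow> 0 \<le> t \<Longrightarrow> t \<le> T \<Longrightarrow> U i t = 0 \<and> U' i t = 0"
    and \<eta>: "\<And>t. 0 \<le> t \<Longrightarrow> t \<le> T \<Longrightarrow> \<bar>q t (J + 1) - q' t (J + 1)\<bar> \<le> \<eta>"
    and a: "(\<Sum>i\<in>{1..J}. \<bar>q 0 i - q' 0 i\<bar>) + (2 * real J + 2) * \<delta> \<le> a"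
    and t: "0 \<le> t" "t \<le> T"
  defines "E \<equiv> exp (8 * (real I + 1) * T) * ((4 * real I + 4) * a + \<eta>)"
  shows "(\<Sum>i\<in>{1..J}. \<bar>q t i - q' t i\<bar>) \<le> E" and "i \<le> J \<Longrightarrow> \<bar>U i t - U' i t\<bar> \<le> E"
proof -
  interpret p: sys_path b q U D by fact
  interpret p': sys_path b q' U' D' by fact
  define \<theta> where "\<theta> = 8 * (real I + 1)"
  have th: "0 < \<theta>" by (simp add: \<theta>_def)
  have \<delta>0: "0 \<le> \<delta>" using N T by (force simp: near_fluid_def)
  have \<eta>0: "0 \<le> \<eta>" using \<eta>[of 0] T abs_ge_zero order_trans by blast
  \<comment> \<open>The distance of the paths at level \<open>i\<close> in the weighted norm.\<close>
  define \<kappa> where "\<kappa> i = (SUP t\<in>{0..T}. exp (- \<theta> * t) * \<bar>q t i - q' t i\<bar>)" for i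
  have d1: "\<bar>q t i - q' t i\<bar> \<le> 1" if "0 \<le> t" for t i
    using occ_space_bounds(1,2)[OF p.sp_occ[OF that], of i] occ_space_bounds(1,2)[OF p'.sp_occ[OF that], of i] by linarith
  have bdd: "bdd_above ((\<lambda>t. exp (- \<theta> * t) * \<bar>q t i - q' t i\<bar>) ` {0..T})" for i
  proof (rule bdd_aboveI2[of _ _ 1])
    fix t assume "t \<in> {0..T}"
    then have "exp (- \<theta> * t) \<le> 1" "\<bar>q t i - q' t i\<bar> \<le> 1" using th d1 by auto
    then show "exp (- \<theta> * t) * \<bar>q t i - q' t i\<bar> \<le> 1" using mult_mono[of "exp (- \<theta> * t)" 1 "\<bar>q t i - q' t i\<bar>" 1] by simp
  qed
  have \<kappa>: "\<bar>q t i - q' t i\<bar> \<le> \<kappa> i * exp (\<theta> * t)" if "0 \<le> t" "t \<le> T" for t i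
  proof -
    have "exp (- \<theta> * t) * \<bar>q t i - q' t i\<bar> \<le> \<kappa> i"
      unfolding \<kappa>_def by (rule cSUP_upper[OF _ bdd]) (use that in auto)
    then have "exp (\<theta> * t) * (exp (- \<theta> * t) * \<bar>q t i - q' t i\<bar>) \<le> exp (\<theta> * t) * \<kappa> i" by (intro mult_left_mono) auto
    then show ?thesis by (simp add: mult.assoc[symmetric] exp_add[symmetric] mult.commute)
  qed
  have \<kappa>_least: "\<kappa> i \<le> k" if "\<And>t. 0 \<le> t \<Longrightarrow> t \<le> T \<Longrightarrow> \<bar>q t i - q' t i\<bar> \<le> k * exp (\<theta> * t)" for i k
    unfolding \<kappa>_def
  proof (rule cSUP_least)
    fix t assume "t \<in> {0..T}"
    then have "exp (- \<theta> * t) * \<bar>q t i - q' t i\<bar> \<le> exp (- \<theta> * t) * (k * exp (\<theta> * t))" using that by (intro mult_left_mono) auto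
    then show "exp (- \<theta> * t) * \<bar>q t i - q' t i\<bar> \<le> k" by (simp add: mult.left_commute[of _ k] exp_add[symmetric])
  qed (use T in auto)
  have \<kappa>0: "0 \<le> \<kappa> i" for i using \<kappa>[of 0 i] T by (simp add: order_trans[OF abs_ge_zero])
  have \<kappa>J: "\<kappa> (J + 1) \<le> \<eta>"
  proof (rule \<kappa>_least)
    fix t assume "0 \<le> t" "t \<le> T"
    then show "\<bar>q t (J + 1) - q' t (J + 1)\<bar> \<le> \<eta> * exp (\<theta> * t)"
      using \<eta>[of t] \<eta>0 th mult_left_mono[of 1 "exp (\<theta> * t)" \<eta>] by simp
  qed
  define \<alpha> where "\<alpha> i = \<bar>q 0 i - q' 0 i\<bar> + 2 * \<delta>" for i
  define V where "V i = 2 * \<delta> + (\<Sum>k\<in>{1..i}. \<alpha> k + (\<kappa> k + \<kappa> (k + 1)) / \<theta>)" for i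
  have \<alpha>0: "0 \<le> \<alpha> i" for i by (simp add: \<alpha>_def \<delta>0)
  have V0: "0 \<le> V i" for i unfolding V_def using \<delta>0 \<alpha>0 \<kappa>0 th by (intro add_nonneg_nonneg sum_nonneg) auto
  have e1: "1 \<le> exp (\<theta> * t)" if "0 \<le> t" for t using that th by simp
  have bJ: "enat i \<le> b" if "i \<le> J" for i using that J by (meson enat_ord_simps(1) order_trans)
  have drift: "\<bar>D i t - D' i t\<bar> \<le> (2 * \<delta> + (\<kappa> i + \<kappa> (i + 1)) / \<theta>) * exp (\<theta> * t)" if "1 \<le> i" "i \<le> J" "0 \<le> t" "t \<le> T" for i t
  proof -
    have "\<bar>D i t - drift q i t\<bar> \<le> \<delta>" "\<bar>D' i t - drift q' i t\<bar> \<le> \<delta>" using N N' that bJ by (auto simp: near_fluid_def)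
    moreover have "\<bar>drift q i t - drift q' i t\<bar> \<le> (\<kappa> i + \<kappa> (i + 1)) / \<theta> * exp (\<theta> * t)"
      by (rule drift_diff_bound[OF p.occ_path_axioms p'.occ_path_axioms th that(3)]) (use \<kappa> \<kappa>0 that in \<open>auto intro: add_nonneg_nonneg\<close>)
    moreover have "2 * \<delta> \<le> 2 * \<delta> * exp (\<theta> * t)" using e1[OF that(3)] \<delta>0 mult_left_mono[of 1 "exp (\<theta> * t)" "2 * \<delta>"] by simp
    ultimately show ?thesis by (simp add: distrib_right)
  qed
  have init: "\<bar>q 0 i - q' 0 i\<bar> \<le> \<bar>q 0 i - q' 0 i\<bar> * exp (\<theta> * t)" if "0 \<le> t" for i t
    using e1[OF that] mult_left_mono[of 1 "exp (\<theta> * t)" "\<bar>q 0 i - q' 0 i\<bar>"] by simp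
  have UV: "\<bar>U i t - U' i t\<bar> \<le> V i * exp (\<theta> * t)" if "i \<le> J" "0 \<le> t" "t \<le> T" for i t
    using that
  proof (induction i arbitrary: t)
    case 0
    then have "\<bar>U 0 t - lam * t\<bar> \<le> \<delta>" "\<bar>U' 0 t - lam * t\<bar> \<le> \<delta>" using N N' by (auto simp: near_fluid_def)
    then have "\<bar>U 0 t - U' 0 t\<bar> \<le> 2 * \<delta>" by linarith
    also have "\<dots> \<le> 2 * \<delta> * exp (\<theta> * t)" using e1[OF 0(2)] \<delta>0 mult_left_mono[of 1 "exp (\<theta> * t)" "2 * \<delta>"] by simp
    finally show ?case by (simp add: V_def)
  next
    case (Suc i)
    define \<psi> where "\<psi> s = q 0 (Suc i) + U i s - D (Suc i) s" for s
    define \<psi>' where "\<psi>' s = q' 0 (Suc i) + U' i s - D' (Suc i) s" for s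
    have bi: "enat (Suc i) \<le> b" using bJ Suc.prems by simp
    have q\<psi>: "q s (Suc i) = \<psi> s - U (Suc i) s" "q' s (Suc i) = \<psi>' s - U' (Suc i) s" if "0 \<le> s" for s
      using p.sp_eq[OF that _ bi] p'.sp_eq[OF that _ bi] by (simp_all add: \<psi>_def \<psi>'_def)
    have dpsi: "\<bar>\<psi> s - \<psi>' s\<bar> \<le> V (Suc i) * exp (\<theta> * s)" if "0 \<le> s" "s \<le> T" for s
    proof -
      have "\<bar>U i s - U' i s\<bar> \<le> V i * exp (\<theta> * s)" using Suc that by simp
      moreover have "V (Suc i) = V i + \<bar>q 0 (Suc i) - q' 0 (Suc i)\<bar> + (2 * \<delta> + (\<kappa> (Suc i) + \<kappa> (Suc i + 1)) / \<theta>)"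
        by (simp add: V_def \<alpha>_def)
      ultimately show ?thesis
        using drift[of "Suc i" s] init[OF that(1), of "Suc i"] Suc.prems that
        by (simp add: \<psi>_def \<psi>'_def distrib_right)
    qed
    have mono: "V (Suc i) * exp (\<theta> * r) \<le> V (Suc i) * exp (\<theta> * t)" if "r \<le> t" for r
      using that th V0 by (intro mult_left_mono) auto
    \<comment> \<open>At the last time \<open>r\<close> of increase, the path \<open>q\<close> is at its maximum \<open>1\<close>, so the difference
      of the paths has the favourable sign there. The second estimate exchanges the roles of the
      paths.\<close>
    have one: "U (Suc i) t - U' (Suc i) t \<le> V (Suc i) * exp (\<theta> * t)"
    proof (cases "U (Suc i) t = 0")
      case True
      then show ?thesis using p'.sp_U_nonneg[OF Suc.prems(2), of "Suc i"] V0[of "Suc i"] mult_nonneg_nonneg[OF V0[of "Suc i"] exp_ge_zero[of "\<theta> * t"]] by linarith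
    next
      case False
      then have "U (Suc i) 0 < U (Suc i) t" using p.sp_U_nonneg[OF Suc.prems(2), of "Suc i"] p.sp_0 by simp
      then obtain r where r: "0 \<le> r" "r \<le> t" "q r (Suc i) = 1" "U (Suc i) r = U (Suc i) t"
        using p.sp_reflect[OF _ bi _ Suc.prems(2)] by force
      have "q' r (Suc i) \<le> 1" using occ_space_bounds(2)[OF p'.sp_occ[OF r(1)]] .
      then show ?thesis using q\<psi>[OF r(1)] r dpsi[of r] mono[OF r(2)] p'.sp_U_mono[OF r(1,2), of "Suc i"] Suc.prems by linarith
    qed
    have two: "U' (Suc i) t - U (Suc i) t \<le> V (Suc i) * exp (\<theta> * t)"
    proof (cases "U' (Suc i) t = 0")
      case True
      then show ?thesis using p.sp_U_nonneg[OF Suc.prems(2), of "Suc i"] V0[of "Suc i"] mult_nonneg_nonneg[OF V0[of "Suc i"] exp_ge_zero[of "\<theta> * t"]] by linarith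
    next
      case False
      then have "U' (Suc i) 0 < U' (Suc i) t" using p'.sp_U_nonneg[OF Suc.prems(2), of "Suc i"] p'.sp_0 by simp
      then obtain r where r: "0 \<le> r" "r \<le> t" "q' r (Suc i) = 1" "U' (Suc i) r = U' (Suc i) t"
        using p'.sp_reflect[OF _ bi _ Suc.prems(2)] by force
      have "q r (Suc i) \<le> 1" using occ_space_bounds(2)[OF p.sp_occ[OF r(1)]] .
      then show ?thesis using q\<psi>[OF r(1)] r dpsi[of r] mono[OF r(2)] p.sp_U_mono[OF r(1,2), of "Suc i"] Suc.prems by linarith
    qed
    show ?case using one two by linarith
  qed
  define S where "S = (\<Sum>i\<in>{1..J}. \<kappa> i)"
  have S0: "0 \<le> S" unfolding S_def using \<kappa>0 by (intro sum_nonneg) auto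
  \<comment> \<open>Bounds for the differences of overflow: they vanish from level \<open>I\<close> on, so that only \<open>I\<close> of
    them, and that of the arrivals at level \<open>0\<close>, enter the sum over all levels.\<close>
  define W where "W i = (if i < I \<or> i = 0 then V J else 0)" for i
  have VJ: "V i \<le> V J" if "i \<le> J" for i
    unfolding V_def using that \<alpha>0 \<kappa>0 th by (intro add_left_mono sum_mono2) (auto intro!: add_nonneg_nonneg divide_nonneg_nonneg)
  have UW: "\<bar>U i t - U' i t\<bar> \<le> W i * exp (\<theta> * t)" if "i \<le> J" "0 \<le> t" "t \<le> T" for i t
  proof (cases "i < I \<or> i = 0")
    case True
    have "V i * exp (\<theta> * t) \<le> V J * exp (\<theta> * t)" using VJ[OF that(1)] by (rule mult_right_mono) simp
    with UV[OF that] have "\<bar>U i t - U' i t\<bar> \<le> V J * exp (\<theta> * t)" by (rule order_trans)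
    then show ?thesis using True by (simp add: W_def)
  next
    case False
    then show ?thesis using I[of i t] that by (simp add: W_def)
  qed
  have step: "\<kappa> i \<le> \<alpha> i + W (i - 1) + W i + (\<kappa> i + \<kappa> (i + 1)) / \<theta>" if i: "i \<in> {1..J}" for i
  proof (rule \<kappa>_least)
    fix t assume t: "0 \<le> t" "t \<le> T"
    have "q t i = q 0 i + U (i - 1) t - U i t - D i t" "q' t i = q' 0 i + U' (i - 1) t - U' i t - D' i t"
      using p.sp_eq[OF t(1)] p'.sp_eq[OF t(1)] i bJ by auto
    then show "\<bar>q t i - q' t i\<bar> \<le> (\<alpha> i + W (i - 1) + W i + (\<kappa> i + \<kappa> (i + 1)) / \<theta>) * exp (\<theta> * t)"
      using UW[of i t] UW[of "i - 1" t] drift[of i t] init[OF t(1), of i] t i by (simp add: distrib_right \<alpha>_def) linarith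
  qed
  have sumk: "(\<Sum>i\<in>{1..J}. (\<kappa> i + \<kappa> (i + 1)) / \<theta>) \<le> (2 * S + \<eta>) / \<theta>"
  proof -
    have "(\<Sum>i\<in>{1..J}. \<kappa> (i + 1)) = (\<Sum>i\<in>{2..J+1}. \<kappa> i)"
      by (rule sum.reindex_bij_witness[of _ "\<lambda>i. i - 1" "\<lambda>i. i + 1"]) auto
    also have "\<dots> \<le> (\<Sum>i\<in>{1..J+1}. \<kappa> i)" using \<kappa>0 by (intro sum_mono2) auto
    also have "\<dots> = S + \<kappa> (J + 1)" by (simp add: S_def)
    finally have "(\<Sum>i\<in>{1..J}. \<kappa> i + \<kappa> (i + 1)) \<le> 2 * S + \<eta>" using \<kappa>J by (simp add: sum.distrib S_def)
    then show ?thesis using th by (simp add: sum_divide_distrib[symmetric] divide_right_mono)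
  qed
  have sum\<alpha>: "2 * \<delta> + (\<Sum>i\<in>{1..J}. \<alpha> i) \<le> a" using a by (simp add: \<alpha>_def sum.distrib algebra_simps)
  have VJb: "V J \<le> a + (2 * S + \<eta>) / \<theta>" using sumk sum\<alpha> by (simp add: V_def sum.distrib)
  have sumW: "(\<Sum>i\<in>{1..J}. W (i - 1) + W i) \<le> 2 * real I * V J + V J"
  proof -
    have w0: "0 \<le> W i" for i using V0 by (simp add: W_def)
    have WI: "(\<Sum>i\<in>{1..n}. W i) \<le> real I * V J" for n
    proof -
      have "(\<Sum>i\<in>{1..n}. W i) = (\<Sum>i\<in>{1..n} \<inter> {..<I}. V J)"
        by (subst sum.inter_restrict) (auto simp: W_def intro!: sum.cong)
      also have "\<dots> \<le> (\<Sum>i\<in>{..<I}. V J)" using V0 by (intro sum_mono2) auto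
      finally show ?thesis by simp
    qed
    have "(\<Sum>i\<in>{1..J}. W (i - 1)) \<le> V J + (\<Sum>i\<in>{1..J}. W i)"
    proof (cases J)
      case (Suc n)
      have "(\<Sum>i\<in>{1..J}. W (i - 1)) = (\<Sum>i\<in>{0..n}. W i)"
        unfolding Suc by (rule sum.reindex_bij_witness[of _ "\<lambda>i. i + 1" "\<lambda>i. i - 1"]) auto
      also have "\<dots> = W 0 + (\<Sum>i\<in>{1..n}. W i)" by (simp add: sum.atLeast_Suc_atMost)
      also have "\<dots> \<le> V J + (\<Sum>i\<in>{1..J}. W i)" using w0[of "Suc n"] by (simp add: W_def[of 0] Suc)
      finally show ?thesis .
    qed (use V0 in simp)
    then show ?thesis using WI[of J] by (simp add: sum.distrib)
  qed
  have "S \<le> (\<Sum>i\<in>{1..J}. \<alpha> i + W (i - 1) + W i + (\<kappa> i + \<kappa> (i + 1)) / \<theta>)"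
    unfolding S_def by (rule sum_mono) (rule step)
  also have "\<dots> = (\<Sum>i\<in>{1..J}. \<alpha> i) + (\<Sum>i\<in>{1..J}. W (i - 1) + W i) + (\<Sum>i\<in>{1..J}. (\<kappa> i + \<kappa> (i + 1)) / \<theta>)"
    by (simp only: sum.distrib add.assoc)
  finally have S1: "S \<le> a + (2 * real I + 1) * V J + (2 * S + \<eta>) / \<theta>" using sumk sum\<alpha> sumW \<delta>0 by (simp add: distrib_right)
  have "S \<le> a + (2 * real I + 1) * (a + (2 * S + \<eta>) / \<theta>) + (2 * S + \<eta>) / \<theta>"
    by (rule order_trans[OF S1], intro add_mono order.refl mult_left_mono VJb) simp
  also have "\<dots> = (2 * real I + 2) * (a + (2 * S + \<eta>) / \<theta>)"
  proof -
    have "a + (2 * real I + 1) * (a + x) + x = (2 * real I + 2) * (a + x)" for x by (simp add: algebra_simps)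
    then show ?thesis .
  qed
  finally have S2: "S \<le> (2 * real I + 2) * (a + (2 * S + \<eta>) / \<theta>)" .
  have a0: "0 \<le> a"
  proof -
    have "0 \<le> (\<Sum>i\<in>{1..J}. \<alpha> i)" using \<alpha>0 by (intro sum_nonneg) auto
    then show ?thesis using sum\<alpha> \<delta>0 by linarith
  qed
  have "(2 * real I + 2) * ((2 * S + \<eta>) / \<theta>) = (2 * S + \<eta>) / 4" by (simp add: \<theta>_def field_simps)
  with S2 have "S \<le> (2 * real I + 2) * a + (2 * S + \<eta>) / 4" by (simp only: distrib_left)
  moreover have "S \<le> 2 * z + \<eta> / 2" if "S \<le> z + (2 * S + \<eta>) / 4" for z
    using that by (simp add: field_simps)
  ultimately have "S \<le> 2 * ((2 * real I + 2) * a) + \<eta> / 2" by blast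
  also have "2 * ((2 * real I + 2) * a) = (4 * real I + 4) * a" by (simp add: algebra_simps)
  finally have S3: "S \<le> (4 * real I + 4) * a + \<eta> / 2" .
  have Et: "x * exp (\<theta> * t) \<le> E" if "x \<le> (4 * real I + 4) * a + \<eta>" "0 \<le> x" for x
  proof -
    have "x * exp (\<theta> * t) \<le> ((4 * real I + 4) * a + \<eta>) * exp (\<theta> * T)"
      using that t th by (intro mult_mono) auto
    then show ?thesis by (simp add: E_def \<theta>_def mult.commute)
  qed
  have "(\<Sum>i\<in>{1..J}. \<bar>q t i - q' t i\<bar>) \<le> S * exp (\<theta> * t)"
    unfolding S_def sum_distrib_right by (rule sum_mono) (use \<kappa> t in auto)
  also have "\<dots> \<le> E" by (rule Et) (use S3 \<eta>0 S0 in auto)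
  finally show "(\<Sum>i\<in>{1..J}. \<bar>q t i - q' t i\<bar>) \<le> E" .
  assume "i \<le> J"
  then have "\<bar>U i t - U' i t\<bar> \<le> V i * exp (\<theta> * t)" using UV t by simp
  also have "\<dots> \<le> E"
  proof (rule Et)
    have "(2 * S + \<eta>) / \<theta> \<le> (2 * S + \<eta>) / 8"
      using S0 \<eta>0 by (intro divide_left_mono) (auto simp: \<theta>_def)
    then have "V i \<le> a + (2 * S + \<eta>) / 8"
      by (intro order_trans[OF VJ[OF \<open>i \<le> J\<close>]] order_trans[OF VJb] add_left_mono)
    also have "\<dots> \<le> (4 * real I + 4) * a + \<eta>"
    proof -
      have X: "4 * a \<le> (4 * real I + 4) * a" using a0 by (intro mult_right_mono) auto
      have "a + (2 * S + \<eta>) / 8 \<le> X + \<eta>" if "S \<le> X + \<eta> / 2" "4 * a \<le> X" for X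
        using that a0 \<eta>0 by (simp add: field_simps)
      then show ?thesis using S3 X by blast
    qed
    finally show "V i \<le> (4 * real I + 4) * a + \<eta>" .
  qed (rule V0)
  finally show "\<bar>U i t - U' i t\<bar> \<le> E" .
qed

lemma near_fluid_mono:
  "near_fluid b lam T' J' d' q U D \<Longrightarrow> T \<le> T' \<Longrightarrow> J \<le> J' \<Longrightarrow> d' \<le> d \<Longrightarrow> near_fluid b lam T J d q U D"
  unfolding near_fluid_def by (intro ballI conjI allI impI; force)

text \<open>
  Both paths have mass at most \<open>Cm\<close> up to time \<open>T\<close>, so levels from \<open>I\<close> on never overflow. If \<open>b\<close>
  is infinite, the levels above \<open>J\<close> only lose tasks and carry at most the tail of the initial
  state, which is small. The remaining \<open>J\<close> levels are covered by \<open>stability_core\<close>.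
\<close>

lemma stability:
  assumes qi: "qi \<in> occ_space b" and T: "0 \<le> T" and e: "0 < e" and lam: "0 < lam"
  shows "\<exists>J \<delta>. 0 < \<delta> \<and> (\<forall>q U D q' U' D'. sys_path b q U D \<longrightarrow> sys_path b q' U' D' \<longrightarrow>
     near_fluid b lam T J \<delta> q U D \<longrightarrow> near_fluid b lam T J \<delta> q' U' D' \<longrightarrow>
     l1_dist (q 0) qi \<le> \<delta> \<longrightarrow> l1_dist (q' 0) qi \<le> \<delta> \<longrightarrow>
     (\<forall>t\<in>{0..T}. l1_dist (q t) (q' t) \<le> e \<and> (\<forall>i. enat i \<le> b \<longrightarrow> \<bar>U i t - U' i t\<bar> \<le> e)))"
proof -
  define Cm where "Cm = (\<Sum>i. qi i) + lam * T + 2"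
  define I where "I = nat \<lceil>Cm\<rceil> + 1"
  have ICm: "Cm < real I" unfolding I_def by linarith
  define E1 where "E1 = exp (8 * (real I + 1) * T)"
  have E1: "0 < E1" by (simp add: E1_def)
  define \<eta> where "\<eta> = e / (4 * (E1 + 2))"
  have \<eta>: "0 < \<eta>" using e E1 by (simp add: \<eta>_def)
  have sumqi: "summable qi" by (rule occ_space_bounds(4)[OF qi])
  \<comment> \<open>For a finite buffer all levels are kept; otherwise enough of them to make the tail of the
    initial state small.\<close>
  obtain J where J: "enat J \<le> b" "b = enat J \<or> b = \<infinity> \<and> I \<le> J" "(\<Sum>k. qi (k + (J + 1))) \<le> \<eta>"
  proof (cases b)
    case (enat B)
    have "qi (k + (B + 1)) = 0" for k using occ_space_bounds(6)[OF qi, of "k + (B + 1)"] enat by simp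
    then show ?thesis using that[of B] enat \<eta> by simp
  next
    case infinity
    obtain N where N: "\<And>n. N \<le> n \<Longrightarrow> norm (\<Sum>i. qi (i + n)) < \<eta>"
      using suminf_exist_split[OF \<eta> sumqi] by blast
    have "norm (\<Sum>k. qi (k + (max N I + 1))) < \<eta>" by (rule N) simp
    then have "(\<Sum>k. qi (k + (max N I + 1))) \<le> \<eta>" by simp
    then show ?thesis using that[of "max N I"] infinity by simp
  qed
  define R where "R = E1 + 2 + E1 * (4 * real I + 4) * (2 * real J + 4)"
  have R: "0 < R" using E1 by (simp add: R_def add_pos_nonneg)
  define \<delta> where "\<delta> = min 1 (e / (4 * R))"
  have \<delta>: "0 < \<delta>" "\<delta> \<le> 1" "R * \<delta> \<le> e / 4"
  proof -
    show "0 < \<delta>" "\<delta> \<le> 1" using R e by (auto simp: \<delta>_def)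
    have "R * \<delta> \<le> R * (e / (4 * R))" using R by (intro mult_left_mono) (auto simp: \<delta>_def)
    then show "R * \<delta> \<le> e / 4" using R by simp
  qed
  have facts: "(\<forall>i t. I \<le> i \<longrightarrow> enat i \<le> b \<longrightarrow> 0 \<le> t \<longrightarrow> t \<le> T \<longrightarrow> U i t = 0) \<and>
      (\<forall>t. 0 \<le> t \<longrightarrow> t \<le> T \<longrightarrow> (\<Sum>k. q t (k + (J + 1))) \<le> \<eta> + \<delta>)"
    if P: "sys_path b q U D" and N: "near_fluid b lam T J \<delta> q U D" and l1: "l1_dist (q 0) qi \<le> \<delta>" for q U D
  proof -
    interpret sys_path b q U D by fact
    have q0: "q 0 \<in> occ_space b" by (rule sp_occ) simp
    have sm: "summable (q t)" if "0 \<le> t" for t using occ_space_bounds(4)[OF sp_occ[OF that]] .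
    have sd: "summable (\<lambda>i. \<bar>q 0 i - qi i\<bar>)" by (rule l1_summable[OF q0 qi])
    have "(\<Sum>i. q 0 i) \<le> (\<Sum>i. qi i + \<bar>q 0 i - qi i\<bar>)"
      by (intro suminf_le sm summable_add sumqi sd) auto
    also have "\<dots> = (\<Sum>i. qi i) + l1_dist (q 0) qi" unfolding l1_dist_def by (rule suminf_add[OF sumqi sd, symmetric])
    finally have "(\<Sum>i. q 0 i) \<le> (\<Sum>i. qi i) + 1" using l1 \<delta> by simp
    moreover have "U 0 T \<le> lam * T + 1" using N T \<delta> by (force simp: near_fluid_def)
    ultimately have mass: "(\<Sum>i. q 0 i) + U 0 T < real I" using ICm by (simp add: Cm_def)
    have U0: "U i t = 0" if "I \<le> i" "enat i \<le> b" "0 \<le> t" "t \<le> T" for i t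
      by (rule sp_no_overflow[OF _ that(2-4)]) (use that(1) mass in \<open>auto simp: I_def\<close>)
    have tail: "(\<Sum>k. q t (k + (J + 1))) \<le> \<eta> + \<delta>" if t: "0 \<le> t" "t \<le> T" for t
    proof -
      have "q t (k + (J + 1)) \<le> q 0 (k + (J + 1))" for k
        using J(2)
      proof
        assume "b = enat J"
        then have "q t (k + (J + 1)) = 0" by (intro occ_space_bounds(6)[OF sp_occ[OF t(1)]]) simp
        then show ?thesis using occ_space_bounds(1)[OF q0] by simp
      next
        assume "b = \<infinity> \<and> I \<le> J"
        then show ?thesis using mass by (intro sp_tail[OF t]) (auto simp: I_def)
      qed
      then have "q t (k + (J + 1)) \<le> qi (k + (J + 1)) + \<bar>q 0 (k + (J + 1)) - qi (k + (J + 1))\<bar>" for k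
        by (smt (verit))
      then have "(\<Sum>k. q t (k + (J + 1))) \<le> (\<Sum>k. qi (k + (J + 1)) + \<bar>q 0 (k + (J + 1)) - qi (k + (J + 1))\<bar>)"
        by (intro suminf_le summable_add summable_ignore_initial_segment[OF sm[OF t(1)]] summable_ignore_initial_segment[OF sumqi] summable_ignore_initial_segment[OF sd])
      also have "\<dots> = (\<Sum>k. qi (k + (J + 1))) + (\<Sum>k. \<bar>q 0 (k + (J + 1)) - qi (k + (J + 1))\<bar>)"
        by (intro suminf_add[symmetric] summable_ignore_initial_segment[OF sumqi] summable_ignore_initial_segment[OF sd])
      also have "(\<Sum>k. \<bar>q 0 (k + (J + 1)) - qi (k + (J + 1))\<bar>) \<le> l1_dist (q 0) qi"
        unfolding l1_dist_def suminf_split_initial_segment[OF sd, of "J + 1"] by (simp add: sum_nonneg)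
      finally show ?thesis using J(3) l1 by simp
    qed
    show ?thesis using U0 tail by blast
  qed
  show ?thesis
  proof (intro exI[of _ J] exI[of _ \<delta>] conjI \<delta> allI impI ballI)
    fix q U D q' U' D' t
    assume P: "sys_path b q U D" and P': "sys_path b q' U' D'"
      and N: "near_fluid b lam T J \<delta> q U D" and N': "near_fluid b lam T J \<delta> q' U' D'"
      and l: "l1_dist (q 0) qi \<le> \<delta>" and l': "l1_dist (q' 0) qi \<le> \<delta>" and t: "t \<in> {0..T}"
    interpret p: sys_path b q U D by fact
    interpret p': sys_path b q' U' D' by fact
    note F = facts[OF P N l] and F' = facts[OF P' N' l']
    have sm: "summable (\<lambda>k. q s (k + (J + 1)))" "summable (\<lambda>k. q' s (k + (J + 1)))" if "0 \<le> s" for s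
      using summable_ignore_initial_segment[OF occ_space_bounds(4)[OF p.sp_occ[OF that]], of "J + 1"]
        summable_ignore_initial_segment[OF occ_space_bounds(4)[OF p'.sp_occ[OF that]], of "J + 1"] by auto
    have nn: "0 \<le> q s k" "0 \<le> q' s k" if "0 \<le> s" for s k
      using occ_space_bounds(1)[OF p.sp_occ[OF that]] occ_space_bounds(1)[OF p'.sp_occ[OF that]] by auto
    have \<eta>': "\<bar>q s (J + 1) - q' s (J + 1)\<bar> \<le> \<eta> + \<delta>" if s: "0 \<le> s" "s \<le> T" for s
    proof -
      have "q s (J + 1) \<le> (\<Sum>k. q s (k + (J + 1)))" "q' s (J + 1) \<le> (\<Sum>k. q' s (k + (J + 1)))"
        using sum_le_suminf[OF sm(1)[OF s(1)], of "{0}"] sum_le_suminf[OF sm(2)[OF s(1)], of "{0}"] nn[OF s(1)] by auto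
      then have "q s (J + 1) \<le> \<eta> + \<delta>" "q' s (J + 1) \<le> \<eta> + \<delta>" using F F' s by (meson order_trans)+
      then show ?thesis using nn[OF s(1), of "J + 1"] by linarith
    qed
    have "(\<Sum>i\<in>{1..J}. \<bar>q 0 i - q' 0 i\<bar>) \<le> (\<Sum>i\<in>{1..J}. \<bar>q 0 i - qi i\<bar> + \<bar>q' 0 i - qi i\<bar>)"
      by (rule sum_mono) linarith
    also have "\<dots> \<le> l1_dist (q 0) qi + l1_dist (q' 0) qi"
      unfolding sum.distrib l1_dist_def
      by (intro add_mono sum_le_suminf l1_summable[OF _ qi, of _ ] p.sp_occ p'.sp_occ) auto
    finally have a: "(\<Sum>i\<in>{1..J}. \<bar>q 0 i - q' 0 i\<bar>) + (2 * real J + 2) * \<delta> \<le> (2 * real J + 4) * \<delta>"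
      using l l' by (simp add: algebra_simps)
    have IJ: "U i t = 0 \<and> U' i t = 0" if "I \<le> i" "i \<le> J" "1 \<le> i" "0 \<le> t" "t \<le> T" for i t
      using F F' that J(1) by (meson enat_ord_simps(1) order_trans)
    define Q where "Q = E1 * ((4 * real I + 4) * ((2 * real J + 4) * \<delta>) + (\<eta> + \<delta>))"
    have Eb: "Q + 2 * (\<eta> + \<delta>) \<le> e"
    proof -
      have "Q + 2 * (\<eta> + \<delta>) = (E1 + 2) * \<eta> + R * \<delta>"
        by (simp add: Q_def R_def algebra_simps)
      also have "(E1 + 2) * \<eta> = e / 4"
      proof -
        have "E1 + 2 \<noteq> 0" using E1 by simp
        then show ?thesis unfolding \<eta>_def by (metis (no_types, opaque_lifting) mult.commute nonzero_mult_divide_mult_cancel_right times_divide_eq_right)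
      qed
      finally show ?thesis using \<delta>(3) e by simp
    qed
    have t': "0 \<le> t" "t \<le> T" using t by auto
    have c1: "(\<Sum>i\<in>{1..J}. \<bar>q t i - q' t i\<bar>) \<le> Q"
      using stability_core(1)[OF P P' N N' T J(1) IJ \<eta>' a t'] by (simp add: E1_def Q_def)
    have c2: "\<bar>U i t - U' i t\<bar> \<le> Q" if "i \<le> J" for i
      using stability_core(2)[OF P P' N N' T J(1) IJ \<eta>' a t' that] by (simp add: E1_def Q_def)
    have "l1_dist (q t) (q' t) = (\<Sum>k. \<bar>q t (k + (J + 1)) - q' t (k + (J + 1))\<bar>) + (\<Sum>i<J + 1. \<bar>q t i - q' t i\<bar>)"
      unfolding l1_dist_def
      by (rule suminf_split_initial_segment[OF l1_summable]) (use t p.sp_occ p'.sp_occ in auto)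
    also have "(\<Sum>i<J + 1. \<bar>q t i - q' t i\<bar>) = (\<Sum>i\<in>{1..J}. \<bar>q t i - q' t i\<bar>)"
      using occ_space_bounds(3)[OF p.sp_occ[OF t'(1)]] occ_space_bounds(3)[OF p'.sp_occ[OF t'(1)]]
      by (intro sum.mono_neutral_right) (auto simp: Suc_le_eq intro: gr0I)
    also have "(\<Sum>k. \<bar>q t (k + (J + 1)) - q' t (k + (J + 1))\<bar>) \<le> (\<Sum>k. q t (k + (J + 1)) + q' t (k + (J + 1)))"
    proof (rule suminf_le)
      show "\<bar>q t (k + (J + 1)) - q' t (k + (J + 1))\<bar> \<le> q t (k + (J + 1)) + q' t (k + (J + 1))" for k
        using nn[OF t'(1), of "k + (J + 1)"] by linarith
      show "summable (\<lambda>k. \<bar>q t (k + (J + 1)) - q' t (k + (J + 1))\<bar>)"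
        using summable_ignore_initial_segment[OF l1_summable[OF p.sp_occ[OF t'(1)] p'.sp_occ[OF t'(1)]], of "J + 1"] .
    qed (intro summable_add sm t')
    also have "\<dots> = (\<Sum>k. q t (k + (J + 1))) + (\<Sum>k. q' t (k + (J + 1)))"
      by (intro suminf_add[symmetric] sm t')
    also have "\<dots> \<le> 2 * (\<eta> + \<delta>)"
    proof -
      have "(\<Sum>k. q t (k + (J + 1))) \<le> \<eta> + \<delta>" "(\<Sum>k. q' t (k + (J + 1))) \<le> \<eta> + \<delta>" using F F' t' by blast+
      then have "(\<Sum>k. q t (k + (J + 1))) + (\<Sum>k. q' t (k + (J + 1))) \<le> (\<eta> + \<delta>) + (\<eta> + \<delta>)" by (rule add_mono)
      then show ?thesis by (simp only: mult_2)
    qed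
    finally show "l1_dist (q t) (q' t) \<le> e" using c1 Eb by linarith
    fix i assume i: "enat i \<le> b"
    show "\<bar>U i t - U' i t\<bar> \<le> e"
    proof (cases "i \<le> J")
      case True
      have "Q \<le> Q + 2 * (\<eta> + \<delta>)" using \<eta> \<delta>(1) by simp
      from order_trans[OF this Eb] show ?thesis by (rule order_trans[OF c2[OF True]])
    next
      case False
      then have "I \<le> i" using J(2) i by auto
      then show ?thesis using F F' i t' e by simp
    qed
  qed
qed

section \<open>Exact solutions satisfy the fluid equations\<close>

text \<open>
  Such a function has derivative zero. The bound is summed over finer and finer partitions.
\<close>

lemma constant_if_quadratic_increments:
  fixes G :: "real \<Rightarrow> real"
  assumes G: "\<And>s t. 0 \<le> s \<Longrightarrow> s \<le> t \<Longrightarrow> \<bar>G t - G s\<bar> \<le> K * (t - s)\<^sup>2" and t: "0 \<le> t"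
  shows "G t = G 0"
proof -
  have step: "\<bar>G t - G 0\<bar> \<le> K * t\<^sup>2 * inverse (real (Suc n))" for n
  proof -
    let ?N = "real (Suc n)"
    define p where "p k = real k * t / ?N" for k
    have p: "p (Suc n) = t" "p 0 = 0"
      unfolding p_def by (rule nonzero_mult_div_cancel_left, simp) simp
    have "G t - G 0 = (\<Sum>k<Suc n. G (p (Suc k)) - G (p k))"
      using sum_lessThan_telescope[of "\<lambda>k. G (p k)" "Suc n"] by (simp only: p)
    also have "\<bar>\<dots>\<bar> \<le> (\<Sum>k<Suc n. \<bar>G (p (Suc k)) - G (p k)\<bar>)" by (rule sum_abs)
    also have "\<dots> \<le> (\<Sum>k<Suc n. K * (t / ?N)\<^sup>2)"
    proof (rule sum_mono)
      fix k
      have "(1 + x) * t / N - x * t / N = t / N" for x N :: real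
        by (simp add: diff_divide_distrib[symmetric] distrib_right)
      then have d: "p (Suc k) - p k = t / ?N" by (simp only: p_def of_nat_Suc)
      have "0 \<le> p k" "p k \<le> p (Suc k)" using t by (auto simp: p_def intro!: divide_right_mono mult_right_mono)
      then show "\<bar>G (p (Suc k)) - G (p k)\<bar> \<le> K * (t / ?N)\<^sup>2" using G[of "p k" "p (Suc k)"] d by simp
    qed
    also have "\<dots> = ?N * (K * (t / ?N)\<^sup>2)" by simp
    also have "\<dots> = K * t\<^sup>2 * inverse ?N"
    proof -
      have "N * (K * (t / N)\<^sup>2) = K * t\<^sup>2 * inverse N" if "0 < N" for N :: real
        using that by (simp add: power2_eq_square field_simps)
      then show ?thesis by simp
    qed
    finally show ?thesis .
  qed
  have "(\<lambda>n. K * t\<^sup>2 * inverse (real (Suc n))) \<longlonglongrightarrow> K * t\<^sup>2 * 0"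
    by (intro tendsto_mult_left LIMSEQ_inverse_real_of_nat)
  then have "\<bar>G t - G 0\<bar> \<le> 0"
    using step by (intro LIMSEQ_le_const[where X="\<lambda>n. K * t\<^sup>2 * inverse (real (Suc n))"]) auto
  then show ?thesis by simp
qed

lemma power_taylor:
  fixes x y :: real
  assumes "0 \<le> x" "x \<le> 1" "0 \<le> y" "y \<le> 1"
  shows "\<bar>y ^ Suc m - x ^ Suc m - real (Suc m) * x ^ m * (y - x)\<bar> \<le> real m * real (Suc m) * (y - x)\<^sup>2"
proof (induction m)
  case (Suc m)
  let ?R = "y ^ Suc m - x ^ Suc m - real (Suc m) * x ^ m * (y - x)"
  have "y ^ Suc (Suc m) - x ^ Suc (Suc m) - real (Suc (Suc m)) * x ^ Suc m * (y - x) = y * ?R + real (Suc m) * x ^ m * (y - x)\<^sup>2"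
    by (simp add: power2_eq_square algebra_simps)
  also have "\<bar>\<dots>\<bar> \<le> \<bar>y * ?R\<bar> + \<bar>real (Suc m) * x ^ m * (y - x)\<^sup>2\<bar>" by (rule abs_triangle_ineq)
  also have "\<bar>y * ?R\<bar> \<le> \<bar>?R\<bar>" using assms mult_right_mono[of y 1 "\<bar>?R\<bar>"] by (simp add: abs_mult)
  also have "\<bar>real (Suc m) * x ^ m * (y - x)\<^sup>2\<bar> \<le> real (Suc m) * (y - x)\<^sup>2"
    using assms power_le_one[of x m] by (simp add: abs_mult mult_left_le mult_right_mono)
  finally have "\<bar>y ^ Suc (Suc m) - x ^ Suc (Suc m) - real (Suc (Suc m)) * x ^ Suc m * (y - x)\<bar> \<le> real m * real (Suc m) * (y - x)\<^sup>2 + real (Suc m) * (y - x)\<^sup>2"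
    using Suc by linarith
  also have "\<dots> \<le> real (Suc m) * real (Suc (Suc m)) * (y - x)\<^sup>2"
    by (simp add: algebra_simps)
  finally show ?case .
qed simp

lemma power_lipschitz:
  fixes x y :: real
  assumes "0 \<le> x" "x \<le> 1" "0 \<le> y" "y \<le> 1"
  shows "\<bar>y ^ m - x ^ m\<bar> \<le> real m * \<bar>y - x\<bar>"
proof (induction m)
  case (Suc m)
  have "y ^ Suc m - x ^ Suc m = y * (y ^ m - x ^ m) + x ^ m * (y - x)" by (simp add: algebra_simps)
  also have "\<bar>\<dots>\<bar> \<le> y * \<bar>y ^ m - x ^ m\<bar> + x ^ m * \<bar>y - x\<bar>"
    using assms abs_triangle_ineq[of "y * (y ^ m - x ^ m)" "x ^ m * (y - x)"] by (simp add: abs_mult)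
  also have "\<dots> \<le> 1 * \<bar>y ^ m - x ^ m\<bar> + 1 * \<bar>y - x\<bar>"
    using assms by (intro add_mono mult_right_mono) (auto intro: power_le_one)
  finally show ?case using Suc by (simp add: algebra_simps)
qed simp

text \<open>
  The density of the reflection term, without differentiating. Since \<open>V\<close> increases only where
  \<open>f = 1\<close>, the chain rule suggests \<open>d(f\<^sup>m\<^sup>+\<^sup>1) = (m + 1) (f\<^sup>m \<phi> dt - dV)\<close> for every \<open>m\<close>. The
  integrated identity is exact because both sides differ by a function with quadratic
  increments. As \<open>m\<close> grows, \<open>f\<^sup>m\<close> tends to the indicator of \<open>f = 1\<close> and \<open>f\<^sup>m\<^sup>+\<^sup>1 / (m + 1)\<close>
  vanishes.
\<close>

lemma reflection_density:
  fixes f \<phi> V :: "real \<Rightarrow> real"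
  assumes f01: "\<And>t. 0 \<le> t \<Longrightarrow> 0 \<le> f t \<and> f t \<le> 1"
    and fm: "set_borel_measurable borel {0..} f" and \<phi>m: "set_borel_measurable borel {0..} \<phi>"
    and \<phi>B: "\<And>t. 0 \<le> t \<Longrightarrow> \<bar>\<phi> t\<bar> \<le> B"
    and eq: "\<And>t. 0 \<le> t \<Longrightarrow> f t = f 0 + (LBINT s:{0..t}. \<phi> s) - V t"
    and V0: "V 0 = 0" and Vmono: "\<And>s t. 0 \<le> s \<Longrightarrow> s \<le> t \<Longrightarrow> V s \<le> V t"
    and Vlip: "\<And>s t. 0 \<le> s \<Longrightarrow> s \<le> t \<Longrightarrow> V t - V s \<le> L * (t - s)"
    and refl: "\<And>s t. 0 \<le> s \<Longrightarrow> s \<le> t \<Longrightarrow> V s < V t \<Longrightarrow> \<exists>r\<in>{s..t}. f r = 1"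
    and t: "0 \<le> t"
  shows "V t = (LBINT s:{0..t}. if f s = 1 then \<phi> s else 0)"
proof -
  have B0: "0 \<le> B" using \<phi>B[of 0] by simp
  have L0: "0 \<le> L" using Vlip[of 0 1] Vmono[of 0 1] by simp
  have fm': "set_borel_measurable borel {s..t} f" "set_borel_measurable borel {s..t} \<phi>" if "0 \<le> s" for s t
    using set_borel_measurable_subset[OF fm, of "{s..t}"] set_borel_measurable_subset[OF \<phi>m, of "{s..t}"] that by auto
  have int: "set_integrable lborel {s..t} (\<lambda>r. f r ^ m * \<phi> r)" if s: "0 \<le> s" for s t m
    unfolding set_integrable_def
  proof (rule Bochner_Integration.integrable_bound[where f="\<lambda>r. B * indicator {s..t} r :: real"])
    show "integrable lborel (\<lambda>r. B * indicator {s..t} r :: real)"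
      by (intro integrable_mult_right integrable_real_indicator) (auto simp: emeasure_lborel_Icc_eq)
    have "(\<lambda>r. (indicator {s..t} r *\<^sub>R f r) ^ m * (indicator {s..t} r *\<^sub>R \<phi> r)) \<in> borel_measurable borel"
      using fm'[OF s] by (auto simp: set_borel_measurable_def)
    moreover have "(\<lambda>r. (indicator {s..t} r *\<^sub>R f r) ^ m * (indicator {s..t} r *\<^sub>R \<phi> r)) = (\<lambda>r. indicator {s..t} r *\<^sub>R (f r ^ m * \<phi> r))"
      by (auto simp: fun_eq_iff indicator_def)
    ultimately show "(\<lambda>r. indicator {s..t} r *\<^sub>R (f r ^ m * \<phi> r)) \<in> borel_measurable lborel" by simp
    have "norm (indicator {s..t} r *\<^sub>R (f r ^ m * \<phi> r)) \<le> norm (B * indicator {s..t} r)" for r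
      using \<phi>B[of r] f01[of r] s B0 mult_mono[of "f r ^ m" 1 "\<bar>\<phi> r\<bar>" B] by (auto simp: indicator_def abs_mult power_le_one)
    then show "AE r in lborel. norm (indicator {s..t} r *\<^sub>R (f r ^ m * \<phi> r)) \<le> norm (B * indicator {s..t} r)" by simp
  qed
  have int1: "set_integrable lborel {s..t} \<phi>" if "0 \<le> s" for s t using int[OF that, of t 0] by simp
  have int0: "set_integrable lborel {0..t} (\<lambda>r. f r ^ m * \<phi> r)" for t m by (rule int) simp
  have df: "f t - f s = (LBINT r:{s..t}. \<phi> r) - (V t - V s)" if "0 \<le> s" "s \<le> t" for s t
    using eq[of t] eq[of s] that set_integral_Icc_split[of \<phi> s t] int1[of 0] by simp
  have flip: "\<bar>f t - f s\<bar> \<le> (B + L) * (t - s)" if "0 \<le> s" "s \<le> t" for s t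
    using df[OF that] set_integral_Icc_bound[OF int1[OF that(1)] that(2), of B] \<phi>B Vlip[OF that] Vmono[OF that] that
    by (simp add: distrib_right)
  have key: "V t = (LBINT s:{0..t}. f s ^ m * \<phi> s) - (f t ^ Suc m - f 0 ^ Suc m) / real (Suc m)" for m
  proof -
    \<comment> \<open>The difference of both sides of the identity, up to the constant.\<close>
    define G where "G t = f t ^ Suc m + real (Suc m) * V t - real (Suc m) * (LBINT s:{0..t}. f s ^ m * \<phi> s)" for t
    define K where "K = real m * real (Suc m) * (B + L)\<^sup>2 + real (Suc m) * (real m * (B + L) * B) + real (Suc m) * (real m * (B + L) * L)"
    have "G t = G 0"
    proof (rule constant_if_quadratic_increments[OF _ t])
      fix s t :: real assume st: "0 \<le> s" "s \<le> t"
      have t0: "0 \<le> t" using st by simp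
      let ?d = "t - s"
      have f: "0 \<le> f s" "f s \<le> 1" "0 \<le> f t" "f t \<le> 1" using f01 st t0 by auto
      \<comment> \<open>The three errors of linearisation: of the power, of the integrand, and of the factor
        \<open>f\<^sup>m\<close> in front of \<open>dV\<close>, which is \<open>1\<close> where \<open>V\<close> increases.\<close>
      define R1 where "R1 = f t ^ Suc m - f s ^ Suc m - real (Suc m) * f s ^ m * (f t - f s)"
      define R2 where "R2 = (LBINT r:{s..t}. f r ^ m * \<phi> r) - f s ^ m * (LBINT r:{s..t}. \<phi> r)"
      define R3 where "R3 = (1 - f s ^ m) * (V t - V s)"
      have "G t - G s = R1 + real (Suc m) * f s ^ m * (f t - f s) + real (Suc m) * (V t - V s) - real (Suc m) * (LBINT r:{s..t}. f r ^ m * \<phi> r)"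
        using set_integral_Icc_split[OF int0 st, of m] by (simp add: G_def R1_def algebra_simps)
      also have "\<dots> = R1 - real (Suc m) * R2 + real (Suc m) * R3"
        unfolding df[OF st] R2_def R3_def by (simp add: algebra_simps)
      finally have GR: "G t - G s = R1 - real (Suc m) * R2 + real (Suc m) * R3" .
      have b1: "\<bar>R1\<bar> \<le> real m * real (Suc m) * ((B + L)\<^sup>2 * ?d\<^sup>2)"
      proof -
        have "(f t - f s)\<^sup>2 \<le> ((B + L) * ?d)\<^sup>2" using flip[OF st] by (simp add: abs_le_square_iff[symmetric] abs_mult B0 L0 st)
        then show ?thesis using power_taylor[OF f, of m] mult_left_mono[of "(f t - f s)\<^sup>2" "((B + L) * ?d)\<^sup>2" "real m * real (Suc m)"]
          by (simp add: R1_def power_mult_distrib)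
      qed
      have b2: "\<bar>R2\<bar> \<le> real m * (B + L) * B * ?d\<^sup>2"
      proof -
        have i3: "set_integrable lborel {s..t} (\<lambda>r. (f r ^ m - f s ^ m) * \<phi> r)"
          using set_integral_diff(1)[OF int[OF st(1), of t m] set_integrable_mult_right[OF int1[OF st(1), of t], of "f s ^ m"]] by (simp add: left_diff_distrib)
        have "R2 = (LBINT r:{s..t}. (f r ^ m - f s ^ m) * \<phi> r)"
          unfolding R2_def left_diff_distrib
          by (subst set_integral_diff(2)) (auto intro!: int int1 set_integrable_mult_right st)
        also have "\<bar>\<dots>\<bar> \<le> (real m * ((B + L) * ?d) * B) * ?d"
        proof (rule set_integral_Icc_bound[OF i3 st(2)])
          fix r assume r: "s \<le> r" "r \<le> t"
          have "\<bar>f r ^ m - f s ^ m\<bar> \<le> real m * \<bar>f r - f s\<bar>" by (rule power_lipschitz) (use f01 st r in auto)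
          also have "\<dots> \<le> real m * ((B + L) * ?d)"
          proof (rule mult_left_mono)
            have "\<bar>f r - f s\<bar> \<le> (B + L) * (r - s)" by (rule flip) (use st r in auto)
            also have "\<dots> \<le> (B + L) * ?d" using r B0 L0 by (intro mult_left_mono) auto
            finally show "\<bar>f r - f s\<bar> \<le> (B + L) * ?d" .
          qed simp
          finally show "\<bar>(f r ^ m - f s ^ m) * \<phi> r\<bar> \<le> real m * ((B + L) * ?d) * B"
            unfolding abs_mult using \<phi>B[of r] st r B0 L0 by (intro mult_mono) auto
        qed
        finally show ?thesis by (simp add: power2_eq_square algebra_simps)
      qed
      have b3: "\<bar>R3\<bar> \<le> real m * (B + L) * L * ?d\<^sup>2"
      proof (cases "V s < V t")
        case True
        then obtain r where r: "s \<le> r" "r \<le> t" "f r = 1" using refl[OF st] by auto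
        have "\<bar>1 - f s ^ m\<bar> \<le> real m * \<bar>1 - f s\<bar>" using power_lipschitz[of "f s" 1 m] f by simp
        also have "\<dots> \<le> real m * ((B + L) * ?d)"
        proof (rule mult_left_mono)
          have "\<bar>f r - f s\<bar> \<le> (B + L) * (r - s)" by (rule flip) (use st r in auto)
          also have "\<dots> \<le> (B + L) * ?d" using r B0 L0 by (intro mult_left_mono) auto
          finally show "\<bar>1 - f s\<bar> \<le> (B + L) * ?d" using r by simp
        qed simp
        finally have "\<bar>R3\<bar> \<le> real m * ((B + L) * ?d) * (L * ?d)"
          unfolding R3_def abs_mult using Vlip[OF st] Vmono[OF st] B0 L0 st by (intro mult_mono) auto
        then show ?thesis by (simp add: power2_eq_square algebra_simps)
      next
        case False
        then have "R3 = 0" using Vmono[OF st] by (simp add: R3_def)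
        then show ?thesis using B0 L0 by simp
      qed
      have "\<bar>G t - G s\<bar> \<le> \<bar>R1\<bar> + real (Suc m) * \<bar>R2\<bar> + real (Suc m) * \<bar>R3\<bar>"
        unfolding GR using abs_triangle_ineq[of "R1 - real (Suc m) * R2" "real (Suc m) * R3"] abs_triangle_ineq4[of R1 "real (Suc m) * R2"]
        by (simp add: abs_mult)
      also have "\<dots> \<le> real m * real (Suc m) * ((B + L)\<^sup>2 * ?d\<^sup>2) + real (Suc m) * (real m * (B + L) * B * ?d\<^sup>2) + real (Suc m) * (real m * (B + L) * L * ?d\<^sup>2)"
        using b1 b2 b3 by (intro add_mono mult_left_mono) auto
      also have "\<dots> = K * ?d\<^sup>2" by (simp add: K_def algebra_simps)
      finally show "\<bar>G t - G s\<bar> \<le> K * (t - s)\<^sup>2" .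
    qed
    moreover have "(LBINT s:{0..0}. f s ^ m * \<phi> s) = 0"
      using set_integral_Icc_bound[OF int0[of 0 m], of 0] set_integral_Icc_split[OF int0, of 0 0 m] by simp
    ultimately show ?thesis using V0 unfolding G_def by (simp add: field_simps)
  qed
  have "(\<lambda>m. (LBINT s:{0..t}. f s ^ m * \<phi> s)) \<longlonglongrightarrow> (LBINT s:{0..t}. if f s = 1 then \<phi> s else 0)"
    unfolding set_lebesgue_integral_def
  proof (rule integral_dominated_convergence[where w="\<lambda>r. B * indicator {0..t} r"])
    have 1: "(\<lambda>r. indicator {0..t} r *\<^sub>R f r) \<in> borel_measurable borel" "(\<lambda>r. indicator {0..t} r *\<^sub>R \<phi> r) \<in> borel_measurable borel"
      using fm'[of 0 t] by (auto simp: set_borel_measurable_def)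
    then have "(\<lambda>r. if indicator {0..t} r *\<^sub>R f r = 1 then indicator {0..t} r *\<^sub>R \<phi> r else 0) \<in> borel_measurable borel"
      by measurable
    moreover have "(\<lambda>r. if indicator {0..t} r *\<^sub>R f r = 1 then indicator {0..t} r *\<^sub>R \<phi> r else 0) = (\<lambda>s. indicator {0..t} s *\<^sub>R (if f s = 1 then \<phi> s else 0))"
      by (auto simp: fun_eq_iff indicator_def)
    ultimately show "(\<lambda>s. indicator {0..t} s *\<^sub>R (if f s = 1 then \<phi> s else 0)) \<in> borel_measurable lborel" by simp
    show "(\<lambda>s. indicator {0..t} s *\<^sub>R (f s ^ m * \<phi> s)) \<in> borel_measurable lborel" for m
      using int0[of t m] by (auto simp: set_integrable_def)
    show "integrable lborel (\<lambda>r. B * indicator {0..t} r :: real)"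
      by (intro integrable_mult_right integrable_real_indicator) (auto simp: emeasure_lborel_Icc_eq)
    show "AE s in lborel. norm (indicator {0..t} s *\<^sub>R (f s ^ m * \<phi> s)) \<le> B * indicator {0..t} s" for m
    proof (rule AE_I2)
      fix s show "norm (indicator {0..t} s *\<^sub>R (f s ^ m * \<phi> s)) \<le> B * indicator {0..t} s"
        using \<phi>B[of s] f01[of s] B0 mult_mono[of "f s ^ m" 1 "\<bar>\<phi> s\<bar>" B] by (auto simp: indicator_def abs_mult power_le_one)
    qed
    show "AE s in lborel. (\<lambda>m. indicator {0..t} s *\<^sub>R (f s ^ m * \<phi> s)) \<longlonglongrightarrow> indicator {0..t} s *\<^sub>R (if f s = 1 then \<phi> s else 0)"
    proof (rule AE_I2)
      fix s
      have "(\<lambda>m. f s ^ m * \<phi> s) \<longlonglongrightarrow> (if f s = 1 then \<phi> s else 0)" if "0 \<le> s"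
      proof (cases "f s = 1")
        case False
        then have "(\<lambda>m. f s ^ m) \<longlonglongrightarrow> 0" using f01[OF that] by (intro LIMSEQ_realpow_zero) auto
        from tendsto_mult_right[OF this, of "\<phi> s"] show ?thesis using False by simp
      qed simp
      then show "(\<lambda>m. indicator {0..t} s *\<^sub>R (f s ^ m * \<phi> s)) \<longlonglongrightarrow> indicator {0..t} s *\<^sub>R (if f s = 1 then \<phi> s else 0)"
        by (cases "s \<in> {0..t}") auto
    qed
  qed
  moreover have "(\<lambda>m. (f t ^ Suc m - f 0 ^ Suc m) / real (Suc m)) \<longlonglongrightarrow> 0"
  proof (rule Lim_null_comparison[OF always_eventually LIMSEQ_inverse_real_of_nat], rule allI)
    fix m
    have "\<bar>f t ^ Suc m - f 0 ^ Suc m\<bar> \<le> 1"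
      using f01[OF t] f01[of 0] power_le_one[of "f t" "Suc m"] power_le_one[of "f 0" "Suc m"] zero_le_power[of "f t" "Suc m"] zero_le_power[of "f 0" "Suc m"] by linarith
    then show "norm ((f t ^ Suc m - f 0 ^ Suc m) / real (Suc m)) \<le> inverse (real (Suc m))"
      by (simp add: divide_inverse abs_mult mult_left_le_one_le mult_right_mono del: power_Suc)
  qed
  ultimately have "(\<lambda>m. (LBINT s:{0..t}. f s ^ m * \<phi> s) - (f t ^ Suc m - f 0 ^ Suc m) / real (Suc m)) \<longlonglongrightarrow> (LBINT s:{0..t}. if f s = 1 then \<phi> s else 0) - 0"
    by (rule tendsto_diff)
  then have "(\<lambda>m. V t) \<longlonglongrightarrow> (LBINT s:{0..t}. if f s = 1 then \<phi> s else 0)"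
    unfolding key[symmetric] by simp
  then show ?thesis by (simp add: LIMSEQ_const_iff)
qed

text \<open>
  The density of \<open>U i\<close> for the fluid path: the rate of arrivals that find level \<open>i\<close> full. A full
  level passes on what comes from below it minus what it loses by departures.
\<close>

definition overflow_rate :: "real \<Rightarrow> (nat \<Rightarrow> real) \<Rightarrow> nat \<Rightarrow> real" where
  "overflow_rate lam x = rec_nat lam (\<lambda>i w. if x (Suc i) = 1 then w - x (Suc i) + x (Suc (Suc i)) else 0)"

lemma overflow_rate_simps [simp]:
  "overflow_rate lam x 0 = lam"
  "overflow_rate lam x (Suc i) = (if x (Suc i) = 1 then overflow_rate lam x i - x (Suc i) + x (Suc (Suc i)) else 0)"
  by (simp_all add: overflow_rate_def)

text \<open>
  Only finitely many levels are full, because \<open>x\<close> is summable, and they are the lowest ones.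
\<close>

lemma m_idx_props:
  assumes x: "x \<in> occ_space b"
  shows "x (Suc (m_idx x)) < 1" "\<And>j. 1 \<le> j \<Longrightarrow> j \<le> m_idx x \<Longrightarrow> x j = 1" "\<And>j. m_idx x < j \<Longrightarrow> x j < 1"
    "enat (m_idx x) \<le> b"
proof -
  have "x \<longlonglongrightarrow> 0" using occ_space_bounds(4)[OF x] by (rule summable_LIMSEQ_zero)
  then have "eventually (\<lambda>i. x i < 1) sequentially" by (rule order_tendstoD) simp
  then obtain n where "\<And>i. n \<le> i \<Longrightarrow> x i < 1" by (auto simp: eventually_sequentially)
  then have "x (n + 1) < 1" by simp
  then show 1: "x (Suc (m_idx x)) < 1" unfolding m_idx_def using LeastI[of "\<lambda>i. x (i + 1) < 1" n] by simp
  show 2: "x j = 1" if "1 \<le> j" "j \<le> m_idx x" for j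
  proof -
    have "j - 1 < m_idx x" using that by simp
    then have "\<not> x (j - 1 + 1) < 1" unfolding m_idx_def by (rule not_less_Least)
    then show ?thesis using that occ_space_bounds(2)[OF x, of j] by simp
  qed
  show "x j < 1" if "m_idx x < j" for j
    using Suc_leI[OF that]
  proof (induction rule: dec_induct)
    case (step n)
    then show ?case using occ_space_bounds(5)[OF x, of n] by simp
  qed (rule 1)
  show "enat (m_idx x) \<le> b"
    using 2[of "m_idx x"] occ_space_bounds(6)[OF x, of "m_idx x"] by (cases "m_idx x = 0") (force simp: zero_enat_def[symmetric])+
qed

lemma overflow_rate_full:
  assumes "\<And>j. 1 \<le> j \<Longrightarrow> j \<le> Suc n \<Longrightarrow> x j = 1"
  shows "overflow_rate lam x n = lam"
  using assms
proof (induction n)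
  case (Suc n)
  then show ?case using Suc.prems[of "Suc n"] Suc.prems[of "Suc (Suc n)"] by simp
qed simp

lemma overflow_rate_top:
  assumes "\<And>j. 1 \<le> j \<Longrightarrow> j \<le> Suc n \<Longrightarrow> x j = 1"
  shows "overflow_rate lam x (Suc n) = lam - 1 + x (Suc (Suc n))"
  using overflow_rate_full[OF assms, where lam=lam] assms[of "Suc n"] by simp

text \<open>
  All full levels but the highest pass on the whole arrival rate, the highest one passes on
  \<open>\<lambda> - 1 + q\<^bsub>m+1\<^esub>\<close>. The assumption says that this rate is nonnegative, so that the minimum in
  \<open>p_coeff\<close> is its first argument.
\<close>

lemma p_coeff_overflow_rate:
  assumes x: "x \<in> occ_space b" and lam: "0 < lam"
    and le: "\<And>m. enat (Suc m) \<le> b \<Longrightarrow> x (Suc m) = 1 \<Longrightarrow> 1 - x (Suc (Suc m)) \<le> lam"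
  shows "lam * p_coeff lam x j = overflow_rate lam x j - overflow_rate lam x (Suc j)"
proof -
  note mp = m_idx_props[OF x]
  have z: "overflow_rate lam x k = 0" if "m_idx x < k" for k
    using mp(3)[OF that] that by (cases k) auto
  show ?thesis
  proof (cases "m_idx x")
    case 0
    then show ?thesis using z[of "Suc j"] z[of j] by (cases j) (simp_all add: p_coeff_def del: overflow_rate_simps(2))
  next
    case (Suc m)
    have full: "overflow_rate lam x k = lam" if "k \<le> m" for k
      by (rule overflow_rate_full) (use that Suc mp(2) in auto)
    have top: "overflow_rate lam x (Suc m) = lam - 1 + x (Suc (Suc m))"
      by (rule overflow_rate_top) (use Suc mp(2) in auto)
    have l: "1 - x (Suc (Suc m)) \<le> lam"
      by (rule le) (use mp(4) mp(2)[of "Suc m"] Suc in auto)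
    then have mn: "min ((1 - x (Suc (Suc m))) / lam) 1 = (1 - x (Suc (Suc m))) / lam" using lam by (simp add: min_def)
    consider "j < m" | "j = m" | "j = Suc m" | "Suc m < j" by linarith
    then show ?thesis
    proof cases
      case 1
      then show ?thesis using full[of j] full[of "Suc j"] Suc by (simp add: p_coeff_def del: overflow_rate_simps(2))
    next
      case 2
      then show ?thesis using full[of m] top Suc mn lam by (simp add: p_coeff_def del: overflow_rate_simps(2))
    next
      case 3
      then show ?thesis using z[of "Suc (Suc m)"] top Suc mn lam by (simp add: p_coeff_def field_simps del: overflow_rate_simps(2))
    next
      case 4
      then show ?thesis using z[of j] z[of "Suc j"] Suc by (simp add: p_coeff_def del: overflow_rate_simps(2))
    qed
  qed
qed

text \<open>
  The solutions without error, in terms of the overflow processes instead of the coefficients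
  \<open>p_coeff\<close>.
\<close>

locale fluid_path = sys_path b q U D for b q U D +
  fixes lam :: real
  assumes lam_pos: "0 < lam"
    and U_0: "\<And>t. 0 \<le> t \<Longrightarrow> U 0 t = lam * t"
    and D_drift: "\<And>t i. 0 \<le> t \<Longrightarrow> 1 \<le> i \<Longrightarrow> enat i \<le> b \<Longrightarrow> D i t = drift q i t"
begin

lemma U_lip: "0 \<le> s \<Longrightarrow> s \<le> t \<Longrightarrow> U i t - U i s \<le> lam * (t - s)"
proof (induction i)
  case 0
  then show ?case using U_0[of s] U_0[of t] by (simp add: algebra_simps)
next
  case (Suc i)
  then show ?case using sp_U_Suc[of s t i] by linarith
qed

lemma q_lip:
  assumes "0 \<le> s" "s \<le> t"
  shows "\<bar>q t i - q s i\<bar> \<le> (2 * lam + 1) * (t - s)"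
proof (cases "1 \<le> i \<and> enat i \<le> b")
  case True
  have "q t i - q s i = (U (i - 1) t - U (i - 1) s) - (U i t - U i s) - (drift q i t - drift q i s)"
    using sp_eq[of t i] sp_eq[of s i] D_drift[of t i] D_drift[of s i] assms True by simp
  moreover have "0 \<le> U (i - 1) t - U (i - 1) s" "0 \<le> U i t - U i s" using sp_U_mono assms by auto
  ultimately show ?thesis
    using U_lip[OF assms, of i] U_lip[OF assms, of "i - 1"] sp_drift_bounds[OF assms, of i] True
    by (simp add: distrib_right)
next
  case False
  then have "q t i = 0" "q s i = 0"
    using occ_space_bounds(3,6)[OF sp_occ[of t]] occ_space_bounds(3,6)[OF sp_occ[of s]] assms
    by (metis One_nat_def Suc_leI neq0_conv order_trans)+
  then show ?thesis using assms lam_pos by simp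
qed

lemma q_continuous: "continuous_on {0..} (\<lambda>t. q t i)"
proof (rule continuous_onI)
  fix x e :: real assume x: "x \<in> {0..}" and e: "0 < e"
  have c: "0 < 2 * lam + 1" using lam_pos by simp
  show "\<exists>d>0. \<forall>x'\<in>{0..}. dist x' x < d \<longrightarrow> dist (q x' i) (q x i) \<le> e"
  proof (intro exI[of _ "e / (2 * lam + 1)"] conjI ballI impI)
    show "0 < e / (2 * lam + 1)" using e c by simp
    fix y assume y: "y \<in> {0..}" "dist y x < e / (2 * lam + 1)"
    have "\<bar>q y i - q x i\<bar> \<le> (2 * lam + 1) * \<bar>y - x\<bar>"
      using q_lip[of x y i] q_lip[of y x i] x y by (cases "x \<le> y") (auto simp: abs_minus_commute)
    also have "\<dots> \<le> e" using y c by (simp add: dist_real_def field_simps)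
    finally show "dist (q y i) (q x i) \<le> e" by (simp add: dist_real_def)
  qed
qed

lemma overflow_measurable: "set_borel_measurable borel {0..} (\<lambda>t. overflow_rate lam (q t) i)"
proof (induction i)
  case 0
  show ?case by (simp add: set_borel_measurable_def)
next
  case (Suc i)
  define x where "x t = indicator {0..} t *\<^sub>R q t (Suc i)" for t
  define y where "y t = indicator {0..} t *\<^sub>R q t (Suc (Suc i))" for t
  define w where "w t = indicator {0..} t *\<^sub>R overflow_rate lam (q t) i" for t
  have [measurable]: "x \<in> borel_measurable borel" "y \<in> borel_measurable borel" "w \<in> borel_measurable borel"
    using sp_meas[of "Suc i"] sp_meas[of "Suc (Suc i)"] Suc
    unfolding x_def[abs_def] y_def[abs_def] w_def[abs_def] set_borel_measurable_def by simp_all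
  have "(\<lambda>t. if x t = 1 then w t - x t + y t else 0) \<in> borel_measurable borel" by measurable
  moreover have "(if x t = 1 then w t - x t + y t else 0) = indicator {0..} t *\<^sub>R overflow_rate lam (q t) (Suc i)" for t
    by (cases "0 \<le> t") (simp_all add: x_def y_def w_def)
  ultimately show ?case by (simp only: set_borel_measurable_def)
qed

lemma overflow_bound: "0 \<le> t \<Longrightarrow> \<bar>overflow_rate lam (q t) i\<bar> \<le> lam + real i"
proof (induction i)
  case (Suc i)
  then show ?case
    using occ_space_bounds(1,2)[OF sp_occ[OF Suc.prems], of "Suc i"] occ_space_bounds(1,2)[OF sp_occ[OF Suc.prems], of "Suc (Suc i)"] lam_pos
    by (simp; linarith)
qed (use lam_pos in simp)

lemma overflow_integrable: "0 \<le> s \<Longrightarrow> set_integrable lborel {s..t} (\<lambda>r. overflow_rate lam (q r) i)"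
  unfolding set_integrable_def
proof (rule Bochner_Integration.integrable_bound[where f="\<lambda>r. (lam + real i) * indicator {s..t} r :: real"])
  assume s: "0 \<le> s"
  show "integrable lborel (\<lambda>r. (lam + real i) * indicator {s..t} r :: real)"
    by (intro integrable_mult_right integrable_real_indicator) (auto simp: emeasure_lborel_Icc_eq)
  have "set_borel_measurable borel {s..t} (\<lambda>t. overflow_rate lam (q t) i)"
    by (rule set_borel_measurable_subset[OF overflow_measurable]) (use s in auto)
  then show "(\<lambda>r. indicator {s..t} r *\<^sub>R overflow_rate lam (q r) i) \<in> borel_measurable lborel"
    by (simp add: set_borel_measurable_def)
  have "norm (indicator {s..t} r *\<^sub>R overflow_rate lam (q r) i) \<le> norm ((lam + real i) * indicator {s..t} r)" for r
    using overflow_bound[of r i] s by (auto simp: indicator_def)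
  then show "AE r in lborel. norm (indicator {s..t} r *\<^sub>R overflow_rate lam (q r) i) \<le> norm ((lam + real i) * indicator {s..t} r)" by simp
qed

lemma U_density: "enat i \<le> b \<Longrightarrow> 0 \<le> t \<Longrightarrow> U i t = (LBINT s:{0..t}. overflow_rate lam (q s) i)"
proof (induction i arbitrary: t)
  case 0
  then show ?case using U_0[of t] by (simp add: set_lebesgue_integral_def)
next
  case (Suc i)
  have bi: "enat i \<le> b" using Suc.prems by (meson Suc_ile_eq order_less_imp_le)
  let ?phi = "\<lambda>s. overflow_rate lam (q s) i - (q s (Suc i) - q s (Suc (Suc i)))"
  have "U (Suc i) t = (LBINT s:{0..t}. if q s (Suc i) = 1 then ?phi s else 0)"
  proof (rule reflection_density[where f="\<lambda>t. q t (Suc i)" and B="lam + real i + 1" and L=lam])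
    show "0 \<le> q t (Suc i) \<and> q t (Suc i) \<le> 1" if "0 \<le> t" for t using occ_space_bounds[OF sp_occ[OF that]] by auto
    show "set_borel_measurable borel {0..} (\<lambda>t. q t (Suc i))" by (rule sp_meas)
    show "set_borel_measurable borel {0..} ?phi"
    proof -
      have "(\<lambda>t. indicator {0..} t *\<^sub>R overflow_rate lam (q t) i - (indicator {0..} t *\<^sub>R q t (Suc i) - indicator {0..} t *\<^sub>R q t (Suc (Suc i)))) \<in> borel_measurable borel"
        using overflow_measurable[of i] sp_meas by (intro borel_measurable_diff) (auto simp: set_borel_measurable_def)
      then show ?thesis by (simp add: set_borel_measurable_def algebra_simps)
    qed
    show "\<bar>?phi t\<bar> \<le> lam + real i + 1" if "0 \<le> t" for t
      using overflow_bound[OF that, of i] occ_space_bounds(1,2)[OF sp_occ[OF that], of "Suc i"] occ_space_bounds(1)[OF sp_occ[OF that], of "Suc (Suc i)"]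
        occ_space_bounds(5)[OF sp_occ[OF that], of "Suc i"] by simp
    show "q t (Suc i) = q 0 (Suc i) + (LBINT s:{0..t}. ?phi s) - U (Suc i) t" if "0 \<le> t" for t
    proof -
      have "(LBINT s:{0..t}. ?phi s) = (LBINT s:{0..t}. overflow_rate lam (q s) i) - drift q (Suc i) t"
        unfolding drift_def using sp_integrable_diff[of 0 t "Suc i"] overflow_integrable[of 0 t i] by (subst set_integral_diff(2)) auto
      then show ?thesis using sp_eq[OF that _ Suc.prems(1)] D_drift[OF that _ Suc.prems(1)] Suc.IH[OF bi that] by simp
    qed
    show "U (Suc i) 0 = 0" by (rule sp_0)
    show "U (Suc i) s \<le> U (Suc i) t" if "0 \<le> s" "s \<le> t" for s t using that by (rule sp_U_mono)
    show "U (Suc i) t - U (Suc i) s \<le> lam * (t - s)" if "0 \<le> s" "s \<le> t" for s t using that by (rule U_lip)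
    show "\<exists>r\<in>{s..t}. q r (Suc i) = 1" if "0 \<le> s" "s \<le> t" "U (Suc i) s < U (Suc i) t" for s t
      using sp_reflect[OF _ Suc.prems(1) that] by auto
  qed fact
  also have "\<dots> = (LBINT s:{0..t}. overflow_rate lam (q s) (Suc i))"
    by (rule set_lebesgue_integral_cong) auto
  finally show ?case .
qed

text \<open>
  Where \<open>\<lambda> < 1 - q\<^bsub>m+2\<^esub>\<close> the density of \<open>U (m + 1)\<close> is negative at times with \<open>q\<^bsub>m+1\<^esub> = 1\<close>. As
  \<open>U (m + 1)\<close> does not decrease, these times form a null set on every interval on which the
  inequality holds throughout, and by continuity countably many such intervals suffice.
\<close>

lemma AE_full_level:
  assumes b: "enat (Suc m) \<le> b"
  shows "AE s in lborel. 0 \<le> s \<longrightarrow> q s (Suc m) = 1 \<longrightarrow> 1 - q s (Suc (Suc m)) \<le> lam"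
proof -
  have "AE s in lborel. \<forall>(u, v)\<in>\<rat> \<times> \<rat>. 0 \<le> u \<and> (\<forall>r\<in>{u..v}. lam < 1 - q r (Suc (Suc m))) \<longrightarrow> s \<in> {u..v} \<longrightarrow> q s (Suc m) \<noteq> 1"
  proof (subst AE_ball_countable)
    show "countable (\<rat> \<times> (\<rat> :: real set))" by (simp add: countable_rat)
    show "\<forall>y\<in>\<rat> \<times> \<rat>. AE s in lborel. case y of (u, v) \<Rightarrow> 0 \<le> u \<and> (\<forall>r\<in>{u..v}. lam < 1 - q r (Suc (Suc m))) \<longrightarrow> s \<in> {u..v} \<longrightarrow> q s (Suc m) \<noteq> 1"
    proof (safe, goal_cases)
      case (1 u v)
      show ?case
      proof (cases "0 \<le> u \<and> u \<le> v \<and> (\<forall>r\<in>{u..v}. lam < 1 - q r (Suc (Suc m)))")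
        case True
        let ?w = "\<lambda>s. overflow_rate lam (q s) (Suc m)"
        have w: "?w r = (if q r (Suc m) = 1 then lam - 1 + q r (Suc (Suc m)) else 0)" if "r \<in> {u..v}" for r
        proof (cases "q r (Suc m) = 1")
          case full: True
          have occ: "q r \<in> occ_space b" using that True by (intro sp_occ) auto
          have "q r j = 1" if "1 \<le> j" "j \<le> Suc m" for j
            using that(2,1)
          proof (induction rule: inc_induct)
            case (step n)
            then show ?case using occ_space_bounds(2)[OF occ, of n] occ_space_bounds(5)[OF occ, of n] by auto
          qed (use full in simp)
          then show ?thesis using overflow_rate_top[where lam=lam and x="q r" and n=m] full by auto
        qed simp
        have "(LBINT s:{u..v}. ?w s) = U (Suc m) v - U (Suc m) u"
          using U_density[OF b, of v] U_density[OF b, of u] set_integral_Icc_split[of ?w u v] overflow_integrable[of 0 _ "Suc m"] True by auto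
        then have ge: "0 \<le> (LBINT s:{u..v}. ?w s)" using sp_U_mono[of u v "Suc m"] True by simp
        have i: "integrable lborel (\<lambda>s. indicator {u..v} s *\<^sub>R ?w s)"
          using overflow_integrable[of u v "Suc m"] True by (simp add: set_integrable_def)
        have nonpos: "indicator {u..v} s *\<^sub>R ?w s \<le> 0" for s
        proof (cases "s \<in> {u..v}")
          case s: True
          then have "lam < 1 - q s (Suc (Suc m))" using True by blast
          then have "?w s \<le> 0" unfolding w[OF s] by simp
          then show ?thesis using s by simp
        qed simp
        have "AE s in lborel. - (indicator {u..v} s *\<^sub>R ?w s) = 0"
        proof (subst integral_nonneg_eq_0_iff_AE[symmetric])
          show "integrable lborel (\<lambda>s. - (indicator {u..v} s *\<^sub>R ?w s))" using i by simp
          show "AE s in lborel. 0 \<le> - (indicator {u..v} s *\<^sub>R ?w s)" using nonpos by simp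
          have "0 \<le> (LBINT s. - (indicator {u..v} s *\<^sub>R ?w s))"
            by (rule integral_nonneg_AE) (use nonpos in simp)
          moreover have "(LBINT s. - (indicator {u..v} s *\<^sub>R ?w s)) = - (LBINT s:{u..v}. ?w s)"
            unfolding set_lebesgue_integral_def by (rule integral_minus)
          ultimately show "(LBINT s. - (indicator {u..v} s *\<^sub>R ?w s)) = 0" using ge by linarith
        qed
        then show ?thesis
        proof eventually_elim
          case (elim s)
          show ?case
          proof (intro impI notI)
            assume s: "s \<in> {u..v}" "q s (Suc m) = 1"
            then have "lam < 1 - q s (Suc (Suc m))" using True by blast
            then show False using elim w[OF s(1)] s by (simp del: overflow_rate_simps)
          qed
        qed
      qed auto
    qed
  qed
  moreover have "AE s in lborel. s \<noteq> (0::real)" by (rule AE_lborel_singleton)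
  ultimately show ?thesis
  proof eventually_elim
    case (elim s)
    show ?case
    proof (intro impI, rule ccontr)
      assume s: "0 \<le> s" "q s (Suc m) = 1" "\<not> 1 - q s (Suc (Suc m)) \<le> lam"
      then have s0: "0 < s" using elim by simp
      have c: "continuous_on {0..} (\<lambda>r. 1 - q r (Suc (Suc m)))" by (intro continuous_intros q_continuous)
      have "isCont (\<lambda>r. 1 - q r (Suc (Suc m))) s"
        by (rule continuous_on_interior[OF c]) (use s0 in simp)
      then have "\<forall>\<^sub>F r in at s. lam < 1 - q r (Suc (Suc m))"
        using s(3) unfolding isCont_def not_le by (rule order_tendstoD(1))
      then obtain d where d: "0 < d" "\<And>r. dist r s < d \<Longrightarrow> lam < 1 - q r (Suc (Suc m))"
        using s(3) unfolding eventually_at not_le by (metis UNIV_I)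
      obtain u where u: "u \<in> \<rat>" "max 0 (s - d) < u" "u < s" using Rats_dense_in_real[of "max 0 (s - d)" s] s0 d by auto
      obtain v where v: "v \<in> \<rat>" "s < v" "v < s + d" using Rats_dense_in_real[of s "s + d"] d by auto
      have "lam < 1 - q r (Suc (Suc m))" if "r \<in> {u..v}" for r
        using that u v by (intro d) (auto simp: dist_real_def)
      moreover have "0 \<le> u" "s \<in> {u..v}" using u v by auto
      ultimately have "q s (Suc m) \<noteq> 1" using bspec[OF elim(1), of "(u, v)"] u(1) v(1) by simp
      then show False using s by simp
    qed
  qed
qed

lemma p_coeff_measurable: "set_borel_measurable borel {0..t} (\<lambda>s. p_coeff lam (q s) j)"
proof -
  define x where "x s i = indicator {0..} s *\<^sub>R q s i" for s i
  have [measurable]: "(\<lambda>s. x s i) \<in> borel_measurable borel" for i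
    using sp_meas[of i] by (simp add: set_borel_measurable_def x_def)
  have [measurable]: "(\<lambda>s. m_idx (x s)) \<in> borel \<rightarrow>\<^sub>M count_space UNIV"
    unfolding m_idx_def by measurable
  have alt: "p_coeff lam y j = (if m_idx y = 0 then (if j = 0 then 1 else 0)
     else if m_idx y = Suc j then min ((1 - y (Suc (Suc j))) / lam) 1
     else if m_idx y = j then 1 - min ((1 - y (Suc j)) / lam) 1 else 0)" for y
    by (auto simp: p_coeff_def)
  have "(\<lambda>s. p_coeff lam (x s) j) \<in> borel_measurable borel"
    unfolding alt by measurable
  then have "(\<lambda>s. indicator {0..t} s *\<^sub>R p_coeff lam (x s) j) \<in> borel_measurable borel"
    by measurable
  moreover have "indicator {0..t} s *\<^sub>R p_coeff lam (x s) j = indicator {0..t} s *\<^sub>R p_coeff lam (q s) j" for s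
  proof (cases "0 \<le> s")
    case True
    then have "x s = q s" by (intro ext) (simp add: x_def)
    then show ?thesis by simp
  qed simp
  ultimately show ?thesis by (simp only: set_borel_measurable_def)
qed

theorem satisfies_fluid_equations: "fluid_equations b lam q"
  unfolding fluid_equations_def
proof (intro allI impI)
  fix t :: real and i :: nat assume t: "0 \<le> t" and "1 \<le> i \<and> enat i \<le> b"
  then obtain j where i: "i = Suc j" "enat (Suc j) \<le> b" by (cases i) auto
  have bj: "enat j \<le> b" using i by (meson Suc_ile_eq order_less_imp_le)
  have "AE s in lborel. \<forall>m. enat (Suc m) \<le> b \<longrightarrow> 0 \<le> s \<longrightarrow> q s (Suc m) = 1 \<longrightarrow> 1 - q s (Suc (Suc m)) \<le> lam"
    unfolding AE_all_countable
  proof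
    fix m show "AE s in lborel. enat (Suc m) \<le> b \<longrightarrow> 0 \<le> s \<longrightarrow> q s (Suc m) = 1 \<longrightarrow> 1 - q s (Suc (Suc m)) \<le> lam"
      by (cases "enat (Suc m) \<le> b") (use AE_full_level[of m] in simp_all)
  qed
  then have AE: "AE s in lborel. s \<in> {0..t} \<longrightarrow> (overflow_rate lam (q s) j - overflow_rate lam (q s) (Suc j)) / lam = p_coeff lam (q s) j"
  proof eventually_elim
    case (elim s)
    show ?case
    proof
      assume s: "s \<in> {0..t}"
      have "lam * p_coeff lam (q s) j = overflow_rate lam (q s) j - overflow_rate lam (q s) (Suc j)"
        by (rule p_coeff_overflow_rate[OF sp_occ lam_pos]) (use elim s in auto)
      then show "(overflow_rate lam (q s) j - overflow_rate lam (q s) (Suc j)) / lam = p_coeff lam (q s) j"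
        using lam_pos by (simp add: field_simps del: overflow_rate_simps)
    qed
  qed
  have i1: "set_integrable lborel {0..t} (\<lambda>s. overflow_rate lam (q s) k)" for k by (rule overflow_integrable) simp
  have "(LBINT s:{0..t}. p_coeff lam (q s) j) = (LBINT s:{0..t}. (overflow_rate lam (q s) j - overflow_rate lam (q s) (Suc j)) / lam)"
    unfolding set_lebesgue_integral_def
  proof (rule integral_cong_AE)
    show "(\<lambda>s. indicator {0..t} s *\<^sub>R p_coeff lam (q s) j) \<in> borel_measurable lborel"
      using p_coeff_measurable[of t j] by (simp add: set_borel_measurable_def)
    have "set_integrable lborel {0..t} (\<lambda>s. (overflow_rate lam (q s) j - overflow_rate lam (q s) (Suc j)) / lam)"
      by (intro set_integrable_divide set_integral_diff(1) i1)
    then show "(\<lambda>s. indicator {0..t} s *\<^sub>R ((overflow_rate lam (q s) j - overflow_rate lam (q s) (Suc j)) / lam)) \<in> borel_measurable lborel"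
      unfolding set_integrable_def by (rule borel_measurable_integrable)
    show "AE s in lborel. indicator {0..t} s *\<^sub>R p_coeff lam (q s) j = indicator {0..t} s *\<^sub>R ((overflow_rate lam (q s) j - overflow_rate lam (q s) (Suc j)) / lam)"
      using AE by eventually_elim (auto simp: indicator_def simp del: overflow_rate_simps)
  qed
  also have "\<dots> = (U j t - U (Suc j) t) / lam"
    using U_density[OF bj t] U_density[OF i(2) t] i1[of j] i1[of "Suc j"]
    by (simp add: set_integral_diff(2) del: overflow_rate_simps)
  finally have "lam * (LBINT s:{0..t}. p_coeff lam (q s) j) = U j t - U (Suc j) t" using lam_pos by simp
  then show "q t i = q 0 i + lam * (LBINT s:{0..t}. p_coeff lam (q s) (i - 1)) - (LBINT s:{0..t}. q s i - q s (i + 1))"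
    using sp_eq[OF t _ i(2)] D_drift[OF t _ i(2)] i(1) by (simp add: drift_def)
qed

end

section \<open>Existence of the fluid path\<close>

lemma uniformly_Cauchy_limit:
  fixes x :: "nat \<Rightarrow> real"
  assumes "\<And>n m m'. k \<le> n \<Longrightarrow> n \<le> m \<Longrightarrow> n \<le> m' \<Longrightarrow> \<bar>x m - x m'\<bar> \<le> inverse (real (Suc n))"
  shows "x \<longlonglongrightarrow> lim x" and "\<And>n m. k \<le> n \<Longrightarrow> n \<le> m \<Longrightarrow> \<bar>x m - lim x\<bar> \<le> inverse (real (Suc n))"
proof -
  have "Cauchy x"
  proof (rule metric_CauchyI)
    fix e :: real assume "0 < e"
    then obtain n where n: "inverse (real (Suc n)) < e" using reals_Archimedean by blast
    have le: "inverse (real (Suc (max k n))) \<le> inverse (real (Suc n))" by (intro le_imp_inverse_le) auto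
    show "\<exists>N. \<forall>m\<ge>N. \<forall>n\<ge>N. dist (x m) (x n) < e"
    proof (intro exI[of _ "max k n"] allI impI)
      fix m m' assume "max k n \<le> m" "max k n \<le> m'"
      then have "\<bar>x m - x m'\<bar> \<le> inverse (real (Suc (max k n)))" by (intro assms) auto
      then show "dist (x m) (x m') < e" using le n by (simp only: dist_real_def)
    qed
  qed
  then show lim: "x \<longlonglongrightarrow> lim x" by (simp add: Cauchy_convergent_iff convergent_LIMSEQ_iff)
  fix n m assume nm: "k \<le> n" "n \<le> m"
  have "(\<lambda>m'. \<bar>x m - x m'\<bar>) \<longlonglongrightarrow> \<bar>x m - lim x\<bar>" by (intro tendsto_intros lim)
  then show "\<bar>x m - lim x\<bar> \<le> inverse (real (Suc n))"
    using assms nm by (intro LIMSEQ_le_const2) auto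
qed

text \<open>
  All equations pass to a uniform limit on bounded intervals. The reflection property needs
  compactness: the times of last increase of the approximations accumulate at some \<open>\<rho>\<close>, and
  equicontinuity transfers \<open>q\<^sub>i = 1\<close> and the value of \<open>U i\<close> to \<open>\<rho>\<close>.
\<close>

lemma fluid_path_limit:
  fixes Q :: "nat \<Rightarrow> real \<Rightarrow> nat \<Rightarrow> real"
  assumes lam: "0 < lam" and sp: "\<And>m. sys_path b (Q m) (V m) (E m)"
    and nf: "\<And>m. near_fluid b lam (real m) m (inverse (real (Suc m))) (Q m) (V m) (E m)"
    and q: "occ_path b q"
    and qrate: "\<And>t n m i. 0 \<le> t \<Longrightarrow> t \<le> real n \<Longrightarrow> n \<le> m \<Longrightarrow> \<bar>Q m t i - q t i\<bar> \<le> inverse (real (Suc n))"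
    and Urate: "\<And>t n m i. 0 \<le> t \<Longrightarrow> enat i \<le> b \<Longrightarrow> t \<le> real n \<Longrightarrow> n \<le> m \<Longrightarrow>
      \<bar>V m i t - U i t\<bar> \<le> inverse (real (Suc n))"
    and U_beyond: "\<And>i t. \<not> enat i \<le> b \<Longrightarrow> U i t = 0"
  shows "fluid_path b q U (drift q) lam"
proof -
  interpret qp: occ_path b q by (rule q)
  define D where "D i t = drift q i t" for i t
  have rate_lim: "y \<longlonglongrightarrow> c" if "\<And>m. t \<le> real m \<Longrightarrow> \<bar>y m - c\<bar> \<le> inverse (real (Suc m))" for y :: "nat \<Rightarrow> real" and c t
  proof (rule LIM_zero_cancel, rule Lim_null_comparison[OF _ LIMSEQ_inverse_real_of_nat])
    show "\<forall>\<^sub>F m in sequentially. norm (y m - c) \<le> inverse (real (Suc m))"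
    proof (rule eventually_sequentiallyI[of "nat \<lceil>t\<rceil>"])
      fix m assume "nat \<lceil>t\<rceil> \<le> m"
      then have "t \<le> real m" by linarith
      then show "norm (y m - c) \<le> inverse (real (Suc m))" using that by simp
    qed
  qed
  have qlim: "(\<lambda>m. Q m t i) \<longlonglongrightarrow> q t i" if "0 \<le> t" for t i
    by (rule rate_lim[of t]) (rule qrate[OF that _ order_refl])
  have Ulim: "(\<lambda>m. V m i t) \<longlonglongrightarrow> U i t" if "0 \<le> t" "enat i \<le> b" for t i
    by (rule rate_lim[of t]) (rule Urate[OF that _ order_refl])
  have Dlim: "(\<lambda>m. E m i t) \<longlonglongrightarrow> D i t" if t: "0 \<le> t" and i: "1 \<le> i" "enat i \<le> b" for t i
  proof (rule LIM_zero_cancel, rule Lim_null_comparison[where g="\<lambda>m. inverse (real (Suc m)) * (1 + 2 * exp t)"])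
    have "(\<lambda>m. inverse (real (Suc m)) * (1 + 2 * exp t)) \<longlonglongrightarrow> 0 * (1 + 2 * exp t)"
      by (intro tendsto_mult_right LIMSEQ_inverse_real_of_nat)
    then show "(\<lambda>m. inverse (real (Suc m)) * (1 + 2 * exp t)) \<longlonglongrightarrow> 0" by simp
    show "\<forall>\<^sub>F m in sequentially. norm (E m i t - D i t) \<le> inverse (real (Suc m)) * (1 + 2 * exp t)"
    proof (rule eventually_sequentiallyI[of "max i (nat \<lceil>t\<rceil>)"])
      fix m assume m: "max i (nat \<lceil>t\<rceil>) \<le> m"
      have tm: "t \<le> real m" using m by linarith
      have "\<bar>E m i t - drift (Q m) i t\<bar> \<le> inverse (real (Suc m))"
        using nf[of m] t tm i m by (auto simp: near_fluid_def)
      moreover have "\<bar>drift (Q m) i t - drift q i t\<bar> \<le> (inverse (real (Suc m)) + inverse (real (Suc m))) / 1 * exp (1 * t)"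
      proof (rule drift_diff_bound[OF sys_path.axioms(1)[OF sp] qp.occ_path_axioms _ t])
        have "\<bar>Q m s k - q s k\<bar> \<le> inverse (real (Suc m)) * exp (1 * s)" if s: "0 \<le> s" "s \<le> t" for s k
        proof -
          have "\<bar>Q m s k - q s k\<bar> \<le> inverse (real (Suc m))" using qrate[OF s(1), of m m k] s tm by simp
          also have "\<dots> \<le> inverse (real (Suc m)) * exp (1 * s)" using s(1) mult_left_mono[of 1 "exp (1 * s)" "inverse (real (Suc m))"] by simp
          finally show ?thesis .
        qed
        then show "\<bar>Q m s i - q s i\<bar> \<le> inverse (real (Suc m)) * exp (1 * s)"
          "\<bar>Q m s (i + 1) - q s (i + 1)\<bar> \<le> inverse (real (Suc m)) * exp (1 * s)" if "0 \<le> s" "s \<le> t" for s using that by blast+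
      qed auto
      moreover have "inverse (real (Suc m)) * (1 + 2 * exp t) = inverse (real (Suc m)) + (inverse (real (Suc m)) + inverse (real (Suc m))) / 1 * exp (1 * t)"
        by (simp only: distrib_left distrib_right div_by_1 mult_1_left mult_1_right mult_2)
      ultimately show "norm (E m i t - D i t) \<le> inverse (real (Suc m)) * (1 + 2 * exp t)"
        unfolding D_def real_norm_def by linarith
    qed
  qed
  have U0: "U 0 t = lam * t" if t: "0 \<le> t" for t
  proof -
    have b0: "enat 0 \<le> b" by (simp add: zero_enat_def[symmetric])
    have "(\<lambda>m. V m 0 t) \<longlonglongrightarrow> lam * t"
    proof (rule LIM_zero_cancel, rule Lim_null_comparison[OF _ LIMSEQ_inverse_real_of_nat])
      show "\<forall>\<^sub>F m in sequentially. norm (V m 0 t - lam * t) \<le> inverse (real (Suc m))"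
      proof (rule eventually_sequentiallyI[of "nat \<lceil>t\<rceil>"])
        fix m assume "nat \<lceil>t\<rceil> \<le> m"
        then have "t \<le> real m" by linarith
        then show "norm (V m 0 t - lam * t) \<le> inverse (real (Suc m))" using nf[of m] t by (auto simp: near_fluid_def)
      qed
    qed
    then show ?thesis using Ulim[OF t b0] LIMSEQ_unique by blast
  qed
  have Umono: "U i s \<le> U i t" if st: "0 \<le> s" "s \<le> t" for i s t
  proof (cases "enat i \<le> b")
    case True
    have t: "0 \<le> t" using st by simp
    have "V m i s \<le> V m i t" for m by (rule sys_path.sp_U_mono[OF sp st])
    then show ?thesis by (intro LIMSEQ_le[OF Ulim[OF st(1) True] Ulim[OF t True]]) auto
  qed (simp add: U_beyond)
  have USuc: "U (Suc i) t - U (Suc i) s \<le> U i t - U i s" if st: "0 \<le> s" "s \<le> t" for i s t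
  proof (cases "enat (Suc i) \<le> b")
    case True
    then have bi: "enat i \<le> b" by (meson Suc_ile_eq order_less_imp_le)
    have t: "0 \<le> t" using st by simp
    have "V m (Suc i) t - V m (Suc i) s \<le> V m i t - V m i s" for m by (rule sys_path.sp_U_Suc[OF sp st])
    then show ?thesis
      by (intro LIMSEQ_le[OF tendsto_diff[OF Ulim[OF t True] Ulim[OF st(1) True]] tendsto_diff[OF Ulim[OF t bi] Ulim[OF st(1) bi]]]) auto
  next
    case False
    then show ?thesis using Umono[OF st, of i] by (simp add: U_beyond)
  qed
  have Ulip: "U i t - U i s \<le> lam * (t - s)" if st: "0 \<le> s" "s \<le> t" for i s t
  proof (induction i)
    case 0
    show ?case using U0[of s] U0[of t] st by (simp add: algebra_simps)
  qed (use USuc[OF st] in \<open>meson order_trans\<close>)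
  have eq: "q t i = q 0 i + U (i - 1) t - U i t - D i t" if t: "0 \<le> t" and i: "1 \<le> i" "enat i \<le> b" for t i
  proof -
    have bi: "enat (i - 1) \<le> b" using i by (meson diff_le_self enat_ord_simps(1) order_trans)
    have "(\<lambda>m. Q m 0 i + V m (i - 1) t - V m i t - E m i t) \<longlonglongrightarrow> q 0 i + U (i - 1) t - U i t - D i t"
      by (intro tendsto_intros qlim Ulim Dlim t bi i order_refl)
    moreover have "(\<lambda>m. Q m 0 i + V m (i - 1) t - V m i t - E m i t) = (\<lambda>m. Q m t i)"
      using sys_path.sp_eq[OF sp t i] by auto
    ultimately show ?thesis using qlim[OF t, of i] LIMSEQ_unique by metis
  qed
  have qlip: "\<bar>q t i - q s i\<bar> \<le> (2 * lam + 1) * (t - s)" if st: "0 \<le> s" "s \<le> t" and i: "1 \<le> i" "enat i \<le> b" for s t i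
  proof -
    have t: "0 \<le> t" using st by simp
    have e: "q t i - q s i = (U (i - 1) t - U (i - 1) s) - (U i t - U i s) - (drift q i t - drift q i s)"
      using eq[OF t i] eq[OF st(1) i] by (simp add: D_def)
    have "(2 * lam + 1) * (t - s) = lam * (t - s) + lam * (t - s) + (t - s)" by (simp add: algebra_simps)
    then show ?thesis
      unfolding e using Ulip[OF st, of i] Ulip[OF st, of "i - 1"] Umono[OF st, of i] Umono[OF st, of "i - 1"] qp.sp_drift_bounds[OF st i(1)]
      by (simp only: abs_le_iff) linarith
  qed
  have reflect: "\<exists>r\<in>{s..t}. q r i = 1 \<and> U i r = U i t" if i: "1 \<le> i" "enat i \<le> b" and st: "0 \<le> s" "s \<le> t" and less: "U i s < U i t" for i s t
  proof -
    have t: "0 \<le> t" using st by simp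
    define n0 where "n0 = nat \<lceil>t\<rceil>"
    have tn0: "t \<le> real n0" unfolding n0_def by linarith
    have "(\<lambda>m. V m i t - V m i s) \<longlonglongrightarrow> U i t - U i s" by (intro tendsto_intros Ulim t st i)
    then have "\<forall>\<^sub>F m in sequentially. 0 < V m i t - V m i s" using less by (intro order_tendstoD(1)) auto
    then obtain m0 where m0: "\<And>m. m0 \<le> m \<Longrightarrow> V m i s < V m i t" by (auto simp: eventually_sequentially)
    define m1 where "m1 = max m0 n0"
    have "\<forall>k. \<exists>r. r \<in> {s..t} \<and> Q (k + m1) r i = 1 \<and> V (k + m1) i r = V (k + m1) i t"
      using sys_path.sp_reflect[OF sp i st m0] by (auto simp: m1_def Bex_def)
    then obtain r where r: "\<And>k. r k \<in> {s..t}" "\<And>k. Q (k + m1) (r k) i = 1" "\<And>k. V (k + m1) i (r k) = V (k + m1) i t" by metis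
    \<comment> \<open>A limit point of the times of last increase of the approximations.\<close>
    obtain \<rho> h where \<rho>: "\<rho> \<in> {s..t}" "strict_mono h" "(r \<circ> h) \<longlonglongrightarrow> \<rho>"
      using seq_compactE[OF compact_imp_seq_compact[OF compact_Icc[of s t]], of r] r(1) by blast
    have \<rho>0: "0 \<le> \<rho>" using \<rho> st by simp
    have dist0: "(\<lambda>k. \<bar>r (h k) - \<rho>\<bar>) \<longlonglongrightarrow> 0"
      using \<rho>(3) by (intro tendsto_rabs_zero LIM_zero) (simp add: o_def)
    have inv0: "(\<lambda>k. inverse (real (Suc (h k)))) \<longlonglongrightarrow> 0"
      using LIMSEQ_subseq_LIMSEQ[OF LIMSEQ_inverse_real_of_nat \<rho>(2)] by (simp add: o_def)
    have near: "inverse (real (Suc (h k + m1))) \<le> inverse (real (Suc (h k)))" for k by (intro le_imp_inverse_le) auto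
    have tm: "t \<le> real (h k + m1)" for k using tn0 by (simp add: m1_def)
    have "(\<lambda>k. 1) \<longlonglongrightarrow> q \<rho> i"
    proof (rule LIM_zero_cancel, rule Lim_null_comparison[where g="\<lambda>k. inverse (real (Suc (h k))) + (2 * lam + 1) * \<bar>r (h k) - \<rho>\<bar>"])
      show "\<forall>\<^sub>F k in sequentially. norm (1 - q \<rho> i) \<le> inverse (real (Suc (h k))) + (2 * lam + 1) * \<bar>r (h k) - \<rho>\<bar>"
      proof (rule always_eventually, rule allI)
        fix k
        have rk: "0 \<le> r (h k)" "r (h k) \<le> t" using r(1)[of "h k"] st by auto
        have "\<bar>Q (h k + m1) (r (h k)) i - q (r (h k)) i\<bar> \<le> inverse (real (Suc (h k + m1)))"
          by (rule qrate[OF rk(1)]) (use rk tm[of k] in auto)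
        moreover have "\<bar>q (r (h k)) i - q \<rho> i\<bar> \<le> (2 * lam + 1) * \<bar>r (h k) - \<rho>\<bar>"
          using qlip[of "r (h k)" \<rho> i] qlip[of \<rho> "r (h k)" i] rk \<rho>0 i by (cases "r (h k) \<le> \<rho>") (auto simp: abs_minus_commute)
        ultimately show "norm (1 - q \<rho> i) \<le> inverse (real (Suc (h k))) + (2 * lam + 1) * \<bar>r (h k) - \<rho>\<bar>"
          using near[of k] r(2)[of "h k"] unfolding real_norm_def by linarith
      qed
      show "(\<lambda>k. inverse (real (Suc (h k))) + (2 * lam + 1) * \<bar>r (h k) - \<rho>\<bar>) \<longlonglongrightarrow> 0"
        using tendsto_add[OF inv0 tendsto_mult_left[OF dist0, of "2 * lam + 1"]] by simp
    qed
    then have q1: "q \<rho> i = 1" by (simp add: LIMSEQ_const_iff)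
    have "(\<lambda>k. U i t) \<longlonglongrightarrow> U i \<rho>"
    proof (rule LIM_zero_cancel, rule Lim_null_comparison[where g="\<lambda>k. 2 * inverse (real (Suc (h k))) + lam * \<bar>r (h k) - \<rho>\<bar>"])
      show "\<forall>\<^sub>F k in sequentially. norm (U i t - U i \<rho>) \<le> 2 * inverse (real (Suc (h k))) + lam * \<bar>r (h k) - \<rho>\<bar>"
      proof (rule always_eventually, rule allI)
        fix k
        have rk: "0 \<le> r (h k)" "r (h k) \<le> t" using r(1)[of "h k"] st by auto
        have "\<bar>V (h k + m1) i (r (h k)) - U i (r (h k))\<bar> \<le> inverse (real (Suc (h k + m1)))"
          by (rule Urate[OF rk(1) i(2)]) (use rk tm[of k] in auto)
        moreover have "\<bar>V (h k + m1) i t - U i t\<bar> \<le> inverse (real (Suc (h k + m1)))"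
          by (rule Urate[OF t i(2) tm]) simp
        moreover have "\<bar>U i (r (h k)) - U i \<rho>\<bar> \<le> lam * \<bar>r (h k) - \<rho>\<bar>"
          using Ulip[of "r (h k)" \<rho> i] Ulip[of \<rho> "r (h k)" i] Umono[of "r (h k)" \<rho> i] Umono[of \<rho> "r (h k)" i] rk \<rho>0
          by (cases "r (h k) \<le> \<rho>") (auto simp: abs_minus_commute)
        ultimately show "norm (U i t - U i \<rho>) \<le> 2 * inverse (real (Suc (h k))) + lam * \<bar>r (h k) - \<rho>\<bar>"
          using near[of k] r(3)[of "h k"] unfolding real_norm_def by linarith
      qed
      show "(\<lambda>k. 2 * inverse (real (Suc (h k))) + lam * \<bar>r (h k) - \<rho>\<bar>) \<longlonglongrightarrow> 0"
        using tendsto_add[OF tendsto_mult_left[OF inv0, of 2] tendsto_mult_left[OF dist0, of lam]] by simp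
    qed
    then have "U i \<rho> = U i t" by (simp add: LIMSEQ_const_iff)
    with q1 \<rho>(1) show ?thesis by blast
  qed
  have "fluid_path b q U D lam"
  proof unfold_locales
    show "U i 0 = 0" for i
    proof (cases "enat i \<le> b")
      case True
      have "V m i 0 = 0" for m using sys_path.sp_0(1)[OF sp] by simp
      then show ?thesis using Ulim[OF order_refl True] by (simp add: LIMSEQ_const_iff)
    qed (simp add: U_beyond)
    show "D i 0 = 0" for i
    proof -
      have "drift q i 0 - drift q i 0 = (LBINT r:{0..0}. q r i - q r (i + 1))" by (rule qp.sp_drift_diff) auto
      then show ?thesis by (simp add: D_def drift_def)
    qed
    show "D i s \<le> D i t" if "1 \<le> i" "0 \<le> s" "s \<le> t" for i s t
      using qp.sp_drift_bounds(1)[OF that(2,3,1)] by (simp add: D_def)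
    show "D i t = drift q i t" for i t by (simp add: D_def)
    show "q t i = q 0 i + U (i - 1) t - U i t - D i t" if "0 \<le> t" "1 \<le> i" "enat i \<le> b" for t i
      using that by (rule eq)
    show "U i s \<le> U i t" "U (Suc i) t - U (Suc i) s \<le> U i t - U i s" if "0 \<le> s" "s \<le> t" for i s t
      using that by (rule Umono USuc)+
    show "\<exists>r\<in>{s..t}. q r i = 1 \<and> U i r = U i t" if "1 \<le> i" "enat i \<le> b" "0 \<le> s" "s \<le> t" "U i s < U i t" for i s t
      using that by (rule reflect)
    show "0 < lam" by (rule lam)
    show "U 0 t = lam * t" if "0 \<le> t" for t using that by (rule U0)
  qed
  moreover have "D = drift q" by (simp add: D_def fun_eq_iff)
  ultimately show ?thesis by simp
qed

text \<open>
  By \<open>stability\<close>, approximate solutions whose accuracy increases fast enough form a uniform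
  Cauchy sequence on every bounded interval.
\<close>

theorem fluid_path_exists:
  assumes qi: "qi \<in> occ_space b" and lam: "0 < lam"
    and ex: "\<And>T J d. 0 \<le> T \<Longrightarrow> 0 < d \<Longrightarrow> \<exists>q U D. sys_path b q U D \<and> near_fluid b lam T J d q U D \<and> l1_dist (q 0) qi \<le> d"
  shows "\<exists>q U D. fluid_path b q U D lam \<and> q 0 = qi \<and> (\<forall>t<0. q t = undefined)"
proof -
  define R where "R n J \<delta> \<longleftrightarrow> 0 < \<delta> \<and> (\<forall>q U D q' U' D'. sys_path b q U D \<longrightarrow> sys_path b q' U' D' \<longrightarrow>
     near_fluid b lam (real n) J \<delta> q U D \<longrightarrow> near_fluid b lam (real n) J \<delta> q' U' D' \<longrightarrow>
     l1_dist (q 0) qi \<le> \<delta> \<longrightarrow> l1_dist (q' 0) qi \<le> \<delta> \<longrightarrow>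
     (\<forall>t\<in>{0..real n}. l1_dist (q t) (q' t) \<le> inverse (real (Suc n)) \<and> (\<forall>i. enat i \<le> b \<longrightarrow> \<bar>U i t - U' i t\<bar> \<le> inverse (real (Suc n)))))" for n :: nat and J \<delta>
  have "\<forall>n. \<exists>p. R n (fst p) (snd p)"
  proof
    fix n
    have "\<exists>J \<delta>. R n J \<delta>" unfolding R_def by (rule stability[OF qi _ _ lam]) auto
    then show "\<exists>p. R n (fst p) (snd p)" by auto
  qed
  then obtain p where p: "\<And>n. R n (fst (p n)) (snd (p n))" by metis
  define J where "J n = fst (p n)" for n
  define \<delta> where "\<delta> n = snd (p n)" for n
  have R: "R n (J n) (\<delta> n)" for n using p by (simp add: J_def \<delta>_def)
  \<comment> \<open>The approximation with index \<open>n\<close> must be good enough for all accuracies up to \<open>n\<close>.\<close>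
  define Jm where "Jm n = Max (J ` {..n}) + n" for n
  define dm where "dm n = min (Min (\<delta> ` {..n})) (inverse (real (Suc n)))" for n
  have Jm: "J n \<le> Jm m" "n \<le> Jm m" if "n \<le> m" for n m
  proof -
    have "J n \<le> Max (J ` {..m})" by (rule Max_ge) (use that in auto)
    then show "J n \<le> Jm m" by (simp add: Jm_def)
    show "n \<le> Jm m" using that by (simp add: Jm_def)
  qed
  have dm: "dm m \<le> \<delta> n" "dm m \<le> inverse (real (Suc m))" if "n \<le> m" for n m
    using that by (auto simp: dm_def intro!: min.coboundedI1 Min_le)
  have dm0: "0 < dm n" for n using R by (auto simp: dm_def R_def)
  have "\<forall>n. \<exists>z. sys_path b (fst z) (fst (snd z)) (snd (snd z)) \<and> near_fluid b lam (real n) (Jm n) (dm n) (fst z) (fst (snd z)) (snd (snd z)) \<and> l1_dist (fst z 0) qi \<le> dm n"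
    using ex[OF of_nat_0_le_iff dm0] by fastforce
  then obtain z where z: "\<And>n. sys_path b (fst (z n)) (fst (snd (z n))) (snd (snd (z n))) \<and> near_fluid b lam (real n) (Jm n) (dm n) (fst (z n)) (fst (snd (z n))) (snd (snd (z n))) \<and> l1_dist (fst (z n) 0) qi \<le> dm n"
    by metis
  define Q where "Q n = fst (z n)" for n
  define V where "V n = fst (snd (z n))" for n
  define E where "E n = snd (snd (z n))" for n
  have sp: "sys_path b (Q n) (V n) (E n)" and nf: "near_fluid b lam (real n) (Jm n) (dm n) (Q n) (V n) (E n)"
    and l0: "l1_dist (Q n 0) qi \<le> dm n" for n
    using z[of n] by (auto simp: Q_def V_def E_def)
  have nf': "near_fluid b lam (real n) (J n) (\<delta> n) (Q m) (V m) (E m)" "l1_dist (Q m 0) qi \<le> \<delta> n" if "n \<le> m" for n m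
    using near_fluid_mono[OF nf[of m], of "real n" "J n" "\<delta> n"] Jm dm[of n m] that l0[of m] by auto
  have cl: "l1_dist (Q m t) (Q m' t) \<le> inverse (real (Suc n))" "enat i \<le> b \<Longrightarrow> \<bar>V m i t - V m' i t\<bar> \<le> inverse (real (Suc n))"
    if "n \<le> m" "n \<le> m'" "0 \<le> t" "t \<le> real n" for n m m' t i
    using R[of n] sp[of m] sp[of m'] nf'[OF that(1)] nf'[OF that(2)] that(3,4) unfolding R_def by auto
  have occ: "Q m t \<in> occ_space b" if "0 \<le> t" for m t
    using sys_path.axioms(1)[OF sp] that by (auto simp: occ_path_def)
  have clq: "\<bar>Q m t i - Q m' t i\<bar> \<le> inverse (real (Suc n))"
    if "n \<le> m" "n \<le> m'" "0 \<le> t" "t \<le> real n" for n m m' t i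
    using l1_dist_component[OF occ[OF that(3)] occ[OF that(3)], of m i m'] cl(1)[OF that] by linarith
  define q where "q t = (if 0 \<le> t then (\<lambda>i. lim (\<lambda>m. Q m t i)) else undefined)" for t :: real
  define U where "U i t = (if enat i \<le> b then lim (\<lambda>m. V m i t) else 0)" for i t
  have qlim: "(\<lambda>m. Q m t i) \<longlonglongrightarrow> q t i" and qrate: "\<And>n m. t \<le> real n \<Longrightarrow> n \<le> m \<Longrightarrow> \<bar>Q m t i - q t i\<bar> \<le> inverse (real (Suc n))"
    if t: "0 \<le> t" for t i
  proof -
    have c: "\<bar>Q m t i - Q m' t i\<bar> \<le> inverse (real (Suc n))" if "nat \<lceil>t\<rceil> \<le> n" "n \<le> m" "n \<le> m'" for n m m'
      by (rule clq[OF that(2,3) t]) (use that(1) in linarith)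
    show "(\<lambda>m. Q m t i) \<longlonglongrightarrow> q t i" using uniformly_Cauchy_limit(1)[of "nat \<lceil>t\<rceil>" "\<lambda>m. Q m t i", OF c] t by (simp add: q_def)
    show "\<bar>Q m t i - q t i\<bar> \<le> inverse (real (Suc n))" if "t \<le> real n" "n \<le> m" for n m
      using uniformly_Cauchy_limit(2)[of "nat \<lceil>t\<rceil>" "\<lambda>m. Q m t i", OF c, of n m] t that by (simp add: q_def)
  qed
  have Ulim: "(\<lambda>m. V m i t) \<longlonglongrightarrow> U i t" and Urate: "\<And>n m. t \<le> real n \<Longrightarrow> n \<le> m \<Longrightarrow> \<bar>V m i t - U i t\<bar> \<le> inverse (real (Suc n))"
    if t: "0 \<le> t" and i: "enat i \<le> b" for t i
  proof -
    have c: "\<bar>V m i t - V m' i t\<bar> \<le> inverse (real (Suc n))" if "nat \<lceil>t\<rceil> \<le> n" "n \<le> m" "n \<le> m'" for n m m'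
      by (rule cl(2)[OF that(2,3) t _ i]) (use that(1) in linarith)
    show "(\<lambda>m. V m i t) \<longlonglongrightarrow> U i t" using uniformly_Cauchy_limit(1)[of "nat \<lceil>t\<rceil>" "\<lambda>m. V m i t", OF c] i by (simp add: U_def)
    show "\<bar>V m i t - U i t\<bar> \<le> inverse (real (Suc n))" if "t \<le> real n" "n \<le> m" for n m
      using uniformly_Cauchy_limit(2)[of "nat \<lceil>t\<rceil>" "\<lambda>m. V m i t", OF c, of n m] i that by (simp add: U_def)
  qed
  have q_occ: "q t \<in> occ_space b" if t: "0 \<le> t" for t
  proof -
    have le: "q t i \<le> c" if "\<And>m. Q m t i \<le> c" for i c
      by (rule LIMSEQ_le_const2[OF qlim[OF t]]) (use that in auto)
    have ge: "c \<le> q t i" if "\<And>m. c \<le> Q m t i" for i c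
      by (rule LIMSEQ_le_const[OF qlim[OF t]]) (use that in auto)
    have b01: "0 \<le> q t i" "q t i \<le> 1" for i using occ_space_bounds(1,2)[OF occ[OF t]] by (auto intro: le ge)
    have dec: "q t i \<le> q t (i - 1)" if "2 \<le> i" for i
    proof (rule LIMSEQ_le[OF qlim[OF t] qlim[OF t]])
      have "Q m t i \<le> Q m t (i - 1)" for m
        using occ_space_bounds(5)[OF occ[OF t, of m], of "i - 1"] that by simp
      then show "\<exists>N. \<forall>m\<ge>N. Q m t i \<le> Q m t (i - 1)" by blast
    qed
    have zero: "q t i = 0" if "\<not> (1 \<le> i \<and> enat i \<le> b)" for i
    proof -
      have "Q m t i = 0" for m using occ[OF t, of m] that by (auto simp: occ_space_def)
      then show ?thesis using qlim[OF t, of i] by (simp add: LIMSEQ_const_iff)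
    qed
    have "summable (q t)"
    proof (rule bounded_imp_summable[where B="(\<Sum>i. Q (nat \<lceil>t\<rceil>) t i) + 1"])
      fix k
      show "0 \<le> q t k" by (rule b01)
      have "(\<Sum>i\<le>k. Q m t i) \<le> (\<Sum>i. Q (nat \<lceil>t\<rceil>) t i) + 1" if m: "nat \<lceil>t\<rceil> \<le> m" for m
      proof -
        let ?n = "nat \<lceil>t\<rceil>"
        have tn: "t \<le> real ?n" by linarith
        have "(\<Sum>i\<le>k. Q m t i) \<le> (\<Sum>i\<le>k. Q ?n t i + \<bar>Q m t i - Q ?n t i\<bar>)" by (rule sum_mono) linarith
        also have "\<dots> \<le> (\<Sum>i. Q ?n t i) + l1_dist (Q m t) (Q ?n t)"
          unfolding sum.distrib l1_dist_def
          using occ_space_bounds(1,4)[OF occ[OF t]] by (intro add_mono sum_le_suminf l1_summable[OF occ[OF t] occ[OF t]]) auto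
        also have "l1_dist (Q m t) (Q ?n t) \<le> inverse (real (Suc ?n))" by (rule cl(1)[OF m order_refl t tn])
        also have "inverse (real (Suc ?n)) \<le> 1" by (simp add: inverse_le_1_iff)
        finally show ?thesis by simp
      qed
      then show "(\<Sum>i\<le>k. q t i) \<le> (\<Sum>i. Q (nat \<lceil>t\<rceil>) t i) + 1"
        by (intro LIMSEQ_le_const2[OF tendsto_sum[OF qlim[OF t]]]) blast
    qed
    then show ?thesis using b01 dec zero by (auto simp: occ_space_def)
  qed
  have q_meas: "set_borel_measurable borel {0..} (\<lambda>t. q t i)" for i
    unfolding set_borel_measurable_def
  proof (rule borel_measurable_LIMSEQ_real)
    show "(\<lambda>t. indicator {0..} t *\<^sub>R Q m t i) \<in> borel_measurable borel" for m
      using sys_path.axioms(1)[OF sp, of m] by (auto simp: occ_path_def set_borel_measurable_def)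
    show "(\<lambda>m. indicator {0..} t *\<^sub>R Q m t i) \<longlonglongrightarrow> indicator {0..} t *\<^sub>R q t i" for t
      using qlim[of t i] by (cases "0 \<le> t") auto
  qed
  interpret qp: occ_path b q by unfold_locales (use q_occ q_meas in auto)
  have "fluid_path b q U (drift q) lam"
  proof (rule fluid_path_limit[OF lam sp _ qp.occ_path_axioms])
    show "near_fluid b lam (real m) m (inverse (real (Suc m))) (Q m) (V m) (E m)" for m
      by (rule near_fluid_mono[OF nf order_refl Jm(2)[OF order_refl] dm(2)[OF order_refl]])
  qed (use qrate Urate in \<open>auto simp: U_def\<close>)
  moreover have "q 0 = qi"
  proof
    fix i
    have "(\<lambda>m. Q m 0 i) \<longlonglongrightarrow> qi i"
    proof (rule LIM_zero_cancel, rule Lim_null_comparison[OF always_eventually LIMSEQ_inverse_real_of_nat], rule allI)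
      fix m
      have "\<bar>Q m 0 i - qi i\<bar> \<le> dm m" using l1_dist_component[OF occ[OF order_refl] qi, of m i] l0[of m] by linarith
      also have "\<dots> \<le> inverse (real (Suc m))" by (rule dm(2)[OF order_refl])
      finally show "norm (Q m 0 i - qi i) \<le> inverse (real (Suc m))" by simp
    qed
    then show "q 0 i = qi i" using qlim[OF order_refl] LIMSEQ_unique by blast
  qed
  moreover have "\<forall>t<0. q t = undefined" by (simp add: q_def)
  ultimately show ?thesis by blast
qed

section \<open>Races between exponential clocks\<close>

text \<open>
  A clock \<open>c\<close> has infinitely many waiting times \<open>(c, 0), (c, 1), \<dots>\<close>, all with rate \<open>mu c\<close>.
\<close>

definition exp_law :: "(nat \<Rightarrow> real) \<Rightarrow> nat \<times> nat \<Rightarrow> real measure" where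
  "exp_law mu k = density lborel (exponential_density (mu (fst k)))"

locale clocks =
  fixes C :: "nat set" and mu :: "nat \<Rightarrow> real"
  assumes finite_C: "finite C" and mu_pos: "\<And>c. 0 < mu c"
begin

definition K :: "(nat \<times> nat) set" where "K = C \<times> UNIV"
definition P :: "(nat \<times> nat \<Rightarrow> real) measure" where "P = PiM K (exp_law mu)"

lemma sets_exp_law [simp, measurable_cong]: "sets (exp_law mu k) = sets borel"
  by (simp add: exp_law_def)
lemma space_exp_law [simp]: "space (exp_law mu k) = UNIV"
  by (simp add: exp_law_def)

lemma prob_exp_law: "prob_space (exp_law mu k)"
  unfolding exp_law_def by (rule prob_space_exponential_density) (rule mu_pos)

lemma prob_space_P: "prob_space P"
  unfolding P_def by (rule prob_space_PiM) (rule prob_exp_law)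

lemma component_measurable [measurable]: "k \<in> K \<Longrightarrow> (\<lambda>x. x k) \<in> borel_measurable P"
  unfolding P_def using measurable_component_singleton[of k K "exp_law mu"]
  by (simp cong: measurable_cong_sets)

lemma countable_K: "countable K"
  unfolding K_def using finite_C by (simp add: countable_finite)

text \<open>The memoryless property.\<close>

lemma emeasure_exp_tail:
  assumes "0 \<le> v" and E: "E \<in> sets borel"
  shows "emeasure (exp_law mu k) {x. v < x \<and> x - v \<in> E} =
         ennreal (exp (- mu (fst k) * v)) * emeasure (exp_law mu k) E"
proof -
  let ?l = "mu (fst k)"
  have [measurable]: "E \<in> sets borel" by fact
  have "emeasure (exp_law mu k) {x. v < x \<and> x - v \<in> E} =
    (\<integral>\<^sup>+x. ennreal (exponential_density ?l x) * indicator {x. v < x \<and> x - v \<in> E} x \<partial>lborel)"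
    unfolding exp_law_def by (subst emeasure_density) auto
  also have "\<dots> = (\<integral>\<^sup>+x. ennreal (exponential_density ?l (v + 1 * x)) * indicator {x. v < x \<and> x - v \<in> E} (v + 1 * x) \<partial>lborel)"
    by (subst nn_integral_real_affine[where c=1 and t=v]) auto
  also have "\<dots> = (\<integral>\<^sup>+x. ennreal (exp (- ?l * v)) * (ennreal (exponential_density ?l x) * indicator E x) \<partial>lborel)"
  proof (rule nn_integral_cong_AE)
    have "AE x in lborel. (x::real) \<noteq> 0" by (rule AE_lborel_singleton)
    then show "AE x in lborel. ennreal (exponential_density ?l (v + 1 * x)) * indicator {x. v < x \<and> x - v \<in> E} (v + 1 * x)
       = ennreal (exp (- ?l * v)) * (ennreal (exponential_density ?l x) * indicator E x)"
    proof eventually_elim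
      case (elim x)
      show ?case
      proof (cases "0 < x")
        case True
        then have "exponential_density ?l (v + x) = exp (- ?l * v) * exponential_density ?l x"
          using assms(1) by (simp add: exponential_density_def exp_add[symmetric] algebra_simps)
        then show ?thesis using True by (simp add: indicator_def ennreal_mult')
      next
        case False
        then have "x < 0" using elim by simp
        then show ?thesis by (simp add: indicator_def exponential_density_def)
      qed
    qed
  qed
  also have "\<dots> = ennreal (exp (- ?l * v)) * emeasure (exp_law mu k) E"
    unfolding exp_law_def by (subst nn_integral_cmult) (auto simp: emeasure_density)
  finally show ?thesis .
qed

lemma emeasure_split:
  assumes "a \<in> K" "W \<in> sets P"
  shows "emeasure P W = (\<integral>\<^sup>+v. emeasure (PiM (K - {a}) (exp_law mu))
           {X \<in> space (PiM (K - {a}) (exp_law mu)). X(a := v) \<in> W} \<partial>exp_law mu a)"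
proof -
  let ?Q = "PiM (K - {a}) (exp_law mu)"
  interpret Q: prob_space ?Q by (rule prob_space_PiM) (rule prob_exp_law)
  have ins: "insert a (K - {a}) = K" using assms by auto
  have eq: "distr (exp_law mu a \<Otimes>\<^sub>M ?Q) P (\<lambda>(x, X). X(a := x)) = P"
    using distr_pair_PiM_eq_PiM[of "K - {a}" "exp_law mu" a] prob_exp_law
    unfolding ins P_def by simp
  have m: "(\<lambda>(x, X). X(a := x)) \<in> exp_law mu a \<Otimes>\<^sub>M ?Q \<rightarrow>\<^sub>M P"
    unfolding P_def using measurable_fun_upd[of K "K - {a}" a snd "exp_law mu a \<Otimes>\<^sub>M ?Q" "exp_law mu" fst]
    by (simp add: case_prod_beta assms(1) insert_absorb)
  have "emeasure P W = emeasure (exp_law mu a \<Otimes>\<^sub>M ?Q)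
     ((\<lambda>(x, X). X(a := x)) -` W \<inter> space (exp_law mu a \<Otimes>\<^sub>M ?Q))"
    by (subst eq[symmetric]) (rule emeasure_distr[OF m assms(2)])
  also have "\<dots> = (\<integral>\<^sup>+v. emeasure ?Q (Pair v -` ((\<lambda>(x, X). X(a := x)) -` W \<inter> space (exp_law mu a \<Otimes>\<^sub>M ?Q))) \<partial>exp_law mu a)"
    by (rule Q.emeasure_pair_measure_alt) (rule measurable_sets[OF m assms(2)])
  also have "\<dots> = (\<integral>\<^sup>+v. emeasure ?Q {X \<in> space ?Q. X(a := v) \<in> W} \<partial>exp_law mu a)"
    by (intro nn_integral_cong arg_cong2[where f=emeasure] refl) (auto simp: space_pair_measure)
  finally show ?thesis .
qed

text \<open>
  Fubini with respect to coordinate \<open>a\<close>: for a fixed value of it, the constraints on the other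
  coordinates are a rectangle.
\<close>

lemma emeasure_rectangle:
  assumes a: "a \<in> K" and J: "finite J" "J \<subseteq> K - {a}"
    and H: "\<And>k v. k \<in> J \<Longrightarrow> H k v \<in> sets borel"
    and W: "{x \<in> space P. x a \<in> B \<and> (\<forall>k\<in>J. x k \<in> H k (x a))} \<in> sets P"
  shows "emeasure P {x \<in> space P. x a \<in> B \<and> (\<forall>k\<in>J. x k \<in> H k (x a))} =
    (\<integral>\<^sup>+v. indicator B v * (\<Prod>k\<in>J. emeasure (exp_law mu k) (H k v)) \<partial>exp_law mu a)"
proof -
  let ?Q = "PiM (K - {a}) (exp_law mu)"
  have "emeasure ?Q {X \<in> space ?Q. X(a := v) \<in> {x \<in> space P. x a \<in> B \<and> (\<forall>k\<in>J. x k \<in> H k (x a))}} =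
     indicator B v * (\<Prod>k\<in>J. emeasure (exp_law mu k) (H k v))" for v
  proof (cases "v \<in> B")
    case True
    have "{X \<in> space ?Q. X(a := v) \<in> {x \<in> space P. x a \<in> B \<and> (\<forall>k\<in>J. x k \<in> H k (x a))}} =
       prod_emb (K - {a}) (exp_law mu) J (PiE J (\<lambda>k. H k v))"
    proof (intro set_eqI iffI)
      fix X assume "X \<in> {X \<in> space ?Q. X(a := v) \<in> {x \<in> space P. x a \<in> B \<and> (\<forall>k\<in>J. x k \<in> H k (x a))}}"
      then have "X \<in> space ?Q" and "\<And>k. k \<in> J \<Longrightarrow> (X(a := v)) k \<in> H k v" by auto
      then have "X \<in> space ?Q" "\<And>k. k \<in> J \<Longrightarrow> X k \<in> H k v"
        using J by (simp, metis (no_types, lifting) Diff_iff fun_upd_other insertI1 subsetD)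
      then show "X \<in> prod_emb (K - {a}) (exp_law mu) J (PiE J (\<lambda>k. H k v))"
        using J by (auto simp: prod_emb_def space_PiM)
    next
      fix X assume X: "X \<in> prod_emb (K - {a}) (exp_law mu) J (PiE J (\<lambda>k. H k v))"
      then have 1: "X \<in> space ?Q" and 2: "\<And>k. k \<in> J \<Longrightarrow> X k \<in> H k v"
        by (auto simp: prod_emb_def space_PiM)
      have "X(a := v) \<in> space P"
        using 1 a by (auto simp: P_def space_PiM PiE_iff extensional_def)
      then show "X \<in> {X \<in> space ?Q. X(a := v) \<in> {x \<in> space P. x a \<in> B \<and> (\<forall>k\<in>J. x k \<in> H k (x a))}}"
        using 1 2 True J by auto
    qed
    moreover have "emeasure ?Q (prod_emb (K - {a}) (exp_law mu) J (PiE J (\<lambda>k. H k v))) =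
      (\<Prod>k\<in>J. emeasure (exp_law mu k) (H k v))"
      using J H prob_exp_law by (subst emeasure_PiM_emb) simp_all
    ultimately show ?thesis using True by simp
  qed simp
  then show ?thesis
    by (subst emeasure_split[OF a W]) simp
qed

definition winner :: "nat set \<Rightarrow> (nat \<times> nat \<Rightarrow> real) \<Rightarrow> nat" where
  "winner A x = (LEAST c. c \<in> A \<and> (\<forall>c'\<in>A. x (c, 0) \<le> x (c', 0)))"

definition delay :: "nat set \<Rightarrow> (nat \<times> nat \<Rightarrow> real) \<Rightarrow> real" where
  "delay A x = x (winner A x, 0)"

text \<open>
  The waiting times as seen when the race is over: the winner takes its next waiting time, the
  other participants of the race have waited already, and the clocks outside \<open>A\<close> have not moved.
\<close>

definition advance :: "nat set \<Rightarrow> (nat \<times> nat \<Rightarrow> real) \<Rightarrow> nat \<times> nat \<Rightarrow> real" where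
  "advance A x = (\<lambda>k\<in>K. if fst k = winner A x then x (fst k, Suc (snd k))
      else if fst k \<in> A \<and> snd k = 0 then x k - delay A x else x k)"

definition wins :: "nat set \<Rightarrow> nat \<Rightarrow> (nat \<times> nat \<Rightarrow> real) \<Rightarrow> bool" where
  "wins A c x \<longleftrightarrow> c \<in> A \<and> (\<forall>c'\<in>A - {c}. x (c, 0) < x (c', 0))"

lemma winner_eq: "wins A c x \<Longrightarrow> winner A x = c"
  unfolding winner_def wins_def
  apply (rule Least_equality)
   apply (metis DiffI order.refl order_less_imp_le singletonD)
  by (metis DiffI not_le order.refl singletonD)

text \<open>Exactly one clock of each race wins, and after a positive time.\<close>

definition good :: "(nat \<times> nat \<Rightarrow> real) \<Rightarrow> bool" where
  "good x \<longleftrightarrow> (\<forall>k\<in>K. 0 < x k) \<and> (\<forall>c\<in>C. \<forall>c'\<in>C. c \<noteq> c' \<longrightarrow> x (c, 0) \<noteq> x (c', 0))"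

lemma winner_min:
  assumes "finite A" "A \<noteq> {}"
  shows "winner A x \<in> A" and "\<And>c'. c' \<in> A \<Longrightarrow> x (winner A x, 0) \<le> x (c', 0)"
proof -
  have "Min ((\<lambda>c. x (c, 0)) ` A) \<in> (\<lambda>c. x (c, 0)) ` A" using assms by (intro Min_in) auto
  then obtain c where "c \<in> A" "x (c, 0) = Min ((\<lambda>c. x (c, 0)) ` A)" by auto
  then have "c \<in> A \<and> (\<forall>c'\<in>A. x (c, 0) \<le> x (c', 0))" using assms by auto
  then have "winner A x \<in> A \<and> (\<forall>c'\<in>A. x (winner A x, 0) \<le> x (c', 0))"
    unfolding winner_def by (rule LeastI)
  then show "winner A x \<in> A" and "\<And>c'. c' \<in> A \<Longrightarrow> x (winner A x, 0) \<le> x (c', 0)" by auto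
qed

lemma good_wins:
  assumes "good x" "A \<subseteq> C" "A \<noteq> {}"
  shows "wins A (winner A x) x" and "winner A x \<in> A"
proof -
  have fin: "finite A" using assms finite_C finite_subset by blast
  note w = winner_min[OF fin assms(3), where x=x]
  show "winner A x \<in> A" by (rule w)
  show "wins A (winner A x) x"
    unfolding wins_def
  proof (intro conjI ballI w)
    fix c' assume c': "c' \<in> A - {winner A x}"
    then have "x (winner A x, 0) \<noteq> x (c', 0)"
      using assms(1,2) w(1) unfolding good_def by (metis DiffD1 DiffD2 insertI1 subsetD)
    then show "x (winner A x, 0) < x (c', 0)" using w(2)[of c'] c' by simp
  qed
qed

lemma AE_exp_law_pos: "AE v in exp_law mu k. 0 < v"
proof -
  have "AE v in lborel. (v::real) \<noteq> 0" by (rule AE_lborel_singleton)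
  then show ?thesis
    unfolding exp_law_def
    by (subst AE_density) (auto simp: exponential_density_def)
qed

lemma AE_exp_law_neq: "AE v in exp_law mu k. v \<noteq> a"
proof -
  have "AE v in lborel. (v::real) \<noteq> a" by (rule AE_lborel_singleton)
  then show ?thesis
    unfolding exp_law_def
    by (subst AE_density) auto
qed

lemma AE_good: "AE x in P. good x"
proof -
  have "AE x in P. \<forall>k\<in>K. 0 < x k"
    unfolding P_def AE_ball_countable[OF countable_K]
    by (intro ballI AE_PiM_component prob_exp_law AE_exp_law_pos)
  moreover have "AE x in P. x (c, 0) \<noteq> x (c', 0)" if "c \<in> C" "c' \<in> C" "c \<noteq> c'" for c c'
  proof -
    have K: "(c, 0) \<in> K" "(c', 0) \<in> K" using that by (auto simp: K_def)
    let ?W = "{x \<in> space P. x (c, 0) \<in> UNIV \<and> (\<forall>k\<in>{(c', 0)}. x k \<in> {x (c, 0)})}"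
    have "?W \<in> sets P"
      using K by simp measurable
    moreover have z: "emeasure (exp_law mu k) {v} = 0" for k :: "nat \<times> nat" and v :: real
      using AE_exp_law_neq[where k=k and a=v] AE_iff_measurable[of "{v}" "exp_law mu k" "\<lambda>x. x \<noteq> v"] by auto
    have "emeasure P ?W = 0"
      by (subst emeasure_rectangle) (use that K \<open>?W \<in> sets P\<close> z in auto)
    ultimately show ?thesis
      by (intro AE_I'[of ?W]) auto
  qed
  then have "AE x in P. \<forall>c\<in>C. \<forall>c'\<in>C. c \<noteq> c' \<longrightarrow> x (c, 0) \<noteq> x (c', 0)"
    by (subst AE_ball_countable, use finite_C in \<open>simp add: countable_finite\<close>)+ auto
  ultimately show ?thesis
    unfolding good_def by eventually_elim auto
qed

lemma winner_measurable [measurable]: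
  assumes "A \<subseteq> C"
  shows "winner A \<in> P \<rightarrow>\<^sub>M count_space UNIV"
proof -
  have [simp]: "finite A" using assms finite_C finite_subset by blast
  have [measurable]: "c \<in> A \<Longrightarrow> (\<lambda>x. x (c, 0)) \<in> borel_measurable P" for c
    using assms by (intro component_measurable) (auto simp: K_def)
  have "Measurable.pred P (\<lambda>x. c \<in> A \<and> (\<forall>c'\<in>A. x (c, 0) \<le> x (c', 0)))" for c
  proof (cases "c \<in> A")
    case True
    have "Measurable.pred P (\<lambda>x. \<forall>c'\<in>A. x (c, 0) \<le> x (c', 0))"
      using \<open>finite A\<close> True by (intro pred_intros_finite(3)) (auto simp: pred_def)
    then show ?thesis using True by simp
  qed simp
  then show ?thesis
    unfolding winner_def by (rule measurable_Least)
qed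

lemma delay_measurable [measurable]:
  assumes "A \<subseteq> C" "A \<noteq> {}"
  shows "delay A \<in> borel_measurable P"
proof -
  have fin: "finite A" using assms finite_C finite_subset by blast
  have inC: "winner A x \<in> C" for x using winner_min(1)[OF fin assms(2)] assms(1) by blast
  have "(\<lambda>x. (\<lambda>x. x (winner A x, 0)) x) \<in> borel_measurable P"
  proof (rule measurable_compose_countable'[where I=C and f="\<lambda>c x. x (c, 0)" and g="winner A"])
    show "winner A \<in> P \<rightarrow>\<^sub>M count_space C"
      using winner_measurable[OF assms(1)] inC by (auto simp: measurable_count_space_eq2_countable finite_C countable_finite)
  qed (use finite_C in \<open>auto simp: K_def countable_finite intro!: component_measurable\<close>)
  then show ?thesis by (simp add: delay_def[abs_def])
qed

lemma advance_measurable [measurable]: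
  assumes "A \<subseteq> C" "A \<noteq> {}"
  shows "advance A \<in> P \<rightarrow>\<^sub>M P"
proof -
  note [measurable] = winner_measurable[OF assms(1)] delay_measurable[OF assms]
  have "(\<lambda>x. if fst k = winner A x then x (fst k, Suc (snd k))
      else if fst k \<in> A \<and> snd k = 0 then x k - delay A x else x k) \<in> P \<rightarrow>\<^sub>M exp_law mu k" if "k \<in> K" for k
  proof -
    have [measurable]: "(\<lambda>x. x (fst k, Suc (snd k))) \<in> borel_measurable P" "(\<lambda>x. x k) \<in> borel_measurable P"
      using that by (auto simp: K_def intro!: component_measurable)
    show ?thesis by measurable
  qed
  then have "(\<lambda>x. \<lambda>k\<in>K. if fst k = winner A x then x (fst k, Suc (snd k))
      else if fst k \<in> A \<and> snd k = 0 then x k - delay A x else x k) \<in> P \<rightarrow>\<^sub>M PiM K (exp_law mu)"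
    by (rule measurable_restrict)
  then show ?thesis
    unfolding P_def[symmetric] advance_def .
qed

definition total_rate :: "nat set \<Rightarrow> real" where "total_rate A = (\<Sum>c\<in>A. mu c)"

lemma prod_exp_clocks: "finite A \<Longrightarrow> (\<Prod>c\<in>A. ennreal (exp (- mu c * v))) = ennreal (exp (- total_rate A * v))"
  by (simp add: prod_ennreal total_rate_def exp_sum[symmetric] sum_distrib_right sum_negf)

text \<open>
  The event that \<open>c\<close> wins after a time in \<open>B\<close> and the new waiting times lie in a rectangle \<open>E\<close>
  is, for a fixed value \<open>v\<close> of the winning time, again a rectangle in the old waiting times,
  with residual times \<open>x k - v\<close> for the losers. The memoryless property splits off the factor
  \<open>exp (- mu c' v)\<close> for each loser \<open>c'\<close>, and what remains does not depend on \<open>v\<close>.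
\<close>

lemma emeasure_wins_advance:
  assumes A: "A \<subseteq> C" and c: "c \<in> A" and J: "finite J" "J \<subseteq> K"
    and B [measurable]: "B \<in> sets borel" and E: "\<And>k. k \<in> J \<Longrightarrow> E k \<in> sets borel"
  shows "emeasure P {x \<in> space P. wins A c x \<and> x (c, 0) \<in> B \<and> (\<forall>k\<in>J. advance A x k \<in> E k)} =
    (\<integral>\<^sup>+v. indicator B v * ennreal (exp (- total_rate (A - {c}) * v)) \<partial>exp_law mu (c, 0)) * (\<Prod>k\<in>J. emeasure (exp_law mu k) (E k))"
proof -
  have fin: "finite A" using A finite_C finite_subset by blast
  define E' where "E' k = (if k \<in> J then E k else UNIV)" for k
  define J1 where "J1 = J \<union> (A - {c}) \<times> {0}"
  \<comment> \<open>Position \<open>k\<close> after the race comes from position \<open>\<rho> k\<close> before it. The losers are added to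
    the constrained positions, since winning constrains them as well.\<close>
  define \<rho> :: "nat \<times> nat \<Rightarrow> nat \<times> nat" where "\<rho> k = (if fst k = c then (fst k, Suc (snd k)) else k)" for k
  define \<kappa> :: "nat \<times> nat \<Rightarrow> nat \<times> nat" where "\<kappa> k = (if fst k = c then (c, snd k - 1) else k)" for k
  define H where "H k v = (if fst k \<in> A - {c} \<and> snd k = 0 then {x. v < x \<and> x - v \<in> E' (\<kappa> k)} else E' (\<kappa> k))" for k and v :: real
  have \<kappa>\<rho>: "\<kappa> (\<rho> k) = k" for k by (cases k) (auto simp: \<kappa>_def \<rho>_def)
  have inj: "inj_on \<rho> J1" by (rule inj_on_inverseI) (rule \<kappa>\<rho>)
  have E'm: "E' k \<in> sets borel" for k using E by (auto simp: E'_def)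
  have J1: "finite J1" "J1 \<subseteq> K" using J A fin by (auto simp: J1_def K_def)
  have aK: "(c, 0) \<in> K" using A c by (auto simp: K_def)
  have \<rho>J: "finite (\<rho> ` J1)" "\<rho> ` J1 \<subseteq> K - {(c, 0)}"
    using J1 by (auto simp: \<rho>_def K_def split: if_splits)
  have Hm: "H k v \<in> sets borel" for k v
  proof -
    have [measurable]: "E' (\<kappa> k) \<in> sets borel" by (rule E'm)
    show ?thesis unfolding H_def by simp
  qed
  let ?W = "{x \<in> space P. wins A c x \<and> x (c, 0) \<in> B \<and> (\<forall>k\<in>J. advance A x k \<in> E k)}"
  let ?W' = "{x \<in> space P. x (c, 0) \<in> B \<and> (\<forall>k\<in>\<rho> ` J1. x k \<in> H k (x (c, 0)))}"
  have adv: "advance A x k \<in> E' k \<longleftrightarrow> x (\<rho> k) \<in> H (\<rho> k) (x (c, 0))" if x: "wins A c x" and k: "k \<in> J1" for x k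
  proof -
    have kK: "k \<in> K" using k J1 by auto
    have w: "winner A x = c" using x by (rule winner_eq)
    have "fst k = c \<or> (fst k \<in> A \<and> snd k = 0 \<and> fst k \<noteq> c) \<or> (fst k \<noteq> c \<and> \<not> (fst k \<in> A \<and> snd k = 0))" by metis
    then consider "fst k = c" | "fst k \<in> A" "snd k = 0" "fst k \<noteq> c" | "fst k \<noteq> c" "\<not> (fst k \<in> A \<and> snd k = 0)" by (elim disjE conjE) metis+
    then show ?thesis
    proof cases
      case 1
      then show ?thesis using kK w \<kappa>\<rho>[of k] by (simp add: advance_def H_def \<rho>_def)
    next
      case 2
      then have "x (c, 0) < x k" using x by (cases k) (auto simp: wins_def)
      then show ?thesis using 2 kK w \<kappa>\<rho>[of k] by (simp add: advance_def H_def \<rho>_def delay_def)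
    next
      case 3
      then show ?thesis using kK w \<kappa>\<rho>[of k] by (auto simp: advance_def H_def \<rho>_def)
    qed
  qed
  have WW: "?W = ?W'"
  proof (rule Collect_cong, rule conj_cong, rule refl, rule iffI)
    fix x assume x: "wins A c x \<and> x (c, 0) \<in> B \<and> (\<forall>k\<in>J. advance A x k \<in> E k)"
    then have "\<forall>k\<in>J1. advance A x k \<in> E' k" by (auto simp: E'_def)
    then show "x (c, 0) \<in> B \<and> (\<forall>k\<in>\<rho> ` J1. x k \<in> H k (x (c, 0)))" using adv x by auto
  next
    fix x assume x: "x (c, 0) \<in> B \<and> (\<forall>k\<in>\<rho> ` J1. x k \<in> H k (x (c, 0)))"
    have w: "wins A c x"
      unfolding wins_def
    proof (intro conjI ballI c)
      fix c' assume c': "c' \<in> A - {c}"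
      then have "(c', 0) \<in> J1" "\<rho> (c', 0) = (c', 0)" by (auto simp: J1_def \<rho>_def)
      then have "x (c', 0) \<in> H (c', 0) (x (c, 0))" using x by (metis image_eqI)
      then show "x (c, 0) < x (c', 0)" using c' by (auto simp: H_def)
    qed
    have "advance A x k \<in> E k" if "k \<in> J" for k
      using adv[OF w, of k] x that by (auto simp: J1_def E'_def)
    then show "wins A c x \<and> x (c, 0) \<in> B \<and> (\<forall>k\<in>J. advance A x k \<in> E k)" using w x by auto
  qed
  have Wm: "?W' \<in> sets P"
  proof -
    have [measurable]: "(\<lambda>x. x (c, 0)) \<in> borel_measurable P" using aK by measurable
    have "{x \<in> space P. x k \<in> H k (x (c, 0))} \<in> sets P" if "k \<in> K" for k
    proof -
      have [measurable]: "(\<lambda>x. x k) \<in> borel_measurable P" using that by measurable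
      have [measurable]: "E' (\<kappa> k) \<in> sets borel" by (rule E'm)
      have "{x \<in> space P. x (c, 0) < x k \<and> x k - x (c, 0) \<in> E' (\<kappa> k)} \<in> sets P" by measurable
      moreover have "{x \<in> space P. x k \<in> E' (\<kappa> k)} \<in> sets P" by measurable
      moreover have "H k = (\<lambda>v. {x. v < x \<and> x - v \<in> E' (\<kappa> k)}) \<or> H k = (\<lambda>v. E' (\<kappa> k))"
        by (cases "fst k \<in> A - {c} \<and> snd k = 0") (auto simp: H_def fun_eq_iff)
      ultimately show ?thesis by auto
    qed
    then have "{x \<in> space P. \<forall>k\<in>\<rho> ` J1. x k \<in> H k (x (c, 0))} \<in> sets P"
      using \<rho>J by (intro sets.sets_Collect_finite_All) auto
    moreover have "{x \<in> space P. x (c, 0) \<in> B} \<in> sets P" by simp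
    ultimately have "{x \<in> space P. x (c, 0) \<in> B} \<inter> {x \<in> space P. \<forall>k\<in>\<rho> ` J1. x k \<in> H k (x (c, 0))} \<in> sets P" by (rule sets.Int[rotated])
    then show ?thesis by (rule back_subst[where P="\<lambda>A. A \<in> sets P"]) auto
  qed
  have pr: "(\<Prod>k\<in>\<rho> ` J1. emeasure (exp_law mu k) (H k v)) =
     ennreal (exp (- total_rate (A - {c}) * v)) * (\<Prod>k\<in>J. emeasure (exp_law mu k) (E k))" if v: "0 < v" for v
  proof -
    have "(\<Prod>k\<in>\<rho> ` J1. emeasure (exp_law mu k) (H k v)) = (\<Prod>k\<in>J1. emeasure (exp_law mu (\<rho> k)) (H (\<rho> k) v))"
      by (rule prod.reindex[OF inj, unfolded o_def])
    also have "\<dots> = (\<Prod>k\<in>J1. (if fst k \<in> A - {c} \<and> snd k = 0 then ennreal (exp (- mu (fst k) * v)) else 1) * emeasure (exp_law mu k) (E' k))"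
    proof (rule prod.cong[OF refl])
      fix k assume "k \<in> J1"
      have e: "exp_law mu (\<rho> k) = exp_law mu k" by (simp add: exp_law_def \<rho>_def)
      show "emeasure (exp_law mu (\<rho> k)) (H (\<rho> k) v) = (if fst k \<in> A - {c} \<and> snd k = 0 then ennreal (exp (- mu (fst k) * v)) else 1) * emeasure (exp_law mu k) (E' k)"
      proof (cases "fst k \<in> A - {c} \<and> snd k = 0")
        case True
        then have "\<rho> k = k" by (simp add: \<rho>_def)
        then have "H (\<rho> k) v = {x. v < x \<and> x - v \<in> E' k}" using True \<kappa>\<rho>[of k] by (simp add: H_def)
        then show ?thesis unfolding e using True emeasure_exp_tail[of v "E' k" k] v E'm by simp
      next
        case False
        then have "H (\<rho> k) v = E' k" using \<kappa>\<rho>[of k] by (auto simp: H_def \<rho>_def)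
        then show ?thesis unfolding e using False by auto
      qed
    qed
    also have "\<dots> = (\<Prod>k\<in>J1. if fst k \<in> A - {c} \<and> snd k = 0 then ennreal (exp (- mu (fst k) * v)) else 1) * (\<Prod>k\<in>J1. emeasure (exp_law mu k) (E' k))"
      by (rule prod.distrib)
    also have "(\<Prod>k\<in>J1. emeasure (exp_law mu k) (E' k)) = (\<Prod>k\<in>J. emeasure (exp_law mu k) (E k))"
    proof -
      have u: "emeasure (exp_law mu k) UNIV = 1" for k
        using prob_space.emeasure_space_1[OF prob_exp_law, of k] by simp
      have "(\<Prod>k\<in>J. emeasure (exp_law mu k) (E' k)) = (\<Prod>k\<in>J1. emeasure (exp_law mu k) (E' k))"
        using J1 by (intro prod.mono_neutral_left) (auto simp: J1_def E'_def u)
      then show ?thesis by (simp add: E'_def)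
    qed
    also have "(\<Prod>k\<in>J1. if fst k \<in> A - {c} \<and> snd k = 0 then ennreal (exp (- mu (fst k) * v)) else 1) = (\<Prod>k\<in>(A - {c}) \<times> {0::nat}. ennreal (exp (- mu (fst k) * v)))"
    proof -
      have "{k \<in> J1. fst k \<in> A - {c} \<and> snd k = 0} = (A - {c}) \<times> {0}" by (auto simp: J1_def)
      then show ?thesis
        using prod.inter_filter[OF J1(1), where P="\<lambda>k. fst k \<in> A - {c} \<and> snd k = 0" and g="\<lambda>k. ennreal (exp (- mu (fst k) * v))", symmetric]
        by (simp only:)
    qed
    also have "\<dots> = (\<Prod>c\<in>A - {c}. ennreal (exp (- mu c * v)))"
      by (rule prod.reindex_bij_witness[of _ "\<lambda>c. (c, 0)" fst]) auto
    also have "\<dots> = ennreal (exp (- total_rate (A - {c}) * v))"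
      using fin by (intro prod_exp_clocks) auto
    finally show ?thesis .
  qed
  have "emeasure P ?W = (\<integral>\<^sup>+v. indicator B v * (\<Prod>k\<in>\<rho> ` J1. emeasure (exp_law mu k) (H k v)) \<partial>exp_law mu (c, 0))"
    unfolding WW by (rule emeasure_rectangle[OF aK \<rho>J Hm Wm])
  also have "\<dots> = (\<integral>\<^sup>+v. (indicator B v * ennreal (exp (- total_rate (A - {c}) * v))) * (\<Prod>k\<in>J. emeasure (exp_law mu k) (E k)) \<partial>exp_law mu (c, 0))"
    by (rule nn_integral_cong_AE) (use AE_exp_law_pos[of "(c, 0)"] in \<open>eventually_elim, simp add: pr mult.assoc\<close>)
  also have "\<dots> = (\<integral>\<^sup>+v. (indicator B v * ennreal (exp (- total_rate (A - {c}) * v))) \<partial>exp_law mu (c, 0)) * (\<Prod>k\<in>J. emeasure (exp_law mu k) (E k))"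
    by (rule nn_integral_multc, subst measurable_cong_sets[OF sets_exp_law refl]) measurable
  finally show ?thesis .
qed

lemma emeasure_wins:
  assumes A: "A \<subseteq> C" and c: "c \<in> A" and B [measurable]: "B \<in> sets borel"
  shows "emeasure P {x \<in> space P. wins A c x \<and> x (c, 0) \<in> B} =
    (\<integral>\<^sup>+v. indicator B v * ennreal (indicator {0..} v * (mu c * exp (- total_rate A * v))) \<partial>lborel)"
proof -
  have fin: "finite A" using A finite_C finite_subset by blast
  have t: "total_rate A = mu c + total_rate (A - {c})" using fin c by (simp add: total_rate_def sum.remove)
  have "emeasure P {x \<in> space P. wins A c x \<and> x (c, 0) \<in> B} = (\<integral>\<^sup>+v. indicator B v * ennreal (exp (- total_rate (A - {c}) * v)) \<partial>exp_law mu (c, 0))"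
    using emeasure_wins_advance[OF A c _ _ B, of "{}"] by simp
  also have "\<dots> = (\<integral>\<^sup>+v. ennreal (exponential_density (mu c) v) * (indicator B v * ennreal (exp (- total_rate (A - {c}) * v))) \<partial>lborel)"
    unfolding exp_law_def by (subst nn_integral_density) auto
  also have "\<dots> = (\<integral>\<^sup>+v. indicator B v * ennreal (indicator {0..} v * (mu c * exp (- total_rate A * v))) \<partial>lborel)"
  proof (rule nn_integral_cong)
    fix v :: real
    have "exponential_density (mu c) v * exp (- total_rate (A - {c}) * v) = indicator {0..} v * (mu c * exp (- total_rate A * v))"
      unfolding t by (auto simp: exponential_density_def indicator_def exp_add[symmetric] algebra_simps)
    then show "ennreal (exponential_density (mu c) v) * (indicator B v * ennreal (exp (- total_rate (A - {c}) * v))) =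
       indicator B v * ennreal (indicator {0..} v * (mu c * exp (- total_rate A * v)))"
      by (metis ennreal_mult' exp_ge_zero mult.left_commute ennreal_mult'')
  qed
  finally show ?thesis .
qed

lemma wins_measurable:
  assumes A: "A \<subseteq> C" and c: "c \<in> A"
  shows "Measurable.pred P (wins A c)"
proof -
  have fin: "finite A" using A finite_C finite_subset by blast
  have [measurable]: "c \<in> A \<Longrightarrow> (\<lambda>x. x (c, 0)) \<in> borel_measurable P" for c
    using A by (intro component_measurable) (auto simp: K_def)
  show ?thesis unfolding wins_def using fin c by (auto intro!: pred_intros_finite(3) simp: pred_def)
qed

text \<open>
  After the race the waiting times have their original law and are independent of winner and
  duration. Rectangles generate the product sigma algebra, so \<open>emeasure_wins_advance\<close> suffices.
\<close>

lemma advance_independent: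
  assumes A: "A \<subseteq> C" "A \<noteq> {}" and D [measurable]: "D \<in> sets (count_space UNIV \<Otimes>\<^sub>M borel)" and D' [measurable]: "D' \<in> sets P"
  shows "emeasure P {x \<in> space P. (winner A x, delay A x) \<in> D \<and> advance A x \<in> D'} =
     emeasure P {x \<in> space P. (winner A x, delay A x) \<in> D} * emeasure P D'"
proof -
  interpret P: prob_space P by (rule prob_space_P)
  have fin: "finite A" using A finite_C finite_subset by blast
  note [measurable] = winner_measurable[OF A(1)] delay_measurable[OF A] advance_measurable[OF A]
  define V where "V = {x \<in> space P. (winner A x, delay A x) \<in> D}"
  have V [measurable]: "V \<in> sets P" unfolding V_def by measurable
  define D1 where "D1 c = {v. (c, v) \<in> D}" for c
  have D1 [measurable]: "D1 c \<in> sets borel" for c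
    unfolding D1_def using measurable_sets[OF measurable_Pair1'[of c "count_space UNIV" borel] D] by (simp add: vimage_def)
  have dec: "emeasure P {x \<in> space P. x \<in> V \<and> Q x} = (\<Sum>c\<in>A. emeasure P {x \<in> space P. wins A c x \<and> x (c, 0) \<in> D1 c \<and> Q x})"
    if Q [measurable]: "Measurable.pred P Q" for Q
  proof -
    have m: "{x \<in> space P. wins A c x \<and> x (c, 0) \<in> D1 c \<and> Q x} \<in> sets P" if "c \<in> A" for c
    proof -
      note [measurable] = wins_measurable[OF A(1) that]
      have [measurable]: "(\<lambda>x. x (c, 0)) \<in> borel_measurable P"
        using A that by (intro component_measurable) (auto simp: K_def)
      show ?thesis by measurable
    qed
    have "emeasure P {x \<in> space P. x \<in> V \<and> Q x} = emeasure P (\<Union>c\<in>A. {x \<in> space P. wins A c x \<and> x (c, 0) \<in> D1 c \<and> Q x})"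
    proof (rule emeasure_eq_AE)
      show "AE x in P. (x \<in> {x \<in> space P. x \<in> V \<and> Q x}) = (x \<in> (\<Union>c\<in>A. {x \<in> space P. wins A c x \<and> x (c, 0) \<in> D1 c \<and> Q x}))"
        using AE_good
      proof eventually_elim
        case (elim x)
        have "wins A (winner A x) x" "winner A x \<in> A" using good_wins[OF elim A] by auto
        then show ?case
          by (auto simp: V_def D1_def delay_def dest: winner_eq)
      qed
      show "(\<Union>c\<in>A. {x \<in> space P. wins A c x \<and> x (c, 0) \<in> D1 c \<and> Q x}) \<in> sets P"
        using m fin by (intro sets.finite_UN) auto
    qed measurable
    also have "\<dots> = (\<Sum>c\<in>A. emeasure P {x \<in> space P. wins A c x \<and> x (c, 0) \<in> D1 c \<and> Q x})"
      using m fin by (intro sum_emeasure[symmetric]) (auto simp: disjoint_family_on_def dest: winner_eq)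
    finally show ?thesis .
  qed
  define Q1 where "Q1 = distr (density P (indicator V)) P (advance A)"
  define Q2 where "Q2 = density P (\<lambda>_. emeasure P V)"
  have "Q1 = Q2"
  proof (rule measure_eqI_PiM_infinite[where I=K and M="exp_law mu"])
    show "sets Q1 = sets (PiM K (exp_law mu))" "sets Q2 = sets (PiM K (exp_law mu))"
      by (simp_all add: Q1_def Q2_def P_def[symmetric])
    interpret R: finite_measure "density P (indicator V)"
      by (rule P.finite_measure_restricted) measurable
    show "finite_measure Q1" unfolding Q1_def by (rule R.finite_measure_distr) measurable
    fix E :: "nat \<times> nat \<Rightarrow> real set" and J :: "(nat \<times> nat) set"
    assume J: "finite J" "J \<subseteq> K" and E: "\<And>k. k \<in> J \<Longrightarrow> E k \<in> sets (exp_law mu k)"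
    let ?R = "prod_emb K (exp_law mu) J (Pi\<^sub>E J E)"
    have R [measurable]: "?R \<in> sets P" unfolding P_def using J E by (intro sets_PiM_I) auto
    have advR: "advance A x \<in> ?R \<longleftrightarrow> (\<forall>k\<in>J. advance A x k \<in> E k)" if "x \<in> space P" for x
      using measurable_space[OF advance_measurable[OF A] that] J
      by (auto simp: prod_emb_def P_def space_PiM)
    have "emeasure Q1 ?R = (\<integral>\<^sup>+x. indicator V x * indicator (advance A -` ?R \<inter> space P) x \<partial>P)"
      unfolding Q1_def by (subst emeasure_distr) (simp_all add: emeasure_density)
    also have "\<dots> = (\<integral>\<^sup>+x. indicator {x \<in> space P. x \<in> V \<and> (\<forall>k\<in>J. advance A x k \<in> E k)} x \<partial>P)"
      by (rule nn_integral_cong) (auto simp: indicator_def advR)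
    also have "\<dots> = emeasure P {x \<in> space P. x \<in> V \<and> (\<forall>k\<in>J. advance A x k \<in> E k)}"
    proof (rule nn_integral_indicator)
      have "{x \<in> space P. x \<in> V \<and> (\<forall>k\<in>J. advance A x k \<in> E k)} = {x \<in> space P. x \<in> V \<and> advance A x \<in> ?R}"
        using advR by auto
      also have "\<dots> \<in> sets P" by measurable
      finally show "{x \<in> space P. x \<in> V \<and> (\<forall>k\<in>J. advance A x k \<in> E k)} \<in> sets P" .
    qed
    also have "\<dots> = (\<Sum>c\<in>A. emeasure P {x \<in> space P. wins A c x \<and> x (c, 0) \<in> D1 c \<and> (\<forall>k\<in>J. advance A x k \<in> E k)})"
    proof (rule dec)
      have "Measurable.pred P (\<lambda>x. advance A x \<in> ?R)" by measurable
      then show "Measurable.pred P (\<lambda>x. \<forall>k\<in>J. advance A x k \<in> E k)"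
        by (rule measurable_cong[THEN iffD1, rotated]) (simp add: advR)
    qed
    also have "\<dots> = (\<Sum>c\<in>A. emeasure P {x \<in> space P. wins A c x \<and> x (c, 0) \<in> D1 c} * (\<Prod>k\<in>J. emeasure (exp_law mu k) (E k)))"
    proof (rule sum.cong[OF refl])
      fix c assume c: "c \<in> A"
      have E': "k \<in> J \<Longrightarrow> E k \<in> sets borel" for k using E by simp
      show "emeasure P {x \<in> space P. wins A c x \<and> x (c, 0) \<in> D1 c \<and> (\<forall>k\<in>J. advance A x k \<in> E k)} =
        emeasure P {x \<in> space P. wins A c x \<and> x (c, 0) \<in> D1 c} * (\<Prod>k\<in>J. emeasure (exp_law mu k) (E k))"
        using emeasure_wins_advance[OF A(1) c J D1 E'] emeasure_wins_advance[OF A(1) c _ _ D1, of "{}"] by simp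
    qed
    also have "\<dots> = emeasure P V * (\<Prod>k\<in>J. emeasure (exp_law mu k) (E k))"
    proof -
      have "V = {x \<in> space P. x \<in> V \<and> True}" by (auto simp: V_def)
      then have "emeasure P V = (\<Sum>c\<in>A. emeasure P {x \<in> space P. wins A c x \<and> x (c, 0) \<in> D1 c})"
        using dec[of "\<lambda>_. True"] by simp
      then show ?thesis by (simp add: sum_distrib_right)
    qed
    also have "(\<Prod>k\<in>J. emeasure (exp_law mu k) (E k)) = emeasure P ?R"
      unfolding P_def using J E by (subst emeasure_PiM_emb) (auto simp: prob_exp_law)
    also have "emeasure P V * emeasure P ?R = emeasure Q2 ?R"
      unfolding Q2_def by (simp add: emeasure_density nn_integral_cmult)
    finally show "emeasure Q1 ?R = emeasure Q2 ?R" .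
  qed
  then have "emeasure Q1 D' = emeasure Q2 D'" by simp
  moreover have "emeasure Q2 D' = emeasure P V * emeasure P D'"
    unfolding Q2_def by (simp add: emeasure_density nn_integral_cmult)
  moreover have "emeasure Q1 D' = (\<integral>\<^sup>+x. indicator V x * indicator (advance A -` D' \<inter> space P) x \<partial>P)"
    unfolding Q1_def by (subst emeasure_distr) (simp_all add: emeasure_density)
  moreover have "\<dots> = (\<integral>\<^sup>+x. indicator {x \<in> space P. (winner A x, delay A x) \<in> D \<and> advance A x \<in> D'} x \<partial>P)"
    by (rule nn_integral_cong) (auto simp: indicator_def V_def)
  moreover have "\<dots> = emeasure P {x \<in> space P. (winner A x, delay A x) \<in> D \<and> advance A x \<in> D'}"
    by (rule nn_integral_indicator) measurable
  ultimately show ?thesis by (simp add: V_def)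
qed

end

section \<open>Winner and waiting time of a race\<close>

context clocks begin

lemma winner_delay_density:
  assumes A: "A \<subseteq> C" and c: "c \<in> A"
  shows "distr (density P (\<lambda>x. ennreal (indicator {x \<in> space P. wins A c x} x))) borel (\<lambda>x. x (c, 0)) =
    density lborel (\<lambda>v. ennreal (indicator {0..} v * (mu c * exp (- total_rate A * v))))"
proof (rule measure_eqI)
  note [measurable] = wins_measurable[OF A c]
  have [measurable]: "(\<lambda>x. x (c, 0)) \<in> borel_measurable P"
    using A c by (intro component_measurable) (auto simp: K_def)
  fix B assume "B \<in> sets (distr (density P (\<lambda>x. ennreal (indicator {x \<in> space P. wins A c x} x))) borel (\<lambda>x. x (c, 0)))"
  then have B [measurable]: "B \<in> sets borel" by simp
  have "emeasure (distr (density P (\<lambda>x. ennreal (indicator {x \<in> space P. wins A c x} x))) borel (\<lambda>x. x (c, 0))) B =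
    (\<integral>\<^sup>+x. ennreal (indicator {x \<in> space P. wins A c x} x) * indicator ((\<lambda>x. x (c, 0)) -` B \<inter> space P) x \<partial>P)"
    by (subst emeasure_distr) (simp_all add: emeasure_density)
  also have "\<dots> = (\<integral>\<^sup>+x. indicator {x \<in> space P. wins A c x \<and> x (c, 0) \<in> B} x \<partial>P)"
    by (rule nn_integral_cong) (auto simp: indicator_def)
  also have "\<dots> = emeasure P {x \<in> space P. wins A c x \<and> x (c, 0) \<in> B}"
    by (rule nn_integral_indicator) measurable
  also have "\<dots> = emeasure (density lborel (\<lambda>v. ennreal (indicator {0..} v * (mu c * exp (- total_rate A * v))))) B"
    by (subst emeasure_wins[OF A c B], subst emeasure_density) (auto simp: mult.commute)
  finally show "emeasure (distr (density P (\<lambda>x. ennreal (indicator {x \<in> space P. wins A c x} x))) borel (\<lambda>x. x (c, 0))) B =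
    emeasure (density lborel (\<lambda>v. ennreal (indicator {0..} v * (mu c * exp (- total_rate A * v))))) B" .
qed simp

lemma AE_delay_pos:
  assumes "A \<subseteq> C" "A \<noteq> {}"
  shows "AE x in P. 0 < delay A x"
  using AE_good
proof eventually_elim
  case (elim x)
  then have "winner A x \<in> C" using good_wins(2)[OF elim assms] assms by auto
  then show ?case using elim by (auto simp: good_def delay_def K_def)
qed

text \<open>
  Split according to the winner, whose waiting time has a density by \<open>winner_delay_density\<close>.
\<close>

lemma integral_winner_delay:
  fixes g :: "nat \<Rightarrow> real \<Rightarrow> real"
  assumes A: "A \<subseteq> C" "A \<noteq> {}" and g [measurable]: "\<And>c. g c \<in> borel_measurable borel"
    and bd: "\<And>c v. \<bar>g c v\<bar> \<le> b"
  shows "(\<integral>x. g (winner A x) (delay A x) \<partial>P) =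
    (\<Sum>c\<in>A. mu c * (LBINT v:{0..}. g c v * exp (- total_rate A * v)))"
proof -
  interpret P: prob_space P by (rule prob_space_P)
  have fin: "finite A" using A finite_C finite_subset by blast
  define W where "W c = {x \<in> space P. wins A c x}" for c
  have W: "W c \<in> sets P" if "c \<in> A" for c
    using wins_measurable[OF A(1) that] unfolding W_def by measurable
  have comp: "(\<lambda>x. x (c, 0)) \<in> borel_measurable P" if "c \<in> A" for c
    using A that by (intro component_measurable) (auto simp: K_def)
  have "(\<integral>x. g (winner A x) (delay A x) \<partial>P) = (\<integral>x. (\<Sum>c\<in>A. indicator (W c) x * g c (x (c, 0))) \<partial>P)"
  proof (rule integral_cong_AE)
    have eq: "(\<lambda>x. g (winner A x) (delay A x)) \<in> borel_measurable P"
      by (rule measurable_compose_countable'[where I=UNIV and f="\<lambda>c x. g c (delay A x)"])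
         (use measurable_compose[OF delay_measurable[OF A] g] winner_measurable[OF A(1)] in auto)
    then show "(\<lambda>x. g (winner A x) (delay A x)) \<in> borel_measurable P" .
    show "(\<lambda>x. (\<Sum>c\<in>A. indicator (W c) x * g c (x (c, 0)))) \<in> borel_measurable P"
      using W measurable_compose[OF comp g] by (intro borel_measurable_sum borel_measurable_times borel_measurable_indicator) auto
    show "AE x in P. g (winner A x) (delay A x) = (\<Sum>c\<in>A. indicator (W c) x * g c (x (c, 0)))"
      using AE_good AE_space
    proof eventually_elim
      case (elim x)
      have w: "wins A (winner A x) x" "winner A x \<in> A" using good_wins[OF elim(1) A] by auto
      have "indicator (W c) x * g c (x (c, 0)) = (if c = winner A x then g (winner A x) (delay A x) else 0)" for c
      proof (cases "c = winner A x")
        case True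
        then have "x \<in> W c" using w elim(2) by (simp add: W_def)
        then show ?thesis using True by (simp add: delay_def)
      next
        case False
        then have "x \<notin> W c" using winner_eq[of A c x] by (auto simp: W_def)
        then show ?thesis using False by simp
      qed
      then show ?case using w(2) fin by simp
    qed
  qed
  also have "\<dots> = (\<Sum>c\<in>A. (\<integral>x. indicator (W c) x * g c (x (c, 0)) \<partial>P))"
  proof (rule Bochner_Integration.integral_sum)
    fix c assume c: "c \<in> A"
    show "integrable P (\<lambda>x. indicator (W c) x * g c (x (c, 0)))"
    proof (rule P.integrable_const_bound[of _ b])
      have "\<bar>indicator (W c) x * g c (x (c, 0))\<bar> \<le> b" for x
        using bd[of c "x (c, 0)"] order_trans[OF abs_ge_zero bd[of c 0]] by (cases "x \<in> W c") auto
      then show "AE x in P. norm (indicator (W c) x * g c (x (c, 0))) \<le> b" by simp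
      show "(\<lambda>x. indicator (W c) x * g c (x (c, 0))) \<in> borel_measurable P"
        by (intro borel_measurable_times borel_measurable_indicator W[OF c] measurable_compose[OF comp[OF c] g])
    qed
  qed
  also have "\<dots> = (\<Sum>c\<in>A. mu c * (LBINT v:{0..}. g c v * exp (- total_rate A * v)))"
  proof (rule sum.cong[OF refl])
    fix c assume c: "c \<in> A"
    note [measurable] = W[OF c] comp[OF c]
    have "(\<integral>x. indicator (W c) x * g c (x (c, 0)) \<partial>P) = (\<integral>x. g c (x (c, 0)) \<partial>density P (\<lambda>x. ennreal (indicator (W c) x)))"
      by (subst integral_density) auto
    also have "\<dots> = (\<integral>v. g c v \<partial>distr (density P (\<lambda>x. ennreal (indicator (W c) x))) borel (\<lambda>x. x (c, 0)))"
      by (subst integral_distr) auto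
    also have "\<dots> = (\<integral>v. g c v \<partial>density lborel (\<lambda>v. ennreal (indicator {0..} v * (mu c * exp (- total_rate A * v)))))"
      unfolding W_def winner_delay_density[OF A(1) c] ..
    also have "\<dots> = (\<integral>v. (indicator {0..} v * (mu c * exp (- total_rate A * v))) * g c v \<partial>lborel)"
      using mu_pos[of c] by (subst integral_density) (auto simp: indicator_def less_imp_le)
    also have "\<dots> = (\<integral>v. mu c * (indicator {0..} v * (g c v * exp (- total_rate A * v))) \<partial>lborel)"
      by (rule Bochner_Integration.integral_cong) auto
    finally show "(\<integral>x. indicator (W c) x * g c (x (c, 0)) \<partial>P) = mu c * (LBINT v:{0..}. g c v * exp (- total_rate A * v))"
      by (simp add: set_lebesgue_integral_def)
  qed
  finally show ?thesis .
qed

end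

text \<open>
  Integration by parts. For exponents \<open>1\<close> and \<open>2\<close> it relates the first two moments of a clipped
  duration to integrals over the races that end before \<open>s\<close>.
\<close>

lemma exp_moment_identity:
  fixes a s :: real
  assumes a: "0 < a" and s: "0 \<le> s"
  shows "a * (LBINT v:{0..}. (max 0 (min v s)) ^ Suc k * exp (- a * v)) = real (Suc k) * (LBINT v:{0..s}. v ^ k * exp (- a * v))"
proof -
  have cont: "continuous_on {0..s} (\<lambda>v. v ^ j * exp (- a * v))" for j by (intro continuous_intros)
  have I1: "set_integrable lborel {0..s} (\<lambda>v. v ^ j * exp (- a * v))" for j
    by (rule borel_integrable_atLeastAtMost') (rule cont)
  have tail: "has_bochner_integral lborel (\<lambda>v. indicator {s..} v *\<^sub>R (a * exp (- a * v))) (exp (- a * s))"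
  proof -
    have "(\<integral>\<^sup>+v. ennreal (a * exp (- a * v)) * indicator {s..} v \<partial>lborel) = ennreal (0 - (- exp (- a * s)))"
    proof (rule nn_integral_FTC_atLeast)
      show "((\<lambda>x. - exp (- a * x)) \<longlongrightarrow> 0) at_top"
        using a by real_asymp
    qed (use a in \<open>auto intro!: derivative_eq_intros\<close>)
    then have "(\<integral>\<^sup>+v. ennreal (indicator {s..} v *\<^sub>R (a * exp (- a * v))) \<partial>lborel) = ennreal (exp (- a * s))"
      by (simp add: indicator_mult_ennreal mult.commute)
    then show ?thesis using a
      by (intro has_bochner_integral_nn_integral) (auto simp: indicator_def)
  qed
  then have tail0: "has_bochner_integral lborel (\<lambda>v. indicator {s<..} v *\<^sub>R (a * exp (- a * v))) (exp (- a * s))"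
  proof (rule has_bochner_integral_cong_AE[THEN iffD1, rotated -1])
    show "AE v in lborel. indicator {s..} v *\<^sub>R (a * exp (- a * v)) = indicator {s<..} v *\<^sub>R (a * exp (- a * v))"
      using AE_lborel_singleton[of s] by eventually_elim (auto simp: indicator_def)
  qed auto
  have ftc: "(LBINT v:{0..s}. real (Suc k) * (v ^ k * exp (- a * v)) - a * (v ^ Suc k * exp (- a * v))) = s ^ Suc k * exp (- a * s) - 0 ^ Suc k * exp (- a * 0)"
    unfolding set_lebesgue_integral_def
  proof (rule integral_FTC_atLeastAtMost[OF s])
    fix v :: real
    have "((\<lambda>v. v ^ Suc k * exp (- a * v)) has_real_derivative (real (Suc k) * (v ^ k * exp (- a * v)) - a * (v ^ Suc k * exp (- a * v)))) (at v within {0..s})"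
      by (rule derivative_eq_intros refl)+ (simp add: algebra_simps)
    then show "((\<lambda>v. v ^ Suc k * exp (- a * v)) has_vector_derivative (real (Suc k) * (v ^ k * exp (- a * v)) - a * (v ^ Suc k * exp (- a * v)))) (at v within {0..s})"
      by (simp only: has_real_derivative_iff_has_vector_derivative)
  qed (intro continuous_intros)
  have ftc': "real (Suc k) * (LBINT v:{0..s}. v ^ k * exp (- a * v)) - a * (LBINT v:{0..s}. v ^ Suc k * exp (- a * v)) = s ^ Suc k * exp (- a * s)"
    using ftc I1[of k] I1[of "Suc k"] by (subst (asm) set_integral_diff) (auto intro!: set_integrable_mult_right)
  have Itail: "set_integrable lborel {s<..} (\<lambda>v. (max 0 (min v s)) ^ Suc k * exp (- a * v))"
  proof -
    have "set_integrable lborel {s<..} (\<lambda>v. s ^ Suc k / a * (a * exp (- a * v)))"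
      using tail0 by (intro set_integrable_mult_right[of "s ^ Suc k / a"]) (simp only: has_bochner_integral_iff set_integrable_def)
    then show ?thesis
      by (rule set_integrable_cong[THEN iffD1, rotated -1]) (use a s in \<open>auto simp: max_def min_def\<close>)
  qed
  have "(LBINT v:{0..}. (max 0 (min v s)) ^ Suc k * exp (- a * v)) = (LBINT v:{0..s} \<union> {s<..}. (max 0 (min v s)) ^ Suc k * exp (- a * v))"
    using s by (intro arg_cong2[where f="\<lambda>A f. set_lebesgue_integral lborel A f"]) auto
  also have "\<dots> = (LBINT v:{0..s}. (max 0 (min v s)) ^ Suc k * exp (- a * v)) + (LBINT v:{s<..}. (max 0 (min v s)) ^ Suc k * exp (- a * v))"
  proof (rule set_integral_Un)
    show "set_integrable lborel {0..s} (\<lambda>v. (max 0 (min v s)) ^ Suc k * exp (- a * v))"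
      by (rule set_integrable_cong[THEN iffD1, OF refl refl _ I1[of "Suc k"]]) auto
  qed (use Itail in auto)
  also have "(LBINT v:{0..s}. (max 0 (min v s)) ^ Suc k * exp (- a * v)) = (LBINT v:{0..s}. v ^ Suc k * exp (- a * v))"
    by (rule set_lebesgue_integral_cong) auto
  also have "(LBINT v:{s<..}. (max 0 (min v s)) ^ Suc k * exp (- a * v)) = (LBINT v:{s<..}. s ^ Suc k / a * (a * exp (- a * v)))"
    by (rule set_lebesgue_integral_cong) (use a s in \<open>auto simp: max_def min_def\<close>)
  also have "\<dots> = s ^ Suc k / a * exp (- a * s)"
  proof -
    have "(LBINT v:{s<..}. a * exp (- a * v)) = exp (- a * s)"
      using tail0 by (simp only: set_lebesgue_integral_def has_bochner_integral_iff)
    then show ?thesis by (simp only: set_integral_mult_right)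
  qed
  finally show ?thesis using ftc' a by (simp add: field_simps)
qed

context clocks begin

text \<open>
  Given the past \<open>Y\<close>, the waiting times \<open>X\<close> are still independent exponential variables.
\<close>

definition fresh :: "'w measure \<Rightarrow> 'y measure \<Rightarrow> ('w \<Rightarrow> 'y) \<Rightarrow> ('w \<Rightarrow> nat \<times> nat \<Rightarrow> real) \<Rightarrow> bool" where
  "fresh M NY Y X \<longleftrightarrow> prob_space M \<and> Y \<in> M \<rightarrow>\<^sub>M NY \<and> X \<in> M \<rightarrow>\<^sub>M P \<and>
     distr M (NY \<Otimes>\<^sub>M P) (\<lambda>w. (Y w, X w)) = distr M NY Y \<Otimes>\<^sub>M P"

abbreviation "clock_sets \<equiv> count_space (Pow C - {{}})"

lemma winner_pair_measurable:
  assumes A: "A \<in> NY \<rightarrow>\<^sub>M clock_sets"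
  shows "(\<lambda>p. winner (A (fst p)) (snd p)) \<in> NY \<Otimes>\<^sub>M P \<rightarrow>\<^sub>M count_space UNIV"
    and "(\<lambda>p. delay (A (fst p)) (snd p)) \<in> borel_measurable (NY \<Otimes>\<^sub>M P)"
    and "(\<lambda>p. advance (A (fst p)) (snd p)) \<in> NY \<Otimes>\<^sub>M P \<rightarrow>\<^sub>M P"
proof -
  have c: "countable (Pow C - {{}})" using finite_C by (simp add: countable_finite)
  have g: "(\<lambda>p. A (fst p)) \<in> NY \<Otimes>\<^sub>M P \<rightarrow>\<^sub>M clock_sets" by (rule measurable_compose[OF measurable_fst A])
  show "(\<lambda>p. winner (A (fst p)) (snd p)) \<in> NY \<Otimes>\<^sub>M P \<rightarrow>\<^sub>M count_space UNIV"
    by (rule measurable_compose_countable'[OF _ g c, where f="\<lambda>A p. winner A (snd p)"])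
       (rule measurable_compose[OF measurable_snd winner_measurable], auto)
  show "(\<lambda>p. delay (A (fst p)) (snd p)) \<in> borel_measurable (NY \<Otimes>\<^sub>M P)"
    by (rule measurable_compose_countable'[OF _ g c, where f="\<lambda>A p. delay A (snd p)"])
       (rule measurable_compose[OF measurable_snd delay_measurable], auto)
  show "(\<lambda>p. advance (A (fst p)) (snd p)) \<in> NY \<Otimes>\<^sub>M P \<rightarrow>\<^sub>M P"
    by (rule measurable_compose_countable'[OF _ g c, where f="\<lambda>A p. advance A (snd p)"])
       (rule measurable_compose[OF measurable_snd advance_measurable], auto)
qed

text \<open>
  The race may depend on the past through its set \<open>A y\<close> of participants. Conditionally on
  \<open>Y = y\<close>, \<open>advance_independent\<close> applies to \<open>A y\<close>, and the new past is a function of \<open>y\<close>, the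
  winner and the duration.
\<close>

lemma fresh_step:
  assumes F: "fresh M NY Y X" and A: "A \<in> NY \<rightarrow>\<^sub>M clock_sets"
    and phi: "(\<lambda>(y, c, v). \<phi> y c v) \<in> NY \<Otimes>\<^sub>M (count_space UNIV \<Otimes>\<^sub>M borel) \<rightarrow>\<^sub>M NY'"
  shows "fresh M NY' (\<lambda>w. \<phi> (Y w) (winner (A (Y w)) (X w)) (delay (A (Y w)) (X w))) (\<lambda>w. advance (A (Y w)) (X w))"
proof -
  interpret M: prob_space M using F by (simp add: fresh_def)
  interpret P: prob_space P by (rule prob_space_P)
  have Y [measurable]: "Y \<in> M \<rightarrow>\<^sub>M NY" and X [measurable]: "X \<in> M \<rightarrow>\<^sub>M P"
    and law: "distr M (NY \<Otimes>\<^sub>M P) (\<lambda>w. (Y w, X w)) = distr M NY Y \<Otimes>\<^sub>M P"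
    using F by (auto simp: fresh_def)
  note [measurable] = winner_pair_measurable[OF A]
  define f where "f p = \<phi> (fst p) (winner (A (fst p)) (snd p)) (delay (A (fst p)) (snd p))" for p
  define g where "g p = advance (A (fst p)) (snd p)" for p
  have f [measurable]: "f \<in> NY \<Otimes>\<^sub>M P \<rightarrow>\<^sub>M NY'"
  proof -
    have "(\<lambda>p. (\<lambda>(y, c, v). \<phi> y c v) (fst p, winner (A (fst p)) (snd p), delay (A (fst p)) (snd p))) \<in> NY \<Otimes>\<^sub>M P \<rightarrow>\<^sub>M NY'"
      by (rule measurable_compose[OF _ phi]) measurable
    then show ?thesis by (simp add: f_def[abs_def])
  qed
  have g [measurable]: "g \<in> NY \<Otimes>\<^sub>M P \<rightarrow>\<^sub>M P" unfolding g_def by measurable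
  define Y' where "Y' w = f (Y w, X w)" for w
  define X' where "X' w = g (Y w, X w)" for w
  have Y' [measurable]: "Y' \<in> M \<rightarrow>\<^sub>M NY'" and X' [measurable]: "X' \<in> M \<rightarrow>\<^sub>M P"
    unfolding Y'_def X'_def by measurable
  interpret DY: prob_space "distr M NY Y" by (rule M.prob_space_distr) fact
  interpret DY': prob_space "distr M NY' Y'" by (rule M.prob_space_distr) fact
  interpret pp: pair_prob_space "distr M NY' Y'" P ..
  have "distr M NY' Y' \<Otimes>\<^sub>M P = distr M (NY' \<Otimes>\<^sub>M P) (\<lambda>w. (Y' w, X' w))"
  proof (rule pair_measure_eqI)
    show "sigma_finite_measure (distr M NY' Y')" "sigma_finite_measure P" by unfold_locales
    show "sets (distr M NY' Y' \<Otimes>\<^sub>M P) = sets (distr M (NY' \<Otimes>\<^sub>M P) (\<lambda>w. (Y' w, X' w)))"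
      by simp
    fix B D assume "B \<in> sets (distr M NY' Y')" and D [measurable]: "D \<in> sets P"
    then have B [measurable]: "B \<in> sets NY'" by simp
    have base: "emeasure M {w \<in> space M. Q (Y w, X w)} = (\<integral>\<^sup>+y. emeasure P {x \<in> space P. Q (y, x)} \<partial>distr M NY Y)"
      if [measurable]: "Measurable.pred (NY \<Otimes>\<^sub>M P) Q" for Q
    proof -
      have "emeasure M {w \<in> space M. Q (Y w, X w)} = emeasure (distr M (NY \<Otimes>\<^sub>M P) (\<lambda>w. (Y w, X w))) {p \<in> space (NY \<Otimes>\<^sub>M P). Q p}"
        by (subst emeasure_distr) (auto intro!: arg_cong2[where f=emeasure] simp: space_pair_measure measurable_space[OF Y] measurable_space[OF X])
      also have "\<dots> = (\<integral>\<^sup>+y. emeasure P (Pair y -` {p \<in> space (NY \<Otimes>\<^sub>M P). Q p}) \<partial>distr M NY Y)"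
        unfolding law by (rule P.emeasure_pair_measure_alt) (simp cong: sets_pair_measure_cong)
      also have "\<dots> = (\<integral>\<^sup>+y. emeasure P {x \<in> space P. Q (y, x)} \<partial>distr M NY Y)"
        by (rule nn_integral_cong) (auto intro!: arg_cong2[where f=emeasure] simp: space_pair_measure)
      finally show ?thesis .
    qed
    have "emeasure (distr M (NY' \<Otimes>\<^sub>M P) (\<lambda>w. (Y' w, X' w))) (B \<times> D) = emeasure M {w \<in> space M. f (Y w, X w) \<in> B \<and> g (Y w, X w) \<in> D}"
      by (subst emeasure_distr) (auto intro!: arg_cong2[where f=emeasure] simp: Y'_def X'_def)
    also have "\<dots> = (\<integral>\<^sup>+y. emeasure P {x \<in> space P. f (y, x) \<in> B \<and> g (y, x) \<in> D} \<partial>distr M NY Y)"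
      by (rule base) measurable
    also have "\<dots> = (\<integral>\<^sup>+y. emeasure P {x \<in> space P. f (y, x) \<in> B} * emeasure P D \<partial>distr M NY Y)"
    proof (rule nn_integral_cong)
      fix y assume "y \<in> space (distr M NY Y)"
      then have y: "y \<in> space NY" by simp
      have Ay: "A y \<subseteq> C" "A y \<noteq> {}" using measurable_space[OF A y] by auto
      have "(\<lambda>q. (\<lambda>(y, c, v). \<phi> y c v) (y, q)) \<in> count_space UNIV \<Otimes>\<^sub>M borel \<rightarrow>\<^sub>M NY'"
        by (rule measurable_compose[OF measurable_Pair1'[OF y] phi])
      then have m: "(\<lambda>q. \<phi> y (fst q) (snd q)) \<in> count_space UNIV \<Otimes>\<^sub>M borel \<rightarrow>\<^sub>M NY'"
        by (simp add: case_prod_beta)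
      let ?D = "{q. \<phi> y (fst q) (snd q) \<in> B}"
      have "?D \<in> sets (count_space UNIV \<Otimes>\<^sub>M borel)"
        using measurable_sets[OF m B] by (simp add: space_pair_measure vimage_def)
      from advance_independent[OF Ay this D]
      show "emeasure P {x \<in> space P. f (y, x) \<in> B \<and> g (y, x) \<in> D} = emeasure P {x \<in> space P. f (y, x) \<in> B} * emeasure P D"
        by (simp add: f_def g_def)
    qed
    also have "\<dots> = (\<integral>\<^sup>+y. emeasure P {x \<in> space P. f (y, x) \<in> B} \<partial>distr M NY Y) * emeasure P D"
    proof (rule nn_integral_multc)
      have "(\<lambda>y. emeasure P (Pair y -` {p \<in> space (NY \<Otimes>\<^sub>M P). f p \<in> B})) \<in> borel_measurable NY"
        by (rule P.measurable_emeasure_Pair) measurable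
      then show "(\<lambda>y. emeasure P {x \<in> space P. f (y, x) \<in> B}) \<in> borel_measurable (distr M NY Y)"
        by (subst measurable_distr_eq1, rule measurable_cong[THEN iffD1, rotated])
           (auto intro!: arg_cong2[where f=emeasure] simp: space_pair_measure)
    qed
    also have "(\<integral>\<^sup>+y. emeasure P {x \<in> space P. f (y, x) \<in> B} \<partial>distr M NY Y) = emeasure M {w \<in> space M. f (Y w, X w) \<in> B}"
      by (rule base[symmetric]) measurable
    also have "\<dots> = emeasure (distr M NY' Y') B"
      by (subst emeasure_distr) (auto intro!: arg_cong2[where f=emeasure] simp: Y'_def)
    finally show "emeasure (distr M NY' Y') B * emeasure P D = emeasure (distr M (NY' \<Otimes>\<^sub>M P) (\<lambda>w. (Y' w, X' w))) (B \<times> D)" ..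
  qed
  then have "fresh M NY' Y' X'"
    unfolding fresh_def using M.prob_space_axioms by simp
  then show ?thesis unfolding Y'_def X'_def f_def g_def by simp
qed

text \<open>Conditioning on the past: average over the waiting times first.\<close>

lemma fresh_expectation:
  fixes F :: "'y \<times> (nat \<times> nat \<Rightarrow> real) \<Rightarrow> real"
  assumes fr: "fresh M NY Y X" and F [measurable]: "F \<in> borel_measurable (NY \<Otimes>\<^sub>M P)"
    and int: "integrable M (\<lambda>w. F (Y w, X w))"
  shows "(\<integral>w. F (Y w, X w) \<partial>M) = (\<integral>w. (\<integral>x. F (Y w, x) \<partial>P) \<partial>M)"
    and "integrable M (\<lambda>w. (\<integral>x. F (Y w, x) \<partial>P))"
proof -
  interpret M: prob_space M using fr by (simp add: fresh_def)
  interpret P: prob_space P by (rule prob_space_P)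
  have Y [measurable]: "Y \<in> M \<rightarrow>\<^sub>M NY" and X [measurable]: "X \<in> M \<rightarrow>\<^sub>M P"
    and law: "distr M (NY \<Otimes>\<^sub>M P) (\<lambda>w. (Y w, X w)) = distr M NY Y \<Otimes>\<^sub>M P"
    using fr by (auto simp: fresh_def)
  interpret DY: prob_space "distr M NY Y" by (rule M.prob_space_distr) fact
  interpret pp: pair_sigma_finite "distr M NY Y" P ..
  have i: "integrable (distr M NY Y \<Otimes>\<^sub>M P) F"
    unfolding law[symmetric] using int by (subst integrable_distr_eq) auto
  have m: "(\<lambda>y. \<integral>x. F (y, x) \<partial>P) \<in> borel_measurable NY"
    by (rule P.borel_measurable_lebesgue_integral[of "\<lambda>y x. F (y, x)", simplified]) simp
  have "(\<integral>w. F (Y w, X w) \<partial>M) = (\<integral>p. F p \<partial>distr M (NY \<Otimes>\<^sub>M P) (\<lambda>w. (Y w, X w)))"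
    by (subst integral_distr) auto
  also have "\<dots> = (\<integral>y. (\<integral>x. F (y, x) \<partial>P) \<partial>distr M NY Y)"
    unfolding law using pp.integral_fst[of "\<lambda>y x. F (y, x)"] i by simp
  also have "\<dots> = (\<integral>w. (\<integral>x. F (Y w, x) \<partial>P) \<partial>M)"
    by (rule integral_distr[OF Y m])
  finally show "(\<integral>w. F (Y w, X w) \<partial>M) = (\<integral>w. (\<integral>x. F (Y w, x) \<partial>P) \<partial>M)" .
  have "integrable (distr M NY Y) (\<lambda>y. \<integral>x. F (y, x) \<partial>P)"
    using pp.integrable_fst[of "\<lambda>y x. F (y, x)"] i by simp
  then show "integrable M (\<lambda>w. (\<integral>x. F (Y w, x) \<partial>P))"
    by (subst (asm) integrable_distr_eq[OF Y m])
qed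

end

section \<open>Chains driven by races\<close>

text \<open>
  The part of a race of duration \<open>v\<close> that falls into a remaining time horizon \<open>s\<close>. The horizon
  may be negative.
\<close>

definition clip :: "real \<Rightarrow> real \<Rightarrow> real" where "clip s v = max 0 (min v s)"
definition hit :: "nat set \<Rightarrow> real \<Rightarrow> nat \<Rightarrow> real \<Rightarrow> real" where
  "hit S s c v = (if c \<in> S \<and> v \<le> s then 1 else 0)"

lemma clip_bounds: "0 \<le> clip s v" "clip s v \<le> max 0 s"
  by (auto simp: clip_def)

lemma hit_bounds: "0 \<le> hit S s c v" "hit S s c v \<le> 1"
  by (auto simp: hit_def)

lemma clip_measurable [measurable]: "clip s \<in> borel_measurable borel"
  unfolding clip_def[abs_def] by measurable

lemma hit_measurable [measurable]: "hit S s c \<in> borel_measurable borel"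
  unfolding hit_def[abs_def] by measurable

context clocks begin

lemma total_rate_nonneg: "0 \<le> total_rate A"
  unfolding total_rate_def by (rule sum_nonneg) (simp add: mu_pos less_imp_le)

lemma total_rate_mono: "A \<subseteq> C \<Longrightarrow> total_rate A \<le> total_rate C"
  unfolding total_rate_def by (rule sum_mono2[OF finite_C]) (simp_all add: mu_pos less_imp_le)

text \<open>
  The compensator of the indicator that a clock in \<open>S\<close> rings within the horizon \<open>s\<close>: its rate
  times the elapsed time. The difference has mean zero, and its variance is the mean of the
  compensator.
\<close>

lemma one_step_moments:
  assumes A: "A \<subseteq> C" "A \<noteq> {}" and S: "S \<subseteq> A"
  shows "(\<integral>x. hit S s (winner A x) (delay A x) - total_rate S * clip s (delay A x) \<partial>P) = 0" (is ?mean)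
    and "(\<integral>x. (hit S s (winner A x) (delay A x) - total_rate S * clip s (delay A x))\<^sup>2 \<partial>P) = total_rate S * (\<integral>x. clip s (delay A x) \<partial>P)" (is ?var)
    and "(\<integral>x. hit S s (winner A x) (delay A x) \<partial>P) = total_rate S * (\<integral>x. clip s (delay A x) \<partial>P)" (is ?hits)
proof -
  interpret P: prob_space P by (rule prob_space_P)
  have fin: "finite A" "finite S"
    using finite_subset[OF A(1) finite_C] finite_subset[OF S] by simp_all
  note [measurable] = delay_measurable[OF A] winner_measurable[OF A(1)]
  have gm: "(\<lambda>x. g (winner A x) (delay A x)) \<in> borel_measurable P" if "\<And>c. g c \<in> borel_measurable borel" for g :: "nat \<Rightarrow> real \<Rightarrow> real"
    by (rule measurable_compose_countable'[where I=UNIV and f="\<lambda>c x. g c (delay A x)"])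
       (use measurable_compose[OF delay_measurable[OF A] that] in auto)
  have gi: "integrable P (\<lambda>x. g (winner A x) (delay A x))"
    if "\<And>c. g c \<in> borel_measurable borel" "\<And>c v. \<bar>g c v\<bar> \<le> b" for g :: "nat \<Rightarrow> real \<Rightarrow> real" and b
    by (rule P.integrable_const_bound[of _ b]) (use gm[OF that(1)] that(2) in auto)
  have main: "(\<integral>x. hit S s (winner A x) (delay A x) \<partial>P) - total_rate S * (\<integral>x. clip s (delay A x) \<partial>P) = 0 \<and>
    (\<integral>x. hit S s (winner A x) (delay A x) \<partial>P) - 2 * total_rate S * (\<integral>x. hit S s (winner A x) (delay A x) * clip s (delay A x) \<partial>P)
     + (total_rate S)\<^sup>2 * (\<integral>x. (clip s (delay A x)) ^ 2 \<partial>P) = total_rate S * (\<integral>x. clip s (delay A x) \<partial>P)"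
  proof (cases "0 \<le> s")
    case True
    define e where "e j = (LBINT v:{0..s}. v ^ j * exp (- total_rate A * v))" for j
    have a: "0 < total_rate A" unfolding total_rate_def using fin A mu_pos by (intro sum_pos) auto
    have cl: "(\<integral>x. clip s (delay A x) ^ Suc k \<partial>P) = real (Suc k) * e k" for k
    proof -
      have "\<bar>clip s v ^ Suc k\<bar> \<le> s ^ Suc k" for v
        using clip_bounds[of s v] True power_mono[of "clip s v" s "Suc k"] by simp
      then have "(\<integral>x. clip s (delay A x) ^ Suc k \<partial>P) = (\<Sum>c\<in>A. mu c * (LBINT v:{0..}. clip s v ^ Suc k * exp (- total_rate A * v)))"
        by (intro integral_winner_delay[OF A, where g="\<lambda>_ v. clip s v ^ Suc k"]) measurable
      also have "\<dots> = total_rate A * (LBINT v:{0..}. clip s v ^ Suc k * exp (- total_rate A * v))"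
        by (simp only: total_rate_def sum_distrib_right)
      also have "\<dots> = real (Suc k) * e k"
        unfolding clip_def e_def by (rule exp_moment_identity[OF a True])
      finally show ?thesis .
    qed
    have hi: "(\<integral>x. hit S s (winner A x) (delay A x) * clip s (delay A x) ^ j \<partial>P) = total_rate S * e j" for j
    proof -
      have "\<bar>hit S s c v * clip s v ^ j\<bar> \<le> max 1 (s ^ j)" for c v
        using clip_bounds[of s v] True power_mono[of "clip s v" s j] by (auto simp: hit_def)
      then have "(\<integral>x. hit S s (winner A x) (delay A x) * clip s (delay A x) ^ j \<partial>P) = (\<Sum>c\<in>A. mu c * (LBINT v:{0..}. hit S s c v * clip s v ^ j * exp (- total_rate A * v)))"
        by (intro integral_winner_delay[OF A, where g="\<lambda>c v. hit S s c v * clip s v ^ j"]) measurable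
      also have "\<dots> = (\<Sum>c\<in>A. if c \<in> S then mu c * e j else 0)"
      proof (rule sum.cong[OF refl])
        fix c assume "c \<in> A"
        have "indicator {0..} v *\<^sub>R (hit S s c v * clip s v ^ j * exp (- total_rate A * v)) = (if c \<in> S then indicator {0..s} v *\<^sub>R (v ^ j * exp (- total_rate A * v)) else 0)" for v
          by (auto simp: hit_def clip_def indicator_def)
        then show "mu c * (LBINT v:{0..}. hit S s c v * clip s v ^ j * exp (- total_rate A * v)) = (if c \<in> S then mu c * e j else 0)"
          unfolding set_lebesgue_integral_def e_def by auto
      qed
      also have "\<dots> = total_rate S * e j"
        using fin S by (simp add: sum.If_cases total_rate_def sum_distrib_right Int_absorb1)
      finally show ?thesis .
    qed
    show ?thesis
      using cl[of 0] cl[of 1] hi[of 0] hi[of 1] by (simp add: power2_eq_square numeral_2_eq_2 algebra_simps)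
  next
    case False
    have "(\<integral>x. hit S s (winner A x) (delay A x) \<partial>P) = (\<integral>x. 0 \<partial>P)"
      using gm[of "hit S s"] AE_delay_pos[OF A] False by (intro integral_cong_AE) (auto simp: hit_def elim!: eventually_mono)
    moreover have "(\<integral>x. hit S s (winner A x) (delay A x) * clip s (delay A x) \<partial>P) = (\<integral>x. 0 \<partial>P)"
      using False by (intro Bochner_Integration.integral_cong) (auto simp: hit_def clip_def)
    moreover have "clip s v = 0" for v using False by (auto simp: clip_def)
    ultimately show ?thesis by simp
  qed
  have i1: "integrable P (\<lambda>x. hit S s (winner A x) (delay A x))"
    by (rule gi[of "hit S s" 1]) (auto simp: hit_def)
  have i2: "integrable P (\<lambda>x. clip s (delay A x))"
    by (rule gi[of "\<lambda>_. clip s" "max 0 s"]) (use clip_bounds in \<open>auto simp: abs_of_nonneg\<close>)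
  have i3: "integrable P (\<lambda>x. hit S s (winner A x) (delay A x) * clip s (delay A x))"
  proof (rule gi[of "\<lambda>c v. hit S s c v * clip s v" "max 0 s"])
    show "\<bar>hit S s c v * clip s v\<bar> \<le> max 0 s" for c v using clip_bounds[of s v] by (auto simp: hit_def)
  qed measurable
  have i4: "integrable P (\<lambda>x. (clip s (delay A x)) ^ 2)"
  proof (rule gi[of "\<lambda>_ v. (clip s v) ^ 2" "(max 0 s) ^ 2"])
    show "\<bar>(clip s v) ^ 2\<bar> \<le> (max 0 s) ^ 2" for v using clip_bounds[of s v] by (auto intro!: power_mono)
  qed measurable
  show ?mean using main i1 i2 by simp
  show ?hits using main by simp
  have "(hit S s (winner A x) (delay A x) - total_rate S * clip s (delay A x))\<^sup>2 =
    hit S s (winner A x) (delay A x) - 2 * total_rate S * (hit S s (winner A x) (delay A x) * clip s (delay A x)) + (total_rate S)\<^sup>2 * (clip s (delay A x)) ^ 2" for x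
    by (auto simp: hit_def power2_eq_square algebra_simps)
  then show ?var using main i1 i2 i3 i4 by simp
qed

lemma fresh_AE:
  assumes "fresh M NY Y X" "AE x in P. Q x"
  shows "AE w in M. Q (X w)"
proof -
  interpret M: prob_space M using assms by (simp add: fresh_def)
  interpret P: prob_space P by (rule prob_space_P)
  have Y [measurable]: "Y \<in> M \<rightarrow>\<^sub>M NY" and X [measurable]: "X \<in> M \<rightarrow>\<^sub>M P"
    and law: "distr M (NY \<Otimes>\<^sub>M P) (\<lambda>w. (Y w, X w)) = distr M NY Y \<Otimes>\<^sub>M P"
    using assms by (auto simp: fresh_def)
  interpret DY: prob_space "distr M NY Y" by (rule M.prob_space_distr) fact
  obtain N where N: "N \<in> null_sets P" "{x \<in> space P. \<not> Q x} \<subseteq> N" using assms(2) by (auto elim!: AE_E simp: null_sets_def)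
  have [measurable]: "N \<in> sets P" using N by auto
  have "emeasure M (X -` N \<inter> space M) = emeasure (distr M (NY \<Otimes>\<^sub>M P) (\<lambda>w. (Y w, X w))) (space NY \<times> N)"
    by (subst emeasure_distr) (auto intro!: arg_cong2[where f=emeasure] dest: measurable_space[OF Y])
  also have "\<dots> = emeasure (distr M NY Y) (space NY) * emeasure P N"
    unfolding law by (rule P.emeasure_pair_measure_Times) auto
  also have "\<dots> = 0" using N by auto
  finally have "X -` N \<inter> space M \<in> null_sets M" by (intro null_setsI) auto
  then show ?thesis
    by (rule AE_I') (use N measurable_space[OF X] in auto)
qed

lemma fresh_map:
  assumes F: "fresh M NY Y X" and f [measurable]: "f \<in> NY \<rightarrow>\<^sub>M NY'"
  shows "fresh M NY' (\<lambda>w. f (Y w)) X"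
proof -
  interpret M: prob_space M using F by (simp add: fresh_def)
  interpret P: prob_space P by (rule prob_space_P)
  have Y [measurable]: "Y \<in> M \<rightarrow>\<^sub>M NY" and X [measurable]: "X \<in> M \<rightarrow>\<^sub>M P"
    and law: "distr M (NY \<Otimes>\<^sub>M P) (\<lambda>w. (Y w, X w)) = distr M NY Y \<Otimes>\<^sub>M P"
    using F by (auto simp: fresh_def)
  interpret DY: prob_space "distr M NY Y" by (rule M.prob_space_distr) fact
  have "distr M NY' (\<lambda>w. f (Y w)) \<Otimes>\<^sub>M P = distr (distr M NY Y) NY' f \<Otimes>\<^sub>M distr P P (\<lambda>x. x)"
    by (simp add: distr_distr comp_def distr_id)
  also have "\<dots> = distr (distr M NY Y \<Otimes>\<^sub>M P) (NY' \<Otimes>\<^sub>M P) (\<lambda>(y, x). (f y, x))"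
    by (rule pair_measure_distr) (auto simp: distr_id intro: P.sigma_finite_measure_axioms)
  also have "\<dots> = distr M (NY' \<Otimes>\<^sub>M P) (\<lambda>w. (f (Y w), X w))"
    unfolding law[symmetric] by (subst distr_distr) (auto simp: comp_def case_prod_beta)
  finally show ?thesis
    unfolding fresh_def using M.prob_space_axioms by simp
qed

end

text \<open>
  A chain with state space \<open>NY\<close>: in state \<open>y\<close> the clocks in \<open>A y\<close> race, and the winner and the
  duration of the race determine the next state. \<open>T y\<close> is the time at which the chain enters the
  state.
\<close>

locale clock_chain = clocks C mu + prob_space M
  for C :: "nat set" and mu :: "nat \<Rightarrow> real" and M :: "'w measure" +
  fixes NY :: "'y measure" and A :: "'y \<Rightarrow> nat set" and \<phi> :: "'y \<Rightarrow> nat \<Rightarrow> real \<Rightarrow> 'y"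
    and T :: "'y \<Rightarrow> real" and Y :: "nat \<Rightarrow> 'w \<Rightarrow> 'y" and X :: "nat \<Rightarrow> 'w \<Rightarrow> nat \<times> nat \<Rightarrow> real"
  assumes A_measurable: "A \<in> NY \<rightarrow>\<^sub>M clock_sets"
    and phi_measurable: "(\<lambda>(y, c, v). \<phi> y c v) \<in> NY \<Otimes>\<^sub>M (count_space UNIV \<Otimes>\<^sub>M borel) \<rightarrow>\<^sub>M NY"
    and T_measurable [measurable]: "T \<in> borel_measurable NY"
    and T_phi: "\<And>y c v. T (\<phi> y c v) = T y + v"
    and T_0: "\<And>w. w \<in> space M \<Longrightarrow> T (Y 0 w) = 0"
    and fresh_0: "fresh M NY (Y 0) (X 0)"
    and Y_Suc: "\<And>n w. Y (Suc n) w = \<phi> (Y n w) (winner (A (Y n w)) (X n w)) (delay (A (Y n w)) (X n w))"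
    and X_Suc: "\<And>n w. X (Suc n) w = advance (A (Y n w)) (X n w)"
begin

abbreviation "win n w \<equiv> winner (A (Y n w)) (X n w)"
abbreviation "del n w \<equiv> delay (A (Y n w)) (X n w)"

lemma active_subset: "y \<in> space NY \<Longrightarrow> A y \<subseteq> C" "y \<in> space NY \<Longrightarrow> A y \<noteq> {}"
  using measurable_space[OF A_measurable] by auto

lemma fresh_n: "fresh M NY (Y n) (X n)"
proof (induction n)
  case (Suc n)
  show ?case
    using fresh_step[OF Suc A_measurable phi_measurable]
    by (simp add: Y_Suc[abs_def] X_Suc[abs_def])
qed (rule fresh_0)

lemma Y_measurable [measurable]: "Y n \<in> M \<rightarrow>\<^sub>M NY" and X_measurable [measurable]: "X n \<in> M \<rightarrow>\<^sub>M P"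
  using fresh_n[of n] by (auto simp: fresh_def)

lemma AE_all_good: "AE w in M. \<forall>n. good (X n w)"
  unfolding AE_all_countable using fresh_AE[OF fresh_n AE_good] by blast

lemma AE_del_pos: "AE w in M. \<forall>n. 0 < del n w"
  using AE_all_good AE_space
proof eventually_elim
  case (elim w)
  have "0 < del n w" for n
  proof -
    have y: "Y n w \<in> space NY" using measurable_space[OF Y_measurable elim(2)] .
    have "win n w \<in> C" using good_wins(2)[of "X n w" "A (Y n w)"] elim(1) active_subset[OF y] by blast
    then show ?thesis using elim(1) by (auto simp: good_def delay_def K_def)
  qed
  then show ?case by blast
qed

lemma T_Suc: "T (Y (Suc n) w) = T (Y n w) + del n w"
  by (simp add: Y_Suc T_phi)

text \<open>
  Accumulated functionals of the past races may be added to the state, so they too are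
  independent of the coming race.
\<close>

lemma fresh_sum:
  fixes h :: "'y \<Rightarrow> nat \<Rightarrow> real \<Rightarrow> real"
  assumes h: "(\<lambda>(y, c, v). h y c v) \<in> borel_measurable (NY \<Otimes>\<^sub>M (count_space UNIV \<Otimes>\<^sub>M borel))"
  shows "fresh M (NY \<Otimes>\<^sub>M borel) (\<lambda>w. (Y n w, \<Sum>m<n. h (Y m w) (win m w) (del m w))) (X n)"
proof (induction n)
  case 0
  show ?case using fresh_map[OF fresh_0, of "\<lambda>y. (y, 0::real)" "NY \<Otimes>\<^sub>M borel"] by simp
next
  case (Suc n)
  have A': "(\<lambda>p. A (fst p)) \<in> NY \<Otimes>\<^sub>M borel \<rightarrow>\<^sub>M clock_sets"
    by (rule measurable_compose[OF measurable_fst A_measurable])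
  have "(\<lambda>q. (\<lambda>(y, c, v). \<phi> y c v) (fst (fst q), snd q)) \<in> (NY \<Otimes>\<^sub>M (borel::real measure)) \<Otimes>\<^sub>M (count_space UNIV \<Otimes>\<^sub>M borel) \<rightarrow>\<^sub>M NY"
    by (rule measurable_compose[OF _ phi_measurable]) measurable
  moreover have "(\<lambda>q. (\<lambda>(y, c, v). h y c v) (fst (fst q), snd q)) \<in> borel_measurable ((NY \<Otimes>\<^sub>M (borel::real measure)) \<Otimes>\<^sub>M (count_space UNIV \<Otimes>\<^sub>M borel))"
    by (rule measurable_compose[OF _ h]) measurable
  ultimately have "(\<lambda>(yz, c, v). (\<phi> (fst yz) c v, snd yz + h (fst yz) c v)) \<in> (NY \<Otimes>\<^sub>M borel) \<Otimes>\<^sub>M (count_space UNIV \<Otimes>\<^sub>M borel) \<rightarrow>\<^sub>M (NY \<Otimes>\<^sub>M borel)"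
    by (simp add: case_prod_beta)
  from fresh_step[OF Suc A' this]
  show ?case by (simp add: Y_Suc[abs_def] X_Suc[abs_def])
qed

end

section \<open>Jump counts and their compensators\<close>

context clock_chain
begin

lemma AE_T_nonneg: "AE w in M. \<forall>n. 0 \<le> T (Y n w) \<and> T (Y n w) < T (Y (Suc n) w)"
  using AE_del_pos AE_space
proof eventually_elim
  case (elim w)
  have "0 \<le> T (Y n w)" for n
    by (induction n) (use T_0[OF elim(2)] elim(1) in \<open>auto simp: T_Suc intro: add_nonneg_nonneg less_imp_le\<close>)
  then show ?case using elim(1) by (auto simp: T_Suc)
qed

lemma sum_clip:
  assumes "\<forall>n. 0 \<le> T (Y n w) \<and> T (Y n w) < T (Y (Suc n) w)" "T (Y 0 w) = 0" "0 \<le> t"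
  shows "(\<Sum>m<n. clip (t - T (Y m w)) (del m w)) = min (T (Y n w)) t"
proof (induction n)
  case (Suc n)
  have "clip (t - T (Y n w)) (del n w) = min (T (Y (Suc n) w)) t - min (T (Y n w)) t"
    using assms(1)[rule_format, of n] by (auto simp: clip_def T_Suc)
  then show ?case using Suc by simp
qed (use assms in simp)

lemma transition_measurable:
  fixes g :: "'y \<Rightarrow> nat \<Rightarrow> real \<Rightarrow> real"
  assumes "(\<lambda>(y, c, v). g y c v) \<in> borel_measurable (NY \<Otimes>\<^sub>M (count_space UNIV \<Otimes>\<^sub>M borel))"
  shows "(\<lambda>p. g (fst p) (winner (A (fst p)) (snd p)) (delay (A (fst p)) (snd p))) \<in> borel_measurable (NY \<Otimes>\<^sub>M P)"
    and "(\<lambda>w. g (Y n w) (win n w) (del n w)) \<in> borel_measurable M"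
proof -
  note [measurable] = winner_pair_measurable[OF A_measurable]
  have "(\<lambda>p. (\<lambda>(y, c, v). g y c v) (fst p, winner (A (fst p)) (snd p), delay (A (fst p)) (snd p))) \<in> borel_measurable (NY \<Otimes>\<^sub>M P)"
    by (rule measurable_compose[OF _ assms]) measurable
  then show 1: "(\<lambda>p. g (fst p) (winner (A (fst p)) (snd p)) (delay (A (fst p)) (snd p))) \<in> borel_measurable (NY \<Otimes>\<^sub>M P)"
    by simp
  show "(\<lambda>w. g (Y n w) (win n w) (del n w)) \<in> borel_measurable M"
    using measurable_compose[OF _ 1, of "\<lambda>w. (Y n w, X n w)" M] by simp
qed

end

text \<open>
  Counting the rings, up to time \<open>t\<close>, of clocks in a set \<open>S y\<close> that depends on the state.
\<close>

locale clock_count = clock_chain C mu M NY A \<phi> T Y X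
  for C mu and M :: "'w measure" and NY :: "'y measure" and A \<phi> T Y X +
  fixes S :: "'y \<Rightarrow> nat set" and t :: real
  assumes S_measurable: "S \<in> NY \<rightarrow>\<^sub>M count_space (Pow C)"
    and S_sub: "\<And>y. y \<in> space NY \<Longrightarrow> S y \<subseteq> A y"
    and t_nonneg: "0 \<le> t"
begin

definition hits :: "nat \<Rightarrow> 'w \<Rightarrow> real" where
  "hits m w = hit (S (Y m w)) (t - T (Y m w)) (win m w) (del m w)"
definition compensator :: "nat \<Rightarrow> 'w \<Rightarrow> real" where
  "compensator m w = total_rate (S (Y m w)) * clip (t - T (Y m w)) (del m w)"
definition excess :: "nat \<Rightarrow> 'w \<Rightarrow> real" where
  "excess n w = (\<Sum>m<n. hits m w - compensator m w)"

lemma hit_clip_measurable: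
  "(\<lambda>(y, c, v). hit (S y) (t - T y) c v) \<in> borel_measurable (NY \<Otimes>\<^sub>M (count_space UNIV \<Otimes>\<^sub>M borel))"
  "(\<lambda>(y, c::nat, v). total_rate (S y) * clip (t - T y) v) \<in> borel_measurable (NY \<Otimes>\<^sub>M (count_space UNIV \<Otimes>\<^sub>M borel))"
proof -
  have cnt: "countable (Pow C)" using finite_C by (simp add: countable_finite)
  have "Measurable.pred (NY \<Otimes>\<^sub>M (count_space UNIV \<Otimes>\<^sub>M (borel :: real measure))) (\<lambda>p. fst (snd p) \<in> S (fst p))"
    by (rule measurable_compose_countable'[OF _ measurable_compose[OF measurable_fst S_measurable] cnt, where f="\<lambda>B p. fst (snd p) \<in> B"]) simp
  note [measurable] = this
  have [measurable]: "(\<lambda>y. total_rate (S y)) \<in> borel_measurable NY"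
    by (rule measurable_compose[OF S_measurable]) simp
  show "(\<lambda>(y, c, v). hit (S y) (t - T y) c v) \<in> borel_measurable (NY \<Otimes>\<^sub>M (count_space UNIV \<Otimes>\<^sub>M borel))"
    unfolding hit_def case_prod_beta by measurable
  show "(\<lambda>(y, c::nat, v). total_rate (S y) * clip (t - T y) v) \<in> borel_measurable (NY \<Otimes>\<^sub>M (count_space UNIV \<Otimes>\<^sub>M borel))"
    unfolding clip_def case_prod_beta by measurable
qed

lemma increment_measurable: "(\<lambda>(y, c, v). hit (S y) (t - T y) c v - total_rate (S y) * clip (t - T y) v) \<in> borel_measurable (NY \<Otimes>\<^sub>M (count_space UNIV \<Otimes>\<^sub>M borel))"
  using borel_measurable_diff[OF hit_clip_measurable] by (simp add: case_prod_beta)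

lemma hits_measurable [measurable]: "hits m \<in> borel_measurable M" "compensator m \<in> borel_measurable M"
  unfolding hits_def compensator_def using transition_measurable(2)[OF hit_clip_measurable(1)] transition_measurable(2)[OF hit_clip_measurable(2)] by auto

lemma AE_bounds: "AE w in M. \<forall>m. 0 \<le> hits m w \<and> hits m w \<le> 1 \<and> 0 \<le> compensator m w \<and> compensator m w \<le> total_rate C * t
   \<and> \<bar>hits m w - compensator m w\<bar> \<le> 1 + total_rate C * t"
  using AE_T_nonneg AE_space
proof eventually_elim
  case (elim w)
  show ?case
  proof
    fix m
    have y: "Y m w \<in> space NY" using measurable_space[OF Y_measurable elim(2)] .
    have "S (Y m w) \<subseteq> C" using S_sub[OF y] active_subset[OF y] by blast
    then have 1: "total_rate (S (Y m w)) \<le> total_rate C" by (rule total_rate_mono)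
    have 2: "clip (t - T (Y m w)) (del m w) \<le> t" using clip_bounds(2)[of "t - T (Y m w)" "del m w"] elim(1) t_nonneg
      by (meson diff_le_eq le_add_same_cancel1 max.boundedI order_trans)
    have 3: "0 \<le> compensator m w" unfolding compensator_def by (intro mult_nonneg_nonneg total_rate_nonneg clip_bounds)
    have 4: "compensator m w \<le> total_rate C * t" unfolding compensator_def by (intro mult_mono 1 2 total_rate_nonneg clip_bounds)
    have 5: "0 \<le> hits m w" "hits m w \<le> 1" unfolding hits_def by (rule hit_bounds)+
    show "0 \<le> hits m w \<and> hits m w \<le> 1 \<and> 0 \<le> compensator m w \<and> compensator m w \<le> total_rate C * t \<and> \<bar>hits m w - compensator m w\<bar> \<le> 1 + total_rate C * t"
      using 3 4 5 by linarith
  qed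
qed

lemma AE_excess_bound: "AE w in M. \<bar>excess n w\<bar> \<le> real n * (1 + total_rate C * t)"
  using AE_bounds
proof eventually_elim
  case (elim w)
  have "\<bar>excess n w\<bar> \<le> (\<Sum>m<n. \<bar>hits m w - compensator m w\<bar>)" unfolding excess_def by (rule sum_abs)
  also have "\<dots> \<le> (\<Sum>m<n. 1 + total_rate C * t)" by (rule sum_mono) (use elim in auto)
  finally show ?case by simp
qed

text \<open>The clipped durations of all races add up to at most \<open>t\<close>.\<close>

lemma AE_sum_compensator: "AE w in M. (\<Sum>m<n. compensator m w) \<le> total_rate C * t"
  using AE_T_nonneg AE_space
proof eventually_elim
  case (elim w)
  have "(\<Sum>m<n. compensator m w) \<le> (\<Sum>m<n. total_rate C * clip (t - T (Y m w)) (del m w))"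
  proof (rule sum_mono)
    fix m
    have y: "Y m w \<in> space NY" using measurable_space[OF Y_measurable elim(2)] .
    have "S (Y m w) \<subseteq> C" using S_sub[OF y] active_subset[OF y] by blast
    then show "compensator m w \<le> total_rate C * clip (t - T (Y m w)) (del m w)"
      unfolding compensator_def by (intro mult_right_mono total_rate_mono clip_bounds)
  qed
  also have "\<dots> = total_rate C * min (T (Y n w)) t"
    unfolding sum_distrib_left[symmetric] using sum_clip[OF elim(1) T_0[OF elim(2)] t_nonneg] by simp
  also have "\<dots> \<le> total_rate C * t" by (intro mult_left_mono total_rate_nonneg) simp
  finally show ?case .
qed

lemma integrable_hits: "integrable M (hits m)" "integrable M (compensator m)"
proof -
  show "integrable M (hits m)"
    by (rule integrable_const_bound[of _ 1]) (use AE_bounds in \<open>auto elim!: eventually_mono\<close>)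
  show "integrable M (compensator m)"
    by (rule integrable_const_bound[of _ "total_rate C * t"]) (use AE_bounds in \<open>auto elim!: eventually_mono\<close>)
qed

lemma expectation_hits: "expectation (hits m) = expectation (compensator m)"
proof -
  let ?F = "\<lambda>p. hit (S (fst p)) (t - T (fst p)) (winner (A (fst p)) (snd p)) (delay (A (fst p)) (snd p))"
  let ?G = "\<lambda>p. total_rate (S (fst p)) * clip (t - T (fst p)) (delay (A (fst p)) (snd p))"
  have "expectation (hits m) = (\<integral>w. (\<integral>x. ?F (Y m w, x) \<partial>P) \<partial>M)"
    using fresh_expectation(1)[OF fresh_n transition_measurable(1)[OF hit_clip_measurable(1)], of m] integrable_hits(1)[of m]
    by (simp add: hits_def[abs_def])
  also have "\<dots> = (\<integral>w. (\<integral>x. ?G (Y m w, x) \<partial>P) \<partial>M)"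
  proof (rule Bochner_Integration.integral_cong[OF refl])
    fix w assume "w \<in> space M"
    then have y: "Y m w \<in> space NY" by (rule measurable_space[OF Y_measurable])
    show "(\<integral>x. ?F (Y m w, x) \<partial>P) = (\<integral>x. ?G (Y m w, x) \<partial>P)"
      using one_step_moments(3)[OF active_subset[OF y] S_sub[OF y]] by simp
  qed
  also have "\<dots> = expectation (compensator m)"
    using fresh_expectation(1)[OF fresh_n transition_measurable(1)[OF hit_clip_measurable(2)], of m] integrable_hits(2)[of m]
    by (simp add: compensator_def[abs_def])
  finally show ?thesis .
qed

lemma integrable_square: "integrable M (\<lambda>w. (hits m w - compensator m w)\<^sup>2)" "integrable M (\<lambda>w. (excess n w)\<^sup>2)"
    "integrable M (\<lambda>w. excess n w * (hits m w - compensator m w))"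
proof -
  have [measurable]: "excess n \<in> borel_measurable M" unfolding excess_def[abs_def] by measurable
  have b: "0 \<le> 1 + total_rate C * t" using total_rate_nonneg t_nonneg by simp
  show "integrable M (\<lambda>w. (hits m w - compensator m w)\<^sup>2)"
  proof (rule integrable_const_bound[of _ "(1 + total_rate C * t)\<^sup>2"])
    show "AE w in M. norm ((hits m w - compensator m w)\<^sup>2) \<le> (1 + total_rate C * t)\<^sup>2"
      using AE_bounds by eventually_elim (simp add: abs_le_square_iff[symmetric] b)
  qed measurable
  show "integrable M (\<lambda>w. (excess n w)\<^sup>2)"
  proof (rule integrable_const_bound[of _ "(real n * (1 + total_rate C * t))\<^sup>2"])
    show "AE w in M. norm ((excess n w)\<^sup>2) \<le> (real n * (1 + total_rate C * t))\<^sup>2"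
      using AE_excess_bound[of n] by eventually_elim (use b in \<open>simp add: abs_le_square_iff[symmetric] abs_mult\<close>)
  qed measurable
  show "integrable M (\<lambda>w. excess n w * (hits m w - compensator m w))"
  proof (rule integrable_const_bound[of _ "real n * (1 + total_rate C * t) * (1 + total_rate C * t)"])
    show "AE w in M. norm (excess n w * (hits m w - compensator m w)) \<le> real n * (1 + total_rate C * t) * (1 + total_rate C * t)"
      using AE_excess_bound[of n] AE_bounds
    proof eventually_elim
      case (elim w)
      have "\<bar>excess n w\<bar> * \<bar>hits m w - compensator m w\<bar> \<le> (real n * (1 + total_rate C * t)) * (1 + total_rate C * t)"
        using elim b by (intro mult_mono) auto
      then show ?case by (simp add: abs_mult)
    qed
  qed measurable
qed

lemma expectation_square_step: "expectation (\<lambda>w. (hits m w - compensator m w)\<^sup>2) = expectation (compensator m)"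
proof -
  let ?F = "\<lambda>p. (hit (S (fst p)) (t - T (fst p)) (winner (A (fst p)) (snd p)) (delay (A (fst p)) (snd p))
     - total_rate (S (fst p)) * clip (t - T (fst p)) (delay (A (fst p)) (snd p)))\<^sup>2"
  let ?G = "\<lambda>p. total_rate (S (fst p)) * clip (t - T (fst p)) (delay (A (fst p)) (snd p))"
  have "?F \<in> borel_measurable (NY \<Otimes>\<^sub>M P)"
    by (intro borel_measurable_power transition_measurable(1)[OF increment_measurable])
  then have "expectation (\<lambda>w. (hits m w - compensator m w)\<^sup>2) = (\<integral>w. (\<integral>x. ?F (Y m w, x) \<partial>P) \<partial>M)"
    using fresh_expectation(1)[OF fresh_n, of ?F m] integrable_square(1)[of m]
    by (simp add: hits_def[abs_def] compensator_def[abs_def])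
  also have "\<dots> = (\<integral>w. (\<integral>x. ?G (Y m w, x) \<partial>P) \<partial>M)"
  proof (rule Bochner_Integration.integral_cong[OF refl])
    fix w assume "w \<in> space M"
    then have y: "Y m w \<in> space NY" by (rule measurable_space[OF Y_measurable])
    show "(\<integral>x. ?F (Y m w, x) \<partial>P) = (\<integral>x. ?G (Y m w, x) \<partial>P)"
      using one_step_moments(2)[OF active_subset[OF y] S_sub[OF y]] by simp
  qed
  also have "\<dots> = expectation (compensator m)"
    using fresh_expectation(1)[OF fresh_n transition_measurable(1)[OF hit_clip_measurable(2)], of m] integrable_hits(2)[of m]
    by (simp add: compensator_def[abs_def])
  finally show ?thesis .
qed

text \<open>
  Orthogonality of martingale increments: the accumulated excess belongs to the past of race
  \<open>m\<close>.
\<close>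

lemma expectation_cross: "expectation (\<lambda>w. excess m w * (hits m w - compensator m w)) = 0"
proof -
  let ?h = "\<lambda>y c v. hit (S y) (t - T y) c v - total_rate (S y) * clip (t - T y) v"
  let ?F = "\<lambda>p. snd (fst p) * ?h (fst (fst p)) (winner (A (fst (fst p))) (snd p)) (delay (A (fst (fst p))) (snd p))"
  have fr: "fresh M (NY \<Otimes>\<^sub>M borel) (\<lambda>w. (Y m w, excess m w)) (X m)"
    using fresh_sum[OF increment_measurable, of m] by (simp add: excess_def hits_def compensator_def)
  have "(\<lambda>q. ?h (fst q) (winner (A (fst q)) (snd q)) (delay (A (fst q)) (snd q))) \<in> borel_measurable (NY \<Otimes>\<^sub>M P)"
    by (rule transition_measurable(1)[OF increment_measurable])
  from measurable_compose[OF _ this, of "\<lambda>p. (fst (fst p), snd p)" "(NY \<Otimes>\<^sub>M borel) \<Otimes>\<^sub>M P"]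
  have Fm: "?F \<in> borel_measurable ((NY \<Otimes>\<^sub>M borel) \<Otimes>\<^sub>M P)"
    by (intro borel_measurable_times[of "\<lambda>p. snd (fst p)"]) simp_all
  have "expectation (\<lambda>w. excess m w * (hits m w - compensator m w)) = (\<integral>w. (\<integral>x. ?F ((Y m w, excess m w), x) \<partial>P) \<partial>M)"
    using fresh_expectation(1)[OF fr Fm] integrable_square(3)[of m m]
    by (simp add: hits_def[abs_def] compensator_def[abs_def])
  also have "\<dots> = (\<integral>w. 0 \<partial>M)"
  proof (rule Bochner_Integration.integral_cong[OF refl])
    fix w assume "w \<in> space M"
    then have y: "Y m w \<in> space NY" by (rule measurable_space[OF Y_measurable])
    show "(\<integral>x. ?F ((Y m w, excess m w), x) \<partial>P) = 0"
      using one_step_moments(1)[OF active_subset[OF y] S_sub[OF y], of "t - T (Y m w)"] by simp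
  qed
  finally show ?thesis by simp
qed

text \<open>
  Orthogonal increments, whose second moments are the means of the compensator, which in total
  is at most the total rate times \<open>t\<close>. The bound does not depend on the number of races.
\<close>

lemma excess_second_moment: "expectation (\<lambda>w. (excess n w)\<^sup>2) \<le> total_rate C * t"
proof -
  have "expectation (\<lambda>w. (excess n w)\<^sup>2) = (\<Sum>m<n. expectation (compensator m))"
  proof (induction n)
    case (Suc n)
    have "(excess (Suc n) w)\<^sup>2 = (excess n w)\<^sup>2 + 2 * (excess n w * (hits n w - compensator n w)) + (hits n w - compensator n w)\<^sup>2" for w
      by (simp add: excess_def power2_eq_square algebra_simps)
    then have "expectation (\<lambda>w. (excess (Suc n) w)\<^sup>2) = expectation (\<lambda>w. (excess n w)\<^sup>2)
       + 2 * expectation (\<lambda>w. excess n w * (hits n w - compensator n w)) + expectation (\<lambda>w. (hits n w - compensator n w)\<^sup>2)"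
      using integrable_square(1)[of n] integrable_square(2)[of n] integrable_square(3)[of n n] by simp
    then show ?case using Suc expectation_cross[of n] expectation_square_step[of n] by simp
  qed (simp add: excess_def)
  also have "\<dots> = expectation (\<lambda>w. \<Sum>m<n. compensator m w)"
    using integrable_hits by (intro Bochner_Integration.integral_sum[symmetric]) auto
  also have "\<dots> \<le> expectation (\<lambda>w. total_rate C * t)"
    using integrable_hits AE_sum_compensator[of n] by (intro integral_mono_AE) auto
  finally show ?thesis by (simp add: prob_space)
qed

lemma prob_excess:
  assumes "0 < e"
  shows "prob {w \<in> space M. e \<le> \<bar>excess n w\<bar>} \<le> total_rate C * t / e\<^sup>2"
proof -
  have [measurable]: "excess n \<in> borel_measurable M" unfolding excess_def[abs_def] by measurable
  have "{w \<in> space M. e \<le> \<bar>excess n w\<bar>} = {w \<in> space M. e\<^sup>2 \<le> (excess n w)\<^sup>2}"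
    using assms by (auto simp: abs_le_square_iff[symmetric])
  also have "prob \<dots> \<le> expectation (\<lambda>w. (excess n w)\<^sup>2) / e\<^sup>2"
    by (rule integral_Markov_inequality_measure[where A="{}"]) (use assms integrable_square(2) in auto)
  also have "\<dots> \<le> total_rate C * t / e\<^sup>2" using excess_second_moment by (intro divide_right_mono) auto
  finally show ?thesis .
qed

lemma expectation_sum_hits: "expectation (\<lambda>w. \<Sum>m<n. hits m w) \<le> total_rate C * t"
proof -
  have "expectation (\<lambda>w. \<Sum>m<n. hits m w) = expectation (\<lambda>w. \<Sum>m<n. compensator m w)"
    using integrable_hits expectation_hits by (simp add: Bochner_Integration.integral_sum)
  also have "\<dots> \<le> expectation (\<lambda>w. total_rate C * t)"
    using integrable_hits AE_sum_compensator[of n] by (intro integral_mono_AE) auto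
  finally show ?thesis by (simp add: prob_space)
qed

end

context clock_chain
begin

text \<open>
  If \<open>n\<close> races end before \<open>t\<close>, then all \<open>n\<close> winners are counted with \<open>S = A\<close>; the expected
  number of rings up to \<open>t\<close> is at most the total rate times \<open>t\<close>.
\<close>

lemma prob_slow:
  assumes t: "0 \<le> t" and n: "0 < n"
  shows "prob {w \<in> space M. T (Y n w) \<le> t} \<le> total_rate C * t / real n"
proof -
  have S: "A \<in> NY \<rightarrow>\<^sub>M count_space (Pow C)"
    using measurable_compose[OF A_measurable, of "\<lambda>x. x" "count_space (Pow C)"] by auto
  interpret count: clock_count C mu M NY A \<phi> T Y X A t
    by unfold_locales (use S t in auto)
  have "prob {w \<in> space M. T (Y n w) \<le> t} \<le> prob {w \<in> space M. real n \<le> (\<Sum>m<n. count.hits m w)}"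
  proof (rule finite_measure_mono_AE)
    show "AE w in M. w \<in> {w \<in> space M. T (Y n w) \<le> t} \<longrightarrow> w \<in> {w \<in> space M. real n \<le> (\<Sum>m<n. count.hits m w)}"
      using AE_T_nonneg AE_all_good AE_space
    proof eventually_elim
      case (elim w)
      show ?case
      proof (intro impI CollectI conjI elim)
        assume "w \<in> {w \<in> space M. T (Y n w) \<le> t}"
        then have le: "T (Y n w) \<le> t" by simp
        have "count.hits m w = 1" if "m < n" for m
        proof -
          have y: "Y m w \<in> space NY" using measurable_space[OF Y_measurable elim(3)] .
          have "win m w \<in> A (Y m w)" using good_wins(2)[of "X m w" "A (Y m w)"] elim(2) active_subset[OF y] by blast
          moreover have "T (Y (Suc m) w) \<le> T (Y n w)"
            using that elim(1) lift_Suc_mono_le[of "\<lambda>n. T (Y n w)" "Suc m" n] by (auto intro: less_imp_le)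
          ultimately show ?thesis using le by (simp add: count.hits_def hit_def T_Suc)
        qed
        then show "real n \<le> (\<Sum>m<n. count.hits m w)" by simp
      qed
    qed
  qed measurable
  also have "\<dots> \<le> expectation (\<lambda>w. \<Sum>m<n. count.hits m w) / real n"
  proof (rule integral_Markov_inequality_measure[where A="{}"])
    show "integrable M (\<lambda>w. \<Sum>m<n. count.hits m w)"
      using count.integrable_hits by (intro Bochner_Integration.integrable_sum) auto
    show "AE w in M. 0 \<le> (\<Sum>m<n. count.hits m w)"
      by (intro AE_I2 sum_nonneg) (simp add: count.hits_def hit_def)
  qed (use n in auto)
  also have "\<dots> \<le> total_rate C * t / real n"
    using count.expectation_sum_hits by (intro divide_right_mono) auto
  finally show ?thesis .
qed

end

section \<open>From the queue equation to the jump chain\<close>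

text \<open>The set is a finite union of intervals between jump times.\<close>

lemma jumps_within_measurable:
  assumes F: "jumps_within x 0 t F"
  shows "{s \<in> {0..t}. Q (x s)} \<in> sets borel"
proof -
  note F = jumps_withinD[OF F]
  have "{s \<in> {0..t}. Q (x s)} = (\<Union>r\<in>{r \<in> insert 0 F. Q (x r)}. {s \<in> {0..t}. r \<le> s \<and> (\<forall>r'\<in>{r' \<in> F. r < r'}. s < r')})" (is "?L = ?R")
  proof (intro equalityI subsetI)
    fix s assume s: "s \<in> ?L"
    let ?S = "{r \<in> insert 0 F. r \<le> s}"
    define r where "r = Max ?S"
    have fin: "finite ?S" "?S \<noteq> {}" using F(1) s by auto
    then have r: "r \<in> ?S" unfolding r_def by (rule Max_in)
    have max: "r' \<le> r" if "r' \<in> ?S" for r' unfolding r_def using fin(1) that by (rule Max_ge)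
    have r0: "0 \<le> r" using max[of 0] s by simp
    have gap: "s < r'" if "r' \<in> F" "r < r'" for r' using max[of r'] that by force
    have "x r = x s" by (rule F(3)) (use r r0 s gap in force)+
    then show "s \<in> ?R" using r s gap by auto
  next
    fix s assume "s \<in> ?R"
    then obtain r where r: "r \<in> insert 0 F" "Q (x r)" "s \<in> {0..t}" "r \<le> s" "\<And>r'. r' \<in> F \<Longrightarrow> r < r' \<Longrightarrow> s < r'" by auto
    have "x r = x s" by (rule F(3)) (use r F(2) in force)+
    then show "s \<in> ?L" using r by simp
  qed
  also have "\<dots> \<in> sets borel"
  proof (rule sets.finite_UN)
    show "finite {r \<in> insert 0 F. Q (x r)}" using F(1) by simp
    fix r
    have "{s \<in> {0..t}. r \<le> s \<and> (\<forall>r'\<in>{r' \<in> F. r < r'}. s < r')} = {0..t} \<inter> {r..} \<inter> {s. \<forall>r'\<in>{r' \<in> F. r < r'}. s < r'}" by auto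
    also have "\<dots> \<in> sets borel"
    proof (intro sets.Int)
      have "{s \<in> space borel. \<forall>r'\<in>{r' \<in> F. r < r'}. s < (r' :: real)} \<in> sets borel"
        using F(1) by (intro sets.sets_Collect_finite_All) auto
      then show "{s. \<forall>r'\<in>{r' \<in> F. r < r'}. s < r'} \<in> sets borel" by simp
    qed auto
    finally show "{s \<in> {0..t}. r \<le> s \<and> (\<forall>r'\<in>{r' \<in> F. r < r'}. s < r')} \<in> sets borel" .
  qed
  finally show ?thesis .
qed

lemma card_partial_sums:
  fixes S :: "nat \<Rightarrow> real"
  assumes S: "strict_mono S" and "\<And>i. i < d \<Longrightarrow> S i \<le> B" and "B < S d"
  shows "{n. S n \<le> B} = {..<d}"
proof (intro equalityI subsetI)
  fix n assume "n \<in> {n. S n \<le> B}"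
  then have "S n < S d" using assms(3) by simp
  then show "n \<in> {..<d}" using strict_mono_less[OF S] by simp
qed (use assms in auto)

text \<open>
  One trajectory of the queues \<open>l\<close>, given by the queue equation \<open>dynamics\<close>, next to a trajectory
  of the jump chain fed by the same service times, interarrival times and seeds. Clock \<open>j < N\<close>
  is the server in position \<open>j\<close>, which races when it is busy; clock \<open>N\<close> is the stream of
  arrivals, which always races. Before jump \<open>n\<close> the chain has queue lengths \<open>x n\<close>, has seen
  \<open>k n\<close> arrivals, and \<open>Xi n (j, m)\<close> are the waiting times still to come; \<open>c n\<close> wins the race.
\<close>

locale jsq_trace =
  fixes N :: nat and b :: enat and pick :: "(nat \<Rightarrow> nat) \<Rightarrow> real \<Rightarrow> nat"
    and gap :: "nat \<Rightarrow> real" and svc :: "nat \<Rightarrow> nat \<Rightarrow> real" and seed :: "nat \<Rightarrow> real"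
    and l :: "nat \<Rightarrow> real \<Rightarrow> nat"
    and x :: "nat \<Rightarrow> nat list" and k :: "nat \<Rightarrow> nat" and T :: "nat \<Rightarrow> real" and Xi :: "nat \<Rightarrow> nat \<times> nat \<Rightarrow> real"
    and c :: "nat \<Rightarrow> nat"
  fixes arrival before dest busy
  defines "arrival \<equiv> \<lambda>k. \<Sum>i\<le>k. gap i"
    and "before \<equiv> \<lambda>k. \<lambda>j\<in>{..<N}. Lim (at_left (arrival k)) (l j)"
    and "dest \<equiv> \<lambda>k. pick (before k) (seed k)"
    and "busy \<equiv> \<lambda>j t. measure lborel {s \<in> {0..t}. 0 < l j s}"
  assumes rule: "jsq_rule N pick"
    and gap_pos: "\<And>i. 0 < gap i" and svc_pos: "\<And>j i. j < N \<Longrightarrow> 0 < svc j i"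
    and l_measurable: "\<And>j t. j < N \<Longrightarrow> {s \<in> {0..t}. 0 < l j s} \<in> sets borel"
    and dynamics: "\<And>j t. j < N \<Longrightarrow> 0 \<le> t \<Longrightarrow>
         l j t + card {n. (\<Sum>i\<le>n. svc j i) \<le> busy j t} =
         l j 0 + card {k. arrival k \<le> t \<and> dest k = j \<and> enat (before k j) < b}"
    and x_0: "x 0 = map (\<lambda>j. l j 0) [0..<N]" and k_0: "k 0 = 0" and T_0: "T 0 = 0"
    and Xi_0: "\<And>j m. j < N \<Longrightarrow> Xi 0 (j, m) = svc j m" "\<And>m. Xi 0 (N, m) = gap m"
  fixes active del
  defines "active \<equiv> \<lambda>n. insert N {j. j < N \<and> 0 < x n ! j}" and "del \<equiv> \<lambda>n. Xi n (c n, 0)"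
  assumes Xi_pos: "\<And>n j m. j \<le> N \<Longrightarrow> 0 < Xi n (j, m)"
    and c_active: "\<And>n. c n \<in> active n" and c_min: "\<And>n j. j \<in> active n \<Longrightarrow> j \<noteq> c n \<Longrightarrow> del n < Xi n (j, 0)"
    and T_Suc: "\<And>n. T (Suc n) = T n + del n"
    and Xi_Suc: "\<And>n j m. j \<le> N \<Longrightarrow> Xi (Suc n) (j, m) =
         (if j = c n then Xi n (j, Suc m) else if j \<in> active n \<and> m = 0 then Xi n (j, 0) - del n else Xi n (j, m))"
    and arrive: "\<And>n. c n = N \<Longrightarrow> k (Suc n) = Suc (k n)"
       "\<And>n j. c n = N \<Longrightarrow> j = pick (\<lambda>j\<in>{..<N}. x n ! j) (seed (k n)) \<Longrightarrow>
          x (Suc n) = (if enat (x n ! j) < b then (x n)[j := Suc (x n ! j)] else x n)"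
    and depart: "\<And>n. c n < N \<Longrightarrow> k (Suc n) = k n" "\<And>n. c n < N \<Longrightarrow> x (Suc n) = (x n)[c n := x n ! c n - 1]"
begin

lemma c_le: "c n \<le> N" using c_active[of n] by (auto simp: active_def)

lemma del_pos: "0 < del n" unfolding del_def by (rule Xi_pos) (rule c_le)

lemma T_less: "T n < T (Suc n)" using del_pos[of n] by (simp add: T_Suc)

lemma T_strict_mono: "strict_mono T" by (rule strict_monoI_Suc) (rule T_less)

lemma T_nonneg: "0 \<le> T n"
  using strict_mono_less_eq[OF T_strict_mono, of 0 n] T_0 by simp

lemma length_x: "length (x n) = N"
proof (induction n)
  case (Suc n)
  then show ?case using c_le[of n] arrive(2)[of n] depart(2)[of n] by (cases "c n = N") auto
qed (simp add: x_0)

lemma del_le: "j \<in> active n \<Longrightarrow> del n \<le> Xi n (j, 0)"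
  using c_min[of j n] by (cases "j = c n") (auto simp: del_def)

abbreviation "S j n \<equiv> \<Sum>i\<le>n. svc j i"

lemma S_mono: "j < N \<Longrightarrow> strict_mono (S j)" by (rule strict_monoI_Suc) (simp add: svc_pos)
lemma arrival_mono: "strict_mono arrival" by (rule strict_monoI_Suc) (simp add: arrival_def gap_pos)

lemma busy_split:
  assumes j: "j < N" and st: "0 \<le> s" "s \<le> t"
  shows "busy j s \<le> busy j t" "busy j t \<le> busy j s + (t - s)"
    and "\<And>p. (\<And>r. s < r \<Longrightarrow> r < t \<Longrightarrow> (0 < l j r) = p) \<Longrightarrow> busy j t = busy j s + (if p then t - s else 0)"
proof -
  have m: "{r \<in> {0..t}. 0 < l j r} \<in> sets borel" for t by (rule l_measurable[OF j])
  have m1: "{r \<in> {s<..t}. 0 < l j r} \<in> sets borel"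
  proof -
    have "{r \<in> {s<..t}. 0 < l j r} = {r \<in> {0..t}. 0 < l j r} \<inter> {s<..t}" using st by auto
    then show ?thesis using m by simp
  qed
  have fm: "{r \<in> {0..s}. 0 < l j r} \<in> fmeasurable lborel" "{r \<in> {s<..t}. 0 < l j r} \<in> fmeasurable lborel"
  proof -
    have f: "{0..t} \<in> fmeasurable lborel" by (rule fmeasurableI) (auto simp: emeasure_lborel_Icc_eq)
    have sub: "{r \<in> {0..s}. 0 < l j r} \<subseteq> {0..t}" "{r \<in> {s<..t}. 0 < l j r} \<subseteq> {0..t}" using st by auto
    have ms: "{r \<in> {0..s}. 0 < l j r} \<in> sets lborel" "{r \<in> {s<..t}. 0 < l j r} \<in> sets lborel"
      unfolding sets_lborel by (rule m) (rule m1)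
    show "{r \<in> {0..s}. 0 < l j r} \<in> fmeasurable lborel" by (rule fmeasurableI2[OF f sub(1) ms(1)])
    show "{r \<in> {s<..t}. 0 < l j r} \<in> fmeasurable lborel" by (rule fmeasurableI2[OF f sub(2) ms(2)])
  qed
  have "{0..t} = {0..s} \<union> {s<..t}" using st by auto
  then have "{r \<in> {0..t}. 0 < l j r} = {r \<in> {0..s}. 0 < l j r} \<union> {r \<in> {s<..t}. 0 < l j r}" by blast
  then have sp: "busy j t = busy j s + measure lborel {r \<in> {s<..t}. 0 < l j r}"
  proof -
    have "{r \<in> {0..s}. 0 < l j r} \<inter> {r \<in> {s<..t}. 0 < l j r} = {}" by auto
    then show ?thesis
      unfolding busy_def \<open>{r \<in> {0..t}. 0 < l j r} = _\<close> measure_Un3[OF fm] by (simp only: measure_empty diff_zero)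
  qed
  have fI: "{s<..t} \<in> fmeasurable lborel" "{t} \<in> fmeasurable lborel"
    by (rule fmeasurableI; use st in \<open>simp add: emeasure_lborel_Ioc\<close>)+
  show "busy j s \<le> busy j t" using sp measure_nonneg[of lborel "{r \<in> {s<..t}. 0 < l j r}"] by linarith
  have "measure lborel {r \<in> {s<..t}. 0 < l j r} \<le> measure lborel {s<..t}"
    by (rule measure_mono_fmeasurable) (use m1 fI in auto)
  then show "busy j t \<le> busy j s + (t - s)" using sp st by simp
  fix p assume p: "\<And>r. s < r \<Longrightarrow> r < t \<Longrightarrow> (0 < l j r) = p"
  have "measure lborel {r \<in> {s<..t}. 0 < l j r} = (if p then t - s else 0)"
  proof (cases p)
    case True
    have "measure lborel {s<..<t} \<le> measure lborel {r \<in> {s<..t}. 0 < l j r}"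
      by (rule measure_mono_fmeasurable) (use fm p True in auto)
    moreover have "measure lborel {r \<in> {s<..t}. 0 < l j r} \<le> measure lborel {s<..t}"
      by (rule measure_mono_fmeasurable) (use m1 fI in auto)
    ultimately show ?thesis using True st by simp
  next
    case False
    have "{r \<in> {s<..t}. 0 < l j r} \<subseteq> {t}"
    proof
      fix r assume r: "r \<in> {r \<in> {s<..t}. 0 < l j r}"
      then have "\<not> r < t" using p[of r] False by auto
      then show "r \<in> {t}" using r by simp
    qed
    then have "measure lborel {r \<in> {s<..t}. 0 < l j r} \<le> measure lborel {t}"
      by (rule measure_mono_fmeasurable) (use m1 fI in simp_all)
    moreover have "measure lborel {t} = 0" by simp
    moreover have "0 \<le> measure lborel {r \<in> {s<..t}. 0 < l j r}" by (rule measure_nonneg)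
    ultimately have "measure lborel {r \<in> {s<..t}. 0 < l j r} = 0" by linarith
    then show ?thesis using False by simp
  qed
  then show "busy j t = busy j s + (if p then t - s else 0)" using sp by simp
qed

lemma busy_0: "j < N \<Longrightarrow> busy j 0 = 0"
proof -
  assume j: "j < N"
  have "busy j 0 \<le> measure lborel {0::real}"
    unfolding busy_def by (rule measure_mono_fmeasurable) (use l_measurable[OF j, of 0] in \<open>auto intro: fmeasurableI\<close>)
  moreover have "0 \<le> busy j 0" unfolding busy_def by (rule measure_nonneg)
  ultimately show ?thesis by simp
qed

text \<open>
  The invariant of the induction over jumps, where \<open>d j\<close> tasks have left server \<open>j\<close>: the chain
  has the queue lengths of the trajectory, and its clocks show the remaining service times and
  the remaining time to the next arrival.
\<close>

definition synced :: "nat \<Rightarrow> (nat \<Rightarrow> nat) \<Rightarrow> bool" where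
  "synced n d \<longleftrightarrow>
    (\<forall>j<N. l j (T n) = x n ! j \<and> Xi n (j, 0) = S j (d j) - busy j (T n) \<and>
       (\<forall>m>0. Xi n (j, m) = svc j (d j + m)) \<and> (\<forall>i<d j. S j i \<le> busy j (T n))) \<and>
    Xi n (N, 0) = arrival (k n) - T n \<and> (\<forall>m>0. Xi n (N, m) = gap (k n + m)) \<and> (\<forall>i<k n. arrival i \<le> T n)"

abbreviation "accepted K j \<equiv> card {i. i < K \<and> dest i = j \<and> enat (before i j) < b}"

text \<open>
  The queue equation when the numbers \<open>d\<close> of departures and \<open>K\<close> of arrivals are known.
\<close>

lemma dynamics':
  assumes j: "j < N" and t: "0 \<le> t" and d: "\<And>i. i < d \<Longrightarrow> S j i \<le> busy j t" "busy j t < S j d"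
    and K: "\<And>i. i < K \<Longrightarrow> arrival i \<le> t" "t < arrival K"
  shows "l j t + d = l j 0 + accepted K j"
proof -
  have "{n. S j n \<le> busy j t} = {..<d}" by (rule card_partial_sums[OF S_mono[OF j] d])
  moreover have "{k. arrival k \<le> t} = {..<K}" by (rule card_partial_sums[OF arrival_mono K])
  then have "{k. arrival k \<le> t \<and> dest k = j \<and> enat (before k j) < b} = {i. i < K \<and> dest i = j \<and> enat (before i j) < b}"
    by auto
  ultimately show ?thesis using dynamics[OF j t] by simp
qed

lemma synced_0: "synced 0 (\<lambda>_. 0)"
  using busy_0 by (auto simp: synced_def T_0 x_0 k_0 Xi_0 arrival_def)

lemma synced_base:
  assumes s: "synced n d" and j: "j < N"
  shows "x n ! j + d j = l j 0 + accepted (k n) j"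
proof -
  have "Xi n (j, 0) > 0" "Xi n (N, 0) > 0" using Xi_pos j by auto
  then have "l j (T n) + d j = l j 0 + accepted (k n) j"
    using s j by (intro dynamics' T_nonneg) (auto simp: synced_def)
  then show ?thesis using s j by (simp add: synced_def)
qed

text \<open>
  Before the next jump of the chain no service is completed and nobody arrives, so the queue
  equation keeps the queue length. For an idle server this is circular at first sight: the
  equation would permit a departure if the server had been busy, and it is busy only if its
  queue is not empty. But right after the first time \<open>r0\<close> at which the queue is not empty its
  busy time is still too short for a departure, and the equation returns an empty queue.
\<close>

lemma synced_constant:
  assumes s: "synced n d" and j: "j < N" and t: "T n \<le> t" "t < T (Suc n)"
  shows "l j t = x n ! j"
proof -
  have K: "i < k n \<Longrightarrow> arrival i \<le> t" "t < arrival (k n)" if "T n \<le> t" "t < T (Suc n)" for i t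
    using s that del_le[of N n] by (auto simp: synced_def T_Suc active_def intro: order_trans)
  have d0: "S j i \<le> busy j t" if "i < d j" "T n \<le> t" for i t
    using s j that busy_split(1)[OF j T_nonneg that(2)] by (auto simp: synced_def intro: order_trans)
  have fin: "l j t = x n ! j" if t: "T n \<le> t" "t < T (Suc n)" and lt: "busy j t < S j (d j)" for t
  proof -
    have "l j t + d j = l j 0 + accepted (k n) j"
      by (rule dynamics'[OF j _ d0 lt K[OF t]]) (use t T_nonneg[of n] in auto)
    then show ?thesis using synced_base[OF s j] by simp
  qed
  have Xi: "S j (d j) = busy j (T n) + Xi n (j, 0)" "0 < Xi n (j, 0)" using s j Xi_pos[of j n 0] by (auto simp: synced_def)
  show ?thesis
  proof (cases "0 < x n ! j")
    case True
    then have "del n \<le> Xi n (j, 0)" using j by (intro del_le) (simp add: active_def)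
    then show ?thesis using busy_split(2)[OF j T_nonneg t(1)] t Xi by (intro fin t) (simp add: T_Suc)
  next
    case False
    have idle: "x n ! j = 0" using False by simp
    show ?thesis
    proof (rule ccontr)
      assume ne: "l j t \<noteq> x n ! j"
      \<comment> \<open>The times at which the queue of the idle server is not empty, and their infimum.\<close>
      let ?B = "{r. T n \<le> r \<and> r < T (Suc n) \<and> l j r \<noteq> 0}"
      have B: "t \<in> ?B" using t ne idle by simp
      have bdd: "bdd_below ?B" by (rule bdd_belowI[of _ "T n"]) auto
      define r0 where "r0 = Inf ?B"
      have r0: "T n \<le> r0" "r0 \<le> t" unfolding r0_def using B bdd by (auto intro: cInf_lower cInf_greatest)
      have before0: "l j r = 0" if "T n \<le> r" "r < r0" for r
      proof (rule ccontr)
        assume "l j r \<noteq> 0"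
        then have "r \<in> ?B" using that r0 t by auto
        then have "r0 \<le> r" unfolding r0_def using bdd by (rule cInf_lower)
        then show False using that by simp
      qed
      have busy0: "busy j r0 = busy j (T n)"
        using busy_split(3)[OF j T_nonneg r0(1), of False] before0 by simp
      obtain r where r: "r \<in> ?B" "r < r0 + Xi n (j, 0)"
        using cInf_lessD[of ?B "r0 + Xi n (j, 0)"] B Xi(2) unfolding r0_def by auto
      have "r0 \<le> r" unfolding r0_def using r(1) bdd by (rule cInf_lower)
      then have "busy j r < S j (d j)"
        using busy_split(2)[OF j _ \<open>r0 \<le> r\<close>] r0 T_nonneg[of n] r Xi busy0 by linarith
      then have "l j r = 0" using fin[of r] r idle by auto
      then show False using r by simp
    qed
  qed
qed

text \<open>
  At the next jump exactly one of the counters in the queue equation increases: the departures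
  of the winning server, or the arrivals. In the latter case the left limits seen by the
  dispatcher are the queue lengths of the chain.
\<close>

lemma synced_Suc:
  assumes s: "synced n d"
  shows "synced (Suc n) (\<lambda>j. if j = c n then Suc (d j) else d j)"
proof -
  let ?d = "\<lambda>j. if j = c n then Suc (d j) else d j"
  have T: "T n \<le> T (Suc n)" "0 \<le> T (Suc n)" using T_less[of n] T_nonneg by (auto intro: less_imp_le)
  note const = synced_constant[OF s]
  have busy: "busy j (T (Suc n)) = busy j (T n) + (if j \<in> active n then del n else 0)" if "j < N" for j
    using busy_split(3)[OF that T_nonneg T(1), of "0 < x n ! j"] const[OF that] that by (simp add: T_Suc active_def)
  have Xi: "S j (d j) = busy j (T n) + Xi n (j, 0)" "0 < Xi n (j, 0)" "\<And>i. i < d j \<Longrightarrow> S j i \<le> busy j (T n)"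
    "\<And>m. 0 < m \<Longrightarrow> Xi n (j, m) = svc j (d j + m)" if "j < N" for j
    using s that Xi_pos[of j n 0] by (auto simp: synced_def)
  have XiN: "arrival (k n) = T n + Xi n (N, 0)" "0 < Xi n (N, 0)" "\<And>i. i < k n \<Longrightarrow> arrival i \<le> T n" "\<And>m. 0 < m \<Longrightarrow> Xi n (N, m) = gap (k n + m)"
    using s Xi_pos[of N n 0] by (auto simp: synced_def)
  have Nact: "N \<in> active n" by (simp add: active_def)
  have dS: "S j i \<le> busy j (T (Suc n))" if "j < N" "i < ?d j" for i j
  proof (cases "i < d j")
    case True
    then show ?thesis using Xi(3)[OF that(1)] busy[OF that(1)] del_pos[of n] by (auto intro: order_trans add_increasing2)
  next
    case False
    then have "j = c n" "i = d j" using that(2) by (auto split: if_splits)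
    then show ?thesis using Xi(1)[OF that(1)] busy[OF that(1)] c_active[of n] by (simp add: del_def)
  qed
  have dless: "busy j (T (Suc n)) < S j (?d j)" if "j < N" for j
  proof (cases "j = c n")
    case True
    then show ?thesis using Xi(1)[OF that] busy[OF that] c_active[of n] svc_pos[OF that, of "Suc (d j)"] by (simp add: del_def)
  next
    case False
    then show ?thesis using Xi(1,2)[OF that] busy[OF that] c_min[of j n] by simp
  qed
  have Xi_new: "Xi (Suc n) (j, 0) = S j (?d j) - busy j (T (Suc n)) \<and> (\<forall>m>0. Xi (Suc n) (j, m) = svc j (?d j + m))" if "j < N" for j
  proof (cases "j = c n")
    case True
    then show ?thesis using Xi[OF that] busy[OF that] c_active[of n] that Xi_Suc[of j n] by (simp add: del_def)
  next
    case False
    then show ?thesis using Xi[OF that] busy[OF that] that Xi_Suc[of j n] by simp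
  qed
  have XiN_new: "Xi (Suc n) (N, 0) = arrival (k (Suc n)) - T (Suc n) \<and> (\<forall>m>0. Xi (Suc n) (N, m) = gap (k (Suc n) + m)) \<and> (\<forall>i<k (Suc n). arrival i \<le> T (Suc n))"
  proof (intro conjI allI impI)
    fix i assume i: "i < k (Suc n)"
    have old: "arrival i \<le> T (Suc n)" if "i < k n" using XiN(3)[OF that] T(1) by (rule order_trans)
    show "arrival i \<le> T (Suc n)"
    proof (cases "c n = N")
      case True
      then show ?thesis using i old XiN(1) arrive(1)[OF True] by (auto simp: less_Suc_eq T_Suc del_def)
    next
      case False
      then show ?thesis using i old c_le[of n] depart(1)[of n] by simp
    qed
  next
    have "Xi (Suc n) (N, 0) = arrival (k (Suc n)) - T (Suc n) \<and> (\<forall>m>0. Xi (Suc n) (N, m) = gap (k (Suc n) + m))"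
  proof (cases "c n = N")
    case True
    have "arrival (Suc (k n)) = arrival (k n) + gap (Suc (k n))" by (simp add: arrival_def)
    then show ?thesis using XiN True Xi_Suc[of N n] arrive(1)[OF True] by (simp add: T_Suc del_def)
  next
    case False
    then have "c n < N" using c_le[of n] by simp
    then show ?thesis using XiN False Xi_Suc[of N n] Nact depart(1) by (simp add: T_Suc)
  qed
    then show "Xi (Suc n) (N, 0) = arrival (k (Suc n)) - T (Suc n)" "\<And>m. 0 < m \<Longrightarrow> Xi (Suc n) (N, m) = gap (k (Suc n) + m)"
      by simp_all
  qed
  have K: "T (Suc n) < arrival (k (Suc n))" using XiN_new Xi_pos[of N "Suc n" 0] by simp
  have "l j (T (Suc n)) = x (Suc n) ! j" if j: "j < N" for j
  proof -
    have eq: "l j (T (Suc n)) + ?d j = l j 0 + accepted (k (Suc n)) j"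
      by (rule dynamics'[OF j T(2) dS[OF j] dless[OF j] _ K]) (use XiN_new in auto)
    have base: "x n ! j + d j = l j 0 + accepted (k n) j" by (rule synced_base[OF s j])
    show ?thesis
    proof (cases "c n = N")
      case True
      have arr: "arrival (k n) = T (Suc n)" using XiN(1) True by (simp add: T_Suc del_def)
      have "before (k n) i = x n ! i" if i: "i < N" for i
      proof -
        have "\<forall>\<^sub>F r in at_left (T (Suc n)). l i r = x n ! i"
          unfolding eventually_at_left_field using T_less[of n] const[OF i] by (intro exI[of _ "T n"]) auto
        then have "(l i \<longlongrightarrow> x n ! i) (at_left (T (Suc n)))" by (rule tendsto_eventually)
        then have "Lim (at_left (T (Suc n))) (l i) = x n ! i" by (intro tendsto_Lim) auto
        then show ?thesis using i by (simp add: before_def arr)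
      qed
      then have bef: "before (k n) = (\<lambda>j\<in>{..<N}. x n ! j)" by (auto simp: before_def)
      define p where "p = pick (\<lambda>j\<in>{..<N}. x n ! j) (seed (k n))"
      have pN: "p < N" unfolding p_def using rule by (auto simp: jsq_rule_def)
      have dest: "dest (k n) = p" by (simp add: dest_def bef p_def)
      have "{i. i < Suc (k n) \<and> dest i = j \<and> enat (before i j) < b} = {i. i < k n \<and> dest i = j \<and> enat (before i j) < b} \<union> (if p = j \<and> enat (x n ! j) < b then {k n} else {})"
        using dest bef j by (auto simp: less_Suc_eq)
      then have "accepted (Suc (k n)) j = accepted (k n) j + (if p = j \<and> enat (x n ! j) < b then 1 else 0)"
        by (auto simp: card_insert_if)
      then show ?thesis using eq base True j arrive(1)[OF True] arrive(2)[OF True p_def] length_x[of n]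
        by (cases "p = j"; cases "enat (x n ! p) < b") simp_all
    next
      case False
      then have cN: "c n < N" using c_le[of n] by simp
      have "0 < x n ! c n" using c_active[of n] cN by (auto simp: active_def)
      then show ?thesis using eq base depart[OF cN] j length_x[of n] by (auto simp: nth_list_update split: if_splits)
    qed
  qed
  then show ?thesis using Xi_new XiN_new dS by (simp add: synced_def)
qed

theorem path_is_chain:
  assumes j: "j < N" and t: "T n \<le> t" "t < T (Suc n)"
  shows "l j t = x n ! j"
proof -
  have "\<exists>d. synced n d"
  proof (induction n)
    case 0
    show ?case using synced_0 by blast
  next
    case (Suc n)
    then show ?case using synced_Suc by blast
  qed
  then show ?thesis using synced_constant[OF _ j t] by blast
qed

end

section \<open>Occupancies along a trajectory\<close>

lemma occupancy_occ_space:
  assumes "1 \<le> N"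
  shows "occupancy b N y \<in> occ_space b"
proof -
  have fin: "finite {j. j < N \<and> i \<le> y j}" for i by simp
  have le: "card {j. j < N \<and> i \<le> y j} \<le> N" for i
    using card_mono[of "{..<N}" "{j. j < N \<and> i \<le> y j}"] by auto
  have mono: "card {j. j < N \<and> i \<le> y j} \<le> card {j. j < N \<and> i - 1 \<le> y j}" for i
    by (rule card_mono) auto
  have "summable (occupancy b N y)"
  proof (rule summable_finite[of "{..Max (y ` {..<N})}"])
    fix i assume "i \<notin> {..Max (y ` {..<N})}"
    then have "Max (y ` {..<N}) < i" by simp
    then have "\<And>j. j < N \<Longrightarrow> y j < i" using Max_ge[of "y ` {..<N}"] by (meson finite_imageI finite_lessThan image_eqI lessThan_iff order_le_less_trans)
    then have "{j. j < N \<and> i \<le> y j} = {}" by force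
    then show "occupancy b N y i = 0" by (simp add: occupancy_def)
  qed simp
  moreover have "enat (i - 1) \<le> b" if "enat i \<le> b" for i using that by (meson diff_le_self enat_ord_simps(1) order_trans)
  ultimately show ?thesis
    using assms le mono unfolding occ_space_def
    by (auto simp: occupancy_def divide_le_eq_1 intro!: divide_right_mono)
qed

text \<open>
  The integrand is constant between jumps; \<open>clip\<close> cuts the last of these intervals off at \<open>t\<close>.
\<close>

lemma step_integral:
  fixes T :: "nat \<Rightarrow> real" and g :: "nat \<Rightarrow> real"
  assumes T: "strict_mono T" "T 0 = 0" and t: "0 \<le> t" "t < T n"
    and \<nu>: "\<And>m s. T m \<le> s \<Longrightarrow> s < T (Suc m) \<Longrightarrow> \<nu> s = m"
  shows "(LBINT s:{0..t}. g (\<nu> s)) = (\<Sum>m<n. g m * clip (t - T m) (T (Suc m) - T m))"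
proof -
  have T0: "0 \<le> T m" for m using strict_mono_less_eq[OF T(1), of 0 m] T(2) by simp
  let ?I = "\<lambda>m. {T m..<T (Suc m)} \<inter> {0..t}"
  have "indicator {0..t} s *\<^sub>R g (\<nu> s) = (\<Sum>m<n. g m * indicator (?I m) s)" for s
  proof (cases "s \<in> {0..t}")
    case True
    define m where "m = (LEAST m. s < T (Suc m))"
    have "n \<noteq> 0" using t T(2) by (cases n) auto
    then have ex: "s < T (Suc (n - 1))" using True t by simp
    have m: "s < T (Suc m)" unfolding m_def using ex by (rule LeastI)
    have mn: "m \<le> n - 1" unfolding m_def using ex by (rule Least_le)
    have Tm: "T m \<le> s"
    proof (cases m)
      case (Suc m')
      then have "\<not> s < T (Suc m')" unfolding m_def by (metis lessI not_less_Least)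
      then show ?thesis using Suc by simp
    qed (use True T(2) in simp)
    have ind: "indicator (?I k) s = (if k = m then 1 else 0 :: real)" for k
    proof (cases "k = m")
      case False
      then have "Suc k \<le> m \<or> Suc m \<le> k" by linarith
      then have "T (Suc k) \<le> T m \<or> T (Suc m) \<le> T k" using strict_mono_less_eq[OF T(1)] by blast
      then show ?thesis using False m Tm by (auto simp: indicator_def)
    qed (use True m Tm in simp)
    have "(\<Sum>k<n. g k * indicator (?I k) s) = (\<Sum>k<n. if k = m then g m else 0)"
      by (rule sum.cong) (auto simp: ind)
    also have "\<dots> = g m" using mn \<open>n \<noteq> 0\<close> by simp
    finally show ?thesis using \<nu>[OF Tm m] True by simp
  qed (auto simp: indicator_def)
  then have "(LBINT s:{0..t}. g (\<nu> s)) = (\<integral>s. (\<Sum>m<n. g m * indicator (?I m) s) \<partial>lborel)"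
    unfolding set_lebesgue_integral_def by simp
  also have "\<dots> = (\<Sum>m<n. g m * measure lborel (?I m))"
  proof -
    have "integrable lborel (\<lambda>s. g m * indicator (?I m) s)" for m
    proof (intro integrable_mult_right integrable_real_indicator)
      have "emeasure lborel (?I m) \<le> emeasure lborel {0..t}" by (rule emeasure_mono) auto
      also have "\<dots> < \<infinity>" by (simp add: emeasure_lborel_Icc_eq)
      finally show "emeasure lborel (?I m) < \<infinity>" .
    qed simp
    then have "(\<integral>s. (\<Sum>m<n. g m * indicator (?I m) s) \<partial>lborel) = (\<Sum>m<n. (\<integral>s. g m * indicator (?I m) s \<partial>lborel))"
      by (intro Bochner_Integration.integral_sum) auto
    then show ?thesis by simp
  qed
  also have "\<dots> = (\<Sum>m<n. g m * clip (t - T m) (T (Suc m) - T m))"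
  proof (rule sum.cong[OF refl])
    fix m
    have lt: "T m < T (Suc m)" using T(1) by (simp add: strict_mono_less)
    consider "t < T m" | "T m \<le> t" "T (Suc m) \<le> t" | "T m \<le> t" "t < T (Suc m)" by linarith
    then have "measure lborel (?I m) = clip (t - T m) (T (Suc m) - T m)"
    proof cases
      case 1
      then have "?I m = {}" by auto
      then show ?thesis using 1 by (simp add: clip_def)
    next
      case 2
      then have "?I m = {T m..<T (Suc m)}" using T0[of m] by auto
      then show ?thesis using 2 lt by (simp add: clip_def)
    next
      case 3
      then have "?I m = {T m..t}" using T0[of m] by auto
      then show ?thesis using 3 by (simp add: clip_def)
    qed
    then show "g m * measure lborel (?I m) = g m * clip (t - T m) (T (Suc m) - T m)" by simp
  qed
  finally show ?thesis .
qed

text \<open>The chain covers all times, so a trajectory is determined by it.\<close>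

locale jsq_run = jsq_trace +
  assumes N_pos: "1 \<le> N" and T_unbounded: "\<And>t. \<exists>n. t < T n" and init_le: "\<And>j. j < N \<Longrightarrow> enat (l j 0) \<le> b"
begin

text \<open>The number of jumps up to time \<open>t\<close>.\<close>

definition index :: "real \<Rightarrow> nat" where "index t = (LEAST n. t < T (Suc n))"

lemma index_less: "t < T (Suc (index t))"
proof -
  obtain n where "t < T n" using T_unbounded by blast
  also have "T n < T (Suc n)" by (rule T_less)
  finally show ?thesis unfolding index_def by (rule LeastI)
qed

lemma index_ge: "0 \<le> t \<Longrightarrow> T (index t) \<le> t"
proof (cases "index t")
  case (Suc m)
  then have "\<not> t < T (Suc m)" unfolding index_def by (metis lessI not_less_Least)
  then show ?thesis using Suc by simp
qed (simp add: T_0)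

lemma index_eq: "T m \<le> t \<Longrightarrow> t < T (Suc m) \<Longrightarrow> index t = m"
proof -
  assume m: "T m \<le> t" "t < T (Suc m)"
  then have "0 \<le> t" using T_nonneg[of m] by simp
  have "T (index t) < T (Suc m)" using index_ge[OF \<open>0 \<le> t\<close>] m by simp
  moreover have "T m < T (Suc (index t))" using index_less[of t] m by simp
  ultimately show ?thesis using strict_mono_less[OF T_strict_mono] by (simp add: less_Suc_eq_le)
qed

lemma index_T [simp]: "index (T n) = n" by (rule index_eq) (use T_less in auto)

lemma less_index_iff: "0 \<le> t \<Longrightarrow> m < index t \<longleftrightarrow> T (Suc m) \<le> t"
proof
  assume t: "0 \<le> t"
  assume "m < index t"
  then have "T (Suc m) \<le> T (index t)" using strict_mono_less_eq[OF T_strict_mono] by (simp add: Suc_le_eq)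
  then show "T (Suc m) \<le> t" using index_ge[OF t] by simp
next
  assume "T (Suc m) \<le> t"
  then have "T (Suc m) < T (Suc (index t))" using index_less[of t] by simp
  then show "m < index t" using strict_mono_less[OF T_strict_mono] by simp
qed

lemma index_mono: "0 \<le> s \<Longrightarrow> s \<le> t \<Longrightarrow> index s \<le> index t"
  using less_index_iff[of s "index t"] index_less[of t] by (meson leI order_less_le_trans not_less order_trans)

lemma index_measurable: "index \<in> borel \<rightarrow>\<^sub>M count_space UNIV"
  unfolding index_def by measurable

lemma l_index: "0 \<le> t \<Longrightarrow> j < N \<Longrightarrow> l j t = x (index t) ! j"
  using path_is_chain index_ge index_less by blast

lemma pick_min: "p = pick (\<lambda>j\<in>{..<N}. x n ! j) u \<Longrightarrow> p < N \<and> (\<forall>j<N. x n ! p \<le> x n ! j)"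
  using rule unfolding jsq_rule_def by (metis lessThan_iff restrict_apply')

lemma x_le_b: "j < N \<Longrightarrow> enat (x n ! j) \<le> b"
proof (induction n arbitrary: j)
  case (Suc n)
  show ?case
  proof (cases "c n = N")
    case True
    define p where "p = pick (\<lambda>j\<in>{..<N}. x n ! j) (seed (k n))"
    show ?thesis
      using Suc.IH[OF Suc.prems] arrive(2)[OF True p_def] Suc.prems length_x[of n]
      by (cases "p = j") (auto simp: ileI1 eSuc_enat[symmetric] split: if_splits)
  next
    case False
    then have "c n < N" using c_le[of n] by simp
    have "enat (x n ! j - 1) \<le> enat (x n ! j)" by simp
    from this Suc.IH[OF Suc.prems] have "enat (x n ! j - 1) \<le> b" by (rule order_trans)
    then show ?thesis using Suc.IH[OF Suc.prems] depart(2)[OF \<open>c n < N\<close>] Suc.prems length_x[of n]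
      by (cases "c n = j") auto
  qed
qed (simp add: x_0 init_le)

definition count :: "nat \<Rightarrow> nat \<Rightarrow> nat" where "count i n = card {j. j < N \<and> i \<le> x n ! j}"

definition full :: "nat \<Rightarrow> nat \<Rightarrow> real" where
  "full i n = (if c n = N \<and> (\<forall>j<N. i \<le> x n ! j) then 1 else 0)"
definition leave :: "nat \<Rightarrow> nat \<Rightarrow> real" where
  "leave i n = (if c n < N \<and> x n ! c n = i then 1 else 0)"

definition q :: "real \<Rightarrow> nat \<Rightarrow> real" where "q t = occupancy b N (\<lambda>j. l j t)"
definition U :: "nat \<Rightarrow> real \<Rightarrow> real" where "U i t = (\<Sum>m<index t. full i m) / real N"
definition D :: "nat \<Rightarrow> real \<Rightarrow> real" where "D i t = (\<Sum>m<index t. leave i m) / real N"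

lemma q_count: "0 \<le> t \<Longrightarrow> q t i = (if 1 \<le> i \<and> enat i \<le> b then real (count i (index t)) / real N else 0)"
proof -
  assume t: "0 \<le> t"
  have "{j. j < N \<and> i \<le> l j t} = {j. j < N \<and> i \<le> x (index t) ! j}" using l_index[OF t] by auto
  then show ?thesis by (simp add: q_def occupancy_def count_def)
qed

text \<open>
  An arrival joins a shortest queue, which therefore reaches length \<open>i\<close> iff all queues have
  length at least \<open>i - 1\<close> but not all have length at least \<open>i\<close>. If all queues are full the task
  is lost, which agrees with the equation because \<open>i \<le> b\<close>.
\<close>

lemma count_Suc:
  assumes i: "1 \<le> i" "enat i \<le> b"
  shows "real (count i (Suc n)) = real (count i n) + full (i - 1) n - full i n - leave i n"
proof (cases "c n = N")
  case True
  define p where "p = pick (\<lambda>j\<in>{..<N}. x n ! j) (seed (k n))"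
  have p: "p < N" "\<And>j. j < N \<Longrightarrow> x n ! p \<le> x n ! j" using pick_min[OF p_def] by auto
  have all: "(\<forall>j<N. i' \<le> x n ! j) \<longleftrightarrow> i' \<le> x n ! p" for i' using p by (meson order_trans)
  show ?thesis
  proof (cases "enat (x n ! p) < b")
    case acc: True
    have x': "x (Suc n) = (x n)[p := Suc (x n ! p)]" using arrive(2)[OF True p_def] acc by simp
    have "{j. j < N \<and> i \<le> x (Suc n) ! j} = {j. j < N \<and> i \<le> x n ! j} \<union> (if Suc (x n ! p) = i then {p} else {})"
      unfolding x' using length_x[of n] p(1) by (auto simp: nth_list_update)
    then have "count i (Suc n) = count i n + (if Suc (x n ! p) = i then 1 else 0)"
      unfolding count_def by (auto simp: card_insert_if)
    then show ?thesis unfolding full_def leave_def all using True i by auto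
  next
    case False
    have "x (Suc n) = x n" using arrive(2)[OF True p_def] False by simp
    moreover have "i \<le> x n ! p" using False i(2) by (meson enat_ord_simps(1) not_le order_trans)
    ultimately show ?thesis unfolding full_def leave_def all count_def using True by simp
  qed
next
  case False
  then have c: "c n < N" using c_le[of n] by simp
  have pos: "0 < x n ! c n" using c_active[of n] c by (auto simp: active_def)
  have x': "x (Suc n) = (x n)[c n := x n ! c n - 1]" by (rule depart(2)[OF c])
  have "{j. j < N \<and> i \<le> x n ! j} = {j. j < N \<and> i \<le> x (Suc n) ! j} \<union> (if x n ! c n = i then {c n} else {})"
    unfolding x' using length_x[of n] c pos by (auto simp: nth_list_update)
  moreover have "c n \<notin> {j. j < N \<and> i \<le> x (Suc n) ! j}" if "x n ! c n = i"
    unfolding x' using length_x[of n] c pos that by (auto simp: nth_list_update)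
  ultimately have "count i n = count i (Suc n) + (if x n ! c n = i then 1 else 0)"
    unfolding count_def by (auto simp: card_insert_if)
  then show ?thesis using c by (simp add: full_def leave_def)
qed

lemma count_sum:
  assumes i: "1 \<le> i" "enat i \<le> b"
  shows "real (count i n) = real (count i 0) + (\<Sum>m<n. full (i - 1) m) - (\<Sum>m<n. full i m) - (\<Sum>m<n. leave i m)"
  by (induction n) (simp_all add: count_Suc[OF i])

lemma sum_index_mono:
  fixes w :: "nat \<Rightarrow> real"
  assumes "\<And>m. 0 \<le> w m" "0 \<le> s" "s \<le> t"
  shows "(\<Sum>m<index s. w m) \<le> (\<Sum>m<index t. w m)"
  using assms index_mono[OF assms(2,3)] by (intro sum_mono2) auto

sublocale sys_path b q U D
proof
  have N: "0 < real N" using N_pos by simp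
  have i0: "index 0 = 0" using index_T[of 0] by (simp add: T_0)
  show "q t \<in> occ_space b" for t unfolding q_def by (rule occupancy_occ_space[OF N_pos])
  show "set_borel_measurable borel {0..} (\<lambda>t. q t i)" for i
  proof -
    have "(\<lambda>t. (\<lambda>n. if 1 \<le> i \<and> enat i \<le> b then real (count i n) / real N else 0) (index t)) \<in> borel_measurable borel"
      by (rule measurable_compose[OF index_measurable]) simp
    then have "(\<lambda>t. indicator {0..} t *\<^sub>R (if 1 \<le> i \<and> enat i \<le> b then real (count i (index t)) / real N else 0)) \<in> borel_measurable borel"
      by (intro borel_measurable_scaleR borel_measurable_indicator) auto
    moreover have "indicator {0..} t *\<^sub>R (if 1 \<le> i \<and> enat i \<le> b then real (count i (index t)) / real N else 0) = indicator {0..} t *\<^sub>R q t i" for t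
      by (cases "0 \<le> t") (simp_all add: q_count)
    ultimately show ?thesis by (simp only: set_borel_measurable_def)
  qed
  show "q t i = q 0 i + U (i - 1) t - U i t - D i t" if "0 \<le> t" "1 \<le> i" "enat i \<le> b" for t i
    using count_sum[OF that(2,3), of "index t"] that i0
    by (simp add: q_count U_def D_def diff_divide_distrib add_divide_distrib)
  show "U i 0 = 0" "D i 0 = 0" for i by (simp_all add: U_def D_def i0)
  show "U i s \<le> U i t" if "0 \<le> s" "s \<le> t" for i s t
    unfolding U_def by (intro divide_right_mono sum_index_mono that) (auto simp: full_def)
  show "D i s \<le> D i t" if "0 \<le> s" "s \<le> t" for i s t
    unfolding D_def by (intro divide_right_mono sum_index_mono that) (auto simp: leave_def)
  show "U (Suc i) t - U (Suc i) s \<le> U i t - U i s" if "0 \<le> s" "s \<le> t" for i s t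
  proof -
    have "(\<Sum>m<index s. full i m - full (Suc i) m) \<le> (\<Sum>m<index t. full i m - full (Suc i) m)"
      by (intro sum_index_mono that) (auto simp: full_def Suc_le_eq)
    then have "((\<Sum>m<index s. full i m) - (\<Sum>m<index s. full (Suc i) m)) / real N \<le> ((\<Sum>m<index t. full i m) - (\<Sum>m<index t. full (Suc i) m)) / real N"
      by (intro divide_right_mono) (auto simp: sum_subtractf)
    then show ?thesis by (simp add: U_def diff_divide_distrib)
  qed
  show "\<exists>r\<in>{s..t}. q r i = 1 \<and> U i r = U i t"
    if i: "1 \<le> i" "enat i \<le> b" and st: "0 \<le> s" "s \<le> t" and less: "U i s < U i t" for i s t
  proof -
    have t: "0 \<le> t" using st by simp
    let ?M = "{m. m < index t \<and> full i m = 1}"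
    have z: "full i m = 0" if "m < index t" "m \<notin> ?M" for m using that by (auto simp: full_def split: if_splits)
    have lt: "(\<Sum>m<index s. full i m) < (\<Sum>m<index t. full i m)"
      using less N by (simp add: U_def divide_less_cancel)
    have "\<exists>m\<in>?M. index s \<le> m"
    proof (rule ccontr)
      assume "\<not> ?thesis"
      then have "full i m = 0" if "m \<in> {..<index t} - {..<index s}" for m using z[of m] that by force
      then have "(\<Sum>m<index s. full i m) = (\<Sum>m<index t. full i m)"
        using index_mono[OF st] by (intro sum.mono_neutral_left) auto
      then show False using lt by simp
    qed
    then obtain m0 where m0: "m0 \<in> ?M" "index s \<le> m0" by blast
    define m where "m = Max ?M"
    have m: "m \<in> ?M" unfolding m_def using m0(1) by (intro Max_in) auto
    have mmax: "m' \<le> m" if "m' \<in> ?M" for m' unfolding m_def using that by (intro Max_ge) auto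
    have sm: "index s \<le> m" using mmax[OF m0(1)] m0(2) by simp
    let ?r = "T (Suc m)"
    have "s < T (Suc (index s))" by (rule index_less)
    also have "\<dots> \<le> ?r" using sm strict_mono_less_eq[OF T_strict_mono] by simp
    finally have r1: "s \<le> ?r" by simp
    have r2: "?r \<le> t" using less_index_iff[OF t, of m] m by simp
    have "(\<Sum>m<Suc m. full i m) = (\<Sum>m<index t. full i m)"
    proof (rule sum.mono_neutral_left)
      show "{..<Suc m} \<subseteq> {..<index t}" using m by auto
      show "\<forall>i'\<in>{..<index t} - {..<Suc m}. full i i' = 0"
      proof
        fix m' assume "m' \<in> {..<index t} - {..<Suc m}"
        then show "full i m' = 0" using z[of m'] mmax[of m'] by force
      qed
    qed simp
    then have Ueq: "U i ?r = U i t" by (simp add: U_def)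
    have cN: "c m = N" and ge: "\<And>j. j < N \<Longrightarrow> i \<le> x m ! j" using m by (auto simp: full_def split: if_splits)
    define p where "p = pick (\<lambda>j\<in>{..<N}. x m ! j) (seed (k m))"
    have "i \<le> x (Suc m) ! j" if "j < N" for j
      using arrive(2)[OF cN p_def] ge[OF that] that length_x[of m] by (cases "p = j") (auto split: if_splits)
    then have "{j. j < N \<and> i \<le> x (Suc m) ! j} = {..<N}" by auto
    then have "count i (Suc m) = N" by (simp add: count_def)
    then have "q ?r i = 1" using i N_pos by (simp add: q_count T_nonneg)
    then show ?thesis using r1 r2 Ueq by auto
  qed
qed

text \<open>
  The departures from queues of length \<open>i\<close> are the rings of the servers that have such a queue,
  and their compensator is the drift.
\<close>

lemma D_deviation:
  assumes i: "1 \<le> i" "enat i \<le> b" and t: "0 \<le> t" "t < T n"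
  shows "real N * (D i t - drift q i t) =
    (\<Sum>m<n. hit {j. j < N \<and> x m ! j = i} (t - T m) (c m) (del m)
       - real (card {j. j < N \<and> x m ! j = i}) * clip (t - T m) (del m))"
proof -
  have N: "0 < real N" using N_pos by simp
  let ?g = "\<lambda>m. real (card {j. j < N \<and> x m ! j = i}) / real N"
  have diff: "q s i - q s (i + 1) = ?g (index s)" if s: "0 \<le> s" for s
  proof -
    let ?y = "\<lambda>j. x (index s) ! j"
    have "{j. j < N \<and> i \<le> ?y j} = {j. j < N \<and> i + 1 \<le> ?y j} \<union> {j. j < N \<and> ?y j = i}" by auto
    then have c: "count i (index s) = count (i + 1) (index s) + card {j. j < N \<and> ?y j = i}"
    proof -
      have "card ({j. j < N \<and> i + 1 \<le> ?y j} \<union> {j. j < N \<and> ?y j = i}) = card {j. j < N \<and> i + 1 \<le> ?y j} + card {j. j < N \<and> ?y j = i}"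
        by (rule card_Un_disjoint) auto
      then show ?thesis using \<open>{j. j < N \<and> i \<le> ?y j} = _\<close> by (simp only: count_def)
    qed
    have "real (count (i + 1) (index s)) / real N = q s (i + 1)"
    proof (cases "enat (i + 1) \<le> b")
      case False
      have "{j. j < N \<and> i + 1 \<le> ?y j} = {}" using x_le_b False by (auto) (meson enat_ord_simps(1) order_trans)
      then show ?thesis using False s by (simp add: q_count count_def)
    qed (use s in \<open>simp add: q_count\<close>)
    then show ?thesis using c i s by (simp add: q_count add_divide_distrib)
  qed
  have "drift q i t = (LBINT s:{0..t}. ?g (index s))"
    unfolding drift_def by (rule set_lebesgue_integral_cong) (auto simp: diff[simplified])
  also have "\<dots> = (\<Sum>m<n. ?g m * clip (t - T m) (T (Suc m) - T m))"
    by (rule step_integral[OF T_strict_mono T_0 t]) (rule index_eq)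
  also have "\<dots> = (\<Sum>m<n. real (card {j. j < N \<and> x m ! j = i}) * clip (t - T m) (del m)) / real N"
    by (simp add: T_Suc sum_divide_distrib)
  finally have dr: "real N * drift q i t = (\<Sum>m<n. real (card {j. j < N \<and> x m ! j = i}) * clip (t - T m) (del m))"
    using N by simp
  have ind: "index t \<le> n"
  proof -
    have "T (index t) < T n" using index_ge[OF t(1)] t(2) by simp
    then show ?thesis using strict_mono_less[OF T_strict_mono] by simp
  qed
  have "(\<Sum>m<n. hit {j. j < N \<and> x m ! j = i} (t - T m) (c m) (del m)) = (\<Sum>m<n. if m < index t then leave i m else 0)"
    by (rule sum.cong) (auto simp: hit_def leave_def less_index_iff[OF t(1)] T_Suc)
  also have "\<dots> = (\<Sum>m<index t. leave i m)"
    using ind by (intro sum.mono_neutral_cong_right) auto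
  finally have "real N * D i t = (\<Sum>m<n. hit {j. j < N \<and> x m ! j = i} (t - T m) (c m) (del m))"
    using N by (simp add: D_def)
  then show ?thesis using dr by (simp add: right_diff_distrib sum_subtractf)
qed

text \<open>
  The arrivals are the rings of clock \<open>N\<close>, which always races, so that the compensator grows at
  constant rate.
\<close>

lemma U_deviation:
  assumes t: "0 \<le> t" "t < T n"
  shows "real N * U 0 t - rate * t = (\<Sum>m<n. hit {N} (t - T m) (c m) (del m) - rate * clip (t - T m) (del m))"
proof -
  have N: "0 < real N" using N_pos by simp
  have "(LBINT s:{0..t}. (\<lambda>_. 1) (index s)) = (\<Sum>m<n. 1 * clip (t - T m) (T (Suc m) - T m))"
    by (rule step_integral[OF T_strict_mono T_0 t]) (rule index_eq)
  moreover have "(LBINT s:{0..t}. 1) = t" using t by (simp add: set_lebesgue_integral_def)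
  ultimately have cl: "(\<Sum>m<n. clip (t - T m) (del m)) = t" by (simp add: T_Suc)
  have ind: "index t \<le> n"
  proof -
    have "T (index t) < T n" using index_ge[OF t(1)] t(2) by simp
    then show ?thesis using strict_mono_less[OF T_strict_mono] by simp
  qed
  have "(\<Sum>m<n. hit {N} (t - T m) (c m) (del m)) = (\<Sum>m<n. if m < index t then full 0 m else 0)"
    by (rule sum.cong) (auto simp: hit_def full_def less_index_iff[OF t(1)] T_Suc)
  also have "\<dots> = (\<Sum>m<index t. full 0 m)"
    using ind by (intro sum.mono_neutral_cong_right) auto
  finally have "real N * U 0 t = (\<Sum>m<n. hit {N} (t - T m) (c m) (del m))"
    using N by (simp add: U_def)
  then show ?thesis using cl by (simp add: sum_subtractf sum_distrib_left[symmetric])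
qed

lemma run_sys_path: "sys_path b q U D" ..

end

section \<open>The jump chain of the random system\<close>

lemma map_upt_measurable:
  assumes "\<And>j. j < n \<Longrightarrow> f j \<in> M \<rightarrow>\<^sub>M count_space (UNIV :: 'v :: countable set)"
  shows "(\<lambda>w. map (\<lambda>j. f j w) [0..<n]) \<in> M \<rightarrow>\<^sub>M count_space UNIV"
  using assms
proof (induction n)
  case (Suc n)
  have "(\<lambda>w. map (\<lambda>j. f j w) [0..<n]) \<in> M \<rightarrow>\<^sub>M count_space UNIV" by (rule Suc.IH) (simp add: Suc.prems)
  then have "(\<lambda>w. map (\<lambda>j. f j w) [0..<n] @ [v]) \<in> M \<rightarrow>\<^sub>M count_space UNIV" for v
    by (rule measurable_compose) simp
  from measurable_compose_countable[OF this, of "f n"] Suc.prems[of n]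
  show ?case by simp
qed simp

locale jsq_chain = jsq_system +
  assumes N_pos: "1 \<le> N"
begin

definition mu :: "nat \<Rightarrow> real" where "mu c = (if c = N then rate else 1)"

sublocale clk: clocks "{..N}" mu
  by unfold_locales (auto simp: mu_def rate_pos)

type_synonym state = "nat list \<times> nat \<times> real \<times> (nat \<Rightarrow> real)"

text \<open>
  A state of the chain consists of the queue lengths, the number of past arrivals, the time and
  all seeds. Lists make the queue lengths a countable type. Putting the whole sequence of seeds
  into the initial state leaves only the clocks to be refreshed at each jump.
\<close>

definition states :: "state measure" where
  "states = count_space UNIV \<Otimes>\<^sub>M (count_space UNIV \<Otimes>\<^sub>M (borel \<Otimes>\<^sub>M PiM UNIV (\<lambda>_. borel)))"

definition active :: "state \<Rightarrow> nat set" where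
  "active y = insert N {j. j < N \<and> 0 < fst y ! j}"

definition route :: "nat list \<Rightarrow> real \<Rightarrow> nat list" where
  "route x u = (let p = pick (\<lambda>j\<in>{..<N}. x ! j) u in if enat (x ! p) < b then x[p := Suc (x ! p)] else x)"

definition step :: "state \<Rightarrow> nat \<Rightarrow> real \<Rightarrow> state" where
  "step y c v = (let x = fst y; k = fst (snd y); u = snd (snd (snd y)) in
     (if c = N then route x (u k) else x[c := x ! c - 1], if c = N then Suc k else k, fst (snd (snd y)) + v, u))"

lemma route_measurable: "(\<lambda>u. route x u) \<in> borel \<rightarrow>\<^sub>M count_space UNIV"
proof -
  have [measurable]: "pick (\<lambda>j\<in>{..<N}. x ! j) \<in> borel \<rightarrow>\<^sub>M count_space UNIV"
    using rule by (simp add: jsq_rule_def)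
  have "(\<lambda>p. if enat (x ! p) < b then x[p := Suc (x ! p)] else x) \<in> count_space UNIV \<rightarrow>\<^sub>M count_space UNIV"
    by simp
  from measurable_compose[OF \<open>pick _ \<in> _\<close> this] show ?thesis by (simp add: route_def Let_def)
qed

lemma step_measurable: "(\<lambda>(y, c, v). step y c v) \<in> states \<Otimes>\<^sub>M (count_space UNIV \<Otimes>\<^sub>M borel) \<rightarrow>\<^sub>M states"
proof -
  let ?D = "states \<Otimes>\<^sub>M (count_space (UNIV :: nat set) \<Otimes>\<^sub>M (borel :: real measure))"
  have "fst \<in> states \<rightarrow>\<^sub>M count_space UNIV" "(\<lambda>y. fst (snd y)) \<in> states \<rightarrow>\<^sub>M count_space UNIV"
    "(\<lambda>y. fst (snd (snd y))) \<in> borel_measurable states" "(\<lambda>y. snd (snd (snd y))) \<in> states \<rightarrow>\<^sub>M PiM UNIV (\<lambda>_. borel)"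
    unfolding states_def by measurable
  note parts [measurable] = this[THEN measurable_compose[OF measurable_fst[of states "count_space (UNIV :: nat set) \<Otimes>\<^sub>M (borel :: real measure)"]]]
  have "(\<lambda>p. route x (snd (snd (snd (fst p))) k)) \<in> ?D \<rightarrow>\<^sub>M count_space UNIV" for x k
  proof -
    have "(\<lambda>p. snd (snd (snd (fst p))) k) \<in> borel_measurable ?D"
      by (rule measurable_compose[OF parts(4)]) simp
    then show ?thesis by (rule measurable_compose[OF _ route_measurable])
  qed
  from measurable_compose_countable[OF this parts(2)]
  have r: "(\<lambda>p. route x (snd (snd (snd (fst p))) (fst (snd (fst p))))) \<in> ?D \<rightarrow>\<^sub>M count_space UNIV" for x by simp
  have d: "(\<lambda>p. x[fst (snd p) := x ! fst (snd p) - 1]) \<in> ?D \<rightarrow>\<^sub>M count_space UNIV" for x :: "nat list"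
    by (rule measurable_compose[of "\<lambda>p. fst (snd p)" _ "count_space UNIV"]) measurable
  have "(\<lambda>p. if fst (snd p) = N then route x (snd (snd (snd (fst p))) (fst (snd (fst p)))) else x[fst (snd p) := x ! fst (snd p) - 1]) \<in> ?D \<rightarrow>\<^sub>M count_space UNIV" for x
    by (intro measurable_If[OF r d]) measurable
  from measurable_compose_countable[OF this parts(1)]
  have "(\<lambda>p. if fst (snd p) = N then route (fst (fst p)) (snd (snd (snd (fst p))) (fst (snd (fst p)))) else (fst (fst p))[fst (snd p) := fst (fst p) ! fst (snd p) - 1]) \<in> ?D \<rightarrow>\<^sub>M count_space UNIV"
    by simp
  note c1 = this
  have c2: "(\<lambda>p. if fst (snd p) = N then Suc (fst (snd (fst p))) else fst (snd (fst p))) \<in> ?D \<rightarrow>\<^sub>M count_space UNIV"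
    by (intro measurable_If measurable_compose[OF parts(2)] parts(2)) measurable
  have c3: "(\<lambda>p. fst (snd (snd (fst p))) + snd (snd p)) \<in> borel_measurable ?D"
    by (intro borel_measurable_add parts(3)) measurable
  from measurable_Pair[OF c1 measurable_Pair[OF c2 measurable_Pair[OF c3 parts(4)]]]
  show ?thesis by (simp add: step_def Let_def case_prod_beta states_def)
qed

lemma active_measurable: "active \<in> states \<rightarrow>\<^sub>M count_space (Pow {..N} - {{}})"
proof -
  have "fst \<in> states \<rightarrow>\<^sub>M count_space UNIV" unfolding states_def by measurable
  then show ?thesis unfolding active_def by (rule measurable_compose) auto
qed

text \<open>
  The initial queue lengths are coded as a real number, so that all sources of randomness have
  values in one type.
\<close>

definition source_value :: "source \<Rightarrow> 'a \<Rightarrow> real" where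
  "source_value a w = (case a of Initial \<Rightarrow> real (to_nat (map (\<lambda>j. L w j 0) [0..<N]))
     | Gap k \<Rightarrow> gap k w | Service j n \<Rightarrow> svc j n w | Seed k \<Rightarrow> seed k w)"

abbreviation "initial_sources \<equiv> {Initial} \<union> range Seed"
abbreviation "clock_sources \<equiv> range Gap \<union> {Service j n |j n. j < N}"

lemma random_variables [measurable]:
  "gap k \<in> borel_measurable M" "j < N \<Longrightarrow> svc j n \<in> borel_measurable M" "seed k \<in> borel_measurable M"
  using gap_exponential svc_exponential seed_uniform by (auto simp: distributed_def)

text \<open>
  The independence assumption is about the sigma algebras of the sources; the code of the
  initial queue lengths is a function of the latter.
\<close>

lemma indep_sources: "indep_vars (\<lambda>_. borel) source_value (initial_sources \<union> clock_sources)"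
  unfolding indep_vars_def2
proof (intro conjI ballI)
  have L0 [measurable]: "(\<lambda>w. map (\<lambda>j. L w j 0) [0..<N]) \<in> M \<rightarrow>\<^sub>M count_space UNIV"
    by (rule map_upt_measurable) (simp add: L_measurable)
  have Zi: "source_value Initial \<in> borel_measurable M" unfolding source_value_def
    by (simp, rule measurable_compose[OF L0]) simp
  show "source_value a \<in> borel_measurable M" if "a \<in> initial_sources \<union> clock_sources" for a
    using that Zi unfolding source_value_def[abs_def] by (auto simp: random_variables)
  have single: "{source_value a -` A \<inter> space M |A. A \<in> sets borel} \<subseteq> sets (vimage_algebra (space M) f borel)"
    if "source_value a = f" for a and f :: "'a \<Rightarrow> real"
    using that by (auto intro: in_vimage_algebra)
  show "indep_sets (\<lambda>a. {source_value a -` A \<inter> space M |A. A \<in> sets borel}) (initial_sources \<union> clock_sources)"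
  proof (rule indep_sets_mono_sets)
    show "indep_sets (\<lambda>a. case a of
          Initial \<Rightarrow> sets (vimage_algebra (space M) (\<lambda>\<omega>. \<lambda>j\<in>{..<N}. L \<omega> j 0)
                            (\<Pi>\<^sub>M j\<in>{..<N}. count_space UNIV))
        | Gap k \<Rightarrow> sets (vimage_algebra (space M) (gap k) borel)
        | Service j n \<Rightarrow> sets (vimage_algebra (space M) (svc j n) borel)
        | Seed k \<Rightarrow> sets (vimage_algebra (space M) (seed k) borel)) (initial_sources \<union> clock_sources)"
      by (rule back_subst[of "indep_sets _", OF independent]) auto
    fix a assume "a \<in> initial_sources \<union> clock_sources"
    show "{source_value a -` A \<inter> space M |A. A \<in> sets borel} \<subseteq> (case a of
          Initial \<Rightarrow> sets (vimage_algebra (space M) (\<lambda>\<omega>. \<lambda>j\<in>{..<N}. L \<omega> j 0)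
                            (\<Pi>\<^sub>M j\<in>{..<N}. count_space UNIV))
        | Gap k \<Rightarrow> sets (vimage_algebra (space M) (gap k) borel)
        | Service j n \<Rightarrow> sets (vimage_algebra (space M) (svc j n) borel)
        | Seed k \<Rightarrow> sets (vimage_algebra (space M) (seed k) borel))"
    proof (cases a)
      case Initial
      let ?V = "vimage_algebra (space M) (\<lambda>\<omega>. \<lambda>j\<in>{..<N}. L \<omega> j 0) (\<Pi>\<^sub>M j\<in>{..<N}. count_space UNIV)"
      have "(\<lambda>x. map x [0..<N]) \<in> (\<Pi>\<^sub>M j\<in>{..<N}. count_space (UNIV :: nat set)) \<rightarrow>\<^sub>M count_space UNIV"
        by (rule map_upt_measurable) simp
      then have "(\<lambda>x. real (to_nat (map x [0..<N]))) \<in> borel_measurable (\<Pi>\<^sub>M j\<in>{..<N}. count_space (UNIV :: nat set))"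
        by (rule measurable_compose) simp
      moreover have "(\<lambda>\<omega>. \<lambda>j\<in>{..<N}. L \<omega> j 0) \<in> ?V \<rightarrow>\<^sub>M (\<Pi>\<^sub>M j\<in>{..<N}. count_space UNIV)"
        by (rule measurable_vimage_algebra1) (auto simp: space_PiM)
      ultimately have "(\<lambda>\<omega>. real (to_nat (map (\<lambda>j\<in>{..<N}. L \<omega> j 0) [0..<N]))) \<in> borel_measurable ?V"
        by (rule measurable_compose[rotated])
      moreover have "map (\<lambda>j\<in>{..<N}. L \<omega> j 0) [0..<N] = map (\<lambda>j. L \<omega> j 0) [0..<N]" for \<omega> by simp
      ultimately have "source_value Initial \<in> borel_measurable ?V" by (simp add: source_value_def[abs_def])
      from measurable_sets[OF this] show ?thesis using Initial by auto
    qed (simp_all only: source.case, (rule single, simp add: source_value_def fun_eq_iff)+)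
  qed
qed

definition initial_state :: "'a \<Rightarrow> state" where
  "initial_state w = (map (\<lambda>j. L w j 0) [0..<N], 0, 0, \<lambda>m. seed m w)"
definition initial_clocks :: "'a \<Rightarrow> nat \<times> nat \<Rightarrow> real" where
  "initial_clocks w = (\<lambda>k\<in>clk.K. if fst k < N then svc (fst k) (snd k) w else gap (snd k) w)"

lemma distr_initial_clocks: "distr M clk.P initial_clocks = clk.P"
proof -
  let ?g = "\<lambda>k. if fst k < N then Service (fst k) (snd k) else Gap (snd k)"
  have inj: "inj_on ?g clk.K" by (auto simp: inj_on_def clk.K_def split: if_splits)
  have src: "?g k \<in> clock_sources" for k by (cases "fst k < N") auto
  have "indep_vars (\<lambda>k. PiM {?g k} (\<lambda>_. borel)) (\<lambda>k w. restrict (\<lambda>i. source_value i w) {?g k}) clk.K"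
  proof (rule indep_vars_restrict[OF indep_sources])
    show "{?g k} \<subseteq> initial_sources \<union> clock_sources" for k using src[of k] by blast
    show "disjoint_family_on (\<lambda>k. {?g k}) clk.K" using inj unfolding disjoint_family_on_def inj_on_def by blast
  qed
  then have "indep_vars (\<lambda>_. borel) (\<lambda>k. (\<lambda>z. z (?g k)) \<circ> (\<lambda>w. restrict (\<lambda>i. source_value i w) {?g k})) clk.K"
    by (rule indep_vars_compose) (rule measurable_component_singleton, simp)
  then have ind: "indep_vars (\<lambda>_. borel) (\<lambda>k. source_value (?g k)) clk.K"
    by (simp add: comp_def)
  have rv: "(\<lambda>w. source_value (?g k) w) \<in> borel_measurable M" for k by (auto simp: source_value_def)
  have initial_clocks: "initial_clocks = (\<lambda>w. \<lambda>k\<in>clk.K. source_value (?g k) w)" by (auto simp: initial_clocks_def source_value_def fun_eq_iff)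
  have law: "distr M borel (source_value (?g k)) = exp_law mu k" if "k \<in> clk.K" for k
  proof (cases "fst k < N")
    case True
    then have "distr M lborel (svc (fst k) (snd k)) = density lborel (exponential_density 1)"
      using svc_exponential by (simp add: distributed_def)
    moreover have "distr M borel (svc (fst k) (snd k)) = distr M lborel (svc (fst k) (snd k))" by (rule distr_cong) auto
    ultimately show ?thesis using True by (simp add: source_value_def[abs_def] exp_law_def mu_def)
  next
    case False
    then have "fst k = N" using that by (auto simp: clk.K_def)
    have "distr M lborel (gap (snd k)) = density lborel (exponential_density rate)"
      using gap_exponential by (simp add: distributed_def)
    moreover have "distr M borel (gap (snd k)) = distr M lborel (gap (snd k))" by (rule distr_cong) auto
    ultimately show ?thesis using False \<open>fst k = N\<close> by (simp add: source_value_def[abs_def] exp_law_def mu_def)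
  qed
  have ne: "clk.K \<noteq> {}" by (auto simp: clk.K_def)
  have "distr M (PiM clk.K (\<lambda>_. borel)) initial_clocks = PiM clk.K (\<lambda>k. distr M borel (source_value (?g k)))"
    using ind unfolding initial_clocks by (subst (asm) indep_vars_iff_distr_eq_PiM'[OF ne]) (rule rv)
  also have "\<dots> = clk.P" unfolding clk.P_def by (rule PiM_cong) (simp_all add: law)
  finally have "distr M (PiM clk.K (\<lambda>_. borel)) initial_clocks = clk.P" .
  moreover have "distr M (PiM clk.K (\<lambda>_. borel)) initial_clocks = distr M clk.P initial_clocks"
    unfolding clk.P_def by (rule distr_cong) (auto intro!: sets_PiM_cong)
  ultimately show ?thesis by simp
qed

text \<open>
  Initial queues and seeds on the one hand, interarrival and service times on the other are
  built from disjoint groups of independent sources.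
\<close>

lemma fresh_init: "clk.fresh M states initial_state initial_clocks"
proof -
  \<comment> \<open>Both are measurable functions of the values of their sources; \<open>from_nat\<close> decodes the
    initial queues.\<close>
  let ?fY = "\<lambda>z. (from_nat (nat \<lfloor>z Initial\<rfloor>), 0, 0, \<lambda>m. z (Seed m)) :: state"
  let ?fX = "\<lambda>z. \<lambda>k\<in>clk.K. if fst k < N then z (Service (fst k) (snd k)) else z (Gap (snd k)) :: real"
  let ?PI = "PiM initial_sources (\<lambda>_. borel :: real measure)"
  let ?PC = "PiM clock_sources (\<lambda>_. borel :: real measure)"
  have ind: "indep_var ?PI (\<lambda>w. restrict (\<lambda>a. source_value a w) initial_sources) ?PC (\<lambda>w. restrict (\<lambda>a. source_value a w) clock_sources)"
    by (rule indep_var_restrict[OF indep_sources]) auto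
  have fY: "?fY \<in> ?PI \<rightarrow>\<^sub>M states"
  proof -
    have [measurable]: "(\<lambda>z. z Initial) \<in> borel_measurable ?PI" by (rule measurable_component_singleton) simp
    have "(\<lambda>z. nat \<lfloor>z Initial\<rfloor>) \<in> ?PI \<rightarrow>\<^sub>M count_space UNIV" by measurable
    then have [measurable]: "(\<lambda>z. from_nat (nat \<lfloor>z Initial\<rfloor>) :: nat list) \<in> ?PI \<rightarrow>\<^sub>M count_space UNIV"
      by (rule measurable_compose) simp
    have [measurable]: "(\<lambda>z m. z (Seed m)) \<in> ?PI \<rightarrow>\<^sub>M PiM UNIV (\<lambda>_. borel)"
      by (rule measurable_PiM_single') (auto intro!: measurable_component_singleton)
    show ?thesis unfolding states_def by measurable
  qed
  have fX: "?fX \<in> ?PC \<rightarrow>\<^sub>M clk.P"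
    unfolding clk.P_def
  proof (rule measurable_restrict)
    fix k assume "k \<in> clk.K"
    then show "(\<lambda>z. if fst k < N then z (Service (fst k) (snd k)) else z (Gap (snd k))) \<in> ?PC \<rightarrow>\<^sub>M exp_law mu k"
      by (cases "fst k < N") (auto intro!: measurable_component_singleton simp: measurable_cong_sets[OF refl clk.sets_exp_law])
  qed
  let ?RI = "\<lambda>w. restrict (\<lambda>a. source_value a w) initial_sources" and ?RC = "\<lambda>w. restrict (\<lambda>a. source_value a w) clock_sources"
  have rv [measurable]: "?RI \<in> M \<rightarrow>\<^sub>M ?PI" "?RC \<in> M \<rightarrow>\<^sub>M ?PC"
    and joint: "distr M ?PI ?RI \<Otimes>\<^sub>M distr M ?PC ?RC = distr M (?PI \<Otimes>\<^sub>M ?PC) (\<lambda>w. (?RI w, ?RC w))"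
    using ind unfolding indep_var_distribution_eq by auto
  have initial_state: "?fY (?RI w) = initial_state w" for w by (simp add: initial_state_def source_value_def)
  have initial_clocks: "?fX (?RC w) = initial_clocks w" for w by (auto simp: fun_eq_iff initial_clocks_def source_value_def)
  have Ym: "initial_state \<in> M \<rightarrow>\<^sub>M states" using measurable_compose[OF rv(1) fY] unfolding initial_state .
  have Xm: "initial_clocks \<in> M \<rightarrow>\<^sub>M clk.P" using measurable_compose[OF rv(2) fX] unfolding initial_clocks .
  have dY: "distr (distr M ?PI ?RI) states ?fY = distr M states initial_state"
    by (subst distr_distr[OF fY rv(1)]) (simp only: comp_def initial_state)
  have dX: "distr (distr M ?PC ?RC) clk.P ?fX = clk.P"
    by (subst distr_distr[OF fX rv(2)]) (simp only: comp_def initial_clocks distr_initial_clocks)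
  interpret P: prob_space clk.P by (rule clk.prob_space_P)
  have "distr M states initial_state \<Otimes>\<^sub>M clk.P =
      distr (distr M ?PI ?RI \<Otimes>\<^sub>M distr M ?PC ?RC) (states \<Otimes>\<^sub>M clk.P) (\<lambda>(y, x). (?fY y, ?fX x))"
    unfolding dY[symmetric]
    using pair_measure_distr[of ?fY "distr M ?PI ?RI" states ?fX "distr M ?PC ?RC" clk.P] fY fX P.sigma_finite_measure_axioms
    unfolding dX by simp
  also have "\<dots> = distr M (states \<Otimes>\<^sub>M clk.P) ((\<lambda>(y, x). (?fY y, ?fX x)) \<circ> (\<lambda>w. (?RI w, ?RC w)))"
    unfolding joint
  proof (rule distr_distr)
    show "(\<lambda>(y, x). (?fY y, ?fX x)) \<in> ?PI \<Otimes>\<^sub>M ?PC \<rightarrow>\<^sub>M states \<Otimes>\<^sub>M clk.P"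
      using measurable_Pair[OF measurable_compose[OF measurable_fst fY] measurable_compose[OF measurable_snd fX]]
      by (simp add: case_prod_beta)
  qed (rule measurable_Pair[OF rv])
  also have "(\<lambda>(y, x). (?fY y, ?fX x)) \<circ> (\<lambda>w. (?RI w, ?RC w)) = (\<lambda>w. (initial_state w, initial_clocks w))"
    using initial_state initial_clocks by (simp only: comp_def case_prod_conv)
  finally show ?thesis
    using Ym Xm by (simp add: clk.fresh_def prob_space_axioms)
qed

primrec run :: "nat \<Rightarrow> 'a \<Rightarrow> state \<times> (nat \<times> nat \<Rightarrow> real)" where
  "run 0 w = (initial_state w, initial_clocks w)"
| "run (Suc n) w = (let (y, x) = run n w in
     (step y (clk.winner (active y) x) (clk.delay (active y) x), clk.advance (active y) x))"

abbreviation "Y n w \<equiv> fst (run n w)"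
abbreviation "X n w \<equiv> snd (run n w)"

sublocale ch: clock_chain "{..N}" mu M states active step "\<lambda>y. fst (snd (snd y))" Y X
proof unfold_locales
  show "active \<in> states \<rightarrow>\<^sub>M count_space (Pow {..N} - {{}})" by (rule active_measurable)
  show "(\<lambda>(y, c, v). step y c v) \<in> states \<Otimes>\<^sub>M (count_space UNIV \<Otimes>\<^sub>M borel) \<rightarrow>\<^sub>M states" by (rule step_measurable)
  show "(\<lambda>y. fst (snd (snd y))) \<in> borel_measurable states" unfolding states_def by measurable
  show "clk.fresh M states (Y 0) (X 0)" using fresh_init by simp
qed (auto simp: step_def initial_state_def Let_def split: prod.split)

end

section \<open>Deviation of the random system from its drift\<close>

text \<open>Convergence of natural numbers means eventual equality.\<close>

lemma (in jsq_system) step_like_queues: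
  assumes w: "w \<in> space M"
  shows "step_like (\<lambda>t. map (\<lambda>j. L w j t) [0..<N])"
  unfolding step_like_def
proof (intro conjI allI impI)
  fix t :: real assume t: "0 \<le> t"
  have "\<forall>j\<in>{..<N}. \<forall>\<^sub>F s in at_right t. L w j s = L w j t"
    using L_right_cont[OF w _ t] by (simp add: tendsto_discrete)
  then have "\<forall>\<^sub>F s in at_right t. \<forall>j\<in>{..<N}. L w j s = L w j t"
    by (intro eventually_ball_finite) auto
  then obtain a where a: "t < a" "\<And>s. t < s \<Longrightarrow> s < a \<Longrightarrow> \<forall>j\<in>{..<N}. L w j s = L w j t"
    unfolding eventually_at_right_field by blast
  have eq: "map (\<lambda>j. L w j s) [0..<N] = map (\<lambda>j. L w j t) [0..<N]" if "t \<le> s" "s < t + (a - t)" for s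
    using a(2)[of s] that by (cases "s = t") auto
  show "\<exists>e>0. \<forall>s. t \<le> s \<and> s < t + e \<longrightarrow> map (\<lambda>j. L w j s) [0..<N] = map (\<lambda>j. L w j t) [0..<N]"
  proof (intro exI[of _ "a - t"] conjI allI impI)
    show "0 < a - t" using a(1) by simp
  qed (elim conjE, rule eq)
next
  fix t :: real assume t: "0 < t"
  have "\<exists>l. \<forall>\<^sub>F s in at_left t. L w j s = l" if "j < N" for j
    using L_left_limit[OF w that t] by (simp add: tendsto_discrete)
  then obtain l where "\<And>j. j < N \<Longrightarrow> \<forall>\<^sub>F s in at_left t. L w j s = l j" by metis
  then have "\<forall>\<^sub>F s in at_left t. \<forall>j\<in>{..<N}. L w j s = l j"
    by (intro eventually_ball_finite) auto
  then obtain a where a: "a < t" "\<And>s. a < s \<Longrightarrow> s < t \<Longrightarrow> \<forall>j\<in>{..<N}. L w j s = l j"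
    unfolding eventually_at_left_field by blast
  have eq: "map (\<lambda>j. L w j s) [0..<N] = map l [0..<N]" if "t - (t - a) < s" "s < t" for s
    using a(2)[of s] that by auto
  show "\<exists>e>0. \<exists>l. \<forall>s. 0 \<le> s \<and> t - e < s \<and> s < t \<longrightarrow> map (\<lambda>j. L w j s) [0..<N] = l"
  proof (intro exI[of _ "t - a"] conjI exI[of _ "map l [0..<N]"] allI impI)
    show "0 < t - a" using a(1) by simp
  qed (elim conjE, rule eq)
qed

lemma (in jsq_system) busy_measurable:
  assumes w: "w \<in> space M" and j: "j < N"
  shows "{s \<in> {0..t}. 0 < L w j s} \<in> sets borel"
proof (cases "0 \<le> t")
  case True
  obtain F where "jumps_within (\<lambda>t. map (\<lambda>j. L w j t) [0..<N]) 0 t F"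
    using step_like_finite_jumps[OF step_like_queues[OF w] True] by blast
  from jumps_within_measurable[OF this, of "\<lambda>x. 0 < x ! j"] j show ?thesis by simp
qed (auto simp: not_le)

context jsq_chain
begin

declare run.simps(2) [simp del]

lemma seeds: "snd (snd (snd (Y n w))) = (\<lambda>m. seed m w)"
proof (induction n)
  case (Suc n)
  then show ?case unfolding ch.Y_Suc by (simp add: step_def Let_def)
qed (simp add: initial_state_def)

abbreviation "Tn n w \<equiv> fst (snd (snd (Y n w)))"

lemma total_rate_clocks: "clk.total_rate {..N} = rate + real N"
proof -
  have "{..N} = insert N {..<N}" by auto
  then show ?thesis by (simp add: clk.total_rate_def mu_def)
qed

text \<open>
  By \<open>prob_slow\<close> the probability that \<open>n\<close> jumps happen before a given time tends to zero as \<open>n\<close>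
  grows.
\<close>

lemma AE_unbounded: "AE w in M. \<forall>t. \<exists>n. t < Tn n w"
proof -
  have "AE w in M. \<exists>n. real m < Tn n w" for m
  proof (rule AE_I)
    let ?B = "{w \<in> space M. \<forall>n. Tn n w \<le> real m}"
    have m: "?B \<in> events" by measurable
    show "{w \<in> space M. \<not> (\<exists>n. real m < Tn n w)} \<subseteq> ?B" by (auto simp: not_less)
    show "?B \<in> events" by (rule m)
    have "prob ?B \<le> clk.total_rate {..N} * real m / real (Suc n)" for n
    proof -
      have "prob ?B \<le> prob {w \<in> space M. Tn (Suc n) w \<le> real m}" by (rule finite_measure_mono) auto
      also have "\<dots> \<le> clk.total_rate {..N} * real m / real (Suc n)" by (rule ch.prob_slow) auto
      finally show ?thesis .
    qed
    moreover have "(\<lambda>n. clk.total_rate {..N} * real m / real (Suc n)) \<longlonglongrightarrow> 0"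
      by (rule LIMSEQ_Suc[OF lim_const_over_n])
    ultimately have "prob ?B \<le> 0" by (intro LIMSEQ_le_const) auto
    then show "emeasure M ?B = 0" by (simp add: emeasure_eq_measure measure_le_0_iff)
  qed
  then have "AE w in M. \<forall>m. \<exists>n. real m < Tn n w" by (simp add: AE_all_countable)
  then show ?thesis
  proof eventually_elim
    case (elim w)
    show ?case
    proof
      fix t :: real
      obtain m :: nat where "t < real m" using reals_Archimedean2 by blast
      then show "\<exists>n. t < Tn n w" using elim by (meson order_less_trans)
    qed
  qed
qed

abbreviation "is_run w \<equiv> jsq_run N b pick (\<lambda>i. gap i w) (\<lambda>j i. svc j i w) (\<lambda>k. seed k w) (L w)
    (\<lambda>n. fst (Y n w)) (\<lambda>n. fst (snd (Y n w))) (\<lambda>n. Tn n w) (\<lambda>n. X n w) (\<lambda>n. ch.win n w)"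

text \<open>
  Almost surely the queue equation holds, every race has a unique winner, and jump times are
  unbounded.
\<close>

lemma AE_run: "AE w in M. is_run w"
  using dynamics ch.AE_all_good AE_unbounded AE_space
proof eventually_elim
  case (elim w)
  have w: "w \<in> space M" and good: "\<And>n. clk.good (X n w)" using elim by auto
  have act: "active (Y n w) \<subseteq> {..N}" "active (Y n w) \<noteq> {}" for n by (auto simp: active_def)
  have pos: "0 < X n w (j, m)" if "j \<le> N" for n j m
    using good[of n] that by (auto simp: clk.good_def clk.K_def)
  note wins = clk.good_wins[OF good act]
  have Ysuc: "Y (Suc n) w = step (Y n w) (ch.win n w) (ch.del n w)" for n by (rule ch.Y_Suc)
  have Xsuc: "X (Suc n) w = clk.advance (active (Y n w)) (X n w)" for n by (rule ch.X_Suc)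
  show ?case
  proof unfold_locales
    show "jsq_rule N pick" by (rule rule)
    show "0 < gap i w" for i using pos[of N 0 i] by (simp add: initial_clocks_def clk.K_def)
    show "0 < svc j i w" if "j < N" for i j using pos[of j 0 i] that by (simp add: initial_clocks_def clk.K_def)
    show "{s \<in> {0..t}. 0 < L w j s} \<in> sets borel" if "j < N" for j t by (rule busy_measurable[OF w that])
    show "L w j t + card {n. (\<Sum>i\<le>n. svc j i w) \<le> measure lborel {s \<in> {0..t}. 0 < L w j s}} =
       L w j 0 + card {k. (\<Sum>i\<le>k. gap i w) \<le> t \<and>
          pick (\<lambda>j\<in>{..<N}. Lim (at_left (\<Sum>i\<le>k. gap i w)) (L w j)) (seed k w) = j \<and>
          enat ((\<lambda>j\<in>{..<N}. Lim (at_left (\<Sum>i\<le>k. gap i w)) (L w j)) j) < b}" if "j < N" "0 \<le> t" for j t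
      using elim(1) that unfolding Let_def by blast
    show "fst (Y 0 w) = map (\<lambda>j. L w j 0) [0..<N]" "fst (snd (Y 0 w)) = 0" "Tn 0 w = 0" by (simp_all add: initial_state_def)
    show "X 0 w (j, m) = svc j m w" if "j < N" for j m using that by (simp add: initial_clocks_def clk.K_def)
    show "X 0 w (N, m) = gap m w" for m by (simp add: initial_clocks_def clk.K_def)
    show "0 < X n w (j, m)" if "j \<le> N" for n j m by (rule pos[OF that])
    show "ch.win n w \<in> insert N {j. j < N \<and> 0 < fst (Y n w) ! j}" for n
      using wins(2)[of n] by (simp add: active_def)
    show "X n w (ch.win n w, 0) < X n w (j, 0)"
      if "j \<in> insert N {j. j < N \<and> 0 < fst (Y n w) ! j}" "j \<noteq> ch.win n w" for n j
      using wins(1)[of n] that by (auto simp: clk.wins_def active_def)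
    show "Tn (Suc n) w = Tn n w + X n w (ch.win n w, 0)" for n
      using ch.T_Suc[of n w] by (simp only: clk.delay_def)
    show "X (Suc n) w (j, m) = (if j = ch.win n w then X n w (j, Suc m)
       else if j \<in> insert N {j. j < N \<and> 0 < fst (Y n w) ! j} \<and> m = 0 then X n w (j, 0) - X n w (ch.win n w, 0)
       else X n w (j, m))" if "j \<le> N" for n j m
      using that unfolding Xsuc clk.advance_def clk.delay_def active_def[symmetric] by (simp add: clk.K_def)
    show "fst (snd (Y (Suc n) w)) = Suc (fst (snd (Y n w)))" if "ch.win n w = N" for n
      using that unfolding Ysuc by (simp add: step_def Let_def)
    show "fst (Y (Suc n) w) = (if enat (fst (Y n w) ! j) < b then (fst (Y n w))[j := Suc (fst (Y n w) ! j)] else fst (Y n w))"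
      if "ch.win n w = N" "j = pick (\<lambda>j\<in>{..<N}. fst (Y n w) ! j) (seed (fst (snd (Y n w))) w)" for n j
      using that unfolding Ysuc step_def Let_def by (simp add: route_def Let_def seeds)
    show "fst (snd (Y (Suc n) w)) = fst (snd (Y n w))" if "ch.win n w < N" for n
      using that unfolding Ysuc by (simp add: step_def Let_def)
    show "fst (Y (Suc n) w) = (fst (Y n w))[ch.win n w := fst (Y n w) ! ch.win n w - 1]" if "ch.win n w < N" for n
      using that unfolding Ysuc by (simp add: step_def Let_def)
    show "1 \<le> N" by (rule N_pos)
    show "\<exists>n. t < Tn n w" for t using elim by blast
    show "enat (L w j 0) \<le> b" if "j < N" for j by (rule initial_le_buffer[OF w that])
  qed
qed

abbreviation "occ w \<equiv> \<lambda>t. occupancy b N (\<lambda>j. L w j t)"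

text \<open>
  Chebyshev's inequality for each grid time and each level, where level \<open>0\<close> stands for the
  arrivals. The number \<open>n\<close> of jumps must be large enough to reach time \<open>T\<close>, which fails with a
  small probability by \<open>prob_slow\<close>.
\<close>

lemma deviation_event:
  assumes G: "finite G" "\<And>t. t \<in> G \<Longrightarrow> 0 \<le> t \<and> t \<le> T" and T: "0 \<le> T" and e: "0 < e" and n: "0 < n"
  shows "\<exists>E\<in>events. 1 - (real (card G * Suc J) / (real N * e)\<^sup>2 + 1 / real n) * ((rate + real N) * T) \<le> prob E \<and>
    (\<forall>w\<in>E. \<exists>U D. sys_path b (occ w) U D \<and>
       (\<forall>t\<in>G. \<bar>U 0 t - rate / real N * t\<bar> < e \<and> (\<forall>i. 1 \<le> i \<and> i \<le> J \<and> enat i \<le> b \<longrightarrow> \<bar>D i t - drift (occ w) i t\<bar> < e)))"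
proof -
  \<comment> \<open>The clocks whose rings are counted: arrivals for \<open>i = 0\<close>, and departures from queues of
    length \<open>i\<close> otherwise.\<close>
  define S where "S i y = (if i = 0 then {N} else {j. j < N \<and> fst y ! j = i})" for i :: nat and y :: state
  have count: "clock_count {..N} mu M states active step (\<lambda>y. fst (snd (snd y))) Y X (S i) t" if "0 \<le> t" for i t
  proof unfold_locales
    have "fst \<in> states \<rightarrow>\<^sub>M count_space UNIV" unfolding states_def by measurable
    then show "S i \<in> states \<rightarrow>\<^sub>M count_space (Pow {..N})"
      unfolding S_def[abs_def] by (rule measurable_compose) (auto split: if_splits)
    show "S i y \<subseteq> active y" for y by (auto simp: S_def active_def)
  qed fact
  define ex where "ex i t w = (\<Sum>m<n. hit (S i (Y m w)) (t - Tn m w) (ch.win m w) (ch.del m w)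
      - clk.total_rate (S i (Y m w)) * clip (t - Tn m w) (ch.del m w))" for i t w
  have ex: "ex i t = clock_count.excess mu active (\<lambda>y. fst (snd (snd y))) Y X (S i) t n" if "0 \<le> t" for i t
    by (rule ext) (simp add: ex_def clock_count.excess_def[OF count[OF that]] clock_count.hits_def[OF count[OF that]] clock_count.compensator_def[OF count[OF that]])
  have Ne: "0 < real N * e" using N_pos e by simp
  define B where "B p = {w \<in> space M. real N * e \<le> \<bar>ex (snd p) (fst p) w\<bar>}" for p :: "real \<times> nat"
  have exm: "ex i t \<in> borel_measurable M" if "0 \<le> t" for i t
    unfolding ex[OF that] clock_count.excess_def[OF count[OF that], abs_def]
    using clock_count.hits_measurable[OF count[OF that]] by (intro borel_measurable_sum borel_measurable_diff) auto
  let ?I = "G \<times> {..J}" and ?c = "(rate + real N) * T"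
  have Bm: "B p \<in> events" if "p \<in> ?I" for p
  proof -
    have [measurable]: "ex (snd p) (fst p) \<in> borel_measurable M" using exm G(2) that by auto
    show ?thesis unfolding B_def by measurable
  qed
  have Bp: "prob (B p) \<le> ?c / (real N * e)\<^sup>2" if "p \<in> ?I" for p
  proof -
    have t: "0 \<le> fst p" "fst p \<le> T" using that G by auto
    have "prob (B p) \<le> clk.total_rate {..N} * fst p / (real N * e)\<^sup>2"
      unfolding B_def ex[OF t(1)] by (rule clock_count.prob_excess[OF count[OF t(1)] Ne])
    also have "\<dots> \<le> ?c / (real N * e)\<^sup>2"
      using t rate_pos by (intro divide_right_mono) (auto simp: total_rate_clocks intro!: mult_left_mono)
    finally show ?thesis .
  qed
  define R where "R = {w \<in> space M. Tn n w \<le> T}"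
  have Rm: "R \<in> events" unfolding R_def by measurable
  have Rp: "prob R \<le> ?c / real n" unfolding R_def using ch.prob_slow[OF T n] by (simp add: total_rate_clocks)
  obtain Z0 where Z0: "Z0 \<in> null_sets M" "{w \<in> space M. \<not> is_run w} \<subseteq> Z0"
    using AE_run by (auto elim!: AE_E simp: null_sets_def)
  let ?bad = "Z0 \<union> (R \<union> (\<Union>p\<in>?I. B p))"
  let ?E = "space M - ?bad"
  have fin: "finite ?I" using G by simp
  have bm: "(\<Union>p\<in>?I. B p) \<in> events" using fin Bm by (intro sets.finite_UN) auto
  have badm: "?bad \<in> events" using Z0(1) Rm bm by auto
  have "prob ?bad \<le> prob Z0 + prob (R \<union> (\<Union>p\<in>?I. B p))"
    using Z0(1) Rm bm by (intro measure_Un_le) auto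
  also have "prob Z0 = 0" using Z0(1) by (simp add: measure_eq_0_null_sets)
  also have "prob (R \<union> (\<Union>p\<in>?I. B p)) \<le> prob R + prob (\<Union>p\<in>?I. B p)"
    using Rm bm by (intro measure_Un_le) auto
  also have "prob (\<Union>p\<in>?I. B p) \<le> (\<Sum>p\<in>?I. prob (B p))"
    using fin Bm by (intro measure_UNION_le) auto
  also have "\<dots> \<le> (\<Sum>p\<in>?I. ?c / (real N * e)\<^sup>2)" by (rule sum_mono) (rule Bp)
  also have "\<dots> = real (card G * Suc J) * (?c / (real N * e)\<^sup>2)" by (simp add: card_cartesian_product)
  finally have "prob ?bad \<le> ?c / real n + real (card G * Suc J) * (?c / (real N * e)\<^sup>2)" using Rp by simp
  also have "\<dots> = (real (card G * Suc J) / (real N * e)\<^sup>2 + 1 / real n) * ?c" by (simp add: distrib_right)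
  finally have pE: "1 - (real (card G * Suc J) / (real N * e)\<^sup>2 + 1 / real n) * ?c \<le> prob ?E"
    using prob_compl[OF badm] by simp
  have "\<exists>U D. sys_path b (occ w) U D \<and>
       (\<forall>t\<in>G. \<bar>U 0 t - rate / real N * t\<bar> < e \<and> (\<forall>i. 1 \<le> i \<and> i \<le> J \<and> enat i \<le> b \<longrightarrow> \<bar>D i t - drift (occ w) i t\<bar> < e))"
    if w: "w \<in> ?E" for w
  proof -
    have run: "is_run w" using w Z0(2) by blast
    let ?U = "jsq_run.U N (\<lambda>n. fst (Y n w)) (\<lambda>n. Tn n w) (\<lambda>n. ch.win n w)"
    let ?D = "jsq_run.D N (\<lambda>n. fst (Y n w)) (\<lambda>n. Tn n w) (\<lambda>n. ch.win n w)"
    have q: "jsq_run.q N b (L w) = occ w" by (rule ext) (simp add: jsq_run.q_def[OF run])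
    have small: "\<bar>ex i t w\<bar> < real N * e" if "t \<in> G" "i \<le> J" for i t
      using w that by (force simp: B_def)
    have lt: "t < Tn n w" if "t \<in> G" for t using w G(2)[OF that] by (auto simp: R_def)
    have N: "0 < real N" using N_pos by simp
    have scale: "\<bar>z\<bar> < e" if "\<bar>real N * z\<bar> < real N * e" for z
      using that N by (simp add: abs_mult)
    have "\<bar>?U 0 t - rate / real N * t\<bar> < e" if t: "t \<in> G" for t
    proof (rule scale)
      have "real N * (?U 0 t - rate / real N * t) = real N * ?U 0 t - rate * t" using N by (simp add: right_diff_distrib)
      also have "\<dots> = ex 0 t w"
        using jsq_run.U_deviation[OF run _ lt[OF t], of rate] G(2)[OF t]
        by (simp add: ex_def S_def clk.delay_def clk.total_rate_def mu_def)
      finally show "\<bar>real N * (?U 0 t - rate / real N * t)\<bar> < real N * e" using small[OF t, of 0] by simp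
    qed
    moreover have "\<bar>?D i t - drift (occ w) i t\<bar> < e" if t: "t \<in> G" and i: "1 \<le> i" "i \<le> J" "enat i \<le> b" for i t
    proof (rule scale)
      have "clk.total_rate {j. j < N \<and> fst y ! j = i} = real (card {j. j < N \<and> fst y ! j = i})" for y :: state
        by (simp add: clk.total_rate_def mu_def)
      then have "real N * (?D i t - drift (occ w) i t) = ex i t w"
        using jsq_run.D_deviation[OF run i(1,3) _ lt[OF t]] G(2)[OF t] i(1)
        by (simp add: ex_def S_def clk.delay_def q)
      then show "\<bar>real N * (?D i t - drift (occ w) i t)\<bar> < real N * e" using small[OF t i(2)] by simp
    qed
    moreover have "sys_path b (occ w) ?U ?D" using jsq_run.run_sys_path[OF run] by (simp only: q)
    ultimately show ?thesis by blast
  qed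
  moreover have "?E \<in> events" using badm by auto
  ultimately show ?thesis using pE by blast
qed

end

section \<open>Weak convergence and continuity of the fluid path\<close>

lemma space_borel_of_topology: "space (borel_of_topology X) = topspace X"
  unfolding borel_of_topology_def by (rule space_measure_of) (auto dest: openin_subset)

lemma openin_borel_of_topology: "openin X U \<Longrightarrow> U \<in> sets (borel_of_topology X)"
  unfolding borel_of_topology_def by (subst sets_measure_of) (auto dest: openin_subset)

lemma continuous_map_borel_measurable:
  assumes "continuous_map X euclideanreal f"
  shows "f \<in> borel_measurable (borel_of_topology X)"
proof (rule borel_measurableI)
  fix S :: "real set" assume "open S"
  then have "openin X {x \<in> topspace X. f x \<in> S}" using assms by (intro openin_continuous_map_preimage) auto
  moreover have "f -` S \<inter> space (borel_of_topology X) = {x \<in> topspace X. f x \<in> S}"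
    by (auto simp: space_borel_of_topology)
  ultimately show "f -` S \<inter> space (borel_of_topology X) \<in> sets (borel_of_topology X)"
    using openin_borel_of_topology by metis
qed

text \<open>
  A bounded continuous \<open>f\<close> is nearly constant on a neighbourhood \<open>W\<close> of \<open>x\<close> and contributes
  little on the complement of \<open>E\<close>.
\<close>

lemma converges_weakly_returnI:
  assumes M: "\<And>n. prob_space (M n)" and X: "\<And>n. X n \<in> M n \<rightarrow>\<^sub>M borel_of_topology T" and x: "x \<in> topspace T"
    and near: "\<And>W \<delta>. openin T W \<Longrightarrow> x \<in> W \<Longrightarrow> 0 < \<delta> \<Longrightarrow>
      \<forall>\<^sub>F n in sequentially. \<exists>E\<in>sets (M n). 1 - \<delta> \<le> measure (M n) E \<and> (\<forall>w\<in>E. X n w \<in> W)"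
  shows "converges_weakly T M X (return (borel_of_topology T) x)"
  unfolding converges_weakly_def
proof (intro conjI allI impI)
  have xs: "x \<in> space (borel_of_topology T)" using x by (simp add: space_borel_of_topology)
  show "prob_space (return (borel_of_topology T) x)" by (rule prob_space_return[OF xs])
  fix f assume "continuous_map T euclideanreal f \<and> bounded (f ` topspace T)"
  then have cont: "continuous_map T euclideanreal f" and bnd: "bounded (f ` topspace T)" by auto
  have f: "f \<in> borel_measurable (borel_of_topology T)" by (rule continuous_map_borel_measurable[OF cont])
  obtain B0 where B0: "\<And>y. y \<in> topspace T \<Longrightarrow> \<bar>f y\<bar> \<le> B0" using bnd by (auto simp: bounded_iff)
  define B where "B = \<bar>B0\<bar> + 1"
  have B: "0 < B" "\<And>y. y \<in> topspace T \<Longrightarrow> \<bar>f y\<bar> \<le> B" using B0 by (force simp: B_def)+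
  have "(\<lambda>n. \<integral>w. f (X n w) \<partial>M n) \<longlonglongrightarrow> f x"
  proof (rule tendstoI)
    fix e :: real assume e: "0 < e"
    let ?W = "{y \<in> topspace T. f y \<in> ball (f x) (e / 3)}"
    have "openin T ?W" using cont by (intro openin_continuous_map_preimage) auto
    moreover have "x \<in> ?W" using x e by simp
    ultimately have "\<forall>\<^sub>F n in sequentially. \<exists>E\<in>sets (M n). 1 - e / (6 * B) \<le> measure (M n) E \<and> (\<forall>w\<in>E. X n w \<in> ?W)"
      using e B(1) by (intro near) auto
    then show "\<forall>\<^sub>F n in sequentially. dist (\<integral>w. f (X n w) \<partial>M n) (f x) < e"
    proof eventually_elim
      case (elim n)
      then obtain E where E: "E \<in> sets (M n)" "1 - e / (6 * B) \<le> measure (M n) E" "\<And>w. w \<in> E \<Longrightarrow> X n w \<in> ?W" by blast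
      interpret M: prob_space "M n" by (rule M)
      have m: "(\<lambda>w. f (X n w)) \<in> borel_measurable (M n)" by (rule measurable_compose[OF X f])
      have XT: "X n w \<in> topspace T" if "w \<in> space (M n)" for w
        using measurable_space[OF X that] by (simp add: space_borel_of_topology)
      have i: "integrable (M n) (\<lambda>w. f (X n w))"
        by (rule M.integrable_const_bound[of _ B]) (use m B(2) XT in auto)
      have "\<bar>(\<integral>w. f (X n w) \<partial>M n) - f x\<bar> = \<bar>\<integral>w. f (X n w) - f x \<partial>M n\<bar>"
        using i by (simp add: M.prob_space)
      also have "\<dots> \<le> (\<integral>w. \<bar>f (X n w) - f x\<bar> \<partial>M n)" by (rule integral_abs_bound)
      finally have bound: "\<bar>(\<integral>w. f (X n w) \<partial>M n) - f x\<bar> \<le> (\<integral>w. \<bar>f (X n w) - f x\<bar> \<partial>M n)" .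
      have int: "integrable (M n) (\<lambda>w. e / 3)" "integrable (M n) (\<lambda>w. 2 * B * indicator (space (M n) - E) w)"
        using E(1) by (auto intro!: integrable_mult_right integrable_real_indicator simp: M.emeasure_eq_measure)
      have "\<bar>(\<integral>w. f (X n w) \<partial>M n) - f x\<bar> \<le> (\<integral>w. \<bar>f (X n w) - f x\<bar> \<partial>M n)" using bound .
      also have "\<dots> \<le> (\<integral>w. e / 3 + 2 * B * indicator (space (M n) - E) w \<partial>M n)"
      proof (rule integral_mono)
        show "integrable (M n) (\<lambda>w. \<bar>f (X n w) - f x\<bar>)" using i by simp
        show "integrable (M n) (\<lambda>w. e / 3 + 2 * B * indicator (space (M n) - E) w)"
          by (rule Bochner_Integration.integrable_add[OF int])
        fix w assume w: "w \<in> space (M n)"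
        show "\<bar>f (X n w) - f x\<bar> \<le> e / 3 + 2 * B * indicator (space (M n) - E) w"
        proof (cases "w \<in> E")
          case True
          then have "dist (f x) (f (X n w)) < e / 3" using E(3) by simp
          then show ?thesis using True by (simp add: dist_real_def abs_minus_commute)
        next
          case False
          then show ?thesis using B(2)[OF x] B(2)[OF XT[OF w]] w e by (simp add: indicator_def)
        qed
      qed
      also have "\<dots> = e / 3 + 2 * B * (1 - measure (M n) E)"
        unfolding Bochner_Integration.integral_add[OF int] using E(1) M.prob_compl[OF E(1)] by (simp add: M.prob_space)
      also have "\<dots> \<le> e / 3 + 2 * B * (e / (6 * B))"
        using E(2) B(1) by (intro add_left_mono mult_left_mono) auto
      also have "\<dots> < e" using e B(1) by (simp add: field_simps)
      finally show ?case by (simp add: dist_real_def)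
    qed
  qed
  then show "(\<lambda>n. \<integral>w. f (X n w) \<partial>M n) \<longlonglongrightarrow> (\<integral>y. f y \<partial>return (borel_of_topology T) x)"
    by (simp add: integral_return[OF xs f])
qed (use M X in auto)

text \<open>
  Between two grid points a nondecreasing function is squeezed between its grid values, and \<open>g\<close>
  changes by at most \<open>c\<close> times the mesh.
\<close>

lemma monotone_near_of_grid:
  fixes f g :: "real \<Rightarrow> real"
  assumes T: "0 \<le> T" and m: "0 < m" and t: "0 \<le> t" "t \<le> T"
    and f: "\<And>s t. 0 \<le> s \<Longrightarrow> s \<le> t \<Longrightarrow> f s \<le> f t"
    and g: "\<And>s t. 0 \<le> s \<Longrightarrow> s \<le> t \<Longrightarrow> 0 \<le> g t - g s \<and> g t - g s \<le> c * (t - s)" and c: "0 \<le> c"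
    and grid: "\<And>s. s \<in> (\<lambda>k. real k * (T / real m)) ` {..m} \<Longrightarrow> \<bar>f s - g s\<bar> < e"
  shows "\<bar>f t - g t\<bar> \<le> e + c * (T / real m)"
proof (cases "T = 0")
  case True
  then have "t = 0" using t by simp
  then show ?thesis using grid[of 0] True by (force simp: image_iff)
next
  case False
  let ?h = "T / real m"
  have h: "0 < ?h" using False T m by simp
  define k where "k = nat \<lceil>t / ?h\<rceil>"
  have pos: "0 \<le> t / ?h" using t h by simp
  have k: "t / ?h \<le> real k" "real k < t / ?h + 1"
    unfolding k_def using pos ceiling_correct[of "t / ?h"] by (auto simp: of_nat_nat)
  have hi: "t \<le> real k * ?h" using k(1) unfolding pos_divide_le_eq[OF h] .
  have hi2: "real k * ?h < t + ?h"
  proof -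
    have "real k * ?h < (t / ?h + 1) * ?h" using k(2) h by (rule mult_strict_right_mono)
    also have "\<dots> = t + ?h"
    proof -
      have "?h \<noteq> 0" using h by (metis less_irrefl)
      from iffD1[OF nonzero_eq_divide_eq[OF this] refl, of t] have "t / ?h * ?h = t" .
      then show ?thesis unfolding distrib_right by (simp only: mult_1)
    qed
    finally show ?thesis .
  qed
  have "real k < real m + 1"
  proof -
    have "t / ?h \<le> T / ?h" using t h by (intro divide_right_mono) auto
    also have "\<dots> = real m" using False by simp
    finally show ?thesis using k(2) by simp
  qed
  then have km: "k \<le> m" by linarith
  define a where "a = real (k - 1) * ?h"
  have a: "0 \<le> a" "a \<le> t" "t - a \<le> ?h"
  proof -
    show "0 \<le> a" unfolding a_def using less_imp_le[OF h] by (intro mult_nonneg_nonneg) simp_all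
    have "real k * ?h = a + ?h \<or> k = 0"
      unfolding a_def by (cases k) (simp_all only: of_nat_Suc distrib_right mult_1 diff_Suc_1 add.commute simp_thms)
    then have "(a \<le> t \<and> t - a \<le> ?h) \<or> k = 0" using hi hi2 by linarith
    then show "a \<le> t" "t - a \<le> ?h" using hi t less_imp_le[OF h] unfolding a_def by auto
  qed
  have gr: "\<bar>f a - g a\<bar> < e" "\<bar>f (real k * ?h) - g (real k * ?h)\<bar> < e"
    unfolding a_def using km by (auto intro!: grid)
  have up: "g (real k * ?h) - g t \<le> c * ?h"
  proof -
    have "g (real k * ?h) - g t \<le> c * (real k * ?h - t)" using g[OF t(1) hi] by blast
    also have "\<dots> \<le> c * ?h" using hi2 c by (intro mult_left_mono) auto
    finally show ?thesis .
  qed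
  have lo: "g t - g a \<le> c * ?h"
  proof -
    have "g t - g a \<le> c * (t - a)" using g[OF a(1,2)] by blast
    also have "\<dots> \<le> c * ?h" using a(3) c by (intro mult_left_mono) auto
    finally show ?thesis .
  qed
  have "f a \<le> f t" "f t \<le> f (real k * ?h)" using f[OF a(1,2)] f[OF t(1) hi] by auto
  then show ?thesis using gr up lo by (intro abs_leI) auto
qed

lemma (in sys_path) near_fluid_of_grid:
  assumes T: "0 \<le> T" and m: "0 < m" and r: "0 \<le> r"
    and grid: "\<And>s. s \<in> (\<lambda>k. real k * (T / real m)) ` {..m} \<Longrightarrow> \<bar>U 0 s - r * s\<bar> < e \<and>
        (\<forall>i. 1 \<le> i \<and> i \<le> J \<and> enat i \<le> b \<longrightarrow> \<bar>D i s - drift q i s\<bar> < e)"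
    and small: "e + r * (T / real m) + \<bar>r - lam\<bar> * T \<le> d" "e + 1 * (T / real m) \<le> d"
  shows "near_fluid b lam T J d q U D"
  unfolding near_fluid_def
proof (intro ballI conjI allI impI)
  fix t assume "t \<in> {0..T}"
  then have t: "0 \<le> t" "t \<le> T" by auto
  have "\<bar>U 0 t - r * t\<bar> \<le> e + r * (T / real m)"
  proof (rule monotone_near_of_grid[OF T m t _ _ r])
    show "U 0 s \<le> U 0 t" if "0 \<le> s" "s \<le> t" for s t by (rule sp_U_mono[OF that])
    show "0 \<le> r * t - r * s \<and> r * t - r * s \<le> r * (t - s)" if "0 \<le> s" "s \<le> t" for s t
      using that r by (simp add: right_diff_distrib mult_left_mono)
  qed (use grid in blast)
  moreover have "\<bar>r * t - lam * t\<bar> \<le> \<bar>r - lam\<bar> * T"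
    using t by (simp add: left_diff_distrib[symmetric] abs_mult mult_left_mono)
  ultimately show "\<bar>U 0 t - lam * t\<bar> \<le> d" using small(1) by linarith
  fix i assume i: "1 \<le> i \<and> i \<le> J \<and> enat i \<le> b"
  have "\<bar>D i t - drift q i t\<bar> \<le> e + 1 * (T / real m)"
  proof (rule monotone_near_of_grid[OF T m t])
    show "D i s \<le> D i t" if "0 \<le> s" "s \<le> t" for s t using i that by (intro sp_D_mono) auto
    show "0 \<le> drift q i t - drift q i s \<and> drift q i t - drift q i s \<le> 1 * (t - s)" if "0 \<le> s" "s \<le> t" for s t
      using sp_drift_bounds[OF that, of i] i by simp
  qed (use grid i in auto)
  then show "\<bar>D i t - drift q i t\<bar> \<le> d" using small(2) by linarith
qed

lemma carrier_metric_occ_space: "carrier_metric (occ_space b) l1_dist"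
  by unfold_locales (auto simp: l1_dist_commute intro: l1_dist_triangle l1_dist_eq_0)

context fluid_path
begin

text \<open>
  Every coordinate is Lipschitz, and the high levels are dominated by those of the initial
  state, uniformly in time.
\<close>

lemma l1_continuous:
  assumes t: "0 \<le> t"
  shows "((\<lambda>s. l1_dist (q s) (q t)) \<longlongrightarrow> 0) (at t within {0..})"
proof (rule tendstoI)
  fix e :: real assume e: "0 < e"
  have occ: "q s \<in> occ_space b" if "0 \<le> s" for s by (rule sp_occ[OF that])
  have sm: "summable (q 0)" by (rule occ_space_bounds(4)[OF occ]) simp
  obtain m :: nat where m: "(\<Sum>i. q 0 i) + U 0 (t + 1) + 1 < real m" using reals_Archimedean2 by blast
  have "\<forall>\<^sub>F k in sequentially. dist (\<Sum>i. q 0 (i + k)) 0 < e / 2"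
    using suminf_exist_split2[OF sm] e by (intro tendstoD) auto
  then obtain k0 where k0: "\<And>k. k0 \<le> k \<Longrightarrow> \<bar>\<Sum>i. q 0 (i + k)\<bar> < e / 2" by (auto simp: eventually_sequentially)
  define k where "k = max k0 (max m 2)"
  \<comment> \<open>A Lipschitz constant for the first \<open>k\<close> levels together.\<close>
  define C where "C = real k * (2 * lam + 1)"
  have C: "0 < C" unfolding C_def k_def using lam_pos by (intro mult_pos_pos) auto
  have tail: "q s i \<le> q 0 i" if "0 \<le> s" "s \<le> t + 1" "k \<le> i" for s i
    by (rule sp_tail[OF that(1,2)]) (use m that(3) in \<open>auto simp: k_def\<close>)
  have "l1_dist (q s) (q t) < e" if s: "0 \<le> s" "dist s t < min 1 (e / (2 * C))" for s
  proof -
    have st: "s \<le> t + 1" "\<bar>s - t\<bar> < e / (2 * C)" using s by (auto simp: dist_real_def)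
    have sd: "summable (\<lambda>i. \<bar>q s i - q t i\<bar>)" by (rule l1_summable[OF occ occ]) (use s t in auto)
    have "l1_dist (q s) (q t) = (\<Sum>i. \<bar>q s (i + k) - q t (i + k)\<bar>) + (\<Sum>i<k. \<bar>q s i - q t i\<bar>)"
      unfolding l1_dist_def by (rule suminf_split_initial_segment[OF sd])
    also have "(\<Sum>i. \<bar>q s (i + k) - q t (i + k)\<bar>) \<le> (\<Sum>i. q 0 (i + k))"
    proof (rule suminf_le)
      show "\<bar>q s (n + k) - q t (n + k)\<bar> \<le> q 0 (n + k)" for n
        using tail[OF s(1) st(1), of "n + k"] tail[OF t, of "n + k"]
          occ_space_bounds(1)[OF occ[OF s(1)], of "n + k"] occ_space_bounds(1)[OF occ[OF t], of "n + k"] by auto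
      show "summable (\<lambda>n. \<bar>q s (n + k) - q t (n + k)\<bar>)" using summable_ignore_initial_segment[OF sd, of k] .
      show "summable (\<lambda>i. q 0 (i + k))" using summable_ignore_initial_segment[OF sm, of k] .
    qed
    also have "(\<Sum>i<k. \<bar>q s i - q t i\<bar>) \<le> (\<Sum>i<k. (2 * lam + 1) * \<bar>s - t\<bar>)"
      using q_lip[of s t] q_lip[of t s] s t by (intro sum_mono) (cases "s \<le> t"; auto simp: abs_minus_commute)
    also have "\<dots> = C * \<bar>s - t\<bar>" by (simp add: C_def)
    also have "\<dots> < e / 2" using st(2) C by (simp add: pos_less_divide_eq mult_ac)
    finally show ?thesis using k0[of k] by (simp add: k_def)
  qed
  moreover have "0 \<le> l1_dist (q s) (q t)" if "0 \<le> s" for s by (rule l1_dist_nonneg[OF occ[OF that] occ[OF t]])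
  ultimately have "\<forall>s\<in>{0..}. s \<noteq> t \<and> dist s t < min 1 (e / (2 * C)) \<longrightarrow> dist (l1_dist (q s) (q t)) 0 < e"
    by (simp add: dist_real_def)
  moreover have "0 < min 1 (e / (2 * C))" using e C by simp
  ultimately show "\<forall>\<^sub>F s in at t within {0..}. dist (l1_dist (q s) (q t)) 0 < e"
    unfolding eventually_at by blast
qed

lemma cadlag:
  assumes "\<And>t. t < 0 \<Longrightarrow> q t = undefined"
  shows "q \<in> cadlag_paths (occ_space b) l1_dist"
  unfolding cadlag_paths_def
proof (intro CollectI conjI allI impI)
  show "q \<in> {0..} \<rightarrow>\<^sub>E occ_space b" using sp_occ assms by (auto simp: PiE_iff extensional_def)
  show "((\<lambda>s. l1_dist (q s) (q t)) \<longlongrightarrow> 0) (at_right t)" if "0 \<le> t" for t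
    by (rule tendsto_mono[OF at_le l1_continuous[OF that]]) (use that in auto)
  fix t :: real assume t: "0 < t"
  have "at t within {0..} = at t" by (rule at_within_interior) (use t in simp)
  then have "((\<lambda>s. l1_dist (q s) (q t)) \<longlongrightarrow> 0) (at_left t)"
    using l1_continuous[of t] t by (auto intro: tendsto_mono[OF at_le])
  then show "\<exists>l\<in>occ_space b. ((\<lambda>s. l1_dist (q s) l) \<longlongrightarrow> 0) (at_left t)"
    using sp_occ[of t] t by (intro bexI[of _ "q t"]) auto
qed

end

section \<open>Convergence to the fluid path\<close>

text \<open>Occupancies are a function of the list of queue lengths, a countable type.\<close>

lemma occupancy_queues: "occupancy b N (\<lambda>j. y j) = occupancy b N ((!) (map y [0..<N]))"
proof
  fix i
  have "{j. j < N \<and> i \<le> y j} = {j. j < N \<and> i \<le> map y [0..<N] ! j}" by auto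
  then show "occupancy b N (\<lambda>j. y j) i = occupancy b N ((!) (map y [0..<N])) i" by (simp add: occupancy_def)
qed

lemma (in jsq_system) occupancy_path_measurable:
  assumes "1 \<le> N"
  shows "occupancy_path b N L \<in> M \<rightarrow>\<^sub>M borel_of_topology (J1_topology (occ_space b) l1_dist)"
proof -
  interpret carrier_metric "occ_space b" l1_dist by (rule carrier_metric_occ_space)
  have "(\<lambda>w. \<lambda>t\<in>{0..}. (\<lambda>l. occupancy b N ((!) l)) (map (\<lambda>j. L w j t) [0..<N]))
      \<in> M \<rightarrow>\<^sub>M borel_of_topology (J1_topology (occ_space b) l1_dist)"
    by (rule step_like_measurable)
      (auto intro!: step_like_queues occupancy_occ_space[OF assms] map_upt_measurable L_measurable)
  then show ?thesis unfolding occupancy_path_def[abs_def] occupancy_queues[of b N "L _ _"]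
    by (subst occupancy_queues)
qed

text \<open>
  With \<open>N\<^sup>2\<close> jumps the bound of \<open>deviation_event\<close> is of order \<open>1 / N\<close>, since the total rate of
  the clocks is of order \<open>N\<close>.
\<close>

lemma near_fluid_event:
  fixes M :: "nat \<Rightarrow> 'w measure"
  assumes sys: "\<forall>N\<ge>1. jsq_system (M N) N b (rate N) (pick N) (gap N) (svc N) (seed N) (L N)"
    and rate: "(\<lambda>N. rate N / real N) \<longlonglongrightarrow> lam" and T: "0 \<le> T" and d: "0 < d" and \<delta>: "0 < \<delta>"
  shows "\<forall>\<^sub>F N in sequentially. \<exists>E\<in>sets (M N). 1 - \<delta> \<le> measure (M N) E \<and>
    (\<forall>w\<in>E. \<exists>U D. sys_path b (\<lambda>t. occupancy b N (\<lambda>j. L N w j t)) U D \<and>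
       near_fluid b lam T J d (\<lambda>t. occupancy b N (\<lambda>j. L N w j t)) U D)"
proof -
  define e where "e = d / 3"
  have e: "0 < e" using d by (simp add: e_def)
  \<comment> \<open>A mesh on which arrivals and departures change by at most \<open>e\<close>.\<close>
  obtain m :: nat where m0: "(\<bar>lam\<bar> + 1) * T / e < real m" using reals_Archimedean2 by blast
  have m: "0 < real m" using T e by (intro le_less_trans[OF _ m0]) simp
  have mT: "(\<bar>lam\<bar> + 1) * (T / real m) \<le> e"
    using m0 m e by (simp add: pos_divide_less_eq pos_divide_le_eq mult_ac)
  define G where "G = (\<lambda>k. real k * (T / real m)) ` {..m}"
  have G: "finite G" "\<And>t. t \<in> G \<Longrightarrow> 0 \<le> t \<and> t \<le> T"
  proof -
    show "finite G" by (simp add: G_def)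
    fix t assume "t \<in> G"
    then obtain k where k: "k \<le> m" "t = real k * (T / real m)" by (auto simp: G_def)
    have "t \<le> real m * (T / real m)" unfolding k(2) using k(1) T by (intro mult_right_mono) auto
    then show "0 \<le> t \<and> t \<le> T" using k T m by simp
  qed
  define c where "c = (real (card G * Suc J) / e\<^sup>2 + 1) * T"
  have "(\<lambda>N. c * (rate N / real N + 1) * (1 / real N)) \<longlonglongrightarrow> c * (lam + 1) * 0"
    by (intro tendsto_intros rate lim_1_over_n)
  then have "(\<lambda>N. c * (rate N / real N + 1) * (1 / real N)) \<longlonglongrightarrow> 0" by simp
  from order_tendstoD(2)[OF this \<delta>]
  have ev1: "\<forall>\<^sub>F N in sequentially. c * (rate N / real N + 1) * (1 / real N) < \<delta>" .
  have "0 < min 1 (e / (T + 1))" using e T by simp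
  from tendstoD[OF rate this] have ev2: "\<forall>\<^sub>F N in sequentially. dist (rate N / real N) lam < min 1 (e / (T + 1))" .
  show ?thesis
    using ev1 ev2 eventually_ge_at_top[of 1]
  proof eventually_elim
    case (elim N)
    interpret S: jsq_chain "M N" N b "rate N" "pick N" "gap N" "svc N" "seed N" "L N"
      by (intro jsq_chain.intro sys[rule_format] jsq_chain_axioms.intro) (use elim in auto)
    let ?r = "rate N / real N"
    have N: "0 < real N" using elim(3) by simp
    have "0 < N ^ 2" using elim(3) by simp
    from S.deviation_event[where G=G and T=T and e=e and n="N ^ 2" and J=J, OF G T e this]
    obtain E where E: "E \<in> sets (M N)"
      and p: "1 - (real (card G * Suc J) / (real N * e)\<^sup>2 + 1 / real (N ^ 2)) * ((rate N + real N) * T) \<le> measure (M N) E"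
      and path: "\<And>w. w \<in> E \<Longrightarrow> \<exists>U D. sys_path b (S.occ w) U D \<and>
       (\<forall>t\<in>G. \<bar>U 0 t - ?r * t\<bar> < e \<and> (\<forall>i. 1 \<le> i \<and> i \<le> J \<and> enat i \<le> b \<longrightarrow> \<bar>D i t - drift (S.occ w) i t\<bar> < e))"
      by blast
    have "(real (card G * Suc J) / (real N * e)\<^sup>2 + 1 / real (N ^ 2)) * ((rate N + real N) * T) = c * (?r + 1) * (1 / real N)"
      using N e by (simp add: c_def field_simps power2_eq_square)
    then have "1 - \<delta> \<le> measure (M N) E" using p elim(1) by linarith
    moreover have "\<exists>U D. sys_path b (S.occ w) U D \<and> near_fluid b lam T J d (S.occ w) U D" if w: "w \<in> E" for w
    proof -
      obtain U D where UD: "sys_path b (S.occ w) U D"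
       "\<forall>t\<in>G. \<bar>U 0 t - ?r * t\<bar> < e \<and> (\<forall>i. 1 \<le> i \<and> i \<le> J \<and> enat i \<le> b \<longrightarrow> \<bar>D i t - drift (S.occ w) i t\<bar> < e)"
        using path[OF w] by blast
      have r: "\<bar>?r - lam\<bar> < 1" "\<bar>?r - lam\<bar> < e / (T + 1)" using elim(2) by (auto simp: dist_real_def)
      have r0: "0 \<le> ?r" using S.rate_pos N by simp
      have Tm: "0 \<le> T / real m" using T by simp
      have a: "?r * (T / real m) \<le> e"
        by (rule order_trans[OF mult_right_mono[OF _ Tm] mT]) (use r(1) in linarith)
      have bd: "1 * (T / real m) \<le> e"
        by (rule order_trans[OF mult_right_mono[OF _ Tm] mT]) simp
      have cd: "\<bar>?r - lam\<bar> * T \<le> e"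
      proof -
        have "\<bar>?r - lam\<bar> * T \<le> \<bar>?r - lam\<bar> * (T + 1)" by (rule mult_left_mono) auto
        also have "\<dots> \<le> e" using r(2) T by (simp add: pos_less_divide_eq less_imp_le)
        finally show ?thesis .
      qed
      have "near_fluid b lam T J d (S.occ w) U D"
      proof (rule sys_path.near_fluid_of_grid[OF UD(1) T _ r0, where m=m and e=e])
        show "0 < m" using m by simp
        show "\<bar>U 0 s - ?r * s\<bar> < e \<and> (\<forall>i. 1 \<le> i \<and> i \<le> J \<and> enat i \<le> b \<longrightarrow> \<bar>D i s - drift (S.occ w) i s\<bar> < e)"
          if "s \<in> (\<lambda>k. real k * (T / real m)) ` {..m}" for s
          using UD(2) that unfolding G_def by blast
        show "e + ?r * (T / real m) + \<bar>?r - lam\<bar> * T \<le> d" "e + 1 * (T / real m) \<le> d"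
          using a bd cd e unfolding e_def by linarith+
      qed
      then show ?thesis using UD(1) by blast
    qed
    ultimately show ?case using E by blast
  qed
qed

lemma near_start_event:
  fixes M :: "nat \<Rightarrow> 'w measure"
  assumes sys: "\<forall>N\<ge>1. jsq_system (M N) N b (rate N) (pick N) (gap N) (svc N) (seed N) (L N)"
    and rate: "(\<lambda>N. rate N / real N) \<longlonglongrightarrow> lam" and T: "0 \<le> T" and d: "0 < d" and \<delta>: "0 < \<delta>"
    and init: "converges_in_probability l1_dist M (\<lambda>N \<omega>. occupancy_path b N (L N) \<omega> 0) qi"
  shows "\<forall>\<^sub>F N in sequentially. \<exists>E\<in>sets (M N). 1 - \<delta> \<le> measure (M N) E \<and>
    (\<forall>w\<in>E. l1_dist (occupancy b N (\<lambda>j. L N w j 0)) qi \<le> d \<and>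
       (\<exists>U D. sys_path b (\<lambda>t. occupancy b N (\<lambda>j. L N w j t)) U D \<and>
       near_fluid b lam T J d (\<lambda>t. occupancy b N (\<lambda>j. L N w j t)) U D))"
proof -
  let ?A = "\<lambda>N. {w \<in> space (M N). d < l1_dist (occupancy b N (\<lambda>j. L N w j 0)) qi}"
  have "(\<lambda>N. measure (M N) (?A N)) \<longlonglongrightarrow> 0"
    using init d unfolding converges_in_probability_def by (simp add: occupancy_path_def)
  from order_tendstoD(2)[OF this, of "\<delta> / 2"] \<delta>
  have ev: "\<forall>\<^sub>F N in sequentially. measure (M N) (?A N) < \<delta> / 2" by simp
  have \<delta>2: "0 < \<delta> / 2" using \<delta> by simp
  from near_fluid_event[OF sys rate T d \<delta>2, where J=J] ev eventually_ge_at_top[of 1]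
  show ?thesis
  proof eventually_elim
    case (elim N)
    interpret S: jsq_system "M N" N b "rate N" "pick N" "gap N" "svc N" "seed N" "L N"
      by (rule sys[rule_format]) (use elim in simp)
    have "(\<lambda>w. map (\<lambda>j. L N w j 0) [0..<N]) \<in> M N \<rightarrow>\<^sub>M count_space UNIV"
      by (intro map_upt_measurable S.L_measurable) auto
    then have "(\<lambda>w. l1_dist (occupancy b N ((!) (map (\<lambda>j. L N w j 0) [0..<N]))) qi) \<in> borel_measurable (M N)"
      by (rule measurable_compose) simp
    then have [measurable]: "(\<lambda>w. l1_dist (occupancy b N (\<lambda>j. L N w j 0)) qi) \<in> borel_measurable (M N)"
      by (subst occupancy_queues)
    have A: "?A N \<in> sets (M N)" by measurable
    obtain E where E: "E \<in> sets (M N)" "1 - \<delta> / 2 \<le> measure (M N) E"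
      "\<And>w. w \<in> E \<Longrightarrow> \<exists>U D. sys_path b (\<lambda>t. occupancy b N (\<lambda>j. L N w j t)) U D \<and>
       near_fluid b lam T J d (\<lambda>t. occupancy b N (\<lambda>j. L N w j t)) U D" using elim(1) by blast
    have "S.prob E \<le> S.prob ((E - ?A N) \<union> ?A N)" using E(1) A by (intro S.finite_measure_mono) auto
    also have "\<dots> \<le> S.prob (E - ?A N) + S.prob (?A N)" using E(1) A by (intro measure_Un_le) auto
    finally have "1 - \<delta> \<le> S.prob (E - ?A N)" using E(2) elim(2) by linarith
    moreover have "E - ?A N \<in> sets (M N)" using E(1) A by auto
    moreover have "l1_dist (occupancy b N (\<lambda>j. L N w j 0)) qi \<le> d" if "w \<in> E - ?A N" for w
      using that sets.sets_into_space[OF E(1)] by auto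
    ultimately show ?case using E(3) by blast
  qed
qed

theorem theorem4p1:
  fixes b :: enat
    and rate :: "nat \<Rightarrow> real" and lam :: real
    and M :: "nat \<Rightarrow> 'w measure"
    and pick :: "nat \<Rightarrow> (nat \<Rightarrow> nat) \<Rightarrow> real \<Rightarrow> nat"
    and gap :: "nat \<Rightarrow> nat \<Rightarrow> 'w \<Rightarrow> real"
    and svc :: "nat \<Rightarrow> nat \<Rightarrow> nat \<Rightarrow> 'w \<Rightarrow> real"
    and seed :: "nat \<Rightarrow> nat \<Rightarrow> 'w \<Rightarrow> real"
    and L :: "nat \<Rightarrow> 'w \<Rightarrow> nat \<Rightarrow> real \<Rightarrow> nat"
    and q_inf :: "nat \<Rightarrow> real"
    and s :: "nat \<Rightarrow> nat"
  assumes "1 \<le> b"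
    and "\<And>N. 1 \<le> N \<Longrightarrow> jsq_system (M N) N b (rate N) (pick N) (gap N) (svc N) (seed N) (L N)"
    and "q_inf \<in> occ_space b"
    and "converges_in_probability l1_dist M (\<lambda>N \<omega>. occupancy_path b N (L N) \<omega> 0) q_inf"
    and "(\<lambda>N. rate N / real N) \<longlonglongrightarrow> lam" and "0 < lam"
    and "strict_mono s" and "\<And>k. 1 \<le> s k"
  shows "\<exists>r P. strict_mono r \<and>
    converges_weakly (J1_topology (occ_space b) l1_dist)
      (\<lambda>k. M (s (r k))) (\<lambda>k. occupancy_path b (s (r k)) (L (s (r k)))) P \<and>
    (AE q in P. q 0 = q_inf \<and> fluid_equations b lam q)"
proof -
  let ?J1 = "J1_topology (occ_space b) l1_dist"
  let ?occ = "\<lambda>N w t. occupancy b N (\<lambda>j. L N w j t)"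
  have sys: "\<forall>N\<ge>1. jsq_system (M N) N b (rate N) (pick N) (gap N) (svc N) (seed N) (L N)" using assms(2) by blast
  note qi = assms(3) and init = assms(4) and rate = assms(5) and lam = assms(6)
  interpret J1: carrier_metric "occ_space b" l1_dist by (rule carrier_metric_occ_space)
  \<comment> \<open>Trajectories of large systems serve as approximate solutions: the good event has positive
    probability, so it is not empty.\<close>
  have "\<exists>q U D. sys_path b q U D \<and> near_fluid b lam T J d q U D \<and> l1_dist (q 0) q_inf \<le> d"
    if T: "0 \<le> T" and d: "0 < d" for T J d
  proof -
    have "(0::real) < 1 / 2" by simp
    from near_start_event[OF sys rate T d this init, where J=J] eventually_ge_at_top[of 1]
    have "\<forall>\<^sub>F N in sequentially. \<exists>w. l1_dist (?occ N w 0) q_inf \<le> d \<and> (\<exists>U D. sys_path b (?occ N w) U D \<and> near_fluid b lam T J d (?occ N w) U D)"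
    proof eventually_elim
      case (elim N)
      then obtain E where E: "1 - 1 / 2 \<le> measure (M N) E"
        "\<And>w. w \<in> E \<Longrightarrow> l1_dist (?occ N w 0) q_inf \<le> d \<and> (\<exists>U D. sys_path b (?occ N w) U D \<and> near_fluid b lam T J d (?occ N w) U D)"
        by blast
      have "E \<noteq> {}" using E(1) by auto
      then show ?case using E(2) by blast
    qed
    then obtain N w where "l1_dist (?occ N w 0) q_inf \<le> d \<and> (\<exists>U D. sys_path b (?occ N w) U D \<and> near_fluid b lam T J d (?occ N w) U D)"
      unfolding eventually_sequentially by (meson order_refl)
    then show ?thesis by blast
  qed
  from fluid_path_exists[OF qi lam this]
  obtain q U D where fluid: "fluid_path b q U D lam" and q0: "q 0 = q_inf" and neg: "\<forall>t<0. q t = undefined" by blast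
  interpret F: fluid_path b q U D lam by (rule fluid)
  have cad: "q \<in> cadlag_paths (occ_space b) l1_dist" using neg by (intro F.cadlag) simp
  define P where "P = return (borel_of_topology ?J1) q"
  have qs: "q \<in> space (borel_of_topology ?J1)" using cad by (simp add: space_borel_of_topology)
  have "converges_weakly ?J1 (\<lambda>k. M (s k)) (\<lambda>k. occupancy_path b (s k) (L (s k))) P"
    unfolding P_def
  proof (rule converges_weakly_returnI)
    show "prob_space (M (s n))" for n using assms(2)[OF assms(8)[of n]] by (simp add: jsq_system_def)
    show "occupancy_path b (s n) (L (s n)) \<in> M (s n) \<rightarrow>\<^sub>M borel_of_topology ?J1" for n
      by (rule jsq_system.occupancy_path_measurable[OF assms(2)[OF assms(8)] assms(8)])
    show "q \<in> topspace ?J1" using cad by simp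
    fix W \<delta> assume W: "openin ?J1 W" "q \<in> W" and \<delta>: "0 < (\<delta> :: real)"
    obtain T e where Te: "0 < T" "0 < e" "J1_nbhd (occ_space b) l1_dist q T e \<subseteq> W"
      using W unfolding openin_J1_topology by blast
    have "0 \<le> T" "0 < e / 2" using Te by auto
    from stability[OF qi this lam] obtain J d where d: "0 < d" and
      stab: "\<And>q U D q' U' D'. sys_path b q U D \<Longrightarrow> sys_path b q' U' D' \<Longrightarrow>
        near_fluid b lam T J d q U D \<Longrightarrow> near_fluid b lam T J d q' U' D' \<Longrightarrow>
        l1_dist (q 0) q_inf \<le> d \<Longrightarrow> l1_dist (q' 0) q_inf \<le> d \<Longrightarrow> \<forall>t\<in>{0..T}. l1_dist (q t) (q' t) \<le> e / 2"
      by meson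
    have nf: "near_fluid b lam T J d q U D"
      using d F.U_0 F.D_drift by (simp add: near_fluid_def)
    have "\<forall>\<^sub>F N in sequentially. 1 \<le> N \<longrightarrow> (\<exists>E\<in>sets (M N). 1 - \<delta> \<le> measure (M N) E \<and> (\<forall>w\<in>E. occupancy_path b N (L N) w \<in> W))"
      using near_start_event[OF sys rate \<open>0 \<le> T\<close> d \<delta> init, where J=J]
    proof (eventually_elim, intro impI)
      fix N
      assume N: "1 \<le> N" and "\<exists>E\<in>sets (M N). 1 - \<delta> \<le> measure (M N) E \<and>
        (\<forall>w\<in>E. l1_dist (?occ N w 0) q_inf \<le> d \<and> (\<exists>U D. sys_path b (?occ N w) U D \<and> near_fluid b lam T J d (?occ N w) U D))"
      then obtain E where E: "E \<in> sets (M N)" "1 - \<delta> \<le> measure (M N) E" and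
        w: "\<And>w. w \<in> E \<Longrightarrow> l1_dist (?occ N w 0) q_inf \<le> d \<and> (\<exists>U D. sys_path b (?occ N w) U D \<and> near_fluid b lam T J d (?occ N w) U D)"
        by blast
      have "occupancy_path b N (L N) w \<in> W" if wE: "w \<in> E" for w
      proof -
        obtain U' D' where "sys_path b (?occ N w) U' D'" "near_fluid b lam T J d (?occ N w) U' D'" "l1_dist (?occ N w 0) q_inf \<le> d"
          using w[OF wE] by blast
        from stab[OF this(1) F.sys_path_axioms this(2) nf this(3)] d q0
        have close: "\<forall>t\<in>{0..T}. l1_dist (?occ N w t) (q t) \<le> e / 2" by simp
        have "w \<in> space (M N)" using wE sets.sets_into_space[OF E(1)] by blast
        then have "occupancy_path b N (L N) w \<in> cadlag_paths (occ_space b) l1_dist"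
          using measurable_space[OF jsq_system.occupancy_path_measurable[OF assms(2)[OF N] N]] by (simp add: space_borel_of_topology)
        then have "occupancy_path b N (L N) w \<in> J1_nbhd (occ_space b) l1_dist q T e"
        proof (rule J1_nbhd_uniformI)
          show "0 < e" by (rule Te(2))
          fix t assume t: "0 \<le> t" "t \<le> T"
          then have "l1_dist (?occ N w t) (q t) \<le> e / 2" using close by simp
          then show "l1_dist (occupancy_path b N (L N) w t) (q t) < e" using t Te(2) by (simp add: occupancy_path_def)
        qed
        then show ?thesis using Te(3) by blast
      qed
      then show "\<exists>E\<in>sets (M N). 1 - \<delta> \<le> measure (M N) E \<and> (\<forall>w\<in>E. occupancy_path b N (L N) w \<in> W)" using E by blast
    qed
    from eventually_subseq[OF assms(7) this]
    show "\<forall>\<^sub>F n in sequentially. \<exists>E\<in>sets (M (s n)). 1 - \<delta> \<le> measure (M (s n)) E \<and> (\<forall>w\<in>E. occupancy_path b (s n) (L (s n)) w \<in> W)"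
      using assms(8) by simp
  qed
  moreover have "AE q' in P. q' 0 = q_inf \<and> fluid_equations b lam q'"
  proof (rule AE_I)
    have op: "openin ?J1 (cadlag_paths (occ_space b) l1_dist - {q})"
      by (rule J1.J1_singleton_closed[OF cad F.l1_continuous])
    show "cadlag_paths (occ_space b) l1_dist - {q} \<in> sets P"
      using openin_borel_of_topology[OF op] by (simp add: P_def)
    show "emeasure P (cadlag_paths (occ_space b) l1_dist - {q}) = 0"
      using openin_borel_of_topology[OF op] by (simp add: P_def)
    show "{q' \<in> space P. \<not> (q' 0 = q_inf \<and> fluid_equations b lam q')} \<subseteq> cadlag_paths (occ_space b) l1_dist - {q}"
      using F.satisfies_fluid_equations q0 by (auto simp: P_def space_borel_of_topology)
  qed
  moreover have "strict_mono (\<lambda>k::nat. k)" by (simp add: strict_mono_def)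
  ultimately show ?thesis by (intro exI[of _ "\<lambda>k. k"] exI[of _ P]) simp
qed

end
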